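(* Let $\Omega\subset\mathbb{R}^d$ be a bounded $C^1$-domain and suppose that $\sigma\in(-\frac{1}{d-1},1)$ is fixed. (a) If $\beta,\gamma\in\mathbb{R}$ are fixed, or more generally remain bounded, then for each fixed $k\in\mathbb{N}$, $$\liminf_{\alpha\to-\infty}\frac{\lambda_k(\Omega,\sigma,\alpha,\beta,\gamma)}{-|\alpha|^2}\ge\frac14.$$ (b) If $\alpha,\gamma\in\mathbb{R}$ are fixed, or more generally remain bounded, then for each fixed $k\in\mathbb{N}$, $$\liminf_{\beta\to-\infty}\frac{\lambda_k(\Omega,\sigma,\alpha,\beta,\gamma)}{-|\beta|^4}\ge\frac12\left(\frac32\right)^3.$$ (c) If $\alpha,\beta\in\mathbb{R}$ are fixed, or more generally remain bounded, then for each fixed $k\in\mathbb{N}$, $$\liminf_{\gamma\to-\infty}\frac{\lambda_k(\Omega,\sigma,\alpha,\beta,\gamma)}{-|\gamma|^{4/3}}\ge\left(\frac12\right)^{1/3}\frac32.$$ Treating $\Omega$ and $\sigma$ as fixed, in each case the estimates for $k=1$ are uniform in the other two variables, as long as these remain within a compact interval.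
   Context: Here $d\ge2$, $\nu$ is the outer unit normal to $\partial\Omega$ and $\mathcal{H}^{d-1}$ the surface measure on $\partial\Omega$. For $\alpha,\beta,\gamma\in\mathbb{R}$ and $u,v\in H^2(\Omega)$ let $$\mathcal{Q}_{\Omega,\sigma,\alpha,\beta,\gamma}(u,v)=\int_\Omega\big((1-\sigma)D^2u:D^2v+\sigma\Delta u\,\Delta v\big)dx+\alpha\int_\Omega\nabla u\cdot\nabla v\,dx+\beta\int_{\partial\Omega}\frac{\partial u}{\partial\nu}\frac{\partial v}{\partial\nu}\,d\mathcal{H}^{d-1}+\gamma\int_{\partial\Omega}uv\,d\mathcal{H}^{d-1},$$ with $D^2u:D^2v=\sum_{i,j}\partial^2_{ij}u\,\partial^2_{ij}v$. The associated self-adjoint operator on $L^2(\Omega)$ is bounded below with compact resolvent, and its eigenvalues, with multiplicity, are $\lambda_1\le\lambda_2\le\dots\to+\infty$, with $\lambda_k(\Omega,\sigma,\alpha,\beta,\gamma)=\min_{V\subset H^2(\Omega),\,\dim V=k}\ \max_{0\ne u\in V}\mathcal{Q}_{\Omega,\sigma,\alpha,\beta,\gamma}(u,u)/\int_\Omega u^2dx$. *)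

theory Defs
  imports "HOL-Analysis.Analysis"
begin

section \<open>Functions of class $C^k$\<close>

primrec Ck :: "nat \<Rightarrow> ('a::euclidean_space \<Rightarrow> real) \<Rightarrow> bool" where
  "Ck 0 f \<longleftrightarrow> continuous_on UNIV f"
| "Ck (Suc k) f \<longleftrightarrow> f differentiable_on UNIV \<and>
     (\<forall>b\<in>Basis. Ck k (\<lambda>x. frechet_derivative f (at x) b))"

definition smooth :: "('a::euclidean_space \<Rightarrow> real) \<Rightarrow> bool" where
  "smooth f \<longleftrightarrow> (\<forall>k. Ck k f)"

definition test_function :: "'a::euclidean_space set \<Rightarrow> ('a \<Rightarrow> real) \<Rightarrow> bool" where
  "test_function \<Omega> \<phi> \<longleftrightarrow> smooth \<phi> \<and>
     compact (closure {x. \<phi> x \<noteq> 0}) \<and> closure {x. \<phi> x \<noteq> 0} \<subseteq> \<Omega>"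


section \<open>Bounded $C^1$-domains and the outer unit normal\<close>

text \<open>
  In the open set \<open>U\<close>, the set \<open>\<Omega>\<close> is the strict subgraph, in the direction of the unit vector
  \<open>e\<close>, of a $C^1$ function on the hyperplane orthogonal to \<open>e\<close>. That function is encoded as a
  function \<open>h\<close> on the whole space which is constant along \<open>e\<close>. Since \<open>U\<close> is open,
  \<open>frontier \<Omega> \<inter> U\<close> is then the graph \<open>{x \<in> U. x \<bullet> e = h x}\<close>.
\<close>

definition C1_chart ::
  "'a::euclidean_space set \<Rightarrow> 'a set \<Rightarrow> 'a \<Rightarrow> ('a \<Rightarrow> real) \<Rightarrow> bool" where
  "C1_chart \<Omega> U e h \<longleftrightarrow> open U \<and> norm e = 1 \<and> Ck 1 h \<and>
     (\<forall>x t. h (x + t *\<^sub>R e) = h x) \<and> \<Omega> \<inter> U = {x \<in> U. x \<bullet> e < h x}"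

definition bounded_C1_domain :: "'a::euclidean_space set \<Rightarrow> bool" where
  "bounded_C1_domain \<Omega> \<longleftrightarrow> \<Omega> \<noteq> {} \<and> open \<Omega> \<and> connected \<Omega> \<and> bounded \<Omega> \<and>
     (\<forall>x\<in>frontier \<Omega>. \<exists>U e h. C1_chart \<Omega> U e h \<and> x \<in> U)"

text \<open>
  The normalised gradient of the local defining function \<open>\<lambda>x. x \<bullet> e - h x\<close>, which is negative
  in \<open>\<Omega>\<close>; it does not depend on the chart.
\<close>

definition outer_normal :: "'a::euclidean_space set \<Rightarrow> 'a \<Rightarrow> 'a" where
  "outer_normal \<Omega> x = (THE n. \<exists>U e h g. C1_chart \<Omega> U e h \<and> x \<in> U \<and>
     GDERIV h x :> g \<and> n = (e - g) /\<^sub>R norm (e - g))"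


section \<open>Hausdorff measure and surface measure\<close>

text \<open>
  The constant \<open>unit_ball_vol n / 2 ^ n\<close> is the usual normalisation, for which the
  $n$-dimensional Hausdorff measure is Lebesgue measure on $n$-dimensional subspaces. The covering
  sets have to be bounded since \<open>diameter\<close> is real-valued. Only \<open>n \<ge> 1\<close> is meant: for
  \<open>n = 0\<close> an empty covering set would be counted with weight \<open>1\<close>.
\<close>

definition hausdorff_pre :: "nat \<Rightarrow> real \<Rightarrow> 'a::euclidean_space set \<Rightarrow> ennreal" where
  "hausdorff_pre n \<delta> A =
     (INF C \<in> {C :: nat \<Rightarrow> 'a set. A \<subseteq> (\<Union>i. C i) \<and> (\<forall>i. bounded (C i) \<and> diameter (C i) \<le> \<delta>)}.
        \<Sum>i. ennreal (unit_ball_vol (real n) * (diameter (C i) / 2) ^ n))"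

definition hausdorff_outer :: "nat \<Rightarrow> 'a::euclidean_space set \<Rightarrow> ennreal" where
  "hausdorff_outer n A = (SUP \<delta> \<in> {0<..}. hausdorff_pre n \<delta> A)"

text \<open>
  \<open>hausdorff_outer n\<close> is a metric outer measure, hence by Caratheodory's criterion a measure on
  the Borel sets, so \<open>measure_of\<close> does not degenerate to the null measure here.
\<close>

definition hausdorff_measure :: "nat \<Rightarrow> 'a::euclidean_space measure" where
  "hausdorff_measure n = measure_of UNIV (sets borel) (hausdorff_outer n)"

definition surface_measure :: "'a::euclidean_space set \<Rightarrow> 'a measure" where
  "surface_measure \<Omega> = restrict_space (hausdorff_measure (DIM('a) - 1)) (frontier \<Omega>)"


section \<open>Sobolev spaces and traces\<close>

text \<open>
  Elements of $L^2$, $H^1$ and $H^2$ are represented by functions, not by classes of functions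
  modulo null sets.
\<close>

definition L2 :: "'a measure \<Rightarrow> ('a \<Rightarrow> real) set" where
  "L2 M = {f \<in> borel_measurable M. integrable M (\<lambda>x. (f x)\<^sup>2)}"

definition L2_tendsto :: "'a measure \<Rightarrow> (nat \<Rightarrow> 'a \<Rightarrow> real) \<Rightarrow> ('a \<Rightarrow> real) \<Rightarrow> bool" where
  "L2_tendsto M f g \<longleftrightarrow> (\<lambda>n. \<integral>\<^sup>+x. ennreal ((f n x - g x)\<^sup>2) \<partial>M) \<longlonglongrightarrow> 0"

definition locally_integrable :: "'a::euclidean_space set \<Rightarrow> ('a \<Rightarrow> real) \<Rightarrow> bool" where
  "locally_integrable \<Omega> f \<longleftrightarrow> (\<forall>K. compact K \<and> K \<subseteq> \<Omega> \<longrightarrow> set_integrable lebesgue K f)"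

definition is_weak_deriv ::
  "'a::euclidean_space set \<Rightarrow> 'a \<Rightarrow> ('a \<Rightarrow> real) \<Rightarrow> ('a \<Rightarrow> real) \<Rightarrow> bool" where
  "is_weak_deriv \<Omega> b u g \<longleftrightarrow> locally_integrable \<Omega> u \<and> locally_integrable \<Omega> g \<and>
     (\<forall>\<phi>. test_function \<Omega> \<phi> \<longrightarrow>
        (\<integral>x. u x * frechet_derivative \<phi> (at x) b \<partial>lebesgue_on \<Omega>) =
        - (\<integral>x. g x * \<phi> x \<partial>lebesgue_on \<Omega>))"

text \<open>
  Weak derivatives are unique up to null sets; \<open>wderiv\<close> picks one representative.
\<close>

definition wderiv :: "'a::euclidean_space set \<Rightarrow> 'a \<Rightarrow> ('a \<Rightarrow> real) \<Rightarrow> 'a \<Rightarrow> real" where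
  "wderiv \<Omega> b u = (SOME g. is_weak_deriv \<Omega> b u g)"

definition H1 :: "'a::euclidean_space set \<Rightarrow> ('a \<Rightarrow> real) set" where
  "H1 \<Omega> = {u \<in> L2 (lebesgue_on \<Omega>).
     \<forall>b\<in>Basis. \<exists>g. is_weak_deriv \<Omega> b u g \<and> g \<in> L2 (lebesgue_on \<Omega>)}"

definition H2 :: "'a::euclidean_space set \<Rightarrow> ('a \<Rightarrow> real) set" where
  "H2 \<Omega> = {u \<in> H1 \<Omega>. \<forall>b\<in>Basis. wderiv \<Omega> b u \<in> H1 \<Omega>}"

text \<open>
  The trace on the boundary is the continuous extension to $H^1$ of the restriction of functions
  which are smooth up to the boundary. It is unique up to null sets of the surface measure, and
  \<open>trace\<close> picks one representative.
\<close>

definition is_trace :: "'a::euclidean_space set \<Rightarrow> ('a \<Rightarrow> real) \<Rightarrow> ('a \<Rightarrow> real) \<Rightarrow> bool" where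
  "is_trace \<Omega> v t \<longleftrightarrow> t \<in> L2 (surface_measure \<Omega>) \<and>
     (\<exists>\<phi> :: nat \<Rightarrow> 'a \<Rightarrow> real. (\<forall>n. smooth (\<phi> n)) \<and>
        L2_tendsto (lebesgue_on \<Omega>) \<phi> v \<and>
        (\<forall>b\<in>Basis. L2_tendsto (lebesgue_on \<Omega>)
           (\<lambda>n x. frechet_derivative (\<phi> n) (at x) b) (wderiv \<Omega> b v)) \<and>
        L2_tendsto (surface_measure \<Omega>) \<phi> t)"

definition trace :: "'a::euclidean_space set \<Rightarrow> ('a \<Rightarrow> real) \<Rightarrow> 'a \<Rightarrow> real" where
  "trace \<Omega> v = (SOME t. is_trace \<Omega> v t)"

definition normal_deriv :: "'a::euclidean_space set \<Rightarrow> ('a \<Rightarrow> real) \<Rightarrow> 'a \<Rightarrow> real" where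
  "normal_deriv \<Omega> u x = (\<Sum>b\<in>Basis. trace \<Omega> (wderiv \<Omega> b u) x * (outer_normal \<Omega> x \<bullet> b))"


section \<open>The quadratic form and its eigenvalues\<close>

definition hess :: "'a::euclidean_space set \<Rightarrow> 'a \<Rightarrow> 'a \<Rightarrow> ('a \<Rightarrow> real) \<Rightarrow> 'a \<Rightarrow> real" where
  "hess \<Omega> i j u = wderiv \<Omega> i (wderiv \<Omega> j u)"

definition laplacian :: "'a::euclidean_space set \<Rightarrow> ('a \<Rightarrow> real) \<Rightarrow> 'a \<Rightarrow> real" where
  "laplacian \<Omega> u x = (\<Sum>i\<in>Basis. hess \<Omega> i i u x)"

definition Qform :: "'a::euclidean_space set \<Rightarrow> real \<Rightarrow> real \<Rightarrow> real \<Rightarrow> real \<Rightarrow>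
    ('a \<Rightarrow> real) \<Rightarrow> ('a \<Rightarrow> real) \<Rightarrow> real" where
  "Qform \<Omega> \<sigma> \<alpha> \<beta> \<gamma> u v =
     (\<integral>x. (1 - \<sigma>) * (\<Sum>i\<in>Basis. \<Sum>j\<in>Basis. hess \<Omega> i j u x * hess \<Omega> i j v x)
          + \<sigma> * (laplacian \<Omega> u x * laplacian \<Omega> v x) \<partial>lebesgue_on \<Omega>)
   + \<alpha> * (\<integral>x. (\<Sum>i\<in>Basis. wderiv \<Omega> i u x * wderiv \<Omega> i v x) \<partial>lebesgue_on \<Omega>)
   + \<beta> * (\<integral>x. normal_deriv \<Omega> u x * normal_deriv \<Omega> v x \<partial>surface_measure \<Omega>)
   + \<gamma> * (\<integral>x. trace \<Omega> u x * trace \<Omega> v x \<partial>surface_measure \<Omega>)"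

text \<open>
  A \<open>k\<close>-dimensional subspace of $H^2$, given as the span of \<open>k\<close> functions which are linearly
  independent modulo null sets.
\<close>

definition H2_subspace :: "'a::euclidean_space set \<Rightarrow> nat \<Rightarrow> ('a \<Rightarrow> real) set \<Rightarrow> bool" where
  "H2_subspace \<Omega> k V \<longleftrightarrow> (\<exists>w :: nat \<Rightarrow> 'a \<Rightarrow> real.
     (\<forall>i<k. w i \<in> H2 \<Omega>) \<and>
     (\<forall>c :: nat \<Rightarrow> real.
        (AE x in lebesgue_on \<Omega>. (\<Sum>i<k. c i * w i x) = 0) \<longrightarrow> (\<forall>i<k. c i = 0)) \<and>
     V = {(\<lambda>x. \<Sum>i<k. c i * w i x) | c :: nat \<Rightarrow> real. True})"

text \<open>
  The \<open>k\<close>-th eigenvalue counted with multiplicity, \<open>k \<ge> 1\<close>, by the min-max principle. The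
  infimum and the supremum are attained on a bounded $C^1$-domain for
  $-1/(d-1) < \sigma < 1$; they are taken in \<open>ereal\<close> so that no existence statement is needed for
  the definition.
\<close>

definition eigenvalue ::
  "'a::euclidean_space set \<Rightarrow> real \<Rightarrow> real \<Rightarrow> real \<Rightarrow> real \<Rightarrow> nat \<Rightarrow> ereal" where
  "eigenvalue \<Omega> \<sigma> \<alpha> \<beta> \<gamma> k =
     (INF V \<in> {V. H2_subspace \<Omega> k V}.
        SUP u \<in> {u \<in> V. \<not> (AE x in lebesgue_on \<Omega>. u x = 0)}.
          ereal (Qform \<Omega> \<sigma> \<alpha> \<beta> \<gamma> u u / (\<integral>x. (u x)\<^sup>2 \<partial>lebesgue_on \<Omega>)))"

end

theory Submission imports Defs begin

(*T1*)
abbreviation pd :: "'a::euclidean_space \<Rightarrow> ('a \<Rightarrow> real) \<Rightarrow> 'a \<Rightarrow> real" where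
  "pd b f \<equiv> \<lambda>x. frechet_derivative f (at x) b"

lemma pdI: "(f has_derivative f') (at x) \<Longrightarrow> pd b f x = f' b"
  using frechet_derivative_at by metis

lemma Ck_Suc_D: "Ck (Suc k) f \<Longrightarrow> Ck k f"
proof (induction k arbitrary: f)
  case 0 then show ?case by (auto simp: differentiable_imp_continuous_on)
next
  case (Suc k)
  have "Ck (Suc (Suc k)) f" by fact
  then have "f differentiable_on UNIV" "\<forall>b\<in>Basis. Ck (Suc k) (pd b f)"
    unfolding Ck.simps(2)[of "Suc k"] by blast+
  then show ?case using Suc.IH unfolding Ck.simps(2)[of k f] by blast
qed

lemma Ck_Suc_deriv:
  assumes "\<And>x. (f has_derivative f' x) (at x)" "\<And>b. b \<in> Basis \<Longrightarrow> Ck k (\<lambda>x. f' x b)"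
  shows "Ck (Suc k) f"
proof -
  have "pd b f = (\<lambda>x. f' x b)" for b using pdI[OF assms(1)] by auto
  then show ?thesis using assms
    by (auto simp: differentiable_on_def differentiable_def)
qed

lemma Ck_Suc_has_derivative:
  "Ck (Suc k) f \<Longrightarrow> (f has_derivative frechet_derivative f (at x)) (at x)"
  by (simp add: differentiable_on_def frechet_derivative_works[symmetric])

lemma Ck_const [simp]: "Ck k (\<lambda>x. c)"
proof (induction k arbitrary: c)
  case (Suc k)
  show ?case by (rule Ck_Suc_deriv[where f'="\<lambda>_ _. 0"]) (use Suc in auto)
qed auto

lemma Ck_add: "Ck k f \<Longrightarrow> Ck k g \<Longrightarrow> Ck k (\<lambda>x. f x + g x)"
proof (induction k arbitrary: f g)
  case 0 then show ?case by (auto intro: continuous_intros)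
next
  case (Suc k)
  show ?case
    by (rule Ck_Suc_deriv[OF has_derivative_add[OF Suc.prems[THEN Ck_Suc_has_derivative]]])
      (use Suc in auto)
qed

lemma Ck_mult: "Ck k f \<Longrightarrow> Ck k g \<Longrightarrow> Ck k (\<lambda>x. f x * g x)"
proof (induction k arbitrary: f g)
  case 0 then show ?case by (auto intro: continuous_intros)
next
  case (Suc k)
  show ?case
    by (rule Ck_Suc_deriv[OF has_derivative_mult[OF Suc.prems[THEN Ck_Suc_has_derivative]]])
      (use Suc Suc.prems[THEN Ck_Suc_D] in \<open>auto intro!: Ck_add\<close>)
qed

text \<open>Composition with an affine function, vector-valued (dilation and translation).\<close>
lemma Ck_dilate: "Ck k f \<Longrightarrow> Ck k (\<lambda>x. f (a *\<^sub>R (x - x0)))"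
proof (induction k arbitrary: f)
  case 0 
  have "continuous_on UNIV (\<lambda>x. a *\<^sub>R (x - x0))" by (intro continuous_intros)
  with 0 show ?case by (auto intro: continuous_on_compose2[of UNIV f])
next
  case (Suc k)
  have g: "((\<lambda>x. a *\<^sub>R (x - x0)) has_derivative (\<lambda>v. a *\<^sub>R v)) (at x)" for x
    by (auto intro!: derivative_eq_intros)
  have lin: "linear (frechet_derivative f (at x))" for x
    using Suc.prems Ck_Suc_has_derivative has_derivative_linear by blast
  show ?case
    apply (rule Ck_Suc_deriv[where f'="\<lambda>x v. frechet_derivative f (at (a *\<^sub>R (x - x0))) (a *\<^sub>R v)"])
    subgoal for x using diff_chain_at[OF g Ck_Suc_has_derivative[OF Suc.prems]] by (simp add: o_def)
    subgoal for b using Suc by (auto simp: linear_cmul[OF lin] intro!: Ck_mult)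
    done
qed

lemma Ck_compose_coordinate:
  fixes p :: "real \<Rightarrow> real"
  shows "Ck k p \<Longrightarrow> Ck k (\<lambda>x::'a::euclidean_space. p (x \<bullet> j))"
proof (induction k arbitrary: p)
  case 0 
  have "continuous_on UNIV (\<lambda>x::'a. x \<bullet> j)" by (intro continuous_intros)
  with 0 show ?case by (auto intro: continuous_on_compose2[of UNIV p])
next
  case (Suc k)
  have g: "((\<lambda>x. x \<bullet> j) has_derivative (\<lambda>v. v \<bullet> j)) (at x)" for x
    by (auto intro!: derivative_eq_intros)
  have lin: "linear (frechet_derivative p (at x))" for x
    using Suc.prems Ck_Suc_has_derivative has_derivative_linear by blast
  have e: "frechet_derivative p (at y) c = c * frechet_derivative p (at y) 1" for y c
    using linear_cmul[OF lin, of y c 1] by simp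
  show ?case
    apply (rule Ck_Suc_deriv[where f'="\<lambda>x v. frechet_derivative p (at (x \<bullet> j)) (v \<bullet> j)"])
    subgoal for x using diff_chain_at[OF g Ck_Suc_has_derivative[OF Suc.prems]] by (simp add: o_def)
    subgoal for b using Suc by (subst e) (auto intro!: Ck_mult)
    done
qed

lemma smooth_const [simp]: "smooth (\<lambda>x. c)" by (simp add: smooth_def)
lemma smooth_add: "smooth f \<Longrightarrow> smooth g \<Longrightarrow> smooth (\<lambda>x. f x + g x)" by (simp add: smooth_def Ck_add)
lemma smooth_mult: "smooth f \<Longrightarrow> smooth g \<Longrightarrow> smooth (\<lambda>x. f x * g x)" by (simp add: smooth_def Ck_mult)
lemma smooth_diff: "smooth f \<Longrightarrow> smooth g \<Longrightarrow> smooth (\<lambda>x. f x - g x)"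
  using smooth_add[of f "\<lambda>x. (-1) * g x"] smooth_mult[of "\<lambda>x. -1" g] by simp
lemma smooth_sum: "(\<And>i. i \<in> I \<Longrightarrow> smooth (f i)) \<Longrightarrow> smooth (\<lambda>x. \<Sum>i\<in>I. f i x)"
  by (induction I rule: infinite_finite_induct) (auto intro: smooth_add)
lemma smooth_prod: "(\<And>i. i \<in> I \<Longrightarrow> smooth (f i)) \<Longrightarrow> smooth (\<lambda>x. \<Prod>i\<in>I. f i x)"
  by (induction I rule: infinite_finite_induct) (auto intro: smooth_mult)
lemma smooth_dilate: "smooth f \<Longrightarrow> smooth (\<lambda>x. f (a *\<^sub>R (x - x0)))"
  by (simp add: smooth_def Ck_dilate)
lemma smooth_compose_coordinate: "smooth p \<Longrightarrow> smooth (\<lambda>x. p (x \<bullet> j))" for p :: "real \<Rightarrow> real"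
  by (simp add: smooth_def Ck_compose_coordinate)

lemma smooth_has_derivative: "smooth f \<Longrightarrow> (f has_derivative frechet_derivative f (at x)) (at x)"
  using Ck_Suc_has_derivative smooth_def by blast

lemma smooth_pd: assumes "smooth f" "b \<in> Basis" shows "smooth (pd b f)"
proof -
  have "Ck (Suc k) f" for k using assms by (simp add: smooth_def del: Ck.simps)
  then show ?thesis using assms(2) by (simp add: smooth_def)
qed

lemma smooth_continuous: "smooth f \<Longrightarrow> continuous_on A f"
  by (metis Ck.simps(1) continuous_on_subset smooth_def subset_UNIV)

lemma smooth_borel [measurable_dest]: "smooth f \<Longrightarrow> f \<in> borel_measurable borel"
  by (simp add: borel_measurable_continuous_onI smooth_continuous)

lemma pd_add: "smooth f \<Longrightarrow> smooth g \<Longrightarrow> pd b (\<lambda>x. f x + g x) x = pd b f x + pd b g x"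
  by (rule pdI[OF has_derivative_add[OF smooth_has_derivative smooth_has_derivative]])
lemma pd_diff: "smooth f \<Longrightarrow> smooth g \<Longrightarrow> pd b (\<lambda>x. f x - g x) x = pd b f x - pd b g x"
  by (rule pdI[OF has_derivative_diff[OF smooth_has_derivative smooth_has_derivative]])
lemma pd_mult: "smooth f \<Longrightarrow> smooth g \<Longrightarrow> pd b (\<lambda>x. f x * g x) x = f x * pd b g x + pd b f x * g x"
  by (rule pdI[OF has_derivative_mult[OF smooth_has_derivative smooth_has_derivative]])
lemma pd_cmult: "smooth g \<Longrightarrow> pd b (\<lambda>x. c * g x) x = c * pd b g x"
  using pd_mult[where f="\<lambda>x. c" and g=g and b=b and x=x] by simp
lemma pd_sum: "(\<And>i. i \<in> I \<Longrightarrow> smooth (f i)) \<Longrightarrow> pd b (\<lambda>x. \<Sum>i\<in>I. f i x) x = (\<Sum>i\<in>I. pd b (f i) x)"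
  by (rule pdI[OF has_derivative_sum[OF smooth_has_derivative]])

lemma pd_dilate:
  assumes "smooth f"
  shows "pd b (\<lambda>x. f (a *\<^sub>R (x - x0))) x = a * pd b f (a *\<^sub>R (x - x0))"
proof -
  have g: "((\<lambda>x. a *\<^sub>R (x - x0)) has_derivative (\<lambda>v. a *\<^sub>R v)) (at x)" 
    by (auto intro!: derivative_eq_intros)
  have lin: "linear (frechet_derivative f (at y))" for y
    using assms smooth_has_derivative has_derivative_linear by blast
  show ?thesis
    using pdI[OF diff_chain_at[OF g smooth_has_derivative[OF assms]], of b] linear_cmul[OF lin]
    by (simp add: o_def)
qed

lemma pd_inner: 
  assumes "smooth f" shows "frechet_derivative f (at x) v = (\<Sum>b\<in>Basis. (v \<bullet> b) * pd b f x)"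
proof -
  have lin: "linear (frechet_derivative f (at x))"
    using assms smooth_has_derivative has_derivative_linear by blast
  have "frechet_derivative f (at x) v = frechet_derivative f (at x) (\<Sum>b\<in>Basis. (v \<bullet> b) *\<^sub>R b)"
    by (simp add: euclidean_representation)
  then show ?thesis by (simp add: linear_sum[OF lin] linear_cmul[OF lin])
qed

text \<open>On the real line the single partial derivative is the usual one.\<close>
lemma Ck_Suc_real:
  assumes "\<And>x. (f has_real_derivative f' x) (at x)" "Ck k f'"
  shows "Ck (Suc k) f"
  by (rule Ck_Suc_deriv[where f'="\<lambda>x v. f' x * v"])
    (use assms in \<open>auto simp: has_field_derivative_def\<close>)

lemma smooth_real_deriv: assumes "smooth (p::real\<Rightarrow>real)" 
  shows "(p has_real_derivative deriv p x) (at x)" "smooth (deriv p)"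
proof -
  have lin: "linear (frechet_derivative p (at y))" for y
    using assms smooth_has_derivative has_derivative_linear by blast
  have e: "frechet_derivative p (at y) c = pd 1 p y * c" for y c
    using linear_cmul[OF lin, of y c 1] by simp
  have d: "(p has_real_derivative pd 1 p x) (at x)" for x
    using smooth_has_derivative[OF assms, of x] e unfolding has_field_derivative_def
    by (metis (no_types, lifting) ext)
  then have "deriv p = pd 1 p" using DERIV_imp_deriv by blast
  with d smooth_pd[OF assms, of 1] show "(p has_real_derivative deriv p x) (at x)" "smooth (deriv p)"
    by auto
qed

lemma smooth_exp_mult: "smooth (\<lambda>t::real. exp (c * t))"
proof -
  have "Ck k (\<lambda>t::real. exp (c * t))" for k
  proof (induction k)
    case (Suc k)
    show ?case by (rule Ck_Suc_real[where f'="\<lambda>t. c * exp (c * t)"])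
      (use Suc in \<open>auto intro!: derivative_eq_intros Ck_mult\<close>)
  qed (auto intro!: continuous_intros)
  then show ?thesis by (simp add: smooth_def)
qed

lemma smooth_cos_sin_mult: "smooth (\<lambda>t::real. cos (c * t))" "smooth (\<lambda>t::real. sin (c * t))"
proof -
  have "Ck k (\<lambda>t::real. cos (c * t)) \<and> Ck k (\<lambda>t::real. sin (c * t))" for k
  proof (induction k)
    case (Suc k)
    show ?case 
      by (rule conjI[OF Ck_Suc_real[where f'="\<lambda>t. (-c) * sin (c * t)"] Ck_Suc_real[where f'="\<lambda>t. c * cos (c * t)"]])
      (use Suc in \<open>auto intro!: derivative_eq_intros Ck_mult Ck_mult[of _ "\<lambda>x. -c", simplified]\<close>)
  qed (auto intro!: continuous_intros)
  then show "smooth (\<lambda>t::real. cos (c * t))" "smooth (\<lambda>t::real. sin (c * t))" by (auto simp add: smooth_def)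
qed

definition flat :: "real \<Rightarrow> real" where "flat x = (if x > 0 then exp (- 1 / x) else 0)"

lemma poly_inverse_exp_tendsto:
  "((\<lambda>x::real. poly p (1 / x) * exp (- 1 / x)) \<longlongrightarrow> 0) (at_right 0)"
proof -
  have "((\<lambda>y::real. poly p y / exp y) \<longlongrightarrow> 0) at_top"
  proof -
    have "((\<lambda>y::real. \<Sum>i\<le>degree p. coeff p i * (y ^ i / exp y)) \<longlongrightarrow> (\<Sum>i\<le>degree p. coeff p i * 0)) at_top"
      by (intro tendsto_intros tendsto_power_div_exp_0)
    then show ?thesis by (simp add: poly_altdef sum_divide_distrib)
  qed
  then have "((\<lambda>x::real. poly p (inverse x) / exp (inverse x)) \<longlongrightarrow> 0) (at_right 0)"
    using filterlim_compose filterlim_inverse_at_top_right by blast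
  then show ?thesis by (simp add: exp_minus field_simps inverse_eq_divide)
qed

lemma smooth_flat: "smooth flat"
proof -
  define G where "G p x = (if x > 0 then poly p (1 / x) * exp (- 1 / x) else 0)" for p and x :: real
  define D where "D p = [:0,0,1:] * (p - pderiv p)" for p :: "real poly"
  have der: "(G p has_real_derivative G (D p) x) (at x)" for p x
  proof -
    consider "x > 0" | "x < 0" | "x = 0" by linarith
    then show ?thesis
    proof cases
      case 1
      have "((\<lambda>x. poly p (1 / x) * exp (- 1 / x)) has_real_derivative G (D p) x) (at x)"
        using 1 by (auto intro!: derivative_eq_intros simp: G_def D_def field_simps power2_eq_square)
      then show ?thesis
        by (rule DERIV_cong_ev[OF refl _ refl, THEN iffD1, rotated]) 
          (use 1 eventually_nhds_in_open[of "{0<..}" x] in \<open>auto simp: G_def elim!: eventually_mono\<close>)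
    next
      case 2
      have "((\<lambda>x. 0) has_real_derivative G (D p) x) (at x)" using 2 by (simp add: G_def)
      then show ?thesis
        by (rule DERIV_cong_ev[OF refl _ refl, THEN iffD1, rotated]) 
          (use 2 eventually_nhds_in_open[of "{..<0}" x] in \<open>auto simp: G_def elim!: eventually_mono\<close>)
    next
      case 3
      have r: "((\<lambda>h. G p h / h) \<longlongrightarrow> 0) (at_right 0)"
        using poly_inverse_exp_tendsto[of "[:0,1:] * p"]
        by (rule tendsto_cong[THEN iffD1, rotated]) (auto simp: G_def eventually_at_filter)
      have l: "((\<lambda>h. G p h / h) \<longlongrightarrow> 0) (at_left 0)"
        by (rule tendsto_eventually) (auto simp: G_def eventually_at_filter)
      show ?thesis using filterlim_split_at[OF l r] 3 by (simp add: DERIV_def G_def)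
    qed
  qed
  have "Ck k (G p)" for k p
  proof (induction k arbitrary: p)
    case 0 
    have "isCont (G p) x" for x using der DERIV_isCont by blast
    then show ?case by (simp add: continuous_at_imp_continuous_on)
  next
    case (Suc k) then show ?case using Ck_Suc_real der by blast
  qed
  moreover have "flat = G 1" by (auto simp: flat_def G_def fun_eq_iff)
  ultimately show ?thesis unfolding smooth_def by metis
qed

lemma flat_nonneg: "0 \<le> flat x" and flat_le_1: "flat x \<le> 1" and flat_pos: "0 < flat x \<longleftrightarrow> 0 < x"
  and flat_eq_0: "flat x = 0 \<longleftrightarrow> x \<le> 0"
  by (auto simp: flat_def)

lemma smooth_compose_affine: assumes "smooth (p::real\<Rightarrow>real)" shows "smooth (\<lambda>x. p (a * (x - c)))"
  using smooth_dilate[OF assms, of a c] by simp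

lemma flat_tendsto_1:
  assumes "t > 0" shows "(\<lambda>n. flat (real n * t)) \<longlonglongrightarrow> 1"
proof -
  have "(\<lambda>n. exp (- (inverse t * (1 / real n)))) \<longlonglongrightarrow> exp (- (inverse t * 0))"
    by (intro tendsto_intros lim_1_over_n)
  then have "(\<lambda>n. exp (- (inverse t * (1 / real n)))) \<longlonglongrightarrow> 1" by simp
  then show ?thesis
    by (rule Lim_transform_eventually)
      (use assms in \<open>auto simp: flat_def field_simps intro!: eventually_mono[OF eventually_gt_at_top[of 0]]\<close>)
qed

(*T3*)
lemma hausdorff_pre_le:
  assumes "A \<subseteq> (\<Union>i. C i)" "\<And>i::nat. bounded (C i)" "\<And>i. diameter (C i) \<le> \<delta>"
  shows "hausdorff_pre n \<delta> A \<le> (\<Sum>i. ennreal (unit_ball_vol (real n) * (diameter (C i) / 2) ^ n))"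
  unfolding hausdorff_pre_def by (intro INF_lower) (use assms in auto)

lemma hausdorff_pre_mono: "A \<subseteq> B \<Longrightarrow> hausdorff_pre n \<delta> A \<le> hausdorff_pre n \<delta> B"
  unfolding hausdorff_pre_def by (intro INF_superset_mono) auto

lemma hausdorff_pre_antimono: "\<delta> \<le> \<delta>' \<Longrightarrow> hausdorff_pre n \<delta>' A \<le> hausdorff_pre n \<delta> A"
  unfolding hausdorff_pre_def by (intro INF_superset_mono) (auto intro: order_trans)

lemma hausdorff_outer_mono: "A \<subseteq> B \<Longrightarrow> hausdorff_outer n A \<le> hausdorff_outer n B"
  unfolding hausdorff_outer_def by (intro SUP_mono) (auto intro: hausdorff_pre_mono)

lemma hausdorff_pre_le_outer: "0 < \<delta> \<Longrightarrow> hausdorff_pre n \<delta> A \<le> hausdorff_outer n A"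
  unfolding hausdorff_outer_def by (intro SUP_upper) auto

lemma hausdorff_outer_empty: assumes "n \<ge> 1" shows "hausdorff_outer n {} = 0"
proof -
  have "hausdorff_pre n \<delta> ({}::'a set) \<le> 0" if "\<delta> > 0" for \<delta>
    using hausdorff_pre_le[of "{}" "\<lambda>_. {}::'a set" \<delta> n] that assms by (simp add: zero_power)
  then show ?thesis unfolding hausdorff_outer_def 
    by (metis (mono_tags, lifting) SUP_least greaterThan_iff le_zero_eq)
qed

lemma hausdorff_pre_subadditive:
  fixes A :: "nat \<Rightarrow> 'a::euclidean_space set"
  shows "hausdorff_pre n \<delta> (\<Union>i. A i) \<le> (\<Sum>i. hausdorff_pre n \<delta> (A i))"
proof (rule ennreal_le_epsilon)
  let ?O = "hausdorff_pre n \<delta> :: 'a set \<Rightarrow> _" 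
  let ?w = "\<lambda>C::'a set. ennreal (unit_ball_vol (real n) * (diameter C / 2) ^ n)"
  fix b and e :: real assume e: "0 < e" and fin: "(\<Sum>i. ?O (A i)) < top"
  have "\<exists>B. A i \<subseteq> (\<Union>j. B j) \<and> (\<forall>j. bounded (B j) \<and> diameter (B j) \<le> \<delta>) \<and>
      (\<Sum>j. ?w (B j)) \<le> ?O (A i) + ennreal (e * (1/2)^Suc i)" for i
  proof -
    have "?O (A i) < ?O (A i) + ennreal (e * (1/2) ^ Suc i)"
      using fin e by (auto simp add: less_top dest!: ennreal_suminf_lessD)
    then show ?thesis
      unfolding hausdorff_pre_def[of n \<delta> "A i"] by (subst (asm) INF_less_iff) (auto intro: less_imp_le)
  qed
  then obtain B where B: "\<And>i. A i \<subseteq> (\<Union>j. B i j)" "\<And>i j. bounded (B i j)" "\<And>i j. diameter (B i j) \<le> \<delta>"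
    "\<And>i. (\<Sum>j. ?w (B i j)) \<le> ?O (A i) + ennreal (e * (1/2)^Suc i)" by metis
  define C where "C = case_prod B o prod_decode"
  have "(\<Union>i. A i) \<subseteq> (\<Union>i. C i)"
    using B(1) by (auto simp add: C_def subset_eq) (metis prod.case prod_encode_inverse)
  then have "?O (\<Union>i. A i) \<le> (\<Sum>i. ?w (C i))"
    by (rule hausdorff_pre_le) (auto simp: C_def split_beta B)
  also have "\<dots> = (\<Sum>n. \<Sum>i. ?w (B n i))"
    unfolding C_def comp_def 
    by (rule suminf_ennreal_2dimen[where f="\<lambda>p. ?w (case_prod B p)", simplified, symmetric, OF refl, symmetric])
  also have "\<dots> \<le> (\<Sum>n. ?O (A n) + ennreal (e * (1/2) ^ Suc n))"
    by (intro suminf_le summableI allI B(4))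
  also have "... = (\<Sum>n. ?O (A n)) + (\<Sum>n. ennreal e * ennreal ((1/2) ^ Suc n))"
    using e by (subst suminf_add[symmetric]) (auto simp del: ennreal_suminf_cmult simp add: ennreal_mult[symmetric])
  also have "\<dots> = (\<Sum>n. ?O (A n)) + e"
    unfolding ennreal_suminf_cmult
    by (subst suminf_ennreal_eq[OF zero_le_power power_half_series]) auto
  finally show "?O (\<Union>i. A i) \<le> (\<Sum>n. ?O (A n)) + e" .
qed

lemma hausdorff_outer_subadditive:
  "hausdorff_outer n (\<Union>i::nat. A i) \<le> (\<Sum>i. hausdorff_outer n (A i))"
  unfolding hausdorff_outer_def[of n "\<Union>i. A i"]
proof (rule SUP_least)
  fix \<delta> :: real assume "\<delta> \<in> {0<..}"
  then show "hausdorff_pre n \<delta> (\<Union>i. A i) \<le> (\<Sum>i. hausdorff_outer n (A i))"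
    by (intro order_trans[OF hausdorff_pre_subadditive] suminf_le summableI allI hausdorff_pre_le_outer) auto
qed

lemma hausdorff_outer_Un: 
  assumes "n \<ge> 1" shows "hausdorff_outer n (A \<union> B) \<le> hausdorff_outer n A + hausdorff_outer n B"
proof -
  let ?f = "\<lambda>i::nat. if i = 0 then A else if i = 1 then B else {}"
  have "(\<Union>i. ?f i) = A \<union> B" by (auto split: if_splits)
  moreover have "(\<Sum>i. hausdorff_outer n (?f i)) = (\<Sum>i\<in>{0,1}. hausdorff_outer n (?f i))"
    by (rule suminf_finite) (auto simp: hausdorff_outer_empty[OF assms])
  ultimately show ?thesis using hausdorff_outer_subadditive[of n ?f] by simp
qed

lemma hausdorff_outer_metric:
  fixes A B :: "'a::euclidean_space set"
  assumes n: "n \<ge> 1" and d: "d > 0" and sep: "\<And>x y. x \<in> A \<Longrightarrow> y \<in> B \<Longrightarrow> d \<le> dist x y"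
  shows "hausdorff_outer n A + hausdorff_outer n B \<le> hausdorff_outer n (A \<union> B)"
proof -
  let ?w = "\<lambda>C::'a set. ennreal (unit_ball_vol (real n) * (diameter C / 2) ^ n)"
  have *: "hausdorff_pre n \<delta> A + hausdorff_pre n \<delta> B \<le> hausdorff_pre n \<delta> (A \<union> B)" if "0 < \<delta>" "\<delta> < d" for \<delta>
    unfolding hausdorff_pre_def[of n \<delta> "A \<union> B"]
  proof (rule INF_greatest, clarify)
    fix C :: "nat \<Rightarrow> 'a set" assume C: "A \<union> B \<subseteq> (\<Union>i. C i)" "\<forall>i. bounded (C i) \<and> diameter (C i) \<le> \<delta>"
    define P where "P i = (if C i \<inter> A = {} then {} else C i)" for i
    define Q where "Q i = (if C i \<inter> A = {} then C i else {})" for i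
    have "C i \<inter> B = {}" if "C i \<inter> A \<noteq> {}" for i
    proof (rule ccontr)
      assume "C i \<inter> B \<noteq> {}"
      with that obtain x y where "x \<in> C i" "x \<in> A" "y \<in> C i" "y \<in> B" by blast
      moreover have "bounded (C i)" "diameter (C i) \<le> \<delta>" using C(2) by auto
      ultimately show False
        using diameter_bounded_bound[of "C i" x y] sep[of x y] \<open>\<delta> < d\<close> by linarith
    qed
    then have "A \<subseteq> (\<Union>i. P i)" "B \<subseteq> (\<Union>i. Q i)" using C(1) by (auto simp: P_def Q_def) blast+
    then have "hausdorff_pre n \<delta> A + hausdorff_pre n \<delta> B \<le> (\<Sum>i. ?w (P i)) + (\<Sum>i. ?w (Q i))"
      using C(2) \<open>0 < \<delta>\<close> by (intro add_mono hausdorff_pre_le) (auto simp: P_def Q_def)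
    also have "\<dots> = (\<Sum>i. ?w (P i) + ?w (Q i))" by (rule suminf_add) auto
    also have "\<dots> = (\<Sum>i. ?w (C i))"
      using n by (intro suminf_cong) (auto simp: P_def Q_def zero_power)
    finally show "hausdorff_pre n \<delta> A + hausdorff_pre n \<delta> B \<le> (\<Sum>i. ?w (C i))" .
  qed
  have **: "hausdorff_pre n \<delta>1 A + hausdorff_pre n \<delta>2 B \<le> hausdorff_outer n (A \<union> B)" 
    if "0 < \<delta>1" "0 < \<delta>2" for \<delta>1 \<delta>2
  proof -
    define \<delta> where "\<delta> = min (min \<delta>1 \<delta>2) (d/2)"
    have "\<delta> > 0" "\<delta> < d" "\<delta> \<le> \<delta>1" "\<delta> \<le> \<delta>2" using that d by (auto simp: \<delta>_def)
    then show ?thesis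
      by (meson * add_mono hausdorff_pre_antimono hausdorff_pre_le_outer order_trans)
  qed
  have ne: "{0<..} \<noteq> ({} :: real set)" using greaterThan_non_empty by blast
  have "hausdorff_outer n A + hausdorff_pre n \<delta>2 B \<le> hausdorff_outer n (A \<union> B)" if "0 < \<delta>2" for \<delta>2
    unfolding hausdorff_outer_def[of n A] ennreal_SUP_add_left[OF ne, symmetric]
    by (rule SUP_least) (use ** that in auto)
  then show ?thesis unfolding hausdorff_outer_def[of n B] ennreal_SUP_add_right[OF ne]
    by (intro SUP_least) auto
qed

lemma hausdorff_outer_closed_split:
  fixes F X :: "'a::euclidean_space set"
  assumes n: "n \<ge> 1" and F: "closed F" "F \<noteq> {}"
  shows "hausdorff_outer n (X \<inter> F) + hausdorff_outer n (X - F) \<le> hausdorff_outer n X"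
proof (cases "hausdorff_outer n X = top")
  case False
  let ?h = "hausdorff_outer n :: 'a set \<Rightarrow> _"
  define Y where "Y k = {x \<in> X. 1 / (real k + 1) \<le> infdist x F}" for k
  define R where "R j = {x \<in> X. 1 / (real j + 2) \<le> infdist x F \<and> infdist x F < 1 / (real j + 1)}" for j
  have hfin: "?h B \<noteq> top" if "B \<subseteq> X" for B using hausdorff_outer_mono[OF that, of n] False top.extremum_unique by force
  have lip: "infdist x F \<le> dist x y + infdist y F" for x y
    using infdist_triangle[of x F y] by (simp add: dist_commute add.commute)
  have shell: "(\<Sum>j<N. ?h (R (2*j + p))) \<le> ?h (\<Union>j<N. R (2*j + p))" for N p
  proof (induction N)
    case (Suc N)
    define d where "d = 1 / (2 * real N + real p) - 1 / (2 * real N + real p + 1)"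
    have "?h (\<Union>j<N. R (2*j + p)) + ?h (R (2*N + p)) \<le> ?h ((\<Union>j<N. R (2*j + p)) \<union> R (2*N + p))"
    proof (cases "N = 0")
      case True then show ?thesis by (simp add: hausdorff_outer_empty[OF n])
    next
      case False
      show ?thesis
      proof (rule hausdorff_outer_metric[OF n])
        have "1 / (2 * real N + real p + 1) < 1 / (2 * real N + real p)"
          using False by (intro divide_strict_left_mono) auto
        then show "d > 0" by (simp add: d_def)
      next
        fix x y assume x: "x \<in> (\<Union>j<N. R (2*j + p))" and y: "y \<in> R (2*N + p)"
        then obtain j where j: "j < N" "x \<in> R (2*j + p)" by auto
        have "1 / (2 * real N + real p) \<le> 1 / (real (2*j + p) + 2)"
          using j(1) by (intro divide_left_mono) auto
        then show "d \<le> dist x y" using lip[of x y] j(2) y by (auto simp: d_def R_def)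
      qed
    qed
    then have "(\<Sum>j<N. ?h (R (2*j + p))) + ?h (R (2*N + p)) \<le> ?h ((\<Union>j<N. R (2*j + p)) \<union> R (2*N + p))"
      using Suc.IH by (meson add_right_mono order_trans)
    moreover have "(\<Union>j<Suc N. R (2*j + p)) = (\<Union>j<N. R (2*j + p)) \<union> R (2*N + p)"
      by (auto simp: lessThan_Suc)
    ultimately show ?case by simp
  qed auto
  have "(\<Sum>j<M. ?h (R j)) \<le> ?h X + ?h X" for M
  proof -
    have "(\<Sum>j<2*N. ?h (R j)) = (\<Sum>j<N. ?h (R (2*j + 0))) + (\<Sum>j<N. ?h (R (2*j + 1)))" for N
      by (induction N) (auto simp: algebra_simps)
    also have "\<dots> N \<le> ?h X + ?h X" for N
      by (intro add_mono order_trans[OF shell] hausdorff_outer_mono) (auto simp: R_def)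
    finally have "(\<Sum>j<2*M. ?h (R j)) \<le> ?h X + ?h X" .
    moreover have "(\<Sum>j<M. ?h (R j)) \<le> (\<Sum>j<2*M. ?h (R j))" by (intro sum_mono2) auto
    ultimately show ?thesis by (rule order_trans[rotated])
  qed
  then have "(\<Sum>j. ?h (R j)) \<le> ?h X + ?h X" unfolding suminf_eq_SUP by (intro SUP_least)
  then have fin: "(\<Sum>j. ?h (R j)) \<noteq> top" using False
    by (metis ennreal_add_eq_top top.extremum_unique)
  define r where "r j = enn2real (?h (R j))" for j
  have hr: "?h (R j) = ennreal (r j)" for j
    using hfin[of "R j"] by (auto simp: r_def R_def less_top)
  have sr: "summable r" using fin by (intro summable_suminf_not_top) (auto simp: hr[symmetric], auto simp: r_def)
  have r0: "r j \<ge> 0" for j by (simp add: r_def)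
  have XF: "X - F = Y k \<union> (\<Union>j. R (j + k))" for k
  proof (rule set_eqI, rule iffI)
    fix x assume x: "x \<in> X - F"
    then have pos: "infdist x F > 0" using F by (simp add: infdist_pos_not_in_closed)
    show "x \<in> Y k \<union> (\<Union>j. R (j + k))"
    proof (cases "x \<in> Y k")
      case False
      with x have lt: "infdist x F < 1 / (real k + 1)" by (auto simp: Y_def)
      define m where "m = (LEAST m. 1 / (real m + 1) \<le> infdist x F)"
      have ex: "\<exists>m::nat. 1 / (real m + 1) \<le> infdist x F"
        using reals_Archimedean[OF pos] by (auto simp: inverse_eq_divide add.commute intro: less_imp_le)
      have m: "1 / (real m + 1) \<le> infdist x F" unfolding m_def by (rule LeastI_ex[OF ex])
      have "k < m"
      proof (rule ccontr)
        assume "\<not> k < m" then have "1 / (real k + 1) \<le> 1 / (real m + 1)" by (intro divide_left_mono) auto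
        with lt m show False by linarith
      qed
      moreover have "\<not> 1 / (real (m - 1) + 1) \<le> infdist x F"
        using \<open>k < m\<close> not_less_Least[of "m - 1" "\<lambda>m. 1 / (real m + 1) \<le> infdist x F"] by (auto simp: m_def)
      ultimately have "x \<in> R ((m - 1 - k) + k)" using m x by (auto simp: R_def of_nat_diff add.commute)
      then show ?thesis by blast
    qed auto
  next
    fix x assume "x \<in> Y k \<union> (\<Union>j. R (j + k))"
    then have "x \<in> X" "infdist x F > 0" by (auto simp: Y_def R_def intro: less_le_trans[rotated])
    then show "x \<in> X - F" by (auto)
  qed
  show ?thesis
  proof (rule ennreal_le_epsilon)
    fix e :: real assume e: "e > 0"
    obtain k where k: "norm (\<Sum>i. r (i + k)) < e" using suminf_exist_split[OF e sr] by blast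
    have "?h (\<Union>j. R (j + k)) \<le> (\<Sum>j. ennreal (r (j + k)))"
      using hausdorff_outer_subadditive[of n "\<lambda>j. R (j + k)"] by (simp add: hr)
    also have "\<dots> = ennreal (\<Sum>i. r (i + k))"
      using sr r0 by (intro suminf_ennreal2) (auto simp: summable_iff_shift)
    also have "\<dots> \<le> ennreal e" using k by (intro ennreal_leI) auto
    finally have tail: "?h (\<Union>j. R (j + k)) \<le> ennreal e" .
    have "?h (X \<inter> F) + ?h (Y k) \<le> ?h (X \<inter> F \<union> Y k)"
    proof (rule hausdorff_outer_metric[OF n])
      show "1 / (real k + 1) > 0" by simp
      fix x y assume "x \<in> X \<inter> F" "y \<in> Y k"
      then show "1 / (real k + 1) \<le> dist x y" using infdist_le[of x F y] by (auto simp: Y_def dist_commute)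
    qed
    also have "\<dots> \<le> ?h X" by (intro hausdorff_outer_mono) (auto simp: Y_def)
    finally have "?h (X \<inter> F) + (?h (Y k) + ?h (\<Union>j. R (j + k))) \<le> ?h X + ennreal e"
      using tail by (metis add.assoc add_mono)
    moreover have "?h (X - F) \<le> ?h (Y k) + ?h (\<Union>j. R (j + k))"
      unfolding XF[of k] by (rule hausdorff_outer_Un[OF n])
    ultimately show "?h (X \<inter> F) + ?h (X - F) \<le> ?h X + ennreal e"
      by (meson add_left_mono order_trans)
  qed
qed simp

lemma measure_space_hausdorff_outer:
  assumes n: "n \<ge> 1"
  shows "measure_space UNIV (sets (borel :: 'a::euclidean_space measure)) (hausdorff_outer n)"
proof -
  let ?h = "hausdorff_outer n :: 'a set \<Rightarrow> _"
  let ?L = "lambda_system UNIV (Pow UNIV) ?h"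
  have out: "outer_measure_space (Pow UNIV) ?h"
    unfolding outer_measure_space_def positive_def increasing_def countably_subadditive_def
    by (auto simp: hausdorff_outer_empty[OF n] hausdorff_outer_mono hausdorff_outer_subadditive)
  interpret sigma_algebra UNIV "Pow (UNIV :: 'a set)" by (rule sigma_algebra_Pow)
  have ms: "measure_space UNIV ?L ?h" by (rule caratheodory_lemma[OF out])
  have "F \<in> ?L" if "closed F" for F
    unfolding lambda_system_eq
  proof (clarsimp)
    fix X
    show "?h (X \<inter> F) + ?h (X - F) = ?h X"
    proof (cases "F = {}")
      case True then show ?thesis by (simp add: hausdorff_outer_empty[OF n])
    next
      case False
      have "?h X \<le> ?h (X \<inter> F) + ?h (X - F)"
        using hausdorff_outer_Un[OF n, of "X \<inter> F" "X - F"] by (simp add: Int_Diff_Un)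
      then show ?thesis using hausdorff_outer_closed_split[OF n that False, of X] by (intro antisym)
    qed
  qed
  then have "sigma_sets UNIV (Collect closed) \<subseteq> ?L"
    by (intro sigma_algebra.sigma_sets_subset) (use ms in \<open>auto simp: measure_space_def\<close>)
  moreover have "sets (borel::'a measure) = sigma_sets UNIV (Collect closed)"
    by (simp add: borel_eq_closed)
  ultimately show ?thesis 
    using measure_down[OF ms] sets.sigma_algebra_axioms[of "borel :: 'a measure"] by auto
qed

lemma sets_hausdorff_measure [simp, measurable_cong]: "sets (hausdorff_measure n) = sets borel"
  and space_hausdorff_measure [simp]: "space (hausdorff_measure n) = UNIV"
  unfolding hausdorff_measure_def using sets.sigma_sets_eq[of borel] by (auto simp: sets_measure_of_conv space_measure_of_conv)

lemma emeasure_hausdorff_measure: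
  fixes A :: "'a::euclidean_space set"
  assumes "n \<ge> 1" "A \<in> sets borel"
  shows "emeasure (hausdorff_measure n) A = hausdorff_outer n A"
  unfolding hausdorff_measure_def
proof (rule emeasure_measure_of_sigma)
  note ms = measure_space_hausdorff_outer[OF assms(1), where 'a='a]
  show "sigma_algebra UNIV (sets (borel::'a measure))" "positive (sets (borel::'a measure)) (hausdorff_outer n)" 
     "countably_additive (sets (borel::'a measure)) (hausdorff_outer n)"
    using ms by (auto simp: measure_space_def)
qed (use assms in auto)

(*T4*)
abbreviation vol :: "'a::euclidean_space set \<Rightarrow> real" where "vol \<equiv> measure lborel"

definition box_family :: "'a::euclidean_space set set \<Rightarrow> bool" where
  "box_family p \<longleftrightarrow> finite p \<and> (\<forall>K\<in>p. (\<exists>a b. K = cbox a b) \<and> interior K \<noteq> {}) \<and>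
     pairwise (\<lambda>K L. interior K \<inter> interior L = {}) p"

abbreviation total_content :: "'a::euclidean_space set set \<Rightarrow> real" where
  "total_content p \<equiv> (\<Sum>K\<in>p. vol K)"

definition sumset :: "'a::real_vector set \<Rightarrow> 'a set \<Rightarrow> 'a set" where
  "sumset A B = {x + y | x y. x \<in> A \<and> y \<in> B}"

lemma sumset_commute: "sumset A B = sumset B A"
  unfolding sumset_def by (metis add.commute)

lemma sumset_mono: "A \<subseteq> A' \<Longrightarrow> B \<subseteq> B' \<Longrightarrow> sumset A B \<subseteq> sumset A' B'"
  by (auto simp: sumset_def)

lemma compact_sumset: "compact A \<Longrightarrow> compact B \<Longrightarrow> compact (sumset A B)"
  for A :: "'a::euclidean_space set"
  unfolding sumset_def by (rule compact_sums)

definition cut_family :: "'a::euclidean_space set \<Rightarrow> 'a set set \<Rightarrow> 'a set set" where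
  "cut_family H p = {K \<inter> H | K. K \<in> p \<and> interior (K \<inter> H) \<noteq> {}}"

lemma box_family_content_pos: "box_family p \<Longrightarrow> K \<in> p \<Longrightarrow> 0 < vol K"
proof -
  assume "box_family p" "K \<in> p"
  then obtain a b where "K = cbox a b" "interior K \<noteq> {}" unfolding box_family_def by metis
  then show ?thesis using content_eq_0_interior[of a b] by (simp add: zero_less_measure_iff)
qed

lemma total_content_pos: "box_family p \<Longrightarrow> p \<noteq> {} \<Longrightarrow> 0 < total_content p"
  using box_family_content_pos by (intro sum_pos) (simp_all add: box_family_def)

lemma compact_Union_box_family: "box_family p \<Longrightarrow> compact (\<Union>p)"
  unfolding box_family_def by (intro compact_Union) (simp, metis compact_cbox)

definition half :: "'a::euclidean_space \<Rightarrow> real \<Rightarrow> bool \<Rightarrow> 'a set" where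
  "half j s up = (if up then {x. x \<bullet> j \<ge> s} else {x. x \<bullet> j \<le> s})"

lemma half_cbox: "j \<in> Basis \<Longrightarrow> \<exists>c d. cbox a b \<inter> half j s up = cbox c d"
proof -
  assume j: "j \<in> Basis"
  show ?thesis
  proof (cases up)
    case True
    show ?thesis unfolding half_def if_P[OF True] interval_split(2)[OF j] by blast
  next
    case False
    show ?thesis unfolding half_def if_not_P[OF False] interval_split(1)[OF j] by blast
  qed
qed

lemma
  assumes p: "box_family p" and j: "j \<in> Basis"
  shows box_family_cut: "box_family (cut_family (half j s up) p)"
    and total_content_cut: "total_content (cut_family (half j s up) p) = (\<Sum>K\<in>p. vol (K \<inter> half j s up))"
    and card_cut: "card (cut_family (half j s up) p) \<le> card p"
    and card_cut_less: "K \<in> p \<Longrightarrow> interior (K \<inter> half j s up) = {} \<Longrightarrow> card (cut_family (half j s up) p) < card p"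
proof -
  let ?H = "half j s up"
  define q where "q = {K \<in> p. interior (K \<inter> ?H) \<noteq> {}}"
  have fin: "finite p" using p by (simp add: box_family_def)
  then have finq: "finite q" by (simp add: q_def)
  have cq: "cut_family ?H p = (\<lambda>K. K \<inter> ?H) ` q" by (auto simp: cut_family_def q_def)
  have dis: "interior (K \<inter> ?H) \<inter> interior (L \<inter> ?H) = {}" if "K \<in> p" "L \<in> p" "K \<noteq> L" for K L
    using p that interior_mono[of "K \<inter> ?H" K] interior_mono[of "L \<inter> ?H" L]
    unfolding box_family_def pairwise_def by blast
  have inj: "inj_on (\<lambda>K. K \<inter> ?H) q"
  proof (rule inj_onI, rule ccontr)
    fix K L assume "K \<in> q" "L \<in> q" "K \<inter> ?H = L \<inter> ?H" "K \<noteq> L"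
    then show False using dis[of K L] by (simp add: q_def)
  qed
  have box: "\<exists>c d. K \<inter> ?H = cbox c d" if "K \<in> p" for K
  proof -
    obtain a b where "K = cbox a b" using p \<open>K \<in> p\<close> unfolding box_family_def by metis
    then show ?thesis using half_cbox[OF j] by metis
  qed
  have "pairwise (\<lambda>K L. interior K \<inter> interior L = {}) (cut_family ?H p)"
    unfolding cq
  proof (rule pairwiseI)
    fix A B assume "A \<in> (\<lambda>K. K \<inter> ?H) ` q" "B \<in> (\<lambda>K. K \<inter> ?H) ` q" "A \<noteq> B"
    then obtain K L where "K \<in> p" "L \<in> p" "A = K \<inter> ?H" "B = L \<inter> ?H" "K \<noteq> L" unfolding q_def by blast
    then show "interior A \<inter> interior B = {}" using dis by metis
  qed
  moreover have "(\<exists>c d. A = cbox c d) \<and> interior A \<noteq> {}" if "A \<in> cut_family ?H p" for A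
  proof -
    from that obtain K where "K \<in> p" "A = K \<inter> ?H" "interior (K \<inter> ?H) \<noteq> {}" unfolding cut_family_def by blast
    then show ?thesis using box by metis
  qed
  ultimately show "box_family (cut_family ?H p)"
    unfolding box_family_def using finq cq by simp
  have "total_content (cut_family ?H p) = (\<Sum>K\<in>q. vol (K \<inter> ?H))"
    unfolding cq by (simp add: sum.reindex[OF inj])
  also have "\<dots> = (\<Sum>K\<in>p. vol (K \<inter> ?H))"
  proof (intro sum.mono_neutral_left fin ballI)
    fix K assume "K \<in> p - q"
    then have "interior (K \<inter> ?H) = {}" "K \<in> p" by (auto simp only: q_def)
    then show "vol (K \<inter> ?H) = 0" using box content_eq_0_interior by metis
  qed (auto simp only: q_def)
  finally show "total_content (cut_family ?H p) = (\<Sum>K\<in>p. vol (K \<inter> ?H))" .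
  have cc: "card (cut_family ?H p) \<le> card q" unfolding cq by (rule card_image_le[OF finq])
  also have "card q \<le> card p" using fin by (intro card_mono) (auto simp: q_def)
  finally show "card (cut_family ?H p) \<le> card p" .
  assume "K \<in> p" "interior (K \<inter> ?H) = {}"
  then have "q \<subset> p" by (auto simp: q_def)
  then have "card q < card p" using fin by (rule psubset_card_mono[rotated])
  with cc show "card (cut_family ?H p) < card p" by simp
qed

lemma total_content_split:
  assumes p: "box_family p" and j: "j \<in> Basis"
  shows "total_content p = total_content (cut_family (half j s False) p) + total_content (cut_family (half j s True) p)"
  unfolding total_content_cut[OF assms] sum.distrib[symmetric]
proof (intro sum.cong refl)
  fix K assume "K \<in> p"
  with p obtain a b where K: "K = cbox a b" unfolding box_family_def by metis
  show "vol K = vol (K \<inter> half j s False) + vol (K \<inter> half j s True)"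
    unfolding K half_def by (simp only: if_True if_False) (rule content_split[OF j])
qed

lemma content_cut_continuous:
  assumes j: "j \<in> Basis" and ne: "interior (cbox a b) \<noteq> {}"
  shows "continuous_on UNIV (\<lambda>t. vol (cbox a b \<inter> half j t False))"
proof -
  have ab: "a \<bullet> i < b \<bullet> i" if "i \<in> Basis" for i using ne that unfolding interior_cbox box_ne_empty by blast
  have "vol (cbox a b \<inter> half j t False) = max 0 (min (b \<bullet> j) t - a \<bullet> j) * (\<Prod>i\<in>Basis - {j}. b \<bullet> i - a \<bullet> i)" for t
  proof -
    let ?d = "(\<Sum>i\<in>Basis. (if i = j then min (b\<bullet>j) t else b\<bullet>i) *\<^sub>R i)"
    have e: "cbox a b \<inter> half j t False = cbox a ?d" using interval_split(1)[OF j] by (simp add: half_def)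
    have d: "?d \<bullet> i = (if i = j then min (b\<bullet>j) t else b\<bullet>i)" if "i \<in> Basis" for i
      using that by simp
    show ?thesis
    proof (cases "cbox a ?d = {}")
      case True
      then obtain i where i: "i \<in> Basis" "?d \<bullet> i < a \<bullet> i" by (auto simp: box_eq_empty)
      with ab[of i] have "i = j" "min (b \<bullet> j) t < a \<bullet> j" by (auto simp: d split: if_splits)
      with True show ?thesis unfolding e by simp
    next
      case False
      then have "a \<bullet> j \<le> min (b \<bullet> j) t" using j unfolding box_ne_empty by (auto simp: d)
      then show ?thesis unfolding e content_cbox'[OF False] using j
        by (subst prod.remove[OF finite_Basis j]) (auto simp: d intro!: prod.cong)
    qed
  qed
  then show ?thesis by (simp only:) (intro continuous_intros)
qed

lemma cut_fraction:
  assumes q: "box_family q" and j: "j \<in> Basis" and th: "0 \<le> \<theta>" "\<theta> \<le> 1"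
  shows "\<exists>t. total_content (cut_family (half j t False) q) = \<theta> * total_content q"
proof -
  define f where "f t = (\<Sum>K\<in>q. vol (K \<inter> half j t False))" for t
  have cont: "continuous_on UNIV f" unfolding f_def
  proof (intro continuous_on_sum)
    fix K assume "K \<in> q"
    with q obtain a b where "K = cbox a b" "interior (cbox a b) \<noteq> {}" unfolding box_family_def by metis
    then show "continuous_on UNIV (\<lambda>t. vol (K \<inter> half j t False))" using content_cut_continuous[OF j] by simp
  qed
  obtain r where r: "\<And>x. x \<in> \<Union>q \<Longrightarrow> norm x \<le> r" 
    using compact_Union_box_family[OF q] compact_imp_bounded bounded_iff by metis
  define lo hi where "lo = - \<bar>r\<bar> - 1" and "hi = \<bar>r\<bar> + 1"
  have x: "lo < x \<bullet> j \<and> x \<bullet> j < hi" if "x \<in> K" "K \<in> q" for x K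
    proof -
    have "norm x \<le> r" using that by (intro r) blast
    then show ?thesis using Basis_le_norm[OF j, of x] by (simp add: lo_def hi_def abs_le_iff)
  qed
  have "K \<inter> half j lo False = {}" if "K \<in> q" for K 
    using x[OF _ that] unfolding half_def by fastforce
  moreover have "K \<inter> half j hi False = K" if "K \<in> q" for K 
    using x[OF _ that] unfolding half_def by fastforce
  ultimately have "f lo = 0" "f hi = total_content q" by (auto simp: f_def)
  moreover have "0 \<le> total_content q" by (intro sum_nonneg) auto
  ultimately have "f lo \<le> \<theta> * total_content q" "\<theta> * total_content q \<le> f hi"
    using th by (auto simp: mult_left_le_one_le)
  moreover have "lo \<le> hi" by (simp add: lo_def hi_def)
  ultimately obtain t where "f t = \<theta> * total_content q"
    using IVT'[of f lo "\<theta> * total_content q" hi] cont by (meson continuous_on_subset subset_UNIV)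
  then show ?thesis unfolding total_content_cut[OF q j] f_def by blast
qed

lemma sumset_content_split:
  fixes A B A1 A2 B1 B2 :: "'a::euclidean_space set"
  assumes c: "compact A" "compact B" "compact A1" "compact A2" "compact B1" "compact B2" and j: "j \<in> Basis"
    and sub: "A1 \<subseteq> A \<inter> {x. x \<bullet> j \<le> s}" "A2 \<subseteq> A \<inter> {x. x \<bullet> j \<ge> s}"
      "B1 \<subseteq> B \<inter> {x. x \<bullet> j \<le> t}" "B2 \<subseteq> B \<inter> {x. x \<bullet> j \<ge> t}"
  shows "vol (sumset A1 B1) + vol (sumset A2 B2) \<le> vol (sumset A B)"
proof -
  have fm: "sumset A1 B1 \<in> fmeasurable lborel" "sumset A2 B2 \<in> fmeasurable lborel" "sumset A B \<in> fmeasurable lborel"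
    by (intro fmeasurable_compact compact_sumset c)+
  have "AE x in lborel. x \<bullet> j \<noteq> s + t"
  proof -
    have "{x. x \<bullet> j = s + t} \<in> null_sets lebesgue" 
      using negligible_standard_hyperplane[OF j] negligible_iff_null_sets by blast
    then have "{x. x \<bullet> j = s + t} \<in> null_sets lborel"
      by (simp add: null_sets_completion_iff closed_hyperplane[of j, simplified inner_commute[of j]] borel_closed)
    then show ?thesis by (simp add: AE_iff_null closed_hyperplane[of j, simplified inner_commute[of j]] borel_closed)
  qed
  then have "AE x in lborel. x \<notin> sumset A1 B1 \<or> x \<notin> sumset A2 B2"
  proof (rule AE_mp, intro AE_I2 impI)
    fix x assume ne: "x \<bullet> j \<noteq> s + t"
    have "x \<bullet> j \<le> s + t" if "x \<in> sumset A1 B1"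
      using that sub by (fastforce simp: sumset_def inner_add_left)
    moreover have "s + t \<le> x \<bullet> j" if "x \<in> sumset A2 B2"
      using that sub by (fastforce simp: sumset_def inner_add_left)
    ultimately show "x \<notin> sumset A1 B1 \<or> x \<notin> sumset A2 B2" using ne by fastforce
  qed
  then have "vol (sumset A1 B1) + vol (sumset A2 B2) = vol (sumset A1 B1 \<union> sumset A2 B2)"
    using fm by (intro measure_Un_AE[symmetric])
  also have "\<dots> \<le> vol (sumset A B)"
  proof (rule measure_mono_fmeasurable)
    show "sumset A1 B1 \<union> sumset A2 B2 \<subseteq> sumset A B"
      using sub by (intro Un_least sumset_mono) blast+
    show "sumset A1 B1 \<union> sumset A2 B2 \<in> sets lborel" using fm by (intro sets.Un fmeasurableD)
  qed (rule fm)
  finally show ?thesis .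
qed

lemma sqrt_prod: "sqrt (\<Prod>i\<in>I. f i) = (\<Prod>i\<in>I. sqrt (f i))"
  by (induction I rule: infinite_finite_induct) (auto simp: real_sqrt_mult)

lemma brunn_minkowski_box:
  fixes a b c d :: "'a::euclidean_space"
  assumes "interior (cbox a b) \<noteq> {}" "interior (cbox c d) \<noteq> {}"
  shows "2 ^ DIM('a) * sqrt (vol (cbox a b) * vol (cbox c d)) \<le> vol (sumset (cbox a b) (cbox c d))"
proof -
  have ab: "a \<bullet> i < b \<bullet> i" "c \<bullet> i < d \<bullet> i" if "i \<in> Basis" for i 
    using assms that unfolding interior_cbox by (simp_all only: box_ne_empty)
  have ne: "cbox a b \<noteq> {}" "cbox c d \<noteq> {}" "cbox (a + c) (b + d) \<noteq> {}"
    unfolding box_ne_empty inner_add_left using ab by (auto simp: add_strict_mono less_imp_le)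
  have "sqrt (vol (cbox a b) * vol (cbox c d)) = (\<Prod>i\<in>Basis. sqrt ((b \<bullet> i - a \<bullet> i) * (d \<bullet> i - c \<bullet> i)))"
    unfolding content_cbox'[OF ne(1)] content_cbox'[OF ne(2)] prod.distrib[symmetric] sqrt_prod ..
  then have "2 ^ DIM('a) * sqrt (vol (cbox a b) * vol (cbox c d)) 
     = (\<Prod>i\<in>Basis. 2 * sqrt ((b \<bullet> i - a \<bullet> i) * (d \<bullet> i - c \<bullet> i)))"
    by (simp add: prod.distrib)
  also have "\<dots> \<le> (\<Prod>i\<in>Basis. (b + d) \<bullet> i - (a + c) \<bullet> i)"
  proof (intro prod_mono conjI)
    fix i :: 'a assume i: "i \<in> Basis"
    have "sqrt ((b \<bullet> i - a \<bullet> i) * (d \<bullet> i - c \<bullet> i)) \<le> ((b \<bullet> i - a \<bullet> i) + (d \<bullet> i - c \<bullet> i)) / 2"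
      using ab[OF i] by (intro arith_geo_mean_sqrt) auto
    then show "2 * sqrt ((b \<bullet> i - a \<bullet> i) * (d \<bullet> i - c \<bullet> i)) \<le> (b + d) \<bullet> i - (a + c) \<bullet> i"
      by (simp add: inner_add_left)
    show "0 \<le> 2 * sqrt ((b \<bullet> i - a \<bullet> i) * (d \<bullet> i - c \<bullet> i))" using ab[OF i] by simp
  qed
  also have "\<dots> = vol (cbox (a + c) (b + d))" unfolding content_cbox'[OF ne(3)] ..
  also have "\<dots> \<le> vol (sumset (cbox a b) (cbox c d))"
  proof (rule measure_mono_fmeasurable)
    show "cbox (a + c) (b + d) \<subseteq> sumset (cbox a b) (cbox c d)"
    proof
      fix x assume x: "x \<in> cbox (a + c) (b + d)"
      define t where "t i = (x \<bullet> i - a \<bullet> i - c \<bullet> i) / ((b \<bullet> i - a \<bullet> i) + (d \<bullet> i - c \<bullet> i))" for i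
      define y where "y = (\<Sum>i\<in>Basis. (a \<bullet> i + t i * (b \<bullet> i - a \<bullet> i)) *\<^sub>R i)"
      have t: "0 \<le> t i" "t i \<le> 1" "x \<bullet> i = a \<bullet> i + c \<bullet> i + t i * ((b \<bullet> i - a \<bullet> i) + (d \<bullet> i - c \<bullet> i))" 
        if i: "i \<in> Basis" for i
        using x ab[OF i] i by (auto simp: t_def mem_box inner_add_left divide_simps)
      have "y \<bullet> i \<ge> a \<bullet> i" "y \<bullet> i \<le> b \<bullet> i" "(x - y) \<bullet> i \<ge> c \<bullet> i" "(x - y) \<bullet> i \<le> d \<bullet> i" if i: "i \<in> Basis" for i
      proof -
        have y: "y \<bullet> i = a \<bullet> i + t i * (b \<bullet> i - a \<bullet> i)" using i by (simp add: y_def)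
        have xy: "(x - y) \<bullet> i = c \<bullet> i + t i * (d \<bullet> i - c \<bullet> i)" 
          using t(3)[OF i] by (simp add: inner_diff_left y algebra_simps)
        have "0 \<le> t i * (b \<bullet> i - a \<bullet> i)" "t i * (b \<bullet> i - a \<bullet> i) \<le> b \<bullet> i - a \<bullet> i"
          "0 \<le> t i * (d \<bullet> i - c \<bullet> i)" "t i * (d \<bullet> i - c \<bullet> i) \<le> d \<bullet> i - c \<bullet> i"
          using t[OF i] ab[OF i] by (auto intro: mult_left_le_one_le)
        then show "y \<bullet> i \<ge> a \<bullet> i" "y \<bullet> i \<le> b \<bullet> i" "(x - y) \<bullet> i \<ge> c \<bullet> i" "(x - y) \<bullet> i \<le> d \<bullet> i"
          unfolding y xy by linarith+
      qed
      then have "y \<in> cbox a b" "x - y \<in> cbox c d" by (auto simp: mem_box)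
      moreover have "x = y + (x - y)" by simp
      ultimately show "x \<in> sumset (cbox a b) (cbox c d)" unfolding sumset_def by blast
    qed
  qed (auto intro!: fmeasurable_compact compact_sumset)
  finally show ?thesis .
qed

lemma fraction_split:
  fixes m m1 m2 :: real
  assumes "m = m1 + m2" "0 < m1" "0 < m2"
  shows "0 < m1 / m" "m1 / m < 1" "m1 = (m1 / m) * m" "m2 = (1 - m1 / m) * m"
  using assms by (auto simp: field_simps)

lemma brunn_minkowski_step:
  fixes p q :: "'a::euclidean_space set set"
  assumes p: "box_family p" and q: "box_family q" "q \<noteq> {}" and two: "card p \<ge> 2"
    and IH: "\<And>p' q' :: 'a set set. box_family p' \<Longrightarrow> p' \<noteq> {} \<Longrightarrow> box_family q' \<Longrightarrow> q' \<noteq> {} \<Longrightarrow>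
        card p' < card p \<Longrightarrow> card q' \<le> card q \<Longrightarrow>
        2 ^ DIM('a) * sqrt (total_content p' * total_content q') \<le> vol (sumset (\<Union>p') (\<Union>q'))"
  shows "2 ^ DIM('a) * sqrt (total_content p * total_content q) \<le> vol (sumset (\<Union>p) (\<Union>q))"
proof -
  have fin: "finite p" using p by (simp add: box_family_def)
  obtain K0 L0 where KL: "K0 \<in> p" "L0 \<in> p" "K0 \<noteq> L0"
    using two card_le_Suc0_iff_eq[OF fin] by (metis not_less_eq_eq numeral_2_eq_2)
  obtain a b c d where cb: "K0 = cbox a b" "L0 = cbox c d" using p KL unfolding box_family_def by metis
  have ne: "box a b \<noteq> {}" "box c d \<noteq> {}" "box a b \<inter> box c d = {}"
  proof -
    have "interior K0 \<noteq> {}" "interior L0 \<noteq> {}" "interior K0 \<inter> interior L0 = {}"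
      using p KL unfolding box_family_def pairwise_def by metis+
    then show "box a b \<noteq> {}" "box c d \<noteq> {}" "box a b \<inter> box c d = {}" unfolding cb interior_cbox by simp_all
  qed
  have lt: "a \<bullet> i < b \<bullet> i" "c \<bullet> i < d \<bullet> i" if "i \<in> Basis" for i using ne(1,2) that unfolding box_ne_empty by (blast, blast)
  obtain j K L s where j: "j \<in> Basis" and K: "K \<in> p" "K \<subseteq> {x. x \<bullet> j \<le> s}" and L: "L \<in> p" "L \<subseteq> {x. s \<le> x \<bullet> j}"
  proof -
    obtain j where j: "j \<in> Basis" "b \<bullet> j \<le> c \<bullet> j \<or> d \<bullet> j \<le> a \<bullet> j"
      using ne(3) lt unfolding disjoint_interval(4) by (meson not_le)
    from j(2) show thesis
    proof
      assume "b \<bullet> j \<le> c \<bullet> j"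
      with j(1) show thesis
        by (intro that[of j K0 "b \<bullet> j" L0] KL) (auto simp: cb mem_box, force)
    next
      assume "d \<bullet> j \<le> a \<bullet> j"
      with j(1) show thesis
        by (intro that[of j L0 "d \<bullet> j" K0] KL) (auto simp: cb mem_box, force)
    qed
  qed
  have empty_int: "interior ({x. x \<bullet> j \<le> s} \<inter> {x. s \<le> x \<bullet> j}) = {}"
  proof -
    have "{x. x \<bullet> j \<le> s} \<inter> {x. s \<le> x \<bullet> j} = {x. j \<bullet> x = s}" by (auto simp: inner_commute)
    then show ?thesis using j by (simp add: interior_hyperplane nonzero_Basis)
  qed
  have iK: "interior (K \<inter> half j s True) = {}" and iL: "interior (L \<inter> half j s False) = {}"
  proof -
    have "K \<inter> half j s True \<subseteq> {x. x \<bullet> j \<le> s} \<inter> {x. s \<le> x \<bullet> j}"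
      "L \<inter> half j s False \<subseteq> {x. x \<bullet> j \<le> s} \<inter> {x. s \<le> x \<bullet> j}"
      using K(2) L(2) by (auto simp: half_def)
    then show "interior (K \<inter> half j s True) = {}" "interior (L \<inter> half j s False) = {}"
      using empty_int interior_mono by blast+
  qed
  have KH: "K \<inter> half j s False = K" "L \<inter> half j s True = L" using K(2) L(2) by (auto simp: half_def)
  let ?p = "\<lambda>up. cut_family (half j s up) p"
  have ne_p: "?p up \<noteq> {}" for up
  proof -
    have "interior K \<noteq> {}" "interior L \<noteq> {}"
      using p K(1) L(1) unfolding box_family_def by blast+
    then have "interior (K \<inter> half j s False) \<noteq> {}" "interior (L \<inter> half j s True) \<noteq> {}" by (simp_all only: KH not_False_eq_True)
    then have "K \<inter> half j s False \<in> ?p False" "L \<inter> half j s True \<in> ?p True"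
      unfolding cut_family_def using K(1) L(1) by blast+
    then show ?thesis by (cases up) auto
  qed
  have bp: "box_family (?p up)" for up by (rule box_family_cut[OF p j])
  have cp: "card (?p up) < card p" for up
    using card_cut_less[OF p j K(1) iK] card_cut_less[OF p j L(1) iL] by (cases up) simp_all
  define \<theta> where "\<theta> = total_content (?p False) / total_content p"
  have pos: "0 < total_content p" "0 < total_content q" "0 < total_content (?p up)" for up
  proof -
    have "p \<noteq> {}" using KL(1) by blast
    then show "0 < total_content p" by (rule total_content_pos[OF p])
  qed (rule total_content_pos[OF q] total_content_pos[OF bp ne_p])+
  have splitp: "total_content p = total_content (?p False) + total_content (?p True)"
    by (rule total_content_split[OF p j])
  have th: "0 < \<theta>" "\<theta> < 1" unfolding \<theta>_def
    by (rule fraction_split[OF splitp pos(3) pos(3)])+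
  have th3: "0 < 1 - \<theta>" using th(2) by linarith
  note th = th th3
  have tp: "total_content (?p False) = \<theta> * total_content p" "total_content (?p True) = (1 - \<theta>) * total_content p"
    unfolding \<theta>_def by (rule fraction_split[OF splitp pos(3) pos(3)])+
  obtain t where t: "total_content (cut_family (half j t False) q) = \<theta> * total_content q"
    using cut_fraction[OF q(1) j less_imp_le[OF th(1)] less_imp_le[OF th(2)]] by blast
  let ?q = "\<lambda>up. cut_family (half j t up) q"
  have t2: "total_content (?q True) = (1 - \<theta>) * total_content q"
  proof -
    have "total_content q = \<theta> * total_content q + total_content (?q True)"
      using total_content_split[OF q(1) j, of t] unfolding t .
    then show ?thesis unfolding left_diff_distrib mult_1 by linarith
  qed
  have bq: "box_family (?q up)" "card (?q up) \<le> card q" for up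
    by (rule box_family_cut[OF q(1) j], rule card_cut[OF q(1) j])
  have "?q True \<noteq> {}"
  proof
    assume "?q True = {}" then have "(1 - \<theta>) * total_content q = 0" using t2 by (metis sum.empty)
    then show False using th(2) pos(2) by (metis diff_gt_0_iff_gt less_irrefl mult_pos_pos)
  qed
  moreover have "?q False \<noteq> {}"
  proof
    assume "?q False = {}" then have "\<theta> * total_content q = 0" using t by (metis sum.empty)
    then show False using th(1) pos(2) by (metis less_irrefl mult_pos_pos)
  qed
  ultimately have ne_q: "?q up \<noteq> {}" for up by (metis (full_types))
  have scale: "sqrt ((r * x) * (r * y)) = r * sqrt (x * y)" if "r > 0" for r x y :: real
  proof -
    have "(r * x) * (r * y) = r\<^sup>2 * (x * y)" by (simp add: power2_eq_square)
    moreover have "sqrt (r\<^sup>2 * (x * y)) = \<bar>r\<bar> * sqrt (x * y)" unfolding real_sqrt_mult[of "r\<^sup>2"] real_sqrt_abs ..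
    ultimately show ?thesis using that by (metis abs_of_pos)
  qed
  have m: "2 ^ DIM('a) * (\<theta> * sqrt (total_content p * total_content q)) \<le> vol (sumset (\<Union>(?p False)) (\<Union>(?q False)))"
    "2 ^ DIM('a) * ((1 - \<theta>) * sqrt (total_content p * total_content q)) \<le> vol (sumset (\<Union>(?p True)) (\<Union>(?q True)))"
    using IH[OF bp ne_p bq(1) ne_q cp bq(2), of False False] IH[OF bp ne_p bq(1) ne_q cp bq(2), of True True]
    unfolding t t2 tp scale[OF th(1)] scale[OF th(3)] by (simp_all only:)
  have "vol (sumset (\<Union>(?p False)) (\<Union>(?q False))) + vol (sumset (\<Union>(?p True)) (\<Union>(?q True)))
      \<le> vol (sumset (\<Union>p) (\<Union>q))"
  proof (rule sumset_content_split[OF _ _ _ _ _ _ j])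
    have sub: "\<Union>(cut_family H r) \<subseteq> \<Union>r \<inter> H" for H and r :: "'a set set"
      unfolding cut_family_def by blast
    show "\<Union>(?p False) \<subseteq> \<Union>p \<inter> {x. x \<bullet> j \<le> s}" "\<Union>(?p True) \<subseteq> \<Union>p \<inter> {x. x \<bullet> j \<ge> s}"
      "\<Union>(?q False) \<subseteq> \<Union>q \<inter> {x. x \<bullet> j \<le> t}" "\<Union>(?q True) \<subseteq> \<Union>q \<inter> {x. x \<bullet> j \<ge> t}"
      using sub[of "half j s False" p] sub[of "half j s True" p] sub[of "half j t False" q] sub[of "half j t True" q]
      unfolding half_def if_True if_False by (simp_all only:)
  qed (rule compact_Union_box_family, rule p q bp bq)+
  then have X: "2 ^ DIM('a) * (\<theta> * sqrt (total_content p * total_content q)) + 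
     2 ^ DIM('a) * ((1 - \<theta>) * sqrt (total_content p * total_content q)) \<le> vol (sumset (\<Union>p) (\<Union>q))"
    by (rule order_trans[OF add_mono[OF m]])
  have "c * (\<theta> * z) + c * ((1 - \<theta>) * z) = c * z" for c z by (simp add: algebra_simps)
  from this[of "2 ^ DIM('a)" "sqrt (total_content p * total_content q)", symmetric] X
  show ?thesis by (rule ord_eq_le_trans)
qed

theorem brunn_minkowski_boxes:
  fixes p q :: "'a::euclidean_space set set"
  assumes "box_family p" "p \<noteq> {}" "box_family q" "q \<noteq> {}"
  shows "2 ^ DIM('a) * sqrt (total_content p * total_content q) \<le> vol (sumset (\<Union>p) (\<Union>q))"
  using assms
proof (induction "card p + card q" arbitrary: p q rule: less_induct)
  case less
  have fin: "finite p" "finite q" using less.prems(1,3) unfolding box_family_def by blast+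
  then have pos: "card p > 0" "card q > 0" using less.prems(2,4) unfolding card_gt_0_iff by blast+
  consider "card p \<ge> 2" | "card q \<ge> 2" | "card p = 1" "card q = 1" using pos by linarith
  then show ?case
  proof cases
    case 1
    show ?thesis
    proof (rule brunn_minkowski_step[OF less.prems(1,3,4) 1])
      fix p' q' :: "'a set set"
      assume h: "box_family p'" "p' \<noteq> {}" "box_family q'" "q' \<noteq> {}" "card p' < card p" "card q' \<le> card q"
      show "2 ^ DIM('a) * sqrt (total_content p' * total_content q') \<le> vol (sumset (\<Union>p') (\<Union>q'))"
        by (rule less.hyps[OF _ h(1-4)]) (use h(5,6) in linarith)
    qed
  next
    case 2
    have "2 ^ DIM('a) * sqrt (total_content q * total_content p) \<le> vol (sumset (\<Union>q) (\<Union>p))"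
    proof (rule brunn_minkowski_step[OF less.prems(3,1,2) 2])
      fix p' q' :: "'a set set"
      assume h: "box_family p'" "p' \<noteq> {}" "box_family q'" "q' \<noteq> {}" "card p' < card q" "card q' \<le> card p"
      show "2 ^ DIM('a) * sqrt (total_content p' * total_content q') \<le> vol (sumset (\<Union>p') (\<Union>q'))"
        by (rule less.hyps[OF _ h(1-4)]) (use h(5,6) in linarith)
    qed
    then show ?thesis by (metis mult.commute sumset_commute)
  next
    case 3
    then obtain K L where KL: "p = {K}" "q = {L}" by (metis card_1_singletonE)
    then obtain a b c d where "K = cbox a b" "L = cbox c d" "interior K \<noteq> {}" "interior L \<noteq> {}"
      using less.prems(1,3) unfolding box_family_def by (metis singletonI)
    with brunn_minkowski_box[of a b c d] show ?thesis unfolding KL by simp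
  qed
qed

(*T5*)
definition perp :: "'a::euclidean_space \<Rightarrow> 'a \<Rightarrow> 'a" where "perp e x = x - (x \<bullet> e) *\<^sub>R e"

lemma perp_add: "perp e (x + y) = perp e x + perp e y" 
  and perp_diff: "perp e (x - y) = perp e x - perp e y"
  and perp_scale: "perp e (c *\<^sub>R x) = c *\<^sub>R perp e x"
  by (auto simp: perp_def algebra_simps inner_add_left inner_diff_left)

lemma norm_perp: "norm e = 1 \<Longrightarrow> (norm x)\<^sup>2 = (norm (perp e x))\<^sup>2 + (x \<bullet> e)\<^sup>2"
  unfolding perp_def power2_norm_eq_inner
  by (simp add: inner_diff_left inner_diff_right inner_commute power2_eq_square norm_eq_1)

lemma norm_perp_le: assumes "norm e = 1" shows "norm (perp e x) \<le> norm x"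
proof -
  have "(norm (perp e x))\<^sup>2 \<le> (norm x)\<^sup>2" using norm_perp[OF assms, of x] by simp
  then show ?thesis by (rule power2_le_imp_le) simp
qed

lemma continuous_perp: "continuous_on A (perp e)"
  unfolding perp_def by (intro continuous_intros)

lemma measurable_perp [measurable]: "perp e \<in> borel_measurable borel"
  by (intro borel_measurable_continuous_onI continuous_perp)

lemma norm_perp_Basis:
  assumes "b \<in> Basis" shows "norm (perp b y) = sqrt (\<Sum>i\<in>Basis - {b}. (y \<bullet> i)\<^sup>2)"
proof -
  have "(perp b y) \<bullet> i = (if i = b then 0 else y \<bullet> i)" if "i \<in> Basis" for i
    using that assms by (simp add: perp_def inner_diff_left inner_Basis)
  then have "(\<Sum>i\<in>Basis. (perp b y \<bullet> i)\<^sup>2) = (\<Sum>i\<in>Basis - {b}. (y \<bullet> i)\<^sup>2)"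
    by (intro sum.mono_neutral_cong_right) auto
  then show ?thesis unfolding norm_eq_sqrt_inner
    by (subst euclidean_inner) (simp add: power2_eq_square)
qed

lemma emeasure_cylinder:
  fixes b :: "'a::euclidean_space"
  assumes b: "b \<in> Basis" and r: "r > 0" and s: "s \<ge> 0"
  shows "emeasure lborel {y. norm (perp b y) \<le> r \<and> \<bar>y \<bullet> b\<bar> \<le> s} =
     ennreal (2 * s * (unit_ball_vol (real (DIM('a) - 1)) * r ^ (DIM('a) - 1)))"
proof -
  interpret product_sigma_finite "\<lambda>_::'a. lborel :: real measure" by standard
  let ?B = "Basis - {b}" and ?Z = "{y. norm (perp b y) \<le> r \<and> \<bar>y \<bullet> b\<bar> \<le> s}"
  let ?P = "\<lambda>I. Pi\<^sub>M I (\<lambda>_::'a. lborel :: real measure)"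
  have ins: "insert b ?B = Basis" and card: "card ?B = DIM('a) - 1" using b by auto
  have Z: "?Z \<in> sets borel" by measurable
  have ind: "indicator ?Z (\<Sum>i\<in>Basis. (f(b := y)) i *\<^sub>R i) =
      (indicator ({f. sqrt (\<Sum>i\<in>?B. (f i)\<^sup>2) \<le> r} \<inter> space (?P ?B)) f * indicator {-s..s} y :: ennreal)"
    if "f \<in> space (?P ?B)" for f y
  proof -
    have "norm (perp b (\<Sum>i\<in>Basis. (f(b := y)) i *\<^sub>R i)) = sqrt (\<Sum>i\<in>?B. (f i)\<^sup>2)"
      unfolding norm_perp_Basis[OF b] by (intro arg_cong[where f=sqrt] sum.cong) auto
    moreover have "(\<Sum>i\<in>Basis. (f(b := y)) i *\<^sub>R i) \<bullet> b = y" using b by simp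
    ultimately show ?thesis using that by (auto simp: indicator_def abs_le_iff)
  qed
  have "emeasure lborel ?Z = (\<integral>\<^sup>+f. indicator ?Z (\<Sum>i\<in>Basis. f i *\<^sub>R i) \<partial>?P Basis)"
    by (subst lborel_eq) (use Z in \<open>simp add: nn_integral_distr flip: nn_integral_indicator\<close>)
  also have "\<dots> = (\<integral>\<^sup>+f. indicator ?Z (\<Sum>i\<in>Basis. f i *\<^sub>R i) \<partial>?P (insert b ?B))" by (simp only: ins)
  also have "\<dots> = (\<integral>\<^sup>+f. (\<integral>\<^sup>+y. indicator ?Z (\<Sum>i\<in>Basis. (f(b := y)) i *\<^sub>R i) \<partial>lborel) \<partial>?P ?B)"
    by (rule product_nn_integral_insert) (use Z in \<open>auto simp: ins intro!: measurable_compose[OF _ borel_measurable_indicator]\<close>)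
  also have "\<dots> = (\<integral>\<^sup>+f. (\<integral>\<^sup>+y. indicator ({f. sqrt (\<Sum>i\<in>?B. (f i)\<^sup>2) \<le> r} \<inter> space (?P ?B)) f * indicator {-s..s} y \<partial>lborel) \<partial>?P ?B)"
    by (intro nn_integral_cong) (simp only: ind)
  also have "\<dots> = (\<integral>\<^sup>+f. indicator ({f. sqrt (\<Sum>i\<in>?B. (f i)\<^sup>2) \<le> r} \<inter> space (?P ?B)) f * ennreal (2 * s) \<partial>?P ?B)"
    using s by (intro nn_integral_cong, subst nn_integral_cmult) (auto simp: mult.commute)
  also have "\<dots> = emeasure (?P ?B) ({f. sqrt (\<Sum>i\<in>?B. (f i)\<^sup>2) \<le> r} \<inter> space (?P ?B)) * ennreal (2 * s)"
  proof -
    have "{f. sqrt (\<Sum>i\<in>?B. (f i)\<^sup>2) \<le> r} \<inter> space (?P ?B) \<in> sets (?P ?B)" by measurable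
    then show ?thesis by (subst nn_integral_multc) auto
  qed
  also have "\<dots> = ennreal (unit_ball_vol (real (card ?B)) * r ^ card ?B) * ennreal (2 * s)"
    by (subst emeasure_cball_aux) (use r in auto)
  finally show ?thesis using r s unfolding card by (simp add: ennreal_mult'[symmetric] mult_ac)
qed

lemma box_family_cover:
  fixes K :: "'a::euclidean_space set"
  assumes K: "compact K" and eta: "\<eta> > 0"
  obtains p where "box_family p" "measure lborel K \<le> total_content p" "\<And>x. x \<in> \<Union>p \<Longrightarrow> \<exists>k\<in>K. dist x k \<le> \<eta>"
proof -
  have "\<exists>a b. x \<in> box a b \<and> cbox a b \<subseteq> ball x \<eta>" for x :: 'a
    using open_contains_cbox[of "ball x \<eta>" x] eta by (metis centre_in_ball open_ball)
  then obtain a b :: "'a \<Rightarrow> 'a" where ab: "\<And>x. x \<in> box (a x) (b x)" "\<And>x. cbox (a x) (b x) \<subseteq> ball x \<eta>" by metis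
  have "K \<subseteq> (\<Union>x\<in>K. box (a x) (b x))" using ab(1) by blast
  then obtain T where T: "T \<subseteq> K" "finite T" "K \<subseteq> (\<Union>x\<in>T. box (a x) (b x))"
    by (rule compactE_image[OF K open_box])
  define F where "F = (\<lambda>x. cbox (a x) (b x)) ` T"
  have "finite F" "\<And>s. s \<in> F \<Longrightarrow> \<exists>a b. s = cbox a b" using T(2) by (auto simp: F_def)
  then obtain p0 where p0: "p0 division_of (\<Union>F)" by (rule elementary_unions_intervals)
  define p where "p = {L \<in> p0. interior L \<noteq> {}}"
  have fin: "finite p0" using p0 by (rule division_of_finite)
  have box: "\<exists>a b. L = cbox a b" if "L \<in> p0" for L using division_ofD(4)[OF p0 that] .
  show thesis
  proof (rule that[of p])
    have "finite p" using fin by (simp add: p_def)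
    then show "box_family p"
      unfolding box_family_def pairwise_def using box division_ofD(5)[OF p0] unfolding p_def by blast
    have "measure lborel K \<le> measure lborel (\<Union>p0)"
    proof (rule measure_mono_fmeasurable)
      have "K \<subseteq> \<Union>F" using T(3) box_subset_cbox unfolding F_def by blast
      then show "K \<subseteq> \<Union>p0" using division_ofD(6)[OF p0] by blast
      show "\<Union>p0 \<in> fmeasurable lborel" using fin box by (intro fmeasurable_compact compact_Union) (auto, metis compact_cbox)
      show "K \<in> sets lborel" using K by (simp add: borel_compact)
    qed
    also have "\<dots> \<le> (\<Sum>L\<in>p0. vol L)"
      using measure_UNION_le[OF fin, of "\<lambda>L. L" lborel] box fmeasurable_cbox by fastforce
    also have "\<dots> = total_content p"
    proof (rule sum.mono_neutral_right[OF fin])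
      show "\<forall>i\<in>p0 - p. vol i = 0"
      proof
        fix L assume L: "L \<in> p0 - p"
        then obtain a b where "L = cbox a b" using box by blast
        with L show "vol L = 0" using content_eq_0_interior[of a b] unfolding p_def by blast
      qed
    qed (auto simp: p_def)
    finally show "measure lborel K \<le> total_content p" .
  next
    fix x assume "x \<in> \<Union>p"
    then have "x \<in> \<Union>F" using division_ofD(6)[OF p0] unfolding p_def by blast
    then obtain k where "k \<in> T" "x \<in> ball k \<eta>" using ab(2) unfolding F_def by blast
    then show "\<exists>k\<in>K. dist x k \<le> \<eta>" using T(1) by (auto simp: dist_commute intro!: bexI[of _ k])
  qed
qed

lemma uminus_cbox: "uminus ` cbox a b = cbox (- b) (- (a::'a::euclidean_space))"
proof (rule set_eqI, rule iffI)
  fix x assume "x \<in> cbox (- b) (- a)"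
  then have "- x \<in> cbox a b" by (auto simp: mem_box) 
  then show "x \<in> uminus ` cbox a b" by (rule rev_image_eqI) simp
qed (auto simp: mem_box)

lemma box_family_uminus:
  assumes p: "box_family p"
  shows "box_family ((`) uminus ` p)" "total_content ((`) uminus ` p) = total_content p"
proof -
  have inj: "inj_on ((`) (uminus :: 'a \<Rightarrow> 'a)) p" by (rule inj_onI) (metis inj_image_eq_iff inj_uminus)
  have box: "\<exists>a b. K = cbox a b \<and> interior K \<noteq> {}" if "K \<in> p" for K using p that unfolding box_family_def by blast
  have int: "interior (uminus ` K) = uminus ` interior K" for K :: "'a set" by (rule interior_negations)
  have "pairwise (\<lambda>K L. interior K \<inter> interior L = {}) ((`) uminus ` p)"
  proof (rule pairwiseI)
    fix A B assume "A \<in> (`) uminus ` p" "B \<in> (`) uminus ` p" "A \<noteq> B"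
    then obtain K L where KL: "K \<in> p" "L \<in> p" "A = uminus ` K" "B = uminus ` L" "K \<noteq> L" by blast
    then have "interior K \<inter> interior L = {}" using p unfolding box_family_def pairwise_def by blast
    then show "interior A \<inter> interior B = {}" unfolding KL int by auto
  qed
  moreover have "(\<exists>a b. A = cbox a b) \<and> interior A \<noteq> {}" if A: "A \<in> (`) uminus ` p" for A
  proof -
    obtain K where K: "A = uminus ` K" "K \<in> p" using A by (rule imageE)
    obtain a b where ab: "K = cbox a b" "interior K \<noteq> {}" using box[OF K(2)] by metis
    have "A = cbox (- b) (- a)" unfolding K(1) ab(1) by (rule uminus_cbox)
    moreover have "interior A \<noteq> {}" unfolding K(1) int using ab(2) by simp
    ultimately show ?thesis by metis
  qed
  moreover have "finite ((`) uminus ` p)" using p unfolding box_family_def by (intro finite_imageI) (elim conjE)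
  ultimately show "box_family ((`) uminus ` p)" unfolding box_family_def by (intro conjI ballI) simp_all
  have "vol (uminus ` K) = vol K" if Kp: "K \<in> p" for K
  proof -
    obtain a b where K: "K = cbox a b" "interior K \<noteq> {}" using box[OF Kp] by metis
    have 1: "cbox a b \<noteq> {}" using K(2) unfolding K(1) by (metis interior_empty)
    then have 2: "cbox (- b) (- a) \<noteq> {}" by (metis uminus_cbox image_is_empty)
    show ?thesis unfolding K uminus_cbox content_cbox'[OF 1] content_cbox'[OF 2] by simp
  qed
  then show "total_content ((`) uminus ` p) = total_content p"
    by (simp add: sum.reindex[OF inj])
qed

definition slab_over :: "'a::euclidean_space \<Rightarrow> 'a set \<Rightarrow> 'a set" where
  "slab_over b C = {x. perp b x \<in> closure (perp b ` C) \<and> 0 \<le> x \<bullet> b \<and> x \<bullet> b \<le> 1}"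

lemma compact_slab_over:
  assumes b: "norm b = 1" and C: "bounded C" shows "compact (slab_over b C)"
proof -
  have cl: "closed (slab_over b C)"
  proof -
    have "slab_over b C = (perp b -` closure (perp b ` C)) \<inter> {x. 0 \<le> x \<bullet> b} \<inter> {x. x \<bullet> b \<le> 1}"
      by (auto simp: slab_over_def)
    moreover have "closed (perp b -` closure (perp b ` C))"
      by (intro continuous_closed_vimage closed_closure) (use continuous_perp[of UNIV] continuous_on_eq_continuous_at in blast)
    ultimately show ?thesis
      by (auto intro!: closed_Int closed_Collect_le continuous_intros)
  qed
  obtain r where r: "\<And>x. x \<in> C \<Longrightarrow> norm x \<le> r" using C bounded_iff by blast
  have "closure (perp b ` C) \<subseteq> cball 0 r"
    by (rule closure_minimal) (use r norm_perp_le[OF b] order_trans in \<open>auto, blast\<close>)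
  then have "norm x \<le> r + 1" if "x \<in> slab_over b C" for x
  proof -
    have "norm (perp b x) \<le> r" "\<bar>x \<bullet> b\<bar> \<le> 1" using that \<open>_ \<subseteq> cball 0 r\<close> by (auto simp: slab_over_def)
    moreover have "x = perp b x + (x \<bullet> b) *\<^sub>R b" by (simp add: perp_def)
    then have "norm x \<le> norm (perp b x) + \<bar>x \<bullet> b\<bar>" using b norm_triangle_ineq[of "perp b x" "(x \<bullet> b) *\<^sub>R b"] by simp
    ultimately show ?thesis by linarith
  qed
  then have "bounded (slab_over b C)" unfolding bounded_iff by blast
  with cl show ?thesis by (simp add: compact_eq_bounded_closed)
qed

theorem isodiametric_slab:
  fixes C :: "'a::euclidean_space set"
  assumes b: "b \<in> Basis" and C: "bounded C"
  shows "emeasure lborel (slab_over b C) \<le> ennreal (unit_ball_vol (real (DIM('a) - 1)) * (diameter C / 2) ^ (DIM('a) - 1))"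
proof -
  let ?n = "DIM('a) - 1" let ?w = "unit_ball_vol (real ?n)" and ?D = "diameter C"
  let ?K = "slab_over b C"
  have nb: "norm b = 1" using b by simp
  have K: "compact ?K" by (rule compact_slab_over[OF nb C])
  have D0: "0 \<le> ?D" by (rule diameter_ge_0[OF C])
  have bp: "bounded (perp b ` C)"
    using C norm_perp_le[OF nb] unfolding bounded_iff by (metis (no_types, lifting) imageE order_trans)
  have dK: "norm (perp b k - perp b k') \<le> ?D" if "k \<in> ?K" "k' \<in> ?K" for k k'
  proof -
    have "dist (perp b k) (perp b k') \<le> diameter (closure (perp b ` C))"
      using that bp by (intro diameter_bounded_bound bounded_closure) (auto simp: slab_over_def)
    also have "\<dots> = diameter (perp b ` C)" by (rule diameter_closure[OF bp])
    also have "\<dots> \<le> ?D"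
    proof (rule diameter_le)
      fix x y assume "x \<in> perp b ` C" "y \<in> perp b ` C"
      then obtain u v where uv: "u \<in> C" "v \<in> C" "x = perp b u" "y = perp b v" by blast
      have "norm (x - y) \<le> norm (u - v)" unfolding uv perp_diff[symmetric] by (rule norm_perp_le[OF nb])
      also have "\<dots> \<le> ?D" using diameter_bounded_bound[OF C uv(1,2)] by (simp add: dist_norm)
      finally show "norm (x - y) \<le> ?D" .
    qed (use D0 in blast)
    finally show ?thesis by (simp add: dist_norm)
  qed
  have main: "measure lborel ?K \<le> (1 + 2 * \<eta>) * (?w * ((?D + 2 * \<eta>) / 2) ^ ?n)" if eta: "\<eta> > 0" for \<eta>
  proof -
    obtain p where p: "box_family p" "measure lborel ?K \<le> total_content p" 
      and near: "\<And>x. x \<in> \<Union>p \<Longrightarrow> \<exists>k\<in>?K. dist x k \<le> \<eta>"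
      using box_family_cover[OF K eta] by blast
    have rhs: "0 \<le> (1 + 2 * \<eta>) * (?w * ((?D + 2 * \<eta>) / 2) ^ ?n)" using eta D0 by simp
    show ?thesis
    proof (cases "p = {}")
      case True then have "total_content p = 0" by (simp only: sum.empty)
      with p(2) rhs show ?thesis by linarith
    next
      case False
      define q where "q = (`) uminus ` p"
      have q: "box_family q" "total_content q = total_content p" "q \<noteq> {}"
        unfolding q_def by (rule box_family_uminus[OF p(1)], rule box_family_uminus[OF p(1)], simp add: False)
      have e: "sqrt (total_content p * total_content p) = total_content p"
        using total_content_pos[OF p(1) False] real_sqrt_abs2[of "total_content p"] by linarith
      have "2 ^ DIM('a) * total_content p \<le> vol (sumset (\<Union>p) (\<Union>q))"
        using brunn_minkowski_boxes[OF p(1) False q(1,3)] unfolding q(2) e .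
      also have "\<dots> \<le> measure lborel {y. norm (perp b y) \<le> ?D + 2 * \<eta> \<and> \<bar>y \<bullet> b\<bar> \<le> 1 + 2 * \<eta>}"
      proof (rule measure_mono_fmeasurable)
        show "sumset (\<Union>p) (\<Union>q) \<subseteq> {y. norm (perp b y) \<le> ?D + 2 * \<eta> \<and> \<bar>y \<bullet> b\<bar> \<le> 1 + 2 * \<eta>}"
        proof
          fix z assume "z \<in> sumset (\<Union>p) (\<Union>q)"
          then obtain x y' where xy': "x \<in> \<Union>p" "y' \<in> \<Union>q" "z = x + y'" unfolding sumset_def by blast
          then obtain L where L: "L \<in> p" "y' \<in> uminus ` L" unfolding q_def by blast
          then obtain y where y: "y \<in> L" "y' = - y" by blast
          have xy: "x \<in> \<Union>p" "y \<in> \<Union>p" "z = x - y" using xy' L(1) y by (simp, blast, simp)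
          obtain k l where kl: "k \<in> ?K" "l \<in> ?K" "norm (x - k) \<le> \<eta>" "norm (l - y) \<le> \<eta>"
            using near[OF xy(1)] near[OF xy(2)] by (metis dist_norm dist_commute)
          have z: "z = (x - k) + (k - l) + (l - y)" using xy by simp
          have "norm (perp b z) \<le> norm (perp b (x - k)) + norm (perp b (k - l)) + norm (perp b (l - y))"
            unfolding z perp_add by (intro norm_triangle_le add_right_mono norm_triangle_ineq)
          also have "\<dots> \<le> \<eta> + ?D + \<eta>"
            using dK[OF kl(1,2)] norm_perp_le[OF nb, of "x - k"] norm_perp_le[OF nb, of "l - y"] kl(3,4)
            by (simp add: perp_diff)
          finally have 1: "norm (perp b z) \<le> ?D + 2 * \<eta>" by simp
          have "z \<bullet> b = (x - k) \<bullet> b + (k \<bullet> b - l \<bullet> b) + (l - y) \<bullet> b" by (simp add: z inner_diff_left)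
          moreover have "\<bar>k \<bullet> b - l \<bullet> b\<bar> \<le> 1" using kl(1,2) by (auto simp: slab_over_def)
          ultimately have "\<bar>z \<bullet> b\<bar> \<le> 1 + 2 * \<eta>"
            using Basis_le_norm[OF b, of "x - k"] Basis_le_norm[OF b, of "l - y"] kl(3,4) by linarith
          with 1 show "z \<in> {y. norm (perp b y) \<le> ?D + 2 * \<eta> \<and> \<bar>y \<bullet> b\<bar> \<le> 1 + 2 * \<eta>}" by simp
        qed
        show "sumset (\<Union>p) (\<Union>q) \<in> sets lborel"
          unfolding sets_lborel by (intro borel_compact compact_sumset compact_Union_box_family p(1) q(1))
        show "{y. norm (perp b y) \<le> ?D + 2 * \<eta> \<and> \<bar>y \<bullet> b\<bar> \<le> 1 + 2 * \<eta>} \<in> fmeasurable lborel"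
        proof (rule fmeasurableI)
          show "{y. norm (perp b y) \<le> ?D + 2 * \<eta> \<and> \<bar>y \<bullet> b\<bar> \<le> 1 + 2 * \<eta>} \<in> sets lborel" by measurable
          show "emeasure lborel {y. norm (perp b y) \<le> ?D + 2 * \<eta> \<and> \<bar>y \<bullet> b\<bar> \<le> 1 + 2 * \<eta>} < \<infinity>"
            by (subst emeasure_cylinder[OF b]) (use eta D0 in auto)
        qed
      qed
      also have "\<dots> = 2 * (1 + 2 * \<eta>) * (?w * (?D + 2 * \<eta>) ^ ?n)"
        unfolding measure_def by (subst emeasure_cylinder[OF b]) (use eta D0 in auto)
      also have "\<dots> = 2 ^ DIM('a) * ((1 + 2 * \<eta>) * (?w * ((?D + 2 * \<eta>) / 2) ^ ?n))"
      proof -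
        have "(2::real) ^ DIM('a) = 2 * 2 ^ ?n" using DIM_positive[where 'a='a] by (metis Suc_diff_1 power_Suc)
        then show ?thesis by (simp add: power_divide)
      qed
      finally have "total_content p \<le> (1 + 2 * \<eta>) * (?w * ((?D + 2 * \<eta>) / 2) ^ ?n)"
        by (rule mult_left_le_imp_le) simp
      with p(2) show ?thesis by linarith
    qed
  qed
  have "((\<lambda>\<eta>. (1 + 2 * \<eta>) * (?w * ((?D + 2 * \<eta>) / 2) ^ ?n)) \<longlongrightarrow> (1 + 2 * 0) * (?w * ((?D + 2 * 0) / 2) ^ ?n)) (at_right 0)"
    by (intro tendsto_intros) auto
  then have "measure lborel ?K \<le> (1 + 2 * 0) * (?w * ((?D + 2 * 0) / 2) ^ ?n)"
  proof (rule tendsto_lowerbound)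
    show "\<forall>\<^sub>F \<eta> in at_right 0. measure lborel ?K \<le> (1 + 2 * \<eta>) * (?w * ((?D + 2 * \<eta>) / 2) ^ ?n)"
      by (rule eventually_mono[OF eventually_at_right_less]) (rule main)
  qed simp
  then have "measure lborel ?K \<le> ?w * (?D / 2) ^ ?n" by simp
  moreover have "emeasure lborel ?K \<noteq> top" using emeasure_compact_finite[OF K] by (simp add: less_top)
  ultimately show ?thesis by (metis emeasure_eq_ennreal_measure ennreal_leI)
qed

theorem hausdorff_outer_ge_projection:
  fixes S Z :: "'a::euclidean_space set"
  assumes b: "b \<in> Basis" and Z: "Z \<subseteq> {x. perp b x \<in> perp b ` S \<and> 0 \<le> x \<bullet> b \<and> x \<bullet> b \<le> 1}"
  shows "emeasure lborel Z \<le> hausdorff_outer (DIM('a) - 1) S"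
proof -
  let ?n = "DIM('a) - 1"
  have "emeasure lborel Z \<le> hausdorff_pre ?n 1 S"
    unfolding hausdorff_pre_def
  proof (rule INF_greatest, clarify)
    fix C :: "nat \<Rightarrow> 'a set" assume C: "S \<subseteq> (\<Union>i. C i)" "\<forall>i. bounded (C i) \<and> diameter (C i) \<le> 1"
    have meas: "slab_over b (C i) \<in> sets lborel" for i
      using compact_slab_over[of b "C i"] b C(2) by (simp add: borel_compact)
    have "Z \<subseteq> (\<Union>i. slab_over b (C i))"
    proof
      fix x assume "x \<in> Z"
      with Z have x: "perp b x \<in> perp b ` S" "0 \<le> x \<bullet> b" "x \<bullet> b \<le> 1" by auto
      from x(1) obtain s where s: "s \<in> S" "perp b x = perp b s" by (auto simp: image_iff)
      have "s \<in> (\<Union>i. C i)" using C(1) s(1) by (rule subsetD)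
      then obtain i where "s \<in> C i" by (rule UN_E)
      then have "perp b x \<in> closure (perp b ` C i)" unfolding s(2) by (intro closure_subset[THEN subsetD] imageI)
      with x show "x \<in> (\<Union>i. slab_over b (C i))" by (auto simp: slab_over_def)
    qed
    then have "emeasure lborel Z \<le> emeasure lborel (\<Union>i. slab_over b (C i))"
      using meas by (intro emeasure_mono sets.countable_UN) auto
    also have "\<dots> \<le> (\<Sum>i. emeasure lborel (slab_over b (C i)))"
      using meas by (intro emeasure_subadditive_countably) auto
    also have "\<dots> \<le> (\<Sum>i. ennreal (unit_ball_vol (real ?n) * (diameter (C i) / 2) ^ ?n))"
      using C(2) by (intro suminf_le summableI allI isodiametric_slab[OF b]) auto
    finally show "emeasure lborel Z \<le> (\<Sum>i. ennreal (unit_ball_vol (real ?n) * (diameter (C i) / 2) ^ ?n))" .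
  qed
  also have "\<dots> \<le> hausdorff_outer ?n S" by (rule hausdorff_pre_le_outer) simp
  finally show ?thesis .
qed

(*T2*)
lemma measurable_lebesgue_on_AE:
  fixes f g :: "'a::euclidean_space \<Rightarrow> real"
  assumes O: "open \<Omega>" and f: "f \<in> borel_measurable (lebesgue_on \<Omega>)" and ae: "AE x in lebesgue_on \<Omega>. f x = g x"
  shows "g \<in> borel_measurable (lebesgue_on \<Omega>)"
proof -
  have s: "\<Omega> \<inter> space lebesgue \<in> sets lebesgue" using O by (simp add: borel_open sets_completionI_sets)
  have "AE x in lebesgue. indicator \<Omega> x *\<^sub>R f x = indicator \<Omega> x *\<^sub>R g x"
    using ae unfolding AE_restrict_space_iff[OF s] by (rule AE_mp) (auto intro!: AE_I2 simp: indicator_def)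
  then have "(\<lambda>x. indicator \<Omega> x *\<^sub>R g x) \<in> borel_measurable lebesgue"
    using f unfolding borel_measurable_restrict_space_iff[OF s] by (rule borel_measurable_AE[rotated])
  then show ?thesis unfolding borel_measurable_restrict_space_iff[OF s] .
qed

lemma borel_measurable_lebesgue_on: "f \<in> borel_measurable borel \<Longrightarrow> f \<in> borel_measurable (lebesgue_on \<Omega>)"
  by (intro measurable_restrict_space1 measurable_completion) simp

lemma smooth_measurable_lebesgue_on: "smooth f \<Longrightarrow> f \<in> borel_measurable (lebesgue_on \<Omega>)"
  by (intro borel_measurable_lebesgue_on smooth_borel)

lemma integral_lebesgue_on_eq_lborel:
  fixes f :: "'a::euclidean_space \<Rightarrow> real"
  assumes O: "open \<Omega>" and f: "f \<in> borel_measurable borel" and z: "\<And>x. x \<notin> \<Omega> \<Longrightarrow> f x = 0"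
  shows "integral\<^sup>L (lebesgue_on \<Omega>) f = integral\<^sup>L lborel f"
proof -
  have s: "\<Omega> \<inter> space lebesgue \<in> sets lebesgue" using O by (simp add: borel_open sets_completionI_sets)
  have "(\<lambda>x. indicator \<Omega> x *\<^sub>R f x) = f" using z by (auto simp: fun_eq_iff indicator_def)
  then have "integral\<^sup>L (lebesgue_on \<Omega>) f = integral\<^sup>L lebesgue f" unfolding integral_restrict_space[OF s] by simp
  also have "\<dots> = integral\<^sup>L lborel f" using f by (intro integral_completion) simp
  finally show ?thesis .
qed

lemma integrable_lborel_compact_support:
  fixes f :: "'a::euclidean_space \<Rightarrow> real"
  assumes K: "compact K" and f: "continuous_on UNIV f" and z: "\<And>x. x \<notin> K \<Longrightarrow> f x = 0"
  shows "integrable lborel f"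
proof -
  have "(\<lambda>x. indicator K x *\<^sub>R f x) = f" using z by (auto simp: fun_eq_iff indicator_def)
  then show ?thesis using borel_integrable_compact[OF K continuous_on_subset[OF f]] by simp
qed

lemma pd_zero_outside:
  assumes "x \<notin> closure {x. f x \<noteq> 0}" shows "pd b f x = 0"
proof -
  have e: "0 = f y" if "y \<in> - closure {x. f x \<noteq> 0}" for y
    using closure_subset[of "{x. f x \<noteq> 0}"] that by auto
  have h: "((\<lambda>x. 0::real) has_derivative (\<lambda>_. 0)) (at x)" by simp
  have "(f has_derivative (\<lambda>_. 0)) (at x)"
    by (rule has_derivative_transform_within_open[OF h open_Compl[OF closed_closure] _ e]) (use assms in auto)
  then show ?thesis by (rule pdI)
qed

lemma has_derivative_along_line:
  assumes "smooth f"
  shows "((\<lambda>t. f (x + t *\<^sub>R v)) has_real_derivative frechet_derivative f (at (x + t *\<^sub>R v)) v) (at t)"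
proof -
  have g: "((\<lambda>t. x + t *\<^sub>R v) has_derivative (\<lambda>s. s *\<^sub>R v)) (at t)" by (auto intro!: derivative_eq_intros)
  have lin: "linear (frechet_derivative f (at y))" for y
    using assms smooth_has_derivative has_derivative_linear by blast
  show ?thesis
    using diff_chain_at[OF g smooth_has_derivative[OF assms]] 
    by (simp add: o_def has_field_derivative_def linear_cmul[OF lin] mult_commute_abs)
qed

lemma integral_pd_zero:
  fixes f :: "'a::euclidean_space \<Rightarrow> real"
  assumes f: "smooth f" and K: "compact (closure {x. f x \<noteq> 0})" and b: "b \<in> Basis"
  shows "(\<integral>x. pd b f x \<partial>lborel) = 0"
proof -
  let ?K = "closure {x. f x \<noteq> 0}"
  have f0: "f x = 0" if "x \<notin> ?K" for x using closure_subset[of "{x. f x \<noteq> 0}"] that by auto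
  have pd0: "pd b f x = 0" if "x \<notin> ?K" for x by (rule pd_zero_outside[OF that])
  have cont: "continuous_on UNIV (pd b f)" using smooth_continuous[OF smooth_pd[OF f b]] .
  have "bounded (pd b f ` ?K)"
    using compact_continuous_image[OF continuous_on_subset[OF cont] K] compact_imp_bounded by auto
  then obtain M0 where M0: "\<And>x. x \<in> ?K \<Longrightarrow> norm (pd b f x) \<le> M0" unfolding bounded_iff by auto
  define M where "M = max M0 0"
  have M: "\<bar>pd b f x\<bar> \<le> M" for x using M0[of x] pd0[of x] by (cases "x \<in> ?K") (auto simp: M_def)
  obtain R where R: "\<And>x. x \<in> ?K \<Longrightarrow> norm x \<le> R" using K compact_imp_bounded bounded_iff by metis
  define q where "q n x = real (Suc n) * (f (x + (1 / real (Suc n)) *\<^sub>R b) - f x)" for n x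
  have intf: "integrable lborel f" by (rule integrable_lborel_compact_support[OF K smooth_continuous[OF f] f0])
  have sh: "integrable lborel (\<lambda>x. f (x + c))" "(\<integral>x. f (x + c) \<partial>lborel) = (\<integral>x. f x \<partial>lborel)" for c
  proof -
    have m: "f \<in> borel_measurable lborel" using smooth_borel[OF f] by simp
    have e: "(\<lambda>x. f (x + c)) = (\<lambda>x. f ((+) c x))" by (simp add: add.commute)
    have "integrable (distr lborel borel ((+) c)) f" using intf by (simp add: lborel_distr_plus)
    then show "integrable lborel (\<lambda>x. f (x + c))" unfolding e by (subst (asm) integrable_distr_eq) (use smooth_borel[OF f] in auto)
    have "(\<integral>x. f x \<partial>distr lborel borel ((+) c)) = (\<integral>x. f ((+) c x) \<partial>lborel)"
      by (rule integral_distr) (use smooth_borel[OF f] in auto)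
    then show "(\<integral>x. f (x + c) \<partial>lborel) = (\<integral>x. f x \<partial>lborel)" unfolding e by (simp only: lborel_distr_plus)
  qed
  have q0: "(\<integral>x. q n x \<partial>lborel) = 0" for n unfolding q_def by (simp add: sh intf)
  have "(\<lambda>n. \<integral>x. q n x \<partial>lborel) \<longlonglongrightarrow> (\<integral>x. pd b f x \<partial>lborel)"
  proof (rule integral_dominated_convergence[where w="\<lambda>x. indicator (cball 0 (R + 1)) x *\<^sub>R M"])
    show "pd b f \<in> borel_measurable lborel" using cont by (simp add: borel_measurable_continuous_onI)
    show "q n \<in> borel_measurable lborel" for n 
    proof -
      have "continuous_on UNIV (q n)" unfolding q_def
        by (intro continuous_intros continuous_on_compose2[OF smooth_continuous[OF f, of UNIV]] smooth_continuous[OF f]) auto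
      then show ?thesis by (simp add: borel_measurable_continuous_onI)
    qed
    show "integrable lborel (\<lambda>x. indicator (cball 0 (R + 1)) x *\<^sub>R M)"
      by (rule borel_integrable_compact) auto
    show "AE x in lborel. (\<lambda>n. q n x) \<longlonglongrightarrow> pd b f x"
    proof (rule AE_I2)
      fix x
      have "((\<lambda>t. f (x + t *\<^sub>R b)) has_real_derivative pd b f (x + 0 *\<^sub>R b)) (at 0)" by (rule has_derivative_along_line[OF f])
      then have "((\<lambda>h. (f (x + h *\<^sub>R b) - f x) / h) \<longlongrightarrow> pd b f x) (at 0)" by (simp add: DERIV_def)
      moreover have "filterlim (\<lambda>n. 1 / real (Suc n)) (at 0) sequentially"
      proof -
        have "(\<lambda>n. 1 / real (Suc n)) \<longlonglongrightarrow> 0" using LIMSEQ_inverse_real_of_nat by (simp only: inverse_eq_divide)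
        then show ?thesis by (simp add: filterlim_at del: of_nat_Suc)
      qed
      ultimately have "(\<lambda>n. (f (x + (1 / real (Suc n)) *\<^sub>R b) - f x) / (1 / real (Suc n))) \<longlonglongrightarrow> pd b f x"
        by (rule filterlim_compose)
      then show "(\<lambda>n. q n x) \<longlonglongrightarrow> pd b f x" by (simp add: q_def mult.commute)
    qed
    show "AE x in lborel. norm (q n x) \<le> indicator (cball 0 (R + 1)) x *\<^sub>R M" for n
    proof (rule AE_I2)
      fix x :: 'a
      let ?h = "1 / real (Suc n)"
      show "norm (q n x) \<le> indicator (cball 0 (R + 1)) x *\<^sub>R M"
      proof (cases "x \<in> cball 0 (R + 1)")
        case False
        then have nx: "norm x > R + 1" by simp
        have h1: "norm (?h *\<^sub>R b) \<le> 1" using b by simp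
        have "norm x \<le> norm (x + ?h *\<^sub>R b) + norm (?h *\<^sub>R b)"
          using norm_triangle_ineq4[of "x + ?h *\<^sub>R b" "?h *\<^sub>R b"] by simp
        then have "norm (x + ?h *\<^sub>R b) > R" using nx h1 by linarith
        then have n1: "x + ?h *\<^sub>R b \<notin> ?K" and n2: "x \<notin> ?K" using R nx by (force, force)
        have "q n x = 0" unfolding q_def f0[OF n1] f0[OF n2] by simp
        then show ?thesis using False by simp
      next
        case True
        obtain z where z: "0 < z" "z < ?h" "f (x + ?h *\<^sub>R b) - f (x + 0 *\<^sub>R b) = (?h - 0) * pd b f (x + z *\<^sub>R b)"
          using MVT2[of 0 ?h "\<lambda>t. f (x + t *\<^sub>R b)" "\<lambda>t. pd b f (x + t *\<^sub>R b)"] has_derivative_along_line[OF f] by force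
        then have "q n x = pd b f (x + z *\<^sub>R b)" by (simp add: q_def)
        then show ?thesis using True M by simp
      qed
    qed
  qed
  then show ?thesis unfolding q0 using LIMSEQ_unique tendsto_const by blast
qed

lemma locally_integrable_smooth:
  assumes "smooth F" and O: "open \<Omega>" and ae: "AE x in lebesgue_on \<Omega>. F x = u x"
  shows "locally_integrable \<Omega> u"
  unfolding locally_integrable_def
proof (intro allI impI)
  fix K assume K: "compact K \<and> K \<subseteq> \<Omega>"
  have s: "\<Omega> \<inter> space lebesgue \<in> sets lebesgue" using O by (simp add: borel_open sets_completionI_sets)
  have i: "integrable lborel (\<lambda>x. indicator K x *\<^sub>R F x)"
    using K smooth_continuous[OF assms(1)] by (intro borel_integrable_compact) auto
  then have iL: "integrable lebesgue (\<lambda>x. indicator K x *\<^sub>R F x)" by (simp add: integrable_completion)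
  have a: "AE x in lebesgue. indicator K x *\<^sub>R F x = indicator K x *\<^sub>R u x"
    using ae unfolding AE_restrict_space_iff[OF s] by (rule AE_mp) (use K in \<open>auto intro!: AE_I2 simp: indicator_def\<close>)
  have "(\<lambda>x. indicator K x *\<^sub>R u x) \<in> borel_measurable lebesgue"
    by (rule borel_measurable_AE[OF borel_measurable_integrable[OF iL] a])
  then show "set_integrable lebesgue K u"
    unfolding set_integrable_def using integrable_cong_AE_imp[OF iL _ a] by blast
qed

lemma test_function_facts:
  assumes "test_function \<Omega> \<phi>" 
  shows "smooth \<phi>" "compact (closure {x. \<phi> x \<noteq> 0})" "closure {x. \<phi> x \<noteq> 0} \<subseteq> \<Omega>"
    "\<And>x. x \<notin> closure {x. \<phi> x \<noteq> 0} \<Longrightarrow> \<phi> x = 0" "\<And>x. x \<notin> \<Omega> \<Longrightarrow> \<phi> x = 0"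
proof -
  show a: "smooth \<phi>" "compact (closure {x. \<phi> x \<noteq> 0})" "closure {x. \<phi> x \<noteq> 0} \<subseteq> \<Omega>"
    using assms unfolding test_function_def by blast+
  show b: "\<phi> x = 0" if "x \<notin> closure {x. \<phi> x \<noteq> 0}" for x 
    using closure_subset[of "{x. \<phi> x \<noteq> 0}"] that by auto
  show "\<phi> x = 0" if "x \<notin> \<Omega>" for x using b that a(3) by blast
qed

lemma integrable_locally_integrable_times:
  fixes g \<phi> :: "'a::euclidean_space \<Rightarrow> real"
  assumes O: "open \<Omega>" and g: "locally_integrable \<Omega> g" and K: "compact K" "K \<subseteq> \<Omega>" 
    and c: "continuous_on UNIV \<phi>" and z: "\<And>x. x \<notin> K \<Longrightarrow> \<phi> x = 0"
  shows "integrable (lebesgue_on \<Omega>) (\<lambda>x. g x * \<phi> x)"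
proof -
  have s: "\<Omega> \<inter> space lebesgue \<in> sets lebesgue" using O by (simp add: borel_open sets_completionI_sets)
  have i: "integrable lebesgue (\<lambda>x. indicator K x *\<^sub>R g x)"
    using g K unfolding locally_integrable_def set_integrable_def by blast
  have "bounded (\<phi> ` K)" using compact_continuous_image[OF continuous_on_subset[OF c] K(1)] compact_imp_bounded by auto
  then obtain B where B: "\<And>x. x \<in> K \<Longrightarrow> norm (\<phi> x) \<le> B" unfolding bounded_iff by auto
  have e: "(\<lambda>x. indicator \<Omega> x *\<^sub>R (g x * \<phi> x)) = (\<lambda>x. (indicator K x *\<^sub>R g x) * \<phi> x)"
    using z K by (auto simp: fun_eq_iff indicator_def)
  have m: "\<phi> \<in> borel_measurable lebesgue" 
    using borel_measurable_continuous_onI[OF c] by (intro measurable_completion) simp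
  have "integrable lebesgue (\<lambda>x. (indicator K x *\<^sub>R g x) * \<phi> x)"
  proof (rule Bochner_Integration.integrable_bound[of _ "\<lambda>x. B * (indicator K x *\<^sub>R g x)"])
    show "integrable lebesgue (\<lambda>x. B * (indicator K x *\<^sub>R g x))" using i by (rule integrable_mult_right)
    show "(\<lambda>x. (indicator K x *\<^sub>R g x) * \<phi> x) \<in> borel_measurable lebesgue"
      using borel_measurable_integrable[OF i] m by (rule borel_measurable_times)
    have "norm ((indicator K x *\<^sub>R g x) * \<phi> x) \<le> norm (B * (indicator K x *\<^sub>R g x))" for x
    proof (cases "x \<in> K")
      case True
      with B[OF True] have "\<bar>g x\<bar> * \<bar>\<phi> x\<bar> \<le> \<bar>g x\<bar> * \<bar>B\<bar>" by (intro mult_left_mono) auto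
      then show ?thesis using True by (simp add: abs_mult mult.commute)
    qed simp
    then show "AE x in lebesgue. norm ((indicator K x *\<^sub>R g x) * \<phi> x) \<le> norm (B * (indicator K x *\<^sub>R g x))" by (rule AE_I2)
  qed
  then show ?thesis unfolding integrable_restrict_space[OF s] e .
qed

lemma is_weak_deriv_smooth:
  fixes F u :: "'a::euclidean_space \<Rightarrow> real"
  assumes O: "open \<Omega>" and F: "smooth F" and b: "b \<in> Basis" and ae: "AE x in lebesgue_on \<Omega>. F x = u x"
  shows "is_weak_deriv \<Omega> b u (pd b F)"
  unfolding is_weak_deriv_def
proof (intro conjI allI impI)
  show "locally_integrable \<Omega> u" by (rule locally_integrable_smooth[OF F O ae])
  show "locally_integrable \<Omega> (pd b F)" by (rule locally_integrable_smooth[OF smooth_pd[OF F b] O]) simp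
  fix \<phi> assume "test_function \<Omega> \<phi>"
  note t = test_function_facts[OF this]
  let ?K = "closure {x. \<phi> x \<noteq> 0}"
  have mu: "u \<in> borel_measurable (lebesgue_on \<Omega>)"
    by (rule measurable_lebesgue_on_AE[OF O smooth_measurable_lebesgue_on[OF F] ae])
  note mp = smooth_measurable_lebesgue_on[OF smooth_pd[OF t(1) b], of \<Omega>]
  have p0: "pd b \<phi> x = 0" if "x \<notin> \<Omega>" for x using pd_zero_outside[of x \<phi> b] that t(3) by blast
  have "(\<integral>x. u x * pd b \<phi> x \<partial>lebesgue_on \<Omega>) = (\<integral>x. F x * pd b \<phi> x \<partial>lebesgue_on \<Omega>)"
  proof (rule integral_cong_AE)
    show "AE x in lebesgue_on \<Omega>. u x * pd b \<phi> x = F x * pd b \<phi> x" using ae by (rule eventually_mono) simp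
  qed (intro borel_measurable_times mu mp smooth_measurable_lebesgue_on[OF F])+
  also have "\<dots> = (\<integral>x. F x * pd b \<phi> x \<partial>lborel)"
    by (intro integral_lebesgue_on_eq_lborel O borel_measurable_times smooth_borel F smooth_pd t b) (simp add: p0)
  finally have 1: "(\<integral>x. u x * pd b \<phi> x \<partial>lebesgue_on \<Omega>) = (\<integral>x. F x * pd b \<phi> x \<partial>lborel)" .
  have 2: "(\<integral>x. pd b F x * \<phi> x \<partial>lebesgue_on \<Omega>) = (\<integral>x. pd b F x * \<phi> x \<partial>lborel)"
    by (intro integral_lebesgue_on_eq_lborel O borel_measurable_times smooth_borel F smooth_pd t b) (simp add: t(5))
  have cl: "closure {x. F x * \<phi> x \<noteq> 0} \<subseteq> ?K" by (rule closure_mono) auto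
  have cK: "compact (closure {x. F x * \<phi> x \<noteq> 0})"
    using compact_Int_closed[OF t(2) closed_closure, of "{x. F x * \<phi> x \<noteq> 0}"] cl by (simp add: Int_absorb1)
  have "0 = (\<integral>x. pd b (\<lambda>x. F x * \<phi> x) x \<partial>lborel)"
    by (rule integral_pd_zero[OF smooth_mult[OF F t(1)] cK b, symmetric])
  also have "\<dots> = (\<integral>x. F x * pd b \<phi> x + pd b F x * \<phi> x \<partial>lborel)" by (simp only: pd_mult[OF F t(1)])
  also have "\<dots> = (\<integral>x. F x * pd b \<phi> x \<partial>lborel) + (\<integral>x. pd b F x * \<phi> x \<partial>lborel)"
  proof (intro Bochner_Integration.integral_add integrable_lborel_compact_support[OF t(2)] smooth_continuous smooth_mult smooth_pd F t(1) b)
    fix x assume x: "x \<notin> ?K"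
    show "F x * pd b \<phi> x = 0" unfolding pd_zero_outside[OF x] by simp
    show "pd b F x * \<phi> x = 0" unfolding t(4)[OF x] by simp
  qed
  finally show "(\<integral>x. u x * pd b \<phi> x \<partial>lebesgue_on \<Omega>) = - (\<integral>x. pd b F x * \<phi> x \<partial>lebesgue_on \<Omega>)"
    unfolding 1 2 by linarith
qed

definition box_bump :: "nat \<Rightarrow> 'a::euclidean_space \<Rightarrow> 'a \<Rightarrow> 'a \<Rightarrow> real" where
  "box_bump n p q x = (\<Prod>j\<in>Basis. flat (real n * (x \<bullet> j - p \<bullet> j)) * flat (real n * (q \<bullet> j - x \<bullet> j)))"

lemma smooth_box_bump: "smooth (box_bump n p q)"
proof -
  have "smooth (\<lambda>t. flat (real n * (t - c)))" "smooth (\<lambda>t. flat (real n * (c - t)))" for c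
    using smooth_compose_affine[OF smooth_flat, of "real n" c] smooth_compose_affine[OF smooth_flat, of "- real n" c]
    by (simp_all add: algebra_simps)
  then show ?thesis unfolding box_bump_def[abs_def]
    by (intro smooth_prod smooth_mult smooth_compose_coordinate)
qed

lemma box_bump_bounds: "0 \<le> box_bump n p q x" "box_bump n p q x \<le> 1"
  unfolding box_bump_def by (auto intro!: prod_nonneg prod_le_1 mult_nonneg_nonneg mult_le_one simp: flat_nonneg flat_le_1)

lemma box_bump_outside: "x \<notin> box p q \<Longrightarrow> box_bump n p q x = 0"
proof -
  assume "x \<notin> box p q"
  then obtain j where j: "j \<in> Basis" "\<not> (p \<bullet> j < x \<bullet> j \<and> x \<bullet> j < q \<bullet> j)" unfolding mem_box by blast
  then have "real n * (x \<bullet> j - p \<bullet> j) \<le> 0 \<or> real n * (q \<bullet> j - x \<bullet> j) \<le> 0"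
    by (auto simp: mult_le_0_iff not_less)
  then have "flat (real n * (x \<bullet> j - p \<bullet> j)) * flat (real n * (q \<bullet> j - x \<bullet> j)) = 0" by (auto simp: flat_eq_0)
  then show ?thesis unfolding box_bump_def using j(1) by (intro prod_zero) auto
qed

lemma box_bump_tendsto: "(\<lambda>n. box_bump n p q x) \<longlonglongrightarrow> indicator (box p q) x"
proof (cases "x \<in> box p q")
  case True
  have "(\<lambda>n. box_bump n p q x) \<longlonglongrightarrow> (\<Prod>j\<in>(Basis::'a set). 1 * 1)"
    unfolding box_bump_def using True by (intro tendsto_prod tendsto_mult flat_tendsto_1) (auto simp: mem_box)
  then show ?thesis using True by simp
qed (simp add: box_bump_outside)

lemma test_function_box_bump: assumes "cbox p q \<subseteq> \<Omega>" shows "test_function \<Omega> (box_bump n p q)"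
proof -
  have sub: "{x. box_bump n p q x \<noteq> 0} \<subseteq> cbox p q" using box_bump_outside[of _ p q n] box_subset_cbox[of p q] by blast
  then have cl: "closure {x. box_bump n p q x \<noteq> 0} \<subseteq> cbox p q" by (rule closure_minimal) (rule closed_cbox)
  then have "compact (closure {x. box_bump n p q x \<noteq> 0})"
    using compact_Int_closed[OF compact_cbox closed_closure, of p q "{x. box_bump n p q x \<noteq> 0}"] by (simp add: Int_absorb1)
  then show ?thesis unfolding test_function_def using smooth_box_bump cl assms by blast
qed

lemma fundamental_lemma:
  fixes g :: "'a::euclidean_space \<Rightarrow> real"
  assumes O: "open \<Omega>" and g: "locally_integrable \<Omega> g"
    and zero: "\<And>\<phi>. test_function \<Omega> \<phi> \<Longrightarrow> (\<integral>x. g x * \<phi> x \<partial>lebesgue_on \<Omega>) = 0"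
  shows "AE x in lebesgue_on \<Omega>. g x = 0"
proof -
  have s: "\<Omega> \<inter> space lebesgue \<in> sets lebesgue" using O by (simp add: borel_open sets_completionI_sets)
  have si: "set_integrable lebesgue K g" if "compact K" "K \<subseteq> \<Omega>" for K using g that unfolding locally_integrable_def by blast
  have box0: "integral (cbox p q) g = 0" if sub: "cbox p q \<subseteq> \<Omega>" for p q
  proof -
    have i: "integrable lebesgue (\<lambda>x. indicator (cbox p q) x *\<^sub>R g x)" using si[OF compact_cbox sub] unfolding set_integrable_def .
    have ind: "(\<lambda>x. indicator (box p q) x *\<^sub>R g x) = (\<lambda>x. indicator (box p q) x * (indicator (cbox p q) x *\<^sub>R g x))"
      using box_subset_cbox[of p q] by (auto simp: fun_eq_iff indicator_def)
    have z: "(\<integral>x. (indicator (cbox p q) x *\<^sub>R g x) * box_bump n p q x \<partial>lebesgue) = 0" for n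
    proof -
      have "0 = (\<integral>x. indicator \<Omega> x *\<^sub>R (g x * box_bump n p q x) \<partial>lebesgue)"
        using zero[OF test_function_box_bump[OF sub, of n]] unfolding integral_restrict_space[OF s] by simp
      also have "(\<lambda>x. indicator \<Omega> x *\<^sub>R (g x * box_bump n p q x)) = (\<lambda>x. (indicator (cbox p q) x *\<^sub>R g x) * box_bump n p q x)"
        using box_bump_outside[of _ p q n] box_subset_cbox[of p q] sub by (auto simp: fun_eq_iff indicator_def)
      finally show ?thesis by simp
    qed
    have m: "box_bump n p q \<in> borel_measurable lebesgue" for n
      using smooth_borel[OF smooth_box_bump] by (intro measurable_completion) simp
    have mb: "(indicator (box p q) :: 'a \<Rightarrow> real) \<in> borel_measurable lebesgue"
      by (intro borel_measurable_indicator sets_completionI_sets) simp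
    have "(\<lambda>n. \<integral>x. (indicator (cbox p q) x *\<^sub>R g x) * box_bump n p q x \<partial>lebesgue) \<longlonglongrightarrow>
       (\<integral>x. indicator (box p q) x *\<^sub>R g x \<partial>lebesgue)" unfolding ind
    proof (rule integral_dominated_convergence[where w="\<lambda>x. norm (indicator (cbox p q) x *\<^sub>R g x)"])
      show "integrable lebesgue (\<lambda>x. norm (indicator (cbox p q) x *\<^sub>R g x))" using i by (rule integrable_norm)
      show "(\<lambda>x. indicator (box p q) x * (indicator (cbox p q) x *\<^sub>R g x)) \<in> borel_measurable lebesgue"
        "(\<lambda>x. (indicator (cbox p q) x *\<^sub>R g x) * box_bump n p q x) \<in> borel_measurable lebesgue" for n
        by (intro borel_measurable_times mb m borel_measurable_integrable[OF i])+
      show "AE x in lebesgue. (\<lambda>n. (indicator (cbox p q) x *\<^sub>R g x) * box_bump n p q x)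
          \<longlonglongrightarrow> indicator (box p q) x * (indicator (cbox p q) x *\<^sub>R g x)"
        by (intro AE_I2, subst mult.commute) (intro tendsto_mult tendsto_const box_bump_tendsto)
      have "norm ((indicator (cbox p q) x *\<^sub>R g x) * box_bump n p q x) \<le> norm (indicator (cbox p q) x *\<^sub>R g x)" for n x
        using box_bump_bounds[of n p q x] unfolding norm_mult by (intro mult_right_le_one_le) auto
      then show "AE x in lebesgue. norm ((indicator (cbox p q) x *\<^sub>R g x) * box_bump n p q x)
         \<le> norm (indicator (cbox p q) x *\<^sub>R g x)" for n by (intro AE_I2)
    qed
    then have "(\<integral>x. indicator (box p q) x *\<^sub>R g x \<partial>lebesgue) = 0" unfolding z using LIMSEQ_unique tendsto_const by blast
    moreover have "set_integrable lebesgue (box p q) g"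
      by (rule set_integrable_subset[OF si[OF compact_cbox sub]]) (auto simp: box_subset_cbox sets_completionI_sets)
    ultimately have "integral (box p q) g = 0"
      using set_lebesgue_integral_eq_integral[of "box p q" g] by (simp add: set_lebesgue_integral_def)
    then show ?thesis by (simp add: integral_open_interval)
  qed
  have local: "AE x in lebesgue. x \<in> cbox P Q \<longrightarrow> g x = 0" if sub: "cbox P Q \<subseteq> \<Omega>" for P Q
  proof -
    define f where "f x = (if x \<in> cbox P Q then g x else 0)" for x
    have "f integrable_on cbox a b" for a b
    proof -
      have "g integrable_on (cbox a b \<inter> cbox P Q)"
        by (intro set_lebesgue_integral_eq_integral(1) set_integrable_subset[OF si[OF compact_cbox sub]])
          (auto intro!: sets.Int sets_completionI_sets)
      then show ?thesis unfolding f_def by (simp add: integrable_restrict_Int Int_commute)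
    qed
    then obtain N where N: "negligible N" and lim: "\<And>x e. x \<notin> N \<Longrightarrow> 0 < e \<Longrightarrow>
        \<exists>d>0. \<forall>h. 0 < h \<and> h < d \<longrightarrow> norm (integral (cbox x (x + h *\<^sub>R One)) f /\<^sub>R h ^ DIM('a) - f x) < e"
      using integrable_ccontinuous_explicit[of f] by blast
    have "g x = 0" if x: "x \<in> box P Q" "x \<notin> N" for x
    proof (rule ccontr)
      assume "g x \<noteq> 0"
      then obtain d where d: "d > 0" and dd: "\<And>h. 0 < h \<Longrightarrow> h < d \<Longrightarrow> 
          norm (integral (cbox x (x + h *\<^sub>R One)) f /\<^sub>R h ^ DIM('a) - f x) < \<bar>g x\<bar>"
        using lim[OF x(2), of "\<bar>g x\<bar>"] by auto
      obtain e where e: "e > 0" "ball x e \<subseteq> box P Q" using open_box[of P Q] x(1) by (metis open_contains_ball)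
      define h where "h = min (d / 2) (e / (2 * real DIM('a)))"
      have h: "0 < h" "h < d" "h * real DIM('a) < e"
      proof -
        show "0 < h" "h < d" using d e by (auto simp: h_def)
        have "h * real DIM('a) \<le> e / (2 * real DIM('a)) * real DIM('a)" by (intro mult_right_mono) (auto simp: h_def)
        also have "\<dots> < e" using e by simp
        finally show "h * real DIM('a) < e" .
      qed
      have subx: "cbox x (x + h *\<^sub>R One) \<subseteq> cbox P Q"
      proof
        fix y assume y: "y \<in> cbox x (x + h *\<^sub>R One)"
        have "norm (y - x) \<le> (\<Sum>i\<in>Basis. \<bar>(y - x) \<bullet> i\<bar>)" by (rule norm_le_l1)
        also have "\<dots> \<le> (\<Sum>i\<in>(Basis::'a set). h)" 
          using y by (intro sum_mono) (auto simp: mem_box inner_add_left inner_diff_left)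
        finally have "dist x y < e" using h(3) by (simp add: dist_norm norm_minus_commute mult.commute)
        then show "y \<in> cbox P Q" using e(2) box_subset_cbox[of P Q] by (metis mem_ball subsetD)
      qed
      have "integral (cbox x (x + h *\<^sub>R One)) f = integral (cbox x (x + h *\<^sub>R One)) g"
        using subx by (intro integral_cong) (auto simp: f_def)
      also have "\<dots> = 0" using subx sub by (intro box0) (rule order_trans)
      finally have "norm (f x) < \<bar>g x\<bar>" using dd[OF h(1,2)] by simp
      moreover have "f x = g x" using x(1) box_subset_cbox[of P Q] by (auto simp: f_def)
      ultimately show False by simp
    qed
    then have "x \<in> N \<union> (cbox P Q - box P Q)" if "\<not> (x \<in> cbox P Q \<longrightarrow> g x = 0)" for x using that by blast
    moreover have "N \<union> (cbox P Q - box P Q) \<in> null_sets lebesgue"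
      using negligible_Un[OF N negligible_frontier_interval[of P Q]] unfolding negligible_iff_null_sets .
    ultimately show ?thesis by (intro AE_I'[of "N \<union> (cbox P Q - box P Q)"]) auto
  qed
  obtain \<D> where D: "countable \<D>" "\<D> \<subseteq> Pow \<Omega>" "\<And>X. X \<in> \<D> \<Longrightarrow> \<exists>a b. X = cbox a b" "\<Union>\<D> = \<Omega>"
    using open_countable_Union_open_cbox[OF O] by metis
  have "AE x in lebesgue. \<forall>X\<in>\<D>. x \<in> X \<longrightarrow> g x = 0"
    unfolding AE_ball_countable[OF D(1)]
  proof
    fix X assume X: "X \<in> \<D>"
    obtain a b where ab: "X = cbox a b" using D(3)[OF X] by metis
    have "cbox a b \<subseteq> \<Omega>" using D(2) X unfolding ab by blast
    then show "AE x in lebesgue. x \<in> X \<longrightarrow> g x = 0" unfolding ab by (rule local)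
  qed
  then have "AE x in lebesgue. x \<in> \<Omega> \<longrightarrow> g x = 0"
    by (rule AE_mp) (use D(4) in \<open>auto intro!: AE_I2\<close>)
  then show ?thesis unfolding AE_restrict_space_iff[OF s] .
qed

lemma weak_deriv_unique:
  fixes u :: "'a::euclidean_space \<Rightarrow> real"
  assumes O: "open \<Omega>" and g: "is_weak_deriv \<Omega> b u g" "is_weak_deriv \<Omega> b u g'"
  shows "AE x in lebesgue_on \<Omega>. g x = g' x"
proof -
  have l: "locally_integrable \<Omega> g" "locally_integrable \<Omega> g'" using g unfolding is_weak_deriv_def by blast+
  have "AE x in lebesgue_on \<Omega>. g x - g' x = 0"
  proof (rule fundamental_lemma[OF O])
    show "locally_integrable \<Omega> (\<lambda>x. g x - g' x)" using l unfolding locally_integrable_def by (auto intro: set_integral_diff(1))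
    fix \<phi> assume tf: "test_function \<Omega> \<phi>"
    note t = test_function_facts[OF tf]
    note i = integrable_locally_integrable_times[OF O _ t(2,3) smooth_continuous[OF t(1)] t(4)]
    have "(\<integral>x. (g x - g' x) * \<phi> x \<partial>lebesgue_on \<Omega>) = (\<integral>x. g x * \<phi> x \<partial>lebesgue_on \<Omega>) - (\<integral>x. g' x * \<phi> x \<partial>lebesgue_on \<Omega>)"
      unfolding left_diff_distrib by (intro Bochner_Integration.integral_diff i l)
    also have "\<dots> = 0"
    proof -
      have "(\<integral>x. u x * pd b \<phi> x \<partial>lebesgue_on \<Omega>) = - (\<integral>x. g x * \<phi> x \<partial>lebesgue_on \<Omega>)"
        using g(1) tf unfolding is_weak_deriv_def by blast
      moreover have "(\<integral>x. u x * pd b \<phi> x \<partial>lebesgue_on \<Omega>) = - (\<integral>x. g' x * \<phi> x \<partial>lebesgue_on \<Omega>)"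
        using g(2) tf unfolding is_weak_deriv_def by blast
      ultimately show ?thesis by linarith
    qed
    finally show "(\<integral>x. (g x - g' x) * \<phi> x \<partial>lebesgue_on \<Omega>) = 0" .
  qed
  then show ?thesis by simp
qed

lemma wderiv_smooth:
  fixes F u :: "'a::euclidean_space \<Rightarrow> real"
  assumes O: "open \<Omega>" and F: "smooth F" and b: "b \<in> Basis" and ae: "AE x in lebesgue_on \<Omega>. F x = u x"
  shows "AE x in lebesgue_on \<Omega>. pd b F x = wderiv \<Omega> b u x"
proof -
  have w: "is_weak_deriv \<Omega> b u (pd b F)" by (rule is_weak_deriv_smooth[OF assms])
  then have "is_weak_deriv \<Omega> b u (wderiv \<Omega> b u)" unfolding wderiv_def by (rule someI[of "is_weak_deriv \<Omega> b u"])
  with w show ?thesis by (rule weak_deriv_unique[OF O])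
qed

lemma L2_smooth:
  fixes F u :: "'a::euclidean_space \<Rightarrow> real"
  assumes O: "open \<Omega>" and bd: "bounded \<Omega>" and F: "smooth F" and ae: "AE x in lebesgue_on \<Omega>. F x = u x"
  shows "u \<in> L2 (lebesgue_on \<Omega>)"
proof -
  have s: "\<Omega> \<inter> space lebesgue \<in> sets lebesgue" using O by (simp add: borel_open sets_completionI_sets)
  have mu: "u \<in> borel_measurable (lebesgue_on \<Omega>)"
    by (rule measurable_lebesgue_on_AE[OF O smooth_measurable_lebesgue_on[OF F] ae])
  have c: "compact (closure \<Omega>)" using bd by simp
  have "integrable lborel (\<lambda>x. indicator (closure \<Omega>) x *\<^sub>R (F x)\<^sup>2)"
    by (intro borel_integrable_compact c continuous_intros smooth_continuous F)
  then have "integrable lebesgue (\<lambda>x. indicator (closure \<Omega>) x *\<^sub>R (F x)\<^sup>2)" by (simp add: integrable_completion)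
  then have "set_integrable lebesgue \<Omega> (\<lambda>x. (F x)\<^sup>2)"
    using s closure_subset[of \<Omega>] set_integrable_subset[of lebesgue "closure \<Omega>" "\<lambda>x. (F x)\<^sup>2" \<Omega>]
    unfolding set_integrable_def[of _ "closure \<Omega>"] by simp
  then have "integrable (lebesgue_on \<Omega>) (\<lambda>x. (F x)\<^sup>2)" unfolding set_integrable_def integrable_restrict_space[OF s] .
  then have "integrable (lebesgue_on \<Omega>) (\<lambda>x. (u x)\<^sup>2)"
  proof (rule integrable_cong_AE_imp)
    show "(\<lambda>x. (u x)\<^sup>2) \<in> borel_measurable (lebesgue_on \<Omega>)" using mu by (rule borel_measurable_power)
    show "AE x in lebesgue_on \<Omega>. (F x)\<^sup>2 = (u x)\<^sup>2" using ae by (rule eventually_mono) simp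
  qed
  then show ?thesis unfolding L2_def using mu by simp
qed

lemma H1_smooth:
  fixes F u :: "'a::euclidean_space \<Rightarrow> real"
  assumes O: "open \<Omega>" and bd: "bounded \<Omega>" and F: "smooth F" and ae: "AE x in lebesgue_on \<Omega>. F x = u x"
  shows "u \<in> H1 \<Omega>"
proof -
  have "\<exists>g. is_weak_deriv \<Omega> b u g \<and> g \<in> L2 (lebesgue_on \<Omega>)" if b: "b \<in> Basis" for b
  proof (intro exI conjI)
    show "is_weak_deriv \<Omega> b u (pd b F)" by (rule is_weak_deriv_smooth[OF O F b ae])
    show "pd b F \<in> L2 (lebesgue_on \<Omega>)" by (rule L2_smooth[OF O bd smooth_pd[OF F b]]) simp
  qed
  then show ?thesis unfolding H1_def using L2_smooth[OF assms] by simp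
qed

lemma H2_smooth:
  fixes F :: "'a::euclidean_space \<Rightarrow> real"
  assumes O: "open \<Omega>" and bd: "bounded \<Omega>" and F: "smooth F"
  shows "F \<in> H2 \<Omega>"
proof -
  have "F \<in> H1 \<Omega>" by (rule H1_smooth[OF O bd F]) simp
  moreover have "wderiv \<Omega> b F \<in> H1 \<Omega>" if b: "b \<in> Basis" for b
    by (rule H1_smooth[OF O bd smooth_pd[OF F b] wderiv_smooth[OF O F b]]) simp
  ultimately show ?thesis unfolding H2_def by simp
qed

(*T6*)
definition grad :: "('a::euclidean_space \<Rightarrow> real) \<Rightarrow> 'a \<Rightarrow> 'a" where
  "grad h x = (\<Sum>b\<in>Basis. pd b h x *\<^sub>R b)"

lemma grad_has_derivative:
  assumes "h differentiable (at x)" shows "(h has_derivative (\<lambda>v. v \<bullet> grad h x)) (at x)"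
proof -
  have d: "(h has_derivative frechet_derivative h (at x)) (at x)" using assms frechet_derivative_works by blast
  then have lin: "linear (frechet_derivative h (at x))" by (rule has_derivative_linear)
  have "frechet_derivative h (at x) v = v \<bullet> grad h x" for v
  proof -
    have "frechet_derivative h (at x) v = frechet_derivative h (at x) (\<Sum>b\<in>Basis. (v \<bullet> b) *\<^sub>R b)"
      by (simp only: euclidean_representation)
    also have "\<dots> = (\<Sum>b\<in>Basis. (v \<bullet> b) * pd b h x)" by (simp add: linear_sum[OF lin] linear_cmul[OF lin])
    also have "\<dots> = v \<bullet> grad h x" unfolding grad_def by (simp add: inner_sum_right mult.commute)
    finally show ?thesis .
  qed
  then have "frechet_derivative h (at x) = (\<lambda>v. v \<bullet> grad h x)" by (rule ext)
  then show ?thesis using d by (simp only:)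
qed

lemma Ck1_facts:
  assumes "Ck 1 h"
  shows "h differentiable (at x)" "continuous_on A h" "continuous_on A (grad h)"
proof -
  have d: "h differentiable_on UNIV" and c: "\<forall>b\<in>Basis. continuous_on UNIV (pd b h)" using assms by simp_all
  show "h differentiable (at x)" using d by (simp add: differentiable_on_def)
  show "continuous_on A h" using differentiable_imp_continuous_on[OF d] by (rule continuous_on_subset) simp
  show "continuous_on A (grad h)" unfolding grad_def[abs_def]
    by (intro continuous_on_sum continuous_on_scaleR continuous_on_const) (use c continuous_on_subset in blast)
qed

lemma GDERIV_grad: assumes "Ck 1 h" shows "GDERIV h x :> g \<longleftrightarrow> g = grad h x"
proof -
  have 1: "(h has_derivative (\<lambda>v. v \<bullet> grad h x)) (at x)" by (rule grad_has_derivative[OF Ck1_facts(1)[OF assms]])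
  show ?thesis
  proof
    assume "GDERIV h x :> g"
    then have "(\<lambda>v. v \<bullet> g) = (\<lambda>v. v \<bullet> grad h x)" unfolding gderiv_def using 1 has_derivative_unique by blast
    then show "g = grad h x" by (metis vector_eq_ldot inner_commute)
  next
    assume "g = grad h x" then show "GDERIV h x :> g" unfolding gderiv_def using 1 by simp
  qed
qed

lemma C1_chartD:
  assumes "C1_chart \<Omega> U e h"
  shows "open U" "norm e = 1" "Ck 1 h" "h (x + t *\<^sub>R e) = h x" "y \<in> U \<Longrightarrow> y \<in> \<Omega> \<longleftrightarrow> y \<bullet> e < h y"
  using assms unfolding C1_chart_def by blast+

lemma chart_inner_e: assumes "C1_chart \<Omega> U e h" shows "e \<bullet> e = 1"
  using C1_chartD(2)[OF assms] by (simp add: norm_eq_1)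

lemma chart_level_open:
  assumes ch: "C1_chart \<Omega> U e h"
  shows "open {y \<in> U. y \<bullet> e < h y}" "open {y \<in> U. y \<bullet> e > h y}"
proof -
  have c: "continuous_on UNIV (\<lambda>y. y \<bullet> e)" "continuous_on UNIV h"
    using Ck1_facts(2)[OF C1_chartD(3)[OF ch]] by (auto intro!: continuous_intros)
  show "open {y \<in> U. y \<bullet> e < h y}" "open {y \<in> U. y \<bullet> e > h y}"
    using open_Int[OF C1_chartD(1)[OF ch] open_Collect_less[OF c]]
      open_Int[OF C1_chartD(1)[OF ch] open_Collect_less[OF c(2,1)]] by (simp_all add: Collect_conj_eq)
qed

lemma chart_frontier:
  assumes ch: "C1_chart \<Omega> U e h" and O: "open \<Omega>" and x: "x \<in> U"
  shows "x \<in> frontier \<Omega> \<longleftrightarrow> x \<bullet> e = h x"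
proof -
  have fr: "frontier \<Omega> = closure \<Omega> - \<Omega>" using O by (simp add: frontier_def interior_open)
  note iff = C1_chartD(5)[OF ch]
  consider "x \<bullet> e < h x" | "x \<bullet> e > h x" | "x \<bullet> e = h x" by linarith
  then show ?thesis
  proof cases
    case 1 then have "x \<in> \<Omega>" using iff[OF x] by simp
    then show ?thesis using 1 fr by simp
  next
    case 2
    have "x \<notin> closure \<Omega>"
    proof
      assume "x \<in> closure \<Omega>"
      then have "\<Omega> \<inter> {y \<in> U. y \<bullet> e > h y} \<noteq> {}"
        using closure_iff_nhds_not_empty[of x \<Omega>] chart_level_open(2)[OF ch] x 2 by blast
      then show False using iff by fastforce
    qed
    then show ?thesis using 2 fr by simp
  next
    case 3
    have "x \<in> closure \<Omega>"
      unfolding closure_approachable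
    proof (intro allI impI)
      fix \<epsilon> :: real assume "\<epsilon> > 0"
      obtain r where r: "r > 0" "ball x r \<subseteq> U" using C1_chartD(1)[OF ch] x by (metis open_contains_ball)
      define t where "t = min (\<epsilon> / 2) (r / 2)"
      have t: "0 < t" "t < \<epsilon>" "t < r" using r \<open>\<epsilon> > 0\<close> by (auto simp: t_def)
      have n: "dist (x + (- t) *\<^sub>R e) x = t" using t C1_chartD(2)[OF ch] by (simp add: dist_norm)
      then have "x + (- t) *\<^sub>R e \<in> U" using r(2) t by (auto simp: subset_iff dist_commute)
      moreover have "(x + (- t) *\<^sub>R e) \<bullet> e < h (x + (- t) *\<^sub>R e)"
        unfolding C1_chartD(4)[OF ch] using 3 t chart_inner_e[OF ch] by (simp add: inner_diff_left)
      ultimately have "x + (- t) *\<^sub>R e \<in> \<Omega>" using iff by blast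
      with n t(2) show "\<exists>y\<in>\<Omega>. dist y x < \<epsilon>" by metis
    qed
    moreover have "x \<notin> \<Omega>" using iff[OF x] 3 by simp
    ultimately show ?thesis using 3 fr by simp
  qed
qed

lemma chart_tangent:
  fixes \<Omega> :: "'a::euclidean_space set"
  assumes ch: "C1_chart \<Omega> U e h" and O: "open \<Omega>" and x: "x \<in> U" "x \<in> frontier \<Omega>" and eps: "\<epsilon> > 0"
  shows "\<exists>r>0. \<forall>y. norm y < r \<longrightarrow>
     (y \<bullet> (e - grad h x) < - \<epsilon> * norm y \<longrightarrow> x + y \<in> \<Omega>) \<and> (\<epsilon> * norm y < y \<bullet> (e - grad h x) \<longrightarrow> x + y \<notin> \<Omega>)"
proof -
  have d: "(h has_derivative (\<lambda>v. v \<bullet> grad h x)) (at x)" by (rule grad_has_derivative[OF Ck1_facts(1)[OF C1_chartD(3)[OF ch]]])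
  obtain d1 where d1: "d1 > 0" "\<And>z. norm (z - x) < d1 \<Longrightarrow> norm (h z - h x - (z - x) \<bullet> grad h x) \<le> \<epsilon> * norm (z - x)"
    using d eps unfolding has_derivative_at_alt by blast
  obtain r where r: "r > 0" "ball x r \<subseteq> U" using C1_chartD(1)[OF ch] x(1) by (metis open_contains_ball)
  have hx: "x \<bullet> e = h x" using chart_frontier[OF ch O x(1)] x(2) by simp
  show ?thesis
  proof (intro exI[of _ "min d1 r"] conjI allI impI)
    show "0 < min d1 r" using d1 r by simp
    fix y :: 'a assume y: "norm y < min d1 r"
    have U: "x + y \<in> U" using y r(2) by (auto simp: subset_iff dist_norm)
    have b: "\<bar>h (x + y) - h x - y \<bullet> grad h x\<bar> \<le> \<epsilon> * norm y" using d1(2)[of "x + y"] y by simp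
    note iff = C1_chartD(5)[OF ch U]
    { assume "y \<bullet> (e - grad h x) < - \<epsilon> * norm y"
      then have "(x + y) \<bullet> e < h (x + y)" using b hx by (simp add: inner_diff_right inner_add_left)
      then show "x + y \<in> \<Omega>" using iff by simp }
    { assume "\<epsilon> * norm y < y \<bullet> (e - grad h x)"
      then have "\<not> (x + y) \<bullet> e < h (x + y)" using b hx by (simp add: inner_diff_right inner_add_left)
      then show "x + y \<notin> \<Omega>" using iff by simp }
  qed
qed

lemma chart_grad_orth: assumes ch: "C1_chart \<Omega> U e h" shows "e \<bullet> grad h x = 0"
proof -
  have d: "(h has_derivative (\<lambda>v. v \<bullet> grad h x)) (at (x + 0 *\<^sub>R e))"
    using grad_has_derivative[OF Ck1_facts(1)[OF C1_chartD(3)[OF ch]]] by simp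
  have g: "((\<lambda>t. x + t *\<^sub>R e) has_derivative (\<lambda>s. s *\<^sub>R e)) (at 0)" by (auto intro!: derivative_eq_intros)
  have "((\<lambda>t. h x) has_derivative (\<lambda>s. (s *\<^sub>R e) \<bullet> grad h x)) (at (0::real))"
    using diff_chain_at[OF g d] unfolding o_def C1_chartD(4)[OF ch] .
  moreover have "((\<lambda>t. h x) has_derivative (\<lambda>s. 0)) (at (0::real))" by simp
  ultimately have "(\<lambda>s. (s *\<^sub>R e) \<bullet> grad h x) = (\<lambda>s::real. 0)" by (rule has_derivative_unique)
  from fun_cong[OF this, of 1] show ?thesis by simp
qed

definition chart_normal :: "'a::euclidean_space \<Rightarrow> ('a \<Rightarrow> real) \<Rightarrow> 'a \<Rightarrow> 'a" where
  "chart_normal e h x = (e - grad h x) /\<^sub>R norm (e - grad h x)"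

lemma chart_normal_pos: assumes ch: "C1_chart \<Omega> U e h" shows "norm (e - grad h x) > 0"
proof -
  have "e - grad h x \<noteq> 0"
  proof
    assume "e - grad h x = 0" then have "e \<bullet> e = 0" using chart_grad_orth[OF ch, of x] by simp
    then show False using chart_inner_e[OF ch] by simp
  qed
  then show ?thesis by simp
qed

lemma norm_chart_normal: assumes ch: "C1_chart \<Omega> U e h" shows "norm (chart_normal e h x) = 1"
  using chart_normal_pos[OF ch, of x] by (simp add: chart_normal_def)

lemma chart_side:
  assumes ch: "C1_chart \<Omega> U e h" and O: "open \<Omega>" and x: "x \<in> U" "x \<in> frontier \<Omega>"
  shows "v \<bullet> chart_normal e h x < 0 \<Longrightarrow> \<exists>t0>0. \<forall>t. 0 < t \<and> t < t0 \<longrightarrow> x + t *\<^sub>R v \<in> \<Omega>" (is "?A \<Longrightarrow> ?B")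
    and "v \<bullet> chart_normal e h x > 0 \<Longrightarrow> \<exists>t0>0. \<forall>t. 0 < t \<and> t < t0 \<longrightarrow> x + t *\<^sub>R v \<notin> \<Omega>" (is "?C \<Longrightarrow> ?D")
proof -
  let ?m = "e - grad h x"
  have m: "norm ?m > 0" by (rule chart_normal_pos[OF ch])
  have vm: "v \<bullet> chart_normal e h x = (v \<bullet> ?m) / norm ?m" by (simp add: chart_normal_def divide_inverse)
  define \<epsilon> where "\<epsilon> = \<bar>v \<bullet> ?m\<bar> / (2 * (norm v + 1))"
  have key: "\<epsilon> * norm v < \<bar>v \<bullet> ?m\<bar>" if "v \<bullet> ?m \<noteq> 0"
  proof -
    have lt: "norm v < 2 * (norm v + 1)" by (rule order_le_less_trans[of _ "2 * norm v"]) simp_all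
    have "\<bar>v \<bullet> ?m\<bar> * norm v < \<bar>v \<bullet> ?m\<bar> * (2 * (norm v + 1))" 
      using that by (intro mult_strict_left_mono lt) simp
    then show ?thesis unfolding \<epsilon>_def by (simp add: field_simps add_pos_nonneg)
  qed
  have main: "\<exists>t0>0. \<forall>t. 0 < t \<and> t < t0 \<longrightarrow> (v \<bullet> ?m < 0 \<longrightarrow> x + t *\<^sub>R v \<in> \<Omega>) \<and> (v \<bullet> ?m > 0 \<longrightarrow> x + t *\<^sub>R v \<notin> \<Omega>)"
    if nz: "v \<bullet> ?m \<noteq> 0"
  proof -
    have e0: "\<epsilon> > 0" using nz by (simp add: \<epsilon>_def add_nonneg_pos)
    obtain r where r: "r > 0" "\<And>y. norm y < r \<Longrightarrow> 
       (y \<bullet> ?m < - \<epsilon> * norm y \<longrightarrow> x + y \<in> \<Omega>) \<and> (\<epsilon> * norm y < y \<bullet> ?m \<longrightarrow> x + y \<notin> \<Omega>)"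
      using chart_tangent[OF ch O x e0] by blast
    show ?thesis
    proof (intro exI[of _ "r / (norm v + 1)"] conjI allI impI)
      show "0 < r / (norm v + 1)" using r(1) by (simp add: add_nonneg_pos)
      fix t assume t: "0 < t \<and> t < r / (norm v + 1)"
      then have "t * (norm v + 1) < r" by (simp add: pos_less_divide_eq add_nonneg_pos)
      then have nt: "norm (t *\<^sub>R v) < r" using t by (simp add: algebra_simps)
      have "t * (\<epsilon> * norm v) < t * \<bar>v \<bullet> ?m\<bar>" using key[OF nz] t by simp
      then have k: "\<epsilon> * norm (t *\<^sub>R v) < t * \<bar>v \<bullet> ?m\<bar>" using t by (simp add: mult.left_commute)
      { assume "v \<bullet> ?m < 0" then have "(t *\<^sub>R v) \<bullet> ?m < - \<epsilon> * norm (t *\<^sub>R v)" using k by simp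
        then show "x + t *\<^sub>R v \<in> \<Omega>" using r(2)[OF nt] by blast }
      { assume "v \<bullet> ?m > 0" then have "\<epsilon> * norm (t *\<^sub>R v) < (t *\<^sub>R v) \<bullet> ?m" using k by simp
        then show "x + t *\<^sub>R v \<notin> \<Omega>" using r(2)[OF nt] by blast }
    qed
  qed
  show "?A \<Longrightarrow> ?B" 
  proof -
    assume ?A then have "v \<bullet> ?m < 0" unfolding vm using m by (simp add: divide_less_0_iff)
    then show ?B using main by fastforce
  qed
  show "?C \<Longrightarrow> ?D" 
  proof -
    assume ?C then have "v \<bullet> ?m > 0" unfolding vm using m by (simp add: zero_less_divide_iff)
    then show ?D using main by fastforce
  qed
qed

lemma chart_normal_unique:
  assumes ch: "C1_chart \<Omega> U e h" "C1_chart \<Omega> U' e' h'" and O: "open \<Omega>"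
    and x: "x \<in> U" "x \<in> U'" "x \<in> frontier \<Omega>"
  shows "chart_normal e h x = chart_normal e' h' x"
proof (rule ccontr)
  let ?n = "chart_normal e h x" and ?n' = "chart_normal e' h' x"
  assume ne: "?n \<noteq> ?n'"
  have n1: "?n \<bullet> ?n = 1" "?n' \<bullet> ?n' = 1" using norm_chart_normal[OF ch(1)] norm_chart_normal[OF ch(2)] by (simp_all add: norm_eq_1)
  have "0 < (?n - ?n') \<bullet> (?n - ?n')" using ne by (simp add: inner_gt_zero_iff)
  then have lt: "?n \<bullet> ?n' < 1" using n1 by (simp add: inner_diff_left inner_diff_right inner_commute)
  let ?v = "?n' - ?n"
  have "?v \<bullet> ?n = ?n \<bullet> ?n' - 1" "?v \<bullet> ?n' = 1 - ?n \<bullet> ?n'"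
    unfolding inner_diff_left n1 by (simp_all add: inner_commute)
  then have "?v \<bullet> ?n < 0" "?v \<bullet> ?n' > 0" using lt by linarith+
  then obtain t0 t1 where t: "t0 > 0" "\<And>t. 0 < t \<Longrightarrow> t < t0 \<Longrightarrow> x + t *\<^sub>R ?v \<in> \<Omega>"
     "t1 > 0" "\<And>t. 0 < t \<Longrightarrow> t < t1 \<Longrightarrow> x + t *\<^sub>R ?v \<notin> \<Omega>"
    using chart_side(1)[OF ch(1) O x(1,3)] chart_side(2)[OF ch(2) O x(2,3)] by metis
  have "0 < min t0 t1 / 2" "min t0 t1 / 2 < t0" "min t0 t1 / 2 < t1" using t(1,3) by auto
  then show False using t(2,4) by blast
qed

lemma outer_normal_chart:
  assumes ch: "C1_chart \<Omega> U e h" and O: "open \<Omega>" and x: "x \<in> U" "x \<in> frontier \<Omega>"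
  shows "outer_normal \<Omega> x = chart_normal e h x"
  unfolding outer_normal_def
proof (rule the_equality)
  show "\<exists>U e' h' g. C1_chart \<Omega> U e' h' \<and> x \<in> U \<and> GDERIV h' x :> g \<and> chart_normal e h x = (e' - g) /\<^sub>R norm (e' - g)"
    using ch x GDERIV_grad[OF C1_chartD(3)[OF ch]] unfolding chart_normal_def by blast
next
  fix n assume "\<exists>U e' h' g. C1_chart \<Omega> U e' h' \<and> x \<in> U \<and> GDERIV h' x :> g \<and> n = (e' - g) /\<^sub>R norm (e' - g)"
  then obtain U' e' h' g where c: "C1_chart \<Omega> U' e' h'" "x \<in> U'" "GDERIV h' x :> g" "n = (e' - g) /\<^sub>R norm (e' - g)" by blast
  have "n = chart_normal e' h' x" using c(3,4) GDERIV_grad[OF C1_chartD(3)[OF c(1)]] by (simp add: chart_normal_def)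
  then show "n = chart_normal e h x" using chart_normal_unique[OF c(1) ch O c(2) x] by simp
qed

lemma bounded_C1_domainD:
  assumes "bounded_C1_domain \<Omega>"
  shows "\<Omega> \<noteq> {}" "open \<Omega>" "bounded \<Omega>" "x \<in> frontier \<Omega> \<Longrightarrow> \<exists>U e h. C1_chart \<Omega> U e h \<and> x \<in> U"
  using assms unfolding bounded_C1_domain_def by blast+

lemma continuous_on_outer_normal:
  assumes dom: "bounded_C1_domain \<Omega>"
  shows "continuous_on (frontier \<Omega>) (outer_normal \<Omega>)"
  unfolding continuous_on_eq_continuous_within
proof
  fix x assume x: "x \<in> frontier \<Omega>"
  note O = bounded_C1_domainD(2)[OF dom]
  obtain U e h where ch: "C1_chart \<Omega> U e h" and xU: "x \<in> U" using bounded_C1_domainD(4)[OF dom x] by blast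
  obtain r where r: "r > 0" "ball x r \<subseteq> U" using C1_chartD(1)[OF ch] xU by (metis open_contains_ball)
  have "continuous_on (frontier \<Omega>) (chart_normal e h)" unfolding chart_normal_def[abs_def]
    using chart_normal_pos[OF ch] Ck1_facts(3)[OF C1_chartD(3)[OF ch]] by (intro continuous_intros) force+
  then have "continuous (at x within frontier \<Omega>) (chart_normal e h)" using x by (simp add: continuous_on_eq_continuous_within)
  then show "continuous (at x within frontier \<Omega>) (outer_normal \<Omega>)"
  proof (rule continuous_transform_within[OF _ r(1) x])
    fix y assume "y \<in> frontier \<Omega>" "dist y x < r"
    then have "y \<in> U" using r(2) by (auto simp: dist_commute subset_iff)
    then show "chart_normal e h y = outer_normal \<Omega> y" using outer_normal_chart[OF ch O _ \<open>y \<in> frontier \<Omega>\<close>] by simp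
  qed
qed

lemma norm_outer_normal:
  assumes dom: "bounded_C1_domain \<Omega>" and x: "x \<in> frontier \<Omega>" shows "norm (outer_normal \<Omega> x) = 1"
proof -
  obtain U e h where ch: "C1_chart \<Omega> U e h" and xU: "x \<in> U" using bounded_C1_domainD(4)[OF dom x] by blast
  show ?thesis unfolding outer_normal_chart[OF ch bounded_C1_domainD(2)[OF dom] xU x] by (rule norm_chart_normal[OF ch])
qed

lemma Ck1_Lipschitz_cball:
  fixes h :: "'a::euclidean_space \<Rightarrow> real"
  assumes h: "Ck 1 h"
  shows "\<exists>L\<ge>0. \<forall>x\<in>cball p R. \<forall>y\<in>cball p R. \<bar>h x - h y\<bar> \<le> L * norm (x - y)"
proof -
  have "bounded (grad h ` cball p R)"
    using compact_continuous_image[OF Ck1_facts(3)[OF h] compact_cball] compact_imp_bounded by blast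
  then obtain L where L: "\<And>x. x \<in> cball p R \<Longrightarrow> norm (grad h x) \<le> L" unfolding bounded_iff by (metis imageI)
  have "norm (h x - h y) \<le> max L 0 * norm (x - y)" if "x \<in> cball p R" "y \<in> cball p R" for x y
  proof (rule differentiable_bound[of "cball p R" h "\<lambda>x v. v \<bullet> grad h x"])
    fix z assume z: "z \<in> cball p R"
    show "(h has_derivative (\<lambda>v. v \<bullet> grad h z)) (at z within cball p R)"
      using grad_has_derivative[OF Ck1_facts(1)[OF h]] has_derivative_at_withinI by blast
    show "onorm (\<lambda>v. v \<bullet> grad h z) \<le> max L 0"
    proof (rule onorm_le)
      fix v
      have "\<bar>v \<bullet> grad h z\<bar> \<le> norm v * norm (grad h z)" by (rule Cauchy_Schwarz_ineq2)
      also have "\<dots> \<le> norm v * max L 0" using L[OF z] by (intro mult_left_mono) auto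
      finally show "norm (v \<bullet> grad h z) \<le> max L 0 * norm v" by (simp add: mult.commute)
    qed
  qed (use that in auto)
  then show ?thesis by (intro exI[of _ "max L 0"]) auto
qed

lemma compact_separated_net:
  fixes A :: "'a::metric_space set"
  assumes A: "compact A" and d: "\<delta> > 0"
  obtains X where "finite X" "X \<subseteq> A" "\<And>x y. x \<in> X \<Longrightarrow> y \<in> X \<Longrightarrow> x \<noteq> y \<Longrightarrow> \<delta> \<le> dist x y"
    "A \<subseteq> (\<Union>x\<in>X. ball x \<delta>)"
proof -
  obtain T where T: "finite T" "A \<subseteq> (\<Union>t\<in>T. ball t (\<delta>/2))"
  proof -
    have "A \<subseteq> (\<Union>x\<in>A. ball x (\<delta>/2))" using d by (intro subsetI UN_I) auto
    then show thesis by (rule compactE_image[OF A open_ball]) (rule that)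
  qed
  define P where "P X \<longleftrightarrow> finite X \<and> X \<subseteq> A \<and> (\<forall>x\<in>X. \<forall>y\<in>X. x \<noteq> y \<longrightarrow> \<delta> \<le> dist x y)" for X
  have bd: "card X \<le> card T" if PX: "P X" for X
  proof -
    have X: "X \<subseteq> A" and Xs: "\<And>x y. x \<in> X \<Longrightarrow> y \<in> X \<Longrightarrow> x \<noteq> y \<Longrightarrow> \<delta> \<le> dist x y"
      using PX unfolding P_def by simp_all
    have "\<exists>t. t \<in> T \<and> dist t x < \<delta>/2" if "x \<in> X" for x
    proof -
      have "x \<in> (\<Union>t\<in>T. ball t (\<delta>/2))" using T(2) X \<open>x \<in> X\<close> by (meson subsetD)
      then show ?thesis by (auto simp: ball_def)
    qed
    then obtain f where f: "\<And>x. x \<in> X \<Longrightarrow> f x \<in> T" "\<And>x. x \<in> X \<Longrightarrow> dist (f x) x < \<delta>/2" by metis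
    have "inj_on f X"
    proof (rule inj_onI, rule ccontr)
      fix x y assume xy: "x \<in> X" "y \<in> X" "f x = f y" "x \<noteq> y"
      have "dist x y \<le> dist (f x) x + dist (f x) y" by (rule dist_triangle3)
      also have "\<dots> < \<delta>" using f(2)[OF xy(1)] f(2)[OF xy(2)] xy(3) by simp
      finally show False using Xs[OF xy(1,2,4)] by linarith
    qed
    then show ?thesis by (rule card_inj_on_le) (use f(1) T(1) in auto)
  qed
  have "P {}" by (simp add: P_def)
  then obtain X where X: "P X" "\<And>Y. P Y \<Longrightarrow> card Y \<le> card X"
    using ex_has_greatest_nat[of P "{}" card "Suc (card T)"] bd by (metis le_imp_less_Suc)
  have "A \<subseteq> (\<Union>x\<in>X. ball x \<delta>)"
  proof (rule ccontr)
    assume "\<not> A \<subseteq> (\<Union>x\<in>X. ball x \<delta>)"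
    then obtain a where a0: "a \<in> A" "a \<notin> (\<Union>x\<in>X. ball x \<delta>)" by (meson subsetI)
    have a: "a \<in> A" "\<And>x. x \<in> X \<Longrightarrow> \<delta> \<le> dist x a" using a0 by (simp, meson UN_I mem_ball not_le)
    then have "a \<notin> X" using d by force
    moreover have PX: "finite X" "X \<subseteq> A" "\<forall>x\<in>X. \<forall>y\<in>X. x \<noteq> y \<longrightarrow> \<delta> \<le> dist x y" using X(1) unfolding P_def by simp_all
    have "P (insert a X)"
      unfolding P_def
    proof (intro conjI ballI impI)
      fix x y assume xy: "x \<in> insert a X" "y \<in> insert a X" "x \<noteq> y"
      then consider "x = a" "y \<in> X" | "y = a" "x \<in> X" | "x \<in> X" "y \<in> X" by blast
      then show "\<delta> \<le> dist x y"
        by cases (use a(2)[of x] a(2)[of y] PX(3) xy(3) in \<open>simp_all add: dist_commute[of a]\<close>)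
    qed (use PX a(1) in simp_all)
    then have "card (insert a X) \<le> card X" by (rule X(2))
    ultimately show False using PX(1) by simp
  qed
  moreover have "finite X" "X \<subseteq> A" "\<And>x y. x \<in> X \<Longrightarrow> y \<in> X \<Longrightarrow> x \<noteq> y \<Longrightarrow> \<delta> \<le> dist x y" using X(1) unfolding P_def by simp_all
  ultimately show thesis using that by simp
qed

(*T7*)
definition down :: "'a::euclidean_space \<Rightarrow> real \<Rightarrow> 'a set \<Rightarrow> 'a set" where
  "down e s A = (\<lambda>(x, t). x - t *\<^sub>R e) ` (A \<times> {0..s})"

lemma compact_down: "compact A \<Longrightarrow> compact (down e s A)"
  unfolding down_def by (intro compact_continuous_image compact_Times) (auto intro!: continuous_intros simp: split_beta)

lemma perp_self: "norm e = 1 \<Longrightarrow> perp e (t *\<^sub>R e) = 0"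
  by (simp add: perp_def norm_eq_1)

lemma hausdorff_pre_finite_balls:
  fixes A :: "'a::euclidean_space set"
  assumes n: "n \<ge> 1" and X: "finite X" "A \<subseteq> (\<Union>x\<in>X. ball x \<delta>)" and d: "\<delta> > 0"
  shows "hausdorff_pre n (2 * \<delta>) A \<le> ennreal (real (card X) * (unit_ball_vol (real n) * \<delta> ^ n))"
proof -
  obtain f where f: "bij_betw f {0..<card X} X" using ex_bij_betw_nat_finite[OF X(1)] by blast
  define C where "C i = (if i < card X then ball (f i) \<delta> else {})" for i
  let ?w = "\<lambda>C. ennreal (unit_ball_vol (real n) * (diameter C / 2) ^ n)"
  have dC: "diameter (C i) \<le> 2 * \<delta>" "bounded (C i)" for i
    using d by (auto simp: C_def)
  have "A \<subseteq> (\<Union>i. C i)"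
  proof
    fix a assume "a \<in> A"
    then obtain x where "x \<in> X" "a \<in> ball x \<delta>" using X(2) by blast
    moreover obtain i where "i < card X" "f i = x" using f \<open>x \<in> X\<close> unfolding bij_betw_def by force
    ultimately have "a \<in> C i" by (simp add: C_def)
    then show "a \<in> (\<Union>i. C i)" by blast
  qed
  then have "hausdorff_pre n (2 * \<delta>) A \<le> (\<Sum>i. ?w (C i))" by (rule hausdorff_pre_le) (use dC in auto)
  also have "\<dots> = (\<Sum>i<card X. ?w (C i))"
    using n by (intro suminf_finite) (auto simp: C_def zero_power)
  also have "\<dots> \<le> (\<Sum>i<card X. ennreal (unit_ball_vol (real n) * \<delta> ^ n))"
  proof (rule sum_mono)
    fix i
    have half: "diameter (C i) / 2 \<le> \<delta>" using dC(1)[of i] by simp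
    show "?w (C i) \<le> ennreal (unit_ball_vol (real n) * \<delta> ^ n)"
      using diameter_ge_0[OF dC(2)] by (intro ennreal_leI mult_left_mono power_mono half) simp_all
  qed
  also have "\<dots> = ennreal (real (card X) * (unit_ball_vol (real n) * \<delta> ^ n))"
    using d by (simp add: ennreal_of_nat_eq_real_of_nat ennreal_mult)
  finally show ?thesis .
qed

definition layer_const :: "nat \<Rightarrow> real \<Rightarrow> real" where
  "layer_const d L = 2 * (1 / (1 + L)) * unit_ball_vol (real (d - 1)) / (unit_ball_vol (real d) * (1 / (1 + L) / 2) ^ d)"

lemma layer_const_pos: "L \<ge> 0 \<Longrightarrow> layer_const d L > 0"
  unfolding layer_const_def by (intro divide_pos_pos mult_pos_pos zero_less_power) auto

lemma hausdorff_pre_le_open_down: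
  fixes A V :: "'a::euclidean_space set"
  assumes n: "DIM('a) \<ge> 2" and e: "norm e = 1" and L: "L \<ge> 0" and A: "compact A" and s: "s > 0"
    and lip: "\<And>x y. x \<in> A \<Longrightarrow> y \<in> A \<Longrightarrow> \<bar>(x - y) \<bullet> e\<bar> \<le> L * norm (perp e (x - y))"
    and V: "open V" "\<And>x. x \<in> down e s A \<Longrightarrow> ball x d0 \<subseteq> V"
    and d: "\<delta> > 0" "\<delta> \<le> d0" "\<delta> \<le> s"
  shows "hausdorff_pre (DIM('a) - 1) (2 * \<delta>) A \<le> ennreal (layer_const DIM('a) L / s) * emeasure lborel V"
proof -
  let ?d = "DIM('a)" let ?n = "DIM('a) - 1"
  define \<kappa> where "\<kappa> = 1 / (1 + L)"
  have k: "0 < \<kappa>" "\<kappa> \<le> 1" using L by (auto simp: \<kappa>_def)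
  have sep: "\<kappa> * norm (x - y) \<le> norm (perp e (x - y))" if "x \<in> A" "y \<in> A" for x y
  proof -
    have "x - y = perp e (x - y) + ((x - y) \<bullet> e) *\<^sub>R e" by (simp add: perp_def)
    then have "norm (x - y) \<le> norm (perp e (x - y)) + norm (((x - y) \<bullet> e) *\<^sub>R e)"
      using norm_triangle_ineq by metis
    also have "norm (((x - y) \<bullet> e) *\<^sub>R e) = \<bar>(x - y) \<bullet> e\<bar>" using e by simp
    also have "norm (perp e (x - y)) + \<bar>(x - y) \<bullet> e\<bar> \<le> (1 + L) * norm (perp e (x - y))"
      using lip[OF that] by (simp add: algebra_simps)
    finally show ?thesis using L by (simp add: \<kappa>_def field_simps)
  qed
  obtain X where X: "finite X" "X \<subseteq> A" "\<And>x y. x \<in> X \<Longrightarrow> y \<in> X \<Longrightarrow> x \<noteq> y \<Longrightarrow> \<delta> \<le> dist x y"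
    "A \<subseteq> (\<Union>x\<in>X. ball x \<delta>)" by (rule compact_separated_net[OF A d(1)]) blast
  define r where "r = \<kappa> * \<delta>"
  have r: "0 < r" "r \<le> \<delta>" using k d by (auto simp: r_def mult_left_le_one_le)
  define M where "M = nat \<lfloor>s / r\<rfloor>"
  have sr: "1 \<le> s / r" using r d by simp
  have fl: "1 \<le> \<lfloor>s / r\<rfloor>" using sr by (simp only: one_le_floor)
  then have rM: "real M = of_int \<lfloor>s / r\<rfloor>" by (simp add: M_def)
  have M: "real M \<le> s / r" "s / r \<le> 2 * real M"
    unfolding rM using fl floor_correct[of "s / r"] by linarith+
  define c where "c p = fst p - (real (snd p) * r) *\<^sub>R e" for p :: "'a \<times> nat"
  let ?I = "X \<times> {..<M}"
  have cdist: "r \<le> dist (c p) (c q)" if "p \<in> ?I" "q \<in> ?I" "p \<noteq> q" for p q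
  proof (cases "fst p = fst q")
    case False
    have "perp e (c p - c q) = perp e (fst p - fst q)"
    proof -
      have "c p - c q = (fst p - fst q) + ((real (snd q) - real (snd p)) * r) *\<^sub>R e"
        by (simp add: c_def algebra_simps)
      then show ?thesis by (simp only: perp_add perp_self[OF e] add_0_right)
    qed
    then have "norm (perp e (fst p - fst q)) \<le> dist (c p) (c q)"
      using norm_perp_le[OF e, of "c p - c q"] by (simp add: dist_norm)
    moreover have "fst p \<in> X" "fst q \<in> X" using that by auto
    then have "\<kappa> * \<delta> \<le> \<kappa> * norm (fst p - fst q)" "fst p \<in> A" "fst q \<in> A"
      using X(2) X(3)[of "fst p" "fst q"] False k by (auto simp: dist_norm)
    ultimately show ?thesis using sep[of "fst p" "fst q"] by (simp add: r_def)
  next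
    case True
    then have ne: "snd p \<noteq> snd q" using that(3) by (auto simp: prod_eq_iff)
    have "c p - c q = ((real (snd q) - real (snd p)) * r) *\<^sub>R e" using True by (simp add: c_def algebra_simps)
    then have "dist (c p) (c q) = \<bar>real (snd q) - real (snd p)\<bar> * r" using e r by (simp add: dist_norm abs_mult)
    moreover have "1 \<le> \<bar>real (snd q) - real (snd p)\<bar>" using ne by linarith
    ultimately show ?thesis using r by simp
  qed
  have disj: "disjoint_family_on (\<lambda>p. ball (c p) (r / 2)) ?I"
    unfolding disjoint_family_on_def
  proof (intro ballI impI)
    fix p q assume "p \<in> ?I" "q \<in> ?I" "p \<noteq> q"
    from cdist[OF this] show "ball (c p) (r/2) \<inter> ball (c q) (r/2) = {}" by (intro disjoint_ballI) simp
  qed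
  have sub: "ball (c p) (r / 2) \<subseteq> V" if p: "p \<in> ?I" for p
  proof -
    have "real (snd p) * r \<le> real M * r" using p r by (intro mult_right_mono) auto
    also have "\<dots> \<le> s" using M(1) r by (simp add: field_simps)
    finally have "real (snd p) * r \<in> {0..s}" using r by simp
    moreover have "fst p \<in> A" using p X(2) by auto
    ultimately have "(\<lambda>(x, t). x - t *\<^sub>R e) (fst p, real (snd p) * r) \<in> down e s A"
      unfolding down_def by (intro imageI) simp
    then have "c p \<in> down e s A" by (simp add: c_def)
    then have "ball (c p) d0 \<subseteq> V" by (rule V(2))
    moreover have "ball (c p) (r / 2) \<subseteq> ball (c p) d0" using r d by (intro subset_ball) simp
    ultimately show ?thesis by blast
  qed
  have vol: "ennreal (real (card X) * real M * (unit_ball_vol (real ?d) * (r / 2) ^ ?d)) \<le> emeasure lborel V"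
  proof -
    have "ennreal (real (card X) * real M * (unit_ball_vol (real ?d) * (r / 2) ^ ?d)) = (\<Sum>p\<in>?I. emeasure lborel (ball (c p) (r / 2)))"
      using r by (simp add: emeasure_ball card_cartesian_product ennreal_of_nat_eq_real_of_nat ennreal_mult)
    also have "\<dots> = emeasure lborel (\<Union>p\<in>?I. ball (c p) (r / 2))"
      using disj X(1) by (intro sum_emeasure) auto
    also have "\<dots> \<le> emeasure lborel V" using sub V(1) by (intro emeasure_mono) (blast, simp add: borel_open)
    finally show ?thesis .
  qed
  have num: "real (card X) * (unit_ball_vol (real ?n) * \<delta> ^ ?n) \<le>
      layer_const ?d L / s * (real (card X) * real M * (unit_ball_vol (real ?d) * (r / 2) ^ ?d))"
  proof -
    have dn: "\<delta> ^ ?d = \<delta> * \<delta> ^ ?n" using n by (metis Suc_diff_1 DIM_positive power_Suc)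
    define W where "W = unit_ball_vol (real ?d) * (\<kappa> / 2) ^ ?d"
    define w where "w = unit_ball_vol (real ?n)"
    have "unit_ball_vol (real ?d) > 0" by (rule unit_ball_vol_pos) simp
    then have "0 < W" unfolding W_def using k by (intro mult_pos_pos zero_less_power) simp_all
    then have W: "W \<noteq> 0" by (rule less_imp_neq[symmetric])
    have lc: "layer_const ?d L = 2 * \<kappa> * w / W" unfolding layer_const_def \<kappa>_def W_def w_def ..
    have "r / 2 = (\<kappa> / 2) * \<delta>" by (simp add: r_def)
    then have "(r / 2) ^ ?d = (\<kappa> / 2) ^ ?d * \<delta> ^ ?d" by (simp only: power_mult_distrib)
    then have rd: "unit_ball_vol (real ?d) * (r / 2) ^ ?d = W * (\<delta> * \<delta> ^ ?n)" unfolding W_def dn by (simp only: mult.assoc)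
    have eq: "layer_const ?d L * (unit_ball_vol (real ?d) * (r / 2) ^ ?d) = 2 * r * (w * \<delta> ^ ?n)"
      unfolding lc rd using W by (simp add: r_def)
    have one: "1 \<le> 2 * r * real M / s"
    proof -
      have "s \<le> 2 * real M * r" using M(2) r by (simp only: pos_divide_le_eq)
      then show ?thesis using s by (simp add: pos_le_divide_eq mult_ac)
    qed
    have w0: "0 \<le> w * \<delta> ^ ?n" unfolding w_def using d unit_ball_vol_nonneg[of "real ?n"] by (intro mult_nonneg_nonneg) simp_all
    have "(real (card X) * (w * \<delta> ^ ?n)) * 1 \<le> (real (card X) * (w * \<delta> ^ ?n)) * (2 * r * real M / s)"
      by (intro mult_left_mono one mult_nonneg_nonneg w0) simp
    also have "\<dots> = real (card X) * real M / s * (2 * r * (w * \<delta> ^ ?n))" by (simp only: times_divide_eq_right times_divide_eq_left mult_ac)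
    also have "\<dots> = layer_const ?d L / s * (real (card X) * real M * (unit_ball_vol (real ?d) * (r / 2) ^ ?d))"
      unfolding eq[symmetric] by (simp only: times_divide_eq_right times_divide_eq_left mult_ac)
    finally show ?thesis unfolding w_def by (simp only: mult_1_right)
  qed
  have C0: "0 \<le> layer_const ?d L / s" using layer_const_pos[OF L, of ?d] s by simp
  have "hausdorff_pre ?n (2 * \<delta>) A \<le> ennreal (real (card X) * (unit_ball_vol (real ?n) * \<delta> ^ ?n))"
    using n by (intro hausdorff_pre_finite_balls X(1,4) d(1)) simp
  also have "\<dots> \<le> ennreal (layer_const ?d L / s * (real (card X) * real M * (unit_ball_vol (real ?d) * (r / 2) ^ ?d)))"
    by (rule ennreal_leI[OF num])
  also have "\<dots> = ennreal (layer_const ?d L / s) * ennreal (real (card X) * real M * (unit_ball_vol (real ?d) * (r / 2) ^ ?d))"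
    using C0 by (rule ennreal_mult')
  also have "\<dots> \<le> ennreal (layer_const ?d L / s) * emeasure lborel V" by (rule mult_left_mono[OF vol]) simp
  finally show ?thesis .
qed

lemma hausdorff_outer_le_down:
  fixes A :: "'a::euclidean_space set"
  assumes n: "DIM('a) \<ge> 2" and e: "norm e = 1" and L: "L \<ge> 0" and A: "compact A" and s: "s > 0"
    and lip: "\<And>x y. x \<in> A \<Longrightarrow> y \<in> A \<Longrightarrow> \<bar>(x - y) \<bullet> e\<bar> \<le> L * norm (perp e (x - y))"
  shows "hausdorff_outer (DIM('a) - 1) A \<le> ennreal (layer_const DIM('a) L / s) * emeasure lborel (down e s A)"
proof -
  let ?T = "down e s A" and ?C = "layer_const DIM('a) L / s"
  have T: "compact ?T" by (rule compact_down[OF A])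
  have C: "?C > 0" using layer_const_pos[OF L] s by simp
  have open_bound: "hausdorff_outer (DIM('a) - 1) A \<le> ennreal ?C * emeasure lborel V" if V: "open V" "?T \<subseteq> V" for V
  proof -
    obtain d0 where d0: "d0 > 0" "(\<Union>x\<in>?T. ball x d0) \<subseteq> V"
      using compact_subset_open_imp_ball_epsilon_subset[OF T V] by blast
    show ?thesis unfolding hausdorff_outer_def
    proof (rule SUP_least)
      fix \<delta> :: real assume "\<delta> \<in> {0<..}"
      define \<delta>' where "\<delta>' = min (\<delta> / 2) (min d0 s)"
      have d': "\<delta>' > 0" "\<delta>' \<le> d0" "\<delta>' \<le> s" "2 * \<delta>' \<le> \<delta>" using \<open>\<delta> \<in> {0<..}\<close> d0(1) s by (auto simp: \<delta>'_def)
      have "hausdorff_pre (DIM('a) - 1) \<delta> A \<le> hausdorff_pre (DIM('a) - 1) (2 * \<delta>') A"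
        by (rule hausdorff_pre_antimono[OF d'(4)])
      also have "\<dots> \<le> ennreal ?C * emeasure lborel V"
        by (rule hausdorff_pre_le_open_down[OF n e L A s lip V(1) _ d'(1-3)]) (use d0(2) in blast)+
      finally show "hausdorff_pre (DIM('a) - 1) \<delta> A \<le> ennreal ?C * emeasure lborel V" .
    qed
  qed
  show ?thesis
  proof (rule ennreal_le_epsilon)
    fix \<epsilon> :: real assume eps: "\<epsilon> > 0"
    have mT: "?T \<in> sets lborel" using T by (simp add: borel_compact)
    obtain V where V: "open V" "?T \<subseteq> V" "emeasure lebesgue (V - ?T) < ennreal (\<epsilon> / ?C)"
      using sets_lebesgue_outer_open[of ?T "\<epsilon> / ?C"] mT eps C by (metis divide_pos_pos sets_completionI_sets)
    have mV: "V - ?T \<in> sets lborel" using mT V(1) by (simp add: borel_open sets.Diff)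
    have "emeasure lborel V = emeasure lborel ?T + emeasure lborel (V - ?T)"
      using mT mV V(2) by (subst plus_emeasure) (auto simp: Un_absorb1)
    also have "\<dots> \<le> emeasure lborel ?T + ennreal (\<epsilon> / ?C)"
      using V(3) mV by (intro add_left_mono) simp
    finally have "ennreal ?C * emeasure lborel V \<le> ennreal ?C * (emeasure lborel ?T + ennreal (\<epsilon> / ?C))"
      by (rule mult_left_mono) simp
    also have "\<dots> = ennreal ?C * emeasure lborel ?T + ennreal \<epsilon>"
    proof -
      have "?C * (\<epsilon> / ?C) = \<epsilon>" using layer_const_pos[OF L, of "DIM('a)"] s by simp
      then show ?thesis using C eps by (simp only: distrib_left ennreal_mult'[symmetric] less_imp_le)
    qed
    finally show "hausdorff_outer (DIM('a) - 1) A \<le> ennreal ?C * emeasure lborel ?T + ennreal \<epsilon>"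
      using open_bound[OF V(1,2)] by (rule order_trans[rotated])
  qed
qed

definition foot :: "'a::euclidean_space \<Rightarrow> ('a \<Rightarrow> real) \<Rightarrow> 'a \<Rightarrow> 'a" where
  "foot e h x = x + (h x - x \<bullet> e) *\<^sub>R e"

definition layer :: "'a::euclidean_space \<Rightarrow> ('a \<Rightarrow> real) \<Rightarrow> real \<Rightarrow> 'a set \<Rightarrow> 'a set" where
  "layer e h s A = {x. 0 \<le> h x - x \<bullet> e \<and> h x - x \<bullet> e \<le> s \<and> foot e h x \<in> A}"

lemma measurable_foot: "continuous_on UNIV h \<Longrightarrow> foot e h \<in> borel_measurable borel"
  unfolding foot_def[abs_def] by (intro borel_measurable_continuous_onI continuous_intros)

lemma sets_layer: 
  assumes h: "continuous_on UNIV h" and A: "A \<in> sets borel" shows "layer e h s A \<in> sets borel"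
proof -
  note [measurable] = measurable_foot[OF h, of e] A borel_measurable_continuous_onI[OF h]
  show ?thesis unfolding layer_def by measurable
qed

text \<open>Over a piece of the boundary which is a Lipschitz graph, surface measure is dominated by the
  volume of the layer of thickness \<open>s\<close> below it, divided by \<open>s\<close>.\<close>

lemma hausdorff_outer_le_layer:
  fixes \<Gamma> A :: "'a::euclidean_space set"
  assumes n: "DIM('a) \<ge> 2" and e: "norm e = 1" and L: "L \<ge> 0" and G: "compact \<Gamma>" and s: "s > 0"
    and h: "continuous_on UNIV h" "\<And>x t. h (x + t *\<^sub>R e) = h x" "\<And>x. x \<in> \<Gamma> \<Longrightarrow> x \<bullet> e = h x"
    and lip: "\<And>x y. x \<in> \<Gamma> \<Longrightarrow> y \<in> \<Gamma> \<Longrightarrow> \<bar>(x - y) \<bullet> e\<bar> \<le> L * norm (perp e (x - y))"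
    and A: "A \<in> sets borel" "A \<subseteq> \<Gamma>"
  shows "hausdorff_outer (DIM('a) - 1) A \<le> ennreal (layer_const DIM('a) L / s) * emeasure lborel (layer e h s A)"
proof -
  let ?n = "DIM('a) - 1" and ?C = "ennreal (layer_const DIM('a) L / s)"
  have n1: "?n \<ge> 1" using n by simp
  have comp: "hausdorff_outer ?n K \<le> ?C * emeasure lborel (down e s K)" if "compact K" "K \<subseteq> \<Gamma>" for K
    by (rule hausdorff_outer_le_down[OF n e L that(1) s lip]) (use that in blast)+
  have down_layer: "down e s K \<subseteq> layer e h s B" if "K \<subseteq> B" "B \<subseteq> \<Gamma>" for K B
  proof
    fix y assume "y \<in> down e s K"
    then obtain x t where y: "x \<in> K" "0 \<le> t" "t \<le> s" "y = x - t *\<^sub>R e" unfolding down_def by auto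
    have hx: "x \<bullet> e = h x" using h(3) y(1) that by blast
    have hy: "h y = h x" using h(2)[of x "- t"] by (simp add: y(4))
    have ye: "h y - y \<bullet> e = t" using hx hy e by (simp add: y(4) inner_diff_left norm_eq_1)
    have "foot e h y = x" unfolding foot_def ye by (simp add: y(4))
    then show "y \<in> layer e h s B" unfolding layer_def using ye y that by auto
  qed
  define M where "M = density (hausdorff_measure ?n) (indicator \<Gamma> :: 'a \<Rightarrow> ennreal)"
  have sM: "sets M = sets borel" by (simp add: M_def)
  have GB: "\<Gamma> \<in> sets borel" using G by (rule borel_compact)
  have eM: "emeasure M B = hausdorff_outer ?n (\<Gamma> \<inter> B)" if "B \<in> sets borel" for B
    unfolding M_def using that GB n1
    by (subst emeasure_density) (auto simp: nn_integral_indicator emeasure_hausdorff_measure indicator_inter_arith[symmetric] simp del: indicator_inter_arith intro!: borel_measurable_indicator)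
  have "emeasure M (space M) = hausdorff_outer ?n \<Gamma>" using eM[of UNIV] by (simp add: M_def)
  also have "\<dots> < \<infinity>" 
    using comp[OF G order_refl] emeasure_compact_finite[OF compact_down[OF G]]
    by (metis ennreal_mult_less_top ennreal_less_top infinity_ennreal_def order_le_less_trans)
  finally have fin: "emeasure M (space M) \<noteq> \<infinity>" by simp
  have "hausdorff_outer ?n A = emeasure M A" using eM[OF A(1)] A(2) by (simp add: Int_absorb1)
  also have "\<dots> = (SUP K \<in> {K. K \<subseteq> A \<and> compact K}. emeasure M K)" by (rule inner_regular[OF sM fin A(1)])
  also have "\<dots> \<le> ?C * emeasure lborel (layer e h s A)"
  proof (rule SUP_least)
    fix K assume "K \<in> {K. K \<subseteq> A \<and> compact K}"
    then have K: "K \<subseteq> A" "compact K" by auto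
    have "emeasure M K = hausdorff_outer ?n K" using eM[OF borel_compact[OF K(2)]] K(1) A(2) by (simp add: Int_absorb1)
    also have "\<dots> \<le> ?C * emeasure lborel (down e s K)" using K A(2) by (intro comp) auto
    also have "\<dots> \<le> ?C * emeasure lborel (layer e h s A)"
      using down_layer[OF K(1) A(2)] sets_layer[OF h(1) A(1)] by (intro mult_left_mono emeasure_mono) auto
    finally show "emeasure M K \<le> ?C * emeasure lborel (layer e h s A)" .
  qed
  finally show ?thesis .
qed

lemma boundary_layer_chart:
  fixes \<Omega> :: "'a::euclidean_space set"
  assumes n: "DIM('a) \<ge> 2" and ch: "C1_chart \<Omega> U e h" and O: "open \<Omega>" and p: "p \<in> U" 
  obtains \<rho> C where "\<rho> > 0" "C > 0" "cball p (2 * \<rho>) \<subseteq> U" 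
    "\<And>A s. A \<in> sets borel \<Longrightarrow> A \<subseteq> frontier \<Omega> \<inter> cball p \<rho> \<Longrightarrow> 0 < s \<Longrightarrow> 
       hausdorff_outer (DIM('a) - 1) A \<le> ennreal (C / s) * emeasure lborel (layer e h s A)"
proof -
  obtain r where r: "r > 0" "cball p r \<subseteq> U" using C1_chartD(1)[OF ch] p by (metis open_contains_cball)
  define \<rho> where "\<rho> = r / 2"
  have rho: "\<rho> > 0" "cball p (2 * \<rho>) \<subseteq> U" using r by (auto simp: \<rho>_def)
  obtain L where L: "L \<ge> 0" "\<And>x y. x \<in> cball p (3 * \<rho>) \<Longrightarrow> y \<in> cball p (3 * \<rho>) \<Longrightarrow> \<bar>h x - h y\<bar> \<le> L * norm (x - y)"
    using Ck1_Lipschitz_cball[OF C1_chartD(3)[OF ch]] by blast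
  let ?G = "frontier \<Omega> \<inter> cball p \<rho>"
  have G: "compact ?G" using closed_Int_compact[OF frontier_closed compact_cball] .
  have GU: "x \<bullet> e = h x" if "x \<in> ?G" for x
  proof -
    have "x \<in> cball p (2 * \<rho>)" using that rho(1) by simp
    then have "x \<in> U" using rho(2) by (rule subsetD[rotated])
    then show ?thesis using chart_frontier[OF ch O, of x] that by simp
  qed
  have lip: "\<bar>(x - y) \<bullet> e\<bar> \<le> L * norm (perp e (x - y))" if "x \<in> ?G" "y \<in> ?G" for x y
  proof -
    define y' where "y' = y + ((x - y) \<bullet> e) *\<^sub>R e"
    have xy': "x - y' = perp e (x - y)" by (simp add: y'_def perp_def)
    have "dist p y' \<le> dist p y + \<bar>(x - y) \<bullet> e\<bar>"
      using dist_triangle[of p y' y] C1_chartD(2)[OF ch] by (simp add: y'_def dist_norm)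
    also have "\<bar>(x - y) \<bullet> e\<bar> \<le> norm (x - y)" using Cauchy_Schwarz_ineq2[of "x - y" e] C1_chartD(2)[OF ch] by simp
    also have "norm (x - y) \<le> dist p x + dist p y" using dist_triangle3[of x y p] by (simp add: dist_norm)
    finally have "y' \<in> cball p (3 * \<rho>)" using that by simp
    moreover have "x \<in> cball p (3 * \<rho>)" using that rho by simp
    ultimately have "\<bar>h x - h y'\<bar> \<le> L * norm (perp e (x - y))" using L(2)[of x y'] xy' by simp
    moreover have "h y' = h y" unfolding y'_def by (rule C1_chartD(4)[OF ch])
    ultimately show ?thesis using GU[OF that(1)] GU[OF that(2)] by (simp add: inner_diff_left)
  qed
  show thesis
  proof (rule that[OF rho(1) layer_const_pos[OF L(1), of "DIM('a)"] rho(2)])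
    fix A s assume "A \<in> sets borel" "A \<subseteq> ?G" "0 < (s::real)"
    then show "hausdorff_outer (DIM('a) - 1) A \<le> ennreal (layer_const DIM('a) L / s) * emeasure lborel (layer e h s A)"
      by (intro hausdorff_outer_le_layer[OF n C1_chartD(2)[OF ch] L(1) G _ Ck1_facts(2)[OF C1_chartD(3)[OF ch]] C1_chartD(4)[OF ch] GU lip])
  qed
qed

lemma layer_subset_cball:
  assumes e: "norm e = 1" and A: "A \<subseteq> cball p \<rho>" shows "layer e h s A \<subseteq> cball p (\<rho> + s)"
proof
  fix x assume "x \<in> layer e h s A"
  then have x: "0 \<le> h x - x \<bullet> e" "h x - x \<bullet> e \<le> s" "foot e h x \<in> cball p \<rho>" using A by (auto simp: layer_def)
  have "dist p x \<le> dist p (foot e h x) + dist (foot e h x) x" by (rule dist_triangle)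
  moreover have "dist (foot e h x) x = h x - x \<bullet> e" using x(1) e by (simp add: foot_def dist_norm)
  ultimately show "x \<in> cball p (\<rho> + s)" using x by simp
qed

lemma layer_subset_domain:
  assumes ch: "C1_chart \<Omega> U e h" and O: "open \<Omega>" and sub: "cball p (2 * \<rho>) \<subseteq> U" and s: "s \<le> \<rho>"
    and x: "x \<in> layer e h s (frontier \<Omega> \<inter> cball p \<rho>)" "x \<bullet> e < h x"
  shows "x \<in> \<Omega>"
proof -
  have "x \<in> cball p (\<rho> + s)" using layer_subset_cball[OF C1_chartD(2)[OF ch], of "frontier \<Omega> \<inter> cball p \<rho>" p \<rho> h s] x(1) by auto
  then have "x \<in> U" using sub s by auto
  then show ?thesis using C1_chartD(5)[OF ch] x(2) by simp
qed

lemma boundary_growth: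
  fixes \<Omega> :: "'a::euclidean_space set"
  assumes n: "DIM('a) \<ge> 2" and dom: "bounded_C1_domain \<Omega>" and p: "p \<in> frontier \<Omega>" 
  obtains \<rho> C where "\<rho> > 0" "C > 0"
    "\<And>r. 0 < r \<Longrightarrow> r \<le> \<rho> \<Longrightarrow> hausdorff_outer (DIM('a) - 1) (frontier \<Omega> \<inter> cball p r) \<le> ennreal (C * r ^ (DIM('a) - 1))"
proof -
  let ?d = "DIM('a)"
  obtain U e h where ch: "C1_chart \<Omega> U e h" and pU: "p \<in> U" using bounded_C1_domainD(4)[OF dom p] by blast
  obtain \<rho> C where rho: "\<rho> > 0" "C > 0" "cball p (2 * \<rho>) \<subseteq> U" 
    and bd: "\<And>A s. A \<in> sets borel \<Longrightarrow> A \<subseteq> frontier \<Omega> \<inter> cball p \<rho> \<Longrightarrow> 0 < s \<Longrightarrow> 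
       hausdorff_outer (?d - 1) A \<le> ennreal (C / s) * emeasure lborel (layer e h s A)"
    using boundary_layer_chart[OF n ch bounded_C1_domainD(2)[OF dom] pU] by metis
  show thesis
  proof (rule that[of \<rho> "C * (unit_ball_vol (real ?d) * 2 ^ ?d)"])
    fix r assume r: "0 < r" "r \<le> \<rho>"
    let ?A = "frontier \<Omega> \<inter> cball p r"
    have A: "?A \<in> sets borel" by (intro borel_closed closed_Int frontier_closed closed_cball)
    have "hausdorff_outer (?d - 1) ?A \<le> ennreal (C / r) * emeasure lborel (layer e h r ?A)"
      using r by (intro bd[OF A]) auto
    also have "\<dots> \<le> ennreal (C / r) * emeasure lborel (cball p (2 * r))"
    proof (intro mult_left_mono emeasure_mono)
      show "layer e h r ?A \<subseteq> cball p (2 * r)"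
        using layer_subset_cball[OF C1_chartD(2)[OF ch] Int_lower2] by (simp only: mult_2)
    qed simp_all
    also have "\<dots> = ennreal (C / r * (unit_ball_vol (real ?d) * (2 * r) ^ ?d))"
    proof -
      have "emeasure lborel (cball p (2 * r)) = ennreal (unit_ball_vol (real ?d) * (2 * r) ^ ?d)"
        by (rule emeasure_cball) (use r in simp)
      moreover have "0 \<le> C / r" using rho r by simp
      ultimately show ?thesis by (simp only: ennreal_mult')
    qed
    also have "C / r * (unit_ball_vol (real ?d) * (2 * r) ^ ?d) = C * (unit_ball_vol (real ?d) * 2 ^ ?d) * r ^ (?d - 1)"
    proof -
      have "r ^ ?d = r * r ^ (?d - 1)" by (metis Suc_diff_1 DIM_positive power_Suc)
      then show ?thesis using r by (simp add: power_mult_distrib)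
    qed
    finally show "hausdorff_outer (?d - 1) ?A \<le> ennreal (C * (unit_ball_vol (real ?d) * 2 ^ ?d) * r ^ (?d - 1))" .
  qed (use rho in auto)
qed

lemma space_surface_measure [simp]: "space (surface_measure \<Omega>) = frontier \<Omega>"
  by (simp add: surface_measure_def space_restrict_space)

lemma sets_surface_measure: "sets (surface_measure \<Omega>) = sets (restrict_space borel (frontier \<Omega>))"
  unfolding surface_measure_def by (rule sets_restrict_space_cong) simp

lemma emeasure_surface_measure:
  fixes \<Omega> A :: "'a::euclidean_space set"
  assumes n: "DIM('a) \<ge> 2" and A: "A \<in> sets borel" "A \<subseteq> frontier \<Omega>"
  shows "emeasure (surface_measure \<Omega>) A = hausdorff_outer (DIM('a) - 1) A"
proof -
  have "emeasure (surface_measure \<Omega>) A = emeasure (hausdorff_measure (DIM('a) - 1)) A"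
    unfolding surface_measure_def using A(2) by (intro emeasure_restrict_space) (auto simp: borel_closed frontier_closed)
  also have "\<dots> = hausdorff_outer (DIM('a) - 1) A" using n A(1) by (intro emeasure_hausdorff_measure) auto
  finally show ?thesis .
qed

lemma finite_surface_measure:
  fixes \<Omega> :: "'a::euclidean_space set"
  assumes n: "DIM('a) \<ge> 2" and dom: "bounded_C1_domain \<Omega>"
  shows "finite_measure (surface_measure \<Omega>)"
proof
  let ?n = "DIM('a) - 1"
  have n1: "?n \<ge> 1" using n by simp
  have cF: "compact (frontier \<Omega>)" using bounded_C1_domainD(3)[OF dom] by (rule compact_frontier_bounded)
  have "\<exists>r>0. hausdorff_outer ?n (frontier \<Omega> \<inter> cball p r) < top" if pf: "p \<in> frontier \<Omega>" for p
  proof -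
    obtain \<rho> C where "\<rho> > 0" "C > 0" 
      "\<And>r. 0 < r \<Longrightarrow> r \<le> \<rho> \<Longrightarrow> hausdorff_outer ?n (frontier \<Omega> \<inter> cball p r) \<le> ennreal (C * r ^ ?n)"
      using boundary_growth[OF n dom pf] by metis
    then show ?thesis by (metis ennreal_less_top order_le_less_trans order_refl)
  qed
  then obtain r where r: "\<And>p. p \<in> frontier \<Omega> \<Longrightarrow> r p > 0" 
    "\<And>p. p \<in> frontier \<Omega> \<Longrightarrow> hausdorff_outer ?n (frontier \<Omega> \<inter> cball p (r p)) < top" by metis
  have "frontier \<Omega> \<subseteq> (\<Union>p\<in>frontier \<Omega>. ball p (r p))" using r(1) by (intro subsetI UN_I) auto
  then obtain T where T: "T \<subseteq> frontier \<Omega>" "finite T" "frontier \<Omega> \<subseteq> (\<Union>p\<in>T. ball p (r p))"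
    by (rule compactE_image[OF cF open_ball])
  have fin: "hausdorff_outer ?n (\<Union>p\<in>S. frontier \<Omega> \<inter> cball p (r p)) < top" if "S \<subseteq> T" for S
    using finite_subset[OF that T(2)] that
  proof (induction S rule: finite_induct)
    case empty
    show ?case unfolding image_empty Union_empty hausdorff_outer_empty[OF n1] by simp
  next
    case (insert p S)
    have "hausdorff_outer ?n (\<Union>q\<in>insert p S. frontier \<Omega> \<inter> cball q (r q)) \<le>
       hausdorff_outer ?n (frontier \<Omega> \<inter> cball p (r p)) + hausdorff_outer ?n (\<Union>q\<in>S. frontier \<Omega> \<inter> cball q (r q))"
      using hausdorff_outer_Un[OF n1] by simp
    also have "\<dots> < top" using insert r(2)[of p] T(1) by (simp add: subset_iff)
    finally show ?case .
  qed
  have "emeasure (surface_measure \<Omega>) (frontier \<Omega>) = hausdorff_outer ?n (frontier \<Omega>)"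
    by (rule emeasure_surface_measure[OF n]) (auto simp: borel_closed frontier_closed)
  also have "\<dots> \<le> hausdorff_outer ?n (\<Union>p\<in>T. frontier \<Omega> \<inter> cball p (r p))"
    using T(3) ball_subset_cball by (intro hausdorff_outer_mono) blast
  also have "\<dots> < top" by (rule fin) simp
  finally show "emeasure (surface_measure \<Omega>) (space (surface_measure \<Omega>)) \<noteq> \<infinity>" by simp
qed

(*T8*)
lemma nn_integral_mono_scaled_measure:
  assumes s: "sets M = sets N" and le: "\<And>A. A \<in> sets M \<Longrightarrow> emeasure M A \<le> K * emeasure N A"
    and f: "f \<in> borel_measurable M"
  shows "(\<integral>\<^sup>+x. f x \<partial>M) \<le> K * (\<integral>\<^sup>+x. f x \<partial>N)"
  using f
proof (induction rule: borel_measurable_induct)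
  case (cong f g)
  have "(\<integral>\<^sup>+x. f x \<partial>M) = (\<integral>\<^sup>+x. g x \<partial>M)" "(\<integral>\<^sup>+x. f x \<partial>N) = (\<integral>\<^sup>+x. g x \<partial>N)"
    using cong(3) sets_eq_imp_space_eq[OF s] by (auto intro!: nn_integral_cong)
  with cong(4) show ?case by simp
next
  case (set A) then show ?case using le s by simp
next
  case (mult u c)
  have u: "u \<in> borel_measurable N" using mult measurable_cong_sets[OF s refl] by blast
  have "c * (\<integral>\<^sup>+x. u x \<partial>M) \<le> c * (K * (\<integral>\<^sup>+x. u x \<partial>N))" using mult by (intro mult_left_mono) auto
  also have "\<dots> = K * (c * (\<integral>\<^sup>+x. u x \<partial>N))" by (rule mult.left_commute)
  finally show ?case using mult(2) u by (simp only: nn_integral_cmult)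
next
  case (add u v)
  have mM: "u \<in> borel_measurable M" "v \<in> borel_measurable M"
    and IH: "(\<integral>\<^sup>+x. u x \<partial>M) \<le> K * (\<integral>\<^sup>+x. u x \<partial>N)" "(\<integral>\<^sup>+x. v x \<partial>M) \<le> K * (\<integral>\<^sup>+x. v x \<partial>N)"
    using add by blast+
  have mN: "u \<in> borel_measurable N" "v \<in> borel_measurable N" using mM measurable_cong_sets[OF s refl] by blast+
  show ?case unfolding nn_integral_add[OF mM(2,1)] nn_integral_add[OF mN(2,1)] distrib_left
    by (rule add_mono[OF IH(2,1)])
next
  case (seq U)
  have m: "U i \<in> borel_measurable N" for i using seq(1) measurable_cong_sets[OF s refl] by blast
  have "(\<integral>\<^sup>+x. (SUP i. U i) x \<partial>M) = (SUP i. \<integral>\<^sup>+x. U i x \<partial>M)"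
    using nn_integral_monotone_convergence_SUP[OF seq(3)] seq(1) by (simp add: SUP_apply image_comp)
  also have "\<dots> \<le> (SUP i. K * (\<integral>\<^sup>+x. U i x \<partial>N))" by (rule SUP_mono') (use seq in blast)
  also have "\<dots> = K * (SUP i. \<integral>\<^sup>+x. U i x \<partial>N)" by (rule SUP_mult_left_ennreal[symmetric])
  also have "(SUP i. \<integral>\<^sup>+x. U i x \<partial>N) = (\<integral>\<^sup>+x. (SUP i. U i) x \<partial>N)"
    using nn_integral_monotone_convergence_SUP[OF seq(3)] m by (simp add: SUP_apply image_comp)
  finally show ?case .
qed

lemma graph_null:
  assumes ch: "C1_chart \<Omega> U e h" shows "{y. y \<bullet> e = h y} \<in> null_sets lborel"
proof -
  let ?G = "{y. y \<bullet> e = h y}" and ?P = "{x. e \<bullet> x = 0}"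
  have cl: "closed ?G" using Ck1_facts(2)[OF C1_chartD(3)[OF ch]] by (intro closed_Collect_eq continuous_intros)
  have "negligible ?P" by (rule negligible_hyperplane) (use chart_inner_e[OF ch] in auto)
  moreover have "(\<lambda>x. x + h x *\<^sub>R e) differentiable_on ?P"
    unfolding differentiable_on_def using Ck1_facts(1)[OF C1_chartD(3)[OF ch]]
    by (intro ballI differentiable_add differentiable_ident differentiable_scaleR differentiable_const)
      (blast intro: differentiable_at_withinI)
  ultimately have "negligible ((\<lambda>x. x + h x *\<^sub>R e) ` ?P)"
    by (intro negligible_differentiable_image_negligible) auto
  moreover have "?G \<subseteq> (\<lambda>x. x + h x *\<^sub>R e) ` ?P"
  proof
    fix y assume y: "y \<in> ?G"
    have hy: "h (y + (- (y \<bullet> e)) *\<^sub>R e) = h y" by (rule C1_chartD(4)[OF ch])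
    have "y = (y + (- (y \<bullet> e)) *\<^sub>R e) + h (y + (- (y \<bullet> e)) *\<^sub>R e) *\<^sub>R e" unfolding hy using y by simp
    moreover have "y + (- (y \<bullet> e)) *\<^sub>R e \<in> ?P"
      using chart_inner_e[OF ch] by (simp add: inner_diff_right inner_commute)
    ultimately show "y \<in> (\<lambda>x. x + h x *\<^sub>R e) ` ?P" by blast
  qed
  ultimately have "negligible ?G" by (rule negligible_subset)
  then show ?thesis using cl by (simp add: negligible_iff_null_sets null_sets_completion_iff borel_closed)
qed

lemma square_integral_le:
  fixes g :: "real \<Rightarrow> real"
  assumes g: "continuous_on {0..t} g" and t: "0 \<le> t"
  shows "(integral {0..t} g)\<^sup>2 \<le> t * integral {0..t} (\<lambda>u. (g u)\<^sup>2)"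
proof (cases "t = 0")
  case False
  then have t: "t > 0" using t by simp
  let ?I = "integral {0..t} g"
  define c where "c = ?I / t"
  have i: "g integrable_on {0..t}" "(\<lambda>u. (g u)\<^sup>2) integrable_on {0..t}"
    using g by (auto intro!: integrable_continuous_interval continuous_intros)
  have "0 \<le> integral {0..t} (\<lambda>u. (g u - c)\<^sup>2)"
    using g by (intro integral_nonneg integrable_continuous_interval continuous_intros) auto
  also have "(\<lambda>u. (g u - c)\<^sup>2) = (\<lambda>u. (g u)\<^sup>2 - (2 * c) * g u + c\<^sup>2)" by (auto simp: power2_eq_square algebra_simps)
  also have "integral {0..t} \<dots> = integral {0..t} (\<lambda>u. (g u)\<^sup>2) - (2 * c) * ?I + t * c\<^sup>2"
  proof -
    have 1: "(\<lambda>u. (2 * c) * g u) integrable_on {0..t}" using i(1) by (rule integrable_on_mult_right)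
    show ?thesis
      by (subst integral_add[OF integrable_diff[OF i(2) 1] integrable_const_ivl]) (simp_all add: integral_diff[OF i(2) 1] t less_imp_le)
  qed
  finally have "0 \<le> t * (integral {0..t} (\<lambda>u. (g u)\<^sup>2) - (2 * c) * ?I + t * c\<^sup>2)" using t by simp
  also have "\<dots> = t * integral {0..t} (\<lambda>u. (g u)\<^sup>2) - ?I\<^sup>2"
    using t by (simp add: c_def power2_eq_square algebra_simps)
  finally show ?thesis by simp
qed simp

lemma norm_grad_sq: "(norm (grad f x))\<^sup>2 = (\<Sum>b\<in>Basis. (pd b f x)\<^sup>2)"
proof -
  have "grad f x \<bullet> b = pd b f x" if "b \<in> Basis" for b using that by (simp add: grad_def)
  then show ?thesis unfolding power2_norm_eq_inner
    by (subst euclidean_inner) (simp add: power2_eq_square)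
qed

lemma smooth_directional: "smooth f \<Longrightarrow> frechet_derivative f (at x) v = v \<bullet> grad f x"
  by (simp add: pd_inner grad_def inner_sum_right mult.commute)

lemma continuous_grad: "smooth f \<Longrightarrow> continuous_on A (grad f)"
  unfolding grad_def[abs_def] by (intro continuous_on_sum continuous_on_scaleR smooth_continuous smooth_pd continuous_on_const)

lemma foot_difference_bound:
  fixes f :: "'a::euclidean_space \<Rightarrow> real"
  assumes f: "smooth f" and e: "norm e = 1" and V: "V = layer e h s A" and h: "\<And>x t. h (x + t *\<^sub>R e) = h x"
    and x: "x \<in> V"
  shows "ennreal ((f (foot e h x) - f x)\<^sup>2) \<le>
     ennreal s * (\<integral>\<^sup>+t. indicator {0..s} t * (indicator V (x + t *\<^sub>R e) * ennreal ((norm (grad f (x + t *\<^sub>R e)))\<^sup>2)) \<partial>lborel)"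
proof -
  define \<tau> where "\<tau> = h x - x \<bullet> e"
  have tau: "0 \<le> \<tau>" "\<tau> \<le> s" and fx: "foot e h x = x + \<tau> *\<^sub>R e" using x by (auto simp: V layer_def \<tau>_def foot_def)
  define g where "g t = e \<bullet> grad f (x + t *\<^sub>R e)" for t
  have cg: "continuous_on {0..\<tau>} g" unfolding g_def
    by (intro continuous_intros continuous_on_compose2[OF continuous_grad[OF f, of UNIV]]) auto
  have "(g has_integral (f (x + \<tau> *\<^sub>R e) - f (x + 0 *\<^sub>R e))) {0..\<tau>}"
  proof (rule fundamental_theorem_of_calculus[OF tau(1)])
    fix t show "((\<lambda>t. f (x + t *\<^sub>R e)) has_vector_derivative g t) (at t within {0..\<tau>})"
      using has_derivative_along_line[OF f, of x e t] unfolding smooth_directional[OF f] g_def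
      by (simp add: has_real_derivative_iff_has_vector_derivative has_vector_derivative_at_within)
  qed
  then have I: "integral {0..\<tau>} g = f (foot e h x) - f x" using fx by (simp add: integral_unique)
  have gb: "(g t)\<^sup>2 \<le> (norm (grad f (x + t *\<^sub>R e)))\<^sup>2" for t
  proof -
    have "\<bar>g t\<bar> \<le> norm (grad f (x + t *\<^sub>R e))" unfolding g_def using Cauchy_Schwarz_ineq2[of e] e by simp
    then show ?thesis by (metis abs_le_square_iff abs_norm_cancel)
  qed
  have inV: "x + t *\<^sub>R e \<in> V" if "t \<in> {0..\<tau>}" for t
  proof -
    have 1: "h (x + t *\<^sub>R e) - (x + t *\<^sub>R e) \<bullet> e = \<tau> - t"
      using e by (simp add: h \<tau>_def inner_add_left norm_eq_1)
    have "foot e h (x + t *\<^sub>R e) = foot e h x" unfolding foot_def[of e h "x + t *\<^sub>R e"] 1 fx by (simp add: algebra_simps)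
    then show ?thesis using x that tau 1 by (auto simp: V layer_def)
  qed
  have hi: "((\<lambda>u. (g u)\<^sup>2) has_integral integral {0..\<tau>} (\<lambda>u. (g u)\<^sup>2)) {0..\<tau>}"
    using cg by (intro integrable_integral integrable_continuous_interval continuous_intros)
  have nn: "ennreal (integral {0..\<tau>} (\<lambda>u. (g u)\<^sup>2)) = (\<integral>\<^sup>+t. indicator {0..\<tau>} t * ennreal ((g t)\<^sup>2) \<partial>lborel)"
  proof -
    have m: "(\<lambda>t. indicator {0..\<tau>} t * (g t)\<^sup>2) \<in> borel_measurable borel"
    proof -
      have "continuous_on UNIV g" unfolding g_def
        by (intro continuous_intros continuous_on_compose2[OF continuous_grad[OF f, of UNIV]]) auto
      then show ?thesis by (intro borel_measurable_times borel_measurable_indicator borel_measurable_power borel_measurable_continuous_onI) auto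
    qed
    have "((\<lambda>t. indicator {0..\<tau>} t * (g t)\<^sup>2) has_integral integral {0..\<tau>} (\<lambda>u. (g u)\<^sup>2)) UNIV"
      using hi unfolding has_integral_restrict_UNIV[of "{0..\<tau>}", symmetric]
      by (rule has_integral_eq[rotated]) (auto simp: indicator_def)
    then have "(\<integral>\<^sup>+t. ennreal (indicator {0..\<tau>} t * (g t)\<^sup>2) \<partial>lborel) = ennreal (integral {0..\<tau>} (\<lambda>u. (g u)\<^sup>2))"
      using nn_integral_has_integral_lborel[OF m] by simp
    also have "(\<lambda>t. ennreal (indicator {0..\<tau>} t * (g t)\<^sup>2)) = (\<lambda>t. indicator {0..\<tau>} t * ennreal ((g t)\<^sup>2))"
      by (auto simp: indicator_def fun_eq_iff)
    finally show ?thesis by simp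
  qed
  have I0: "0 \<le> integral {0..\<tau>} (\<lambda>u. (g u)\<^sup>2)" using hi by (rule has_integral_nonneg) simp
  have "(f (foot e h x) - f x)\<^sup>2 \<le> \<tau> * integral {0..\<tau>} (\<lambda>u. (g u)\<^sup>2)"
    using square_integral_le[OF cg tau(1)] unfolding I .
  also have "\<dots> \<le> s * integral {0..\<tau>} (\<lambda>u. (g u)\<^sup>2)" using tau(2) I0 by (rule mult_right_mono)
  finally have "ennreal ((f (foot e h x) - f x)\<^sup>2) \<le> ennreal (s * integral {0..\<tau>} (\<lambda>u. (g u)\<^sup>2))" by (rule ennreal_leI)
  also have "\<dots> = ennreal s * (\<integral>\<^sup>+t. indicator {0..\<tau>} t * ennreal ((g t)\<^sup>2) \<partial>lborel)"
    using tau by (subst ennreal_mult') (simp_all add: nn)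
  also have "\<dots> \<le> ennreal s * (\<integral>\<^sup>+t. indicator {0..s} t * (indicator V (x + t *\<^sub>R e) * ennreal ((norm (grad f (x + t *\<^sub>R e)))\<^sup>2)) \<partial>lborel)"
    using inV gb tau by (intro mult_left_mono nn_integral_mono) (auto simp: indicator_def intro!: ennreal_leI)
  finally show ?thesis .
qed

lemma nn_integral_translate:
  fixes G :: "'a::euclidean_space \<Rightarrow> ennreal"
  assumes "G \<in> borel_measurable borel"
  shows "(\<integral>\<^sup>+x. G (x + c) \<partial>lborel) = (\<integral>\<^sup>+x. G x \<partial>lborel)"
proof -
  have "(\<integral>\<^sup>+x. G x \<partial>distr lborel borel ((+) c)) = (\<integral>\<^sup>+x. G ((+) c x) \<partial>lborel)"
    using assms by (intro nn_integral_distr) auto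
  then show ?thesis by (simp add: lborel_distr_plus add.commute)
qed

lemma local_trace_inequality:
  fixes \<Omega> :: "'a::euclidean_space set"
  assumes n: "DIM('a) \<ge> 2" and dom: "bounded_C1_domain \<Omega>" and p: "p \<in> frontier \<Omega>"
  obtains \<rho> K where "\<rho> > 0" "K \<ge> 0"
    "\<And>f. smooth f \<Longrightarrow> (\<integral>\<^sup>+x. indicator (cball p \<rho>) x * ennreal ((f x)\<^sup>2) \<partial>surface_measure \<Omega>) \<le>
       ennreal K * ((\<integral>\<^sup>+x. ennreal ((f x)\<^sup>2) \<partial>lebesgue_on \<Omega>) + (\<Sum>b\<in>Basis. \<integral>\<^sup>+x. ennreal ((pd b f x)\<^sup>2) \<partial>lebesgue_on \<Omega>))"
proof -
  let ?n = "DIM('a) - 1"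
  note O = bounded_C1_domainD(2)[OF dom]
  have s: "\<Omega> \<inter> space lebesgue \<in> sets lebesgue" using O by (simp add: borel_open sets_completionI_sets)
  have OB: "\<Omega> \<in> sets borel" using O by (rule borel_open)
  obtain U e h where ch: "C1_chart \<Omega> U e h" and pU: "p \<in> U" using bounded_C1_domainD(4)[OF dom p] by blast
  obtain \<rho> C where rho: "\<rho> > 0" "C > 0" "cball p (2 * \<rho>) \<subseteq> U" 
    and bd: "\<And>A s. A \<in> sets borel \<Longrightarrow> A \<subseteq> frontier \<Omega> \<inter> cball p \<rho> \<Longrightarrow> 0 < s \<Longrightarrow> 
       hausdorff_outer ?n A \<le> ennreal (C / s) * emeasure lborel (layer e h s A)"
    using boundary_layer_chart[OF n ch O pU] by metis
  note e = C1_chartD(2)[OF ch]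
  have hc: "continuous_on UNIV h" by (rule Ck1_facts(2)[OF C1_chartD(3)[OF ch]])
  let ?G = "frontier \<Omega> \<inter> cball p \<rho>"
  have GB: "?G \<in> sets borel" by (intro borel_closed closed_Int frontier_closed closed_cball)
  define V where "V = layer e h \<rho> ?G"
  have VB: "V \<in> sets borel" unfolding V_def by (rule sets_layer[OF hc GB])
  have VO: "AE x in lborel. x \<in> V \<longrightarrow> x \<in> \<Omega>"
  proof (rule AE_mp[OF AE_not_in[OF graph_null[OF ch]]], intro AE_I2 impI)
    fix x assume "x \<notin> {y. y \<bullet> e = h y}" "x \<in> V"
    then have "x \<bullet> e < h x" by (auto simp: V_def layer_def)
    then show "x \<in> \<Omega>" using layer_subset_domain[OF ch O rho(3) order_refl] \<open>x \<in> V\<close> unfolding V_def by blast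
  qed
  define K where "K = C / \<rho> * (2 + 2 * \<rho>\<^sup>2)"
  have K0: "K \<ge> 0" using rho by (simp add: K_def)
  show thesis
  proof (rule that[OF rho(1) K0])
    fix f :: "'a \<Rightarrow> real" assume f: "smooth f"
    define F where "F x = ennreal ((f x)\<^sup>2)" for x
    define D where "D x = indicator V x * ennreal ((norm (grad f x))\<^sup>2)" for x
    have fB: "f \<in> borel_measurable borel" by (rule smooth_borel[OF f])
    have gB: "grad f \<in> borel_measurable borel" by (rule borel_measurable_continuous_onI[OF continuous_grad[OF f]])
    have FB[measurable]: "F \<in> borel_measurable borel" using fB unfolding F_def[abs_def] by measurable
    have DB[measurable]: "D \<in> borel_measurable borel" using gB VB unfolding D_def[abs_def] by measurable
    have footB: "foot e h \<in> borel_measurable borel" by (rule measurable_foot[OF hc])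
    define N where "N = distr (density lborel (indicator V)) borel (foot e h)"
    define M where "M = density (hausdorff_measure ?n) (indicator ?G :: 'a \<Rightarrow> ennreal)"
    have n1: "?n \<ge> 1" using n by simp
    have eM: "emeasure M B = hausdorff_outer ?n (?G \<inter> B)" if "B \<in> sets borel" for B
    proof -
      have "emeasure M B = (\<integral>\<^sup>+x. indicator (?G \<inter> B) x \<partial>hausdorff_measure ?n)"
      proof -
        have "emeasure M B = (\<integral>\<^sup>+x. indicator ?G x * indicator B x \<partial>hausdorff_measure ?n)"
          unfolding M_def by (rule emeasure_density) (use that GB in \<open>simp_all add: borel_measurable_indicator\<close>)
        then show ?thesis by (simp only: indicator_inter_arith)
      qed
      also have "\<dots> = emeasure (hausdorff_measure ?n) (?G \<inter> B)" using that GB by (intro nn_integral_indicator) auto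
      also have "\<dots> = hausdorff_outer ?n (?G \<inter> B)" using that GB n1 by (intro emeasure_hausdorff_measure) auto
      finally show ?thesis .
    qed
    have eN: "emeasure N B = emeasure lborel (layer e h \<rho> (?G \<inter> B))" if "B \<in> sets borel" for B
    proof -
      have pre: "foot e h -` B \<in> sets borel" using measurable_sets[OF footB that] by simp
      have "emeasure N B = emeasure (density lborel (indicator V)) (foot e h -` B)"
        unfolding N_def using that footB by (subst emeasure_distr) auto
      also have "\<dots> = (\<integral>\<^sup>+x. indicator (V \<inter> foot e h -` B) x \<partial>lborel)"
      proof -
        have "emeasure (density lborel (indicator V)) (foot e h -` B) = (\<integral>\<^sup>+x. indicator V x * indicator (foot e h -` B) x \<partial>lborel)"
          by (rule emeasure_density) (use pre VB in \<open>simp_all add: borel_measurable_indicator\<close>)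
        then show ?thesis by (simp only: indicator_inter_arith)
      qed
      also have "\<dots> = emeasure lborel (V \<inter> foot e h -` B)" using pre VB by (intro nn_integral_indicator) auto
      also have "V \<inter> foot e h -` B = layer e h \<rho> (?G \<inter> B)" by (auto simp: V_def layer_def)
      finally show ?thesis .
    qed
    have le: "emeasure M B \<le> ennreal (C / \<rho>) * emeasure N B" if "B \<in> sets M" for B
    proof -
      have B: "B \<in> sets borel" using that by (simp add: M_def)
      then show ?thesis unfolding eM[OF B] eN[OF B] using GB rho(1) by (intro bd) auto
    qed
    have "(\<integral>\<^sup>+x. indicator (cball p \<rho>) x * F x \<partial>surface_measure \<Omega>) =
      (\<integral>\<^sup>+x. (indicator (cball p \<rho>) x * F x) * indicator (frontier \<Omega>) x \<partial>hausdorff_measure ?n)"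
      unfolding surface_measure_def by (rule nn_integral_restrict_space) (simp add: borel_closed frontier_closed)
    also have "\<dots> = (\<integral>\<^sup>+x. indicator ?G x * F x \<partial>hausdorff_measure ?n)"
      by (intro nn_integral_cong) (auto simp: indicator_def)
    also have "\<dots> = (\<integral>\<^sup>+x. F x \<partial>M)" unfolding M_def 
      using GB by (subst nn_integral_density) (auto intro!: borel_measurable_indicator)
    also have "\<dots> \<le> ennreal (C / \<rho>) * (\<integral>\<^sup>+x. F x \<partial>N)"
      by (rule nn_integral_mono_scaled_measure[OF _ le]) (auto simp: M_def N_def)
    also have "(\<integral>\<^sup>+x. F x \<partial>N) = (\<integral>\<^sup>+x. indicator V x * F (foot e h x) \<partial>lborel)"
      unfolding N_def using footB VB by (subst nn_integral_distr) (auto simp: nn_integral_density)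
    also have "ennreal (C / \<rho>) * (\<integral>\<^sup>+x. indicator V x * F (foot e h x) \<partial>lborel) \<le> ennreal (C / \<rho>) *
       (\<integral>\<^sup>+x. 2 * (indicator V x * F x) + ennreal (2 * \<rho>) * (\<integral>\<^sup>+t. indicator {0..\<rho>} t * D (x + t *\<^sub>R e) \<partial>lborel) \<partial>lborel)"
    proof (intro mult_left_mono nn_integral_mono)
      fix x
      show "indicator V x * F (foot e h x) \<le> 2 * (indicator V x * F x) + ennreal (2 * \<rho>) * (\<integral>\<^sup>+t. indicator {0..\<rho>} t * D (x + t *\<^sub>R e) \<partial>lborel)"
      proof (cases "x \<in> V")
        case True
        let ?a = "f (foot e h x)"
        have "?a\<^sup>2 \<le> 2 * (f x)\<^sup>2 + 2 * (?a - f x)\<^sup>2"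
          using zero_le_power2[of "?a - 2 * f x"] by (simp add: power2_eq_square algebra_simps)
        then have "ennreal (?a\<^sup>2) \<le> ennreal (2 * (f x)\<^sup>2 + 2 * (?a - f x)\<^sup>2)" by (rule ennreal_leI)
        also have "\<dots> = 2 * F x + 2 * ennreal ((?a - f x)\<^sup>2)" by (simp add: F_def ennreal_mult')
        also have "\<dots> \<le> 2 * F x + 2 * (ennreal \<rho> * (\<integral>\<^sup>+t. indicator {0..\<rho>} t * D (x + t *\<^sub>R e) \<partial>lborel))"
          using foot_difference_bound[OF f e V_def C1_chartD(4)[OF ch] True] unfolding D_def
          by (intro add_left_mono mult_left_mono) auto
        finally show ?thesis using True rho(1) by (simp add: F_def ennreal_mult' mult.assoc)
      qed simp
    qed simp
    also have "(\<integral>\<^sup>+x. 2 * (indicator V x * F x) + ennreal (2 * \<rho>) * (\<integral>\<^sup>+t. indicator {0..\<rho>} t * D (x + t *\<^sub>R e) \<partial>lborel) \<partial>lborel) = 2 * (\<integral>\<^sup>+x. indicator V x * F x \<partial>lborel) + ennreal (2 * \<rho>) * (\<integral>\<^sup>+x. \<integral>\<^sup>+t. indicator {0..\<rho>} t * D (x + t *\<^sub>R e) \<partial>lborel \<partial>lborel)"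
      using VB by (subst nn_integral_add) (auto simp: nn_integral_cmult)
    also have "(\<integral>\<^sup>+x. \<integral>\<^sup>+t. indicator {0..\<rho>} t * D (x + t *\<^sub>R e) \<partial>lborel \<partial>lborel) = 
       (\<integral>\<^sup>+t. \<integral>\<^sup>+x. indicator {0..\<rho>} t * D (x + t *\<^sub>R e) \<partial>lborel \<partial>(lborel::real measure))"
      by (rule lborel_pair.Fubini'[symmetric]) measurable
    also have "\<dots> = (\<integral>\<^sup>+t. indicator {0..\<rho>} t * (\<integral>\<^sup>+x. D x \<partial>lborel) \<partial>(lborel::real measure))"
      using nn_integral_translate[OF DB] by (intro nn_integral_cong, subst nn_integral_cmult) auto
    also have "\<dots> = ennreal \<rho> * (\<integral>\<^sup>+x. D x \<partial>lborel)" using rho(1) by (subst nn_integral_multc) auto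
    finally have main: "(\<integral>\<^sup>+x. indicator (cball p \<rho>) x * F x \<partial>surface_measure \<Omega>) \<le>
       ennreal (C / \<rho>) * (2 * (\<integral>\<^sup>+x. indicator V x * F x \<partial>lborel) + ennreal (2 * \<rho>) * (ennreal \<rho> * (\<integral>\<^sup>+x. D x \<partial>lborel)))" .
    have toO: "(\<integral>\<^sup>+x. indicator V x * g x \<partial>lborel) \<le> (\<integral>\<^sup>+x. g x \<partial>lebesgue_on \<Omega>)" if gm: "g \<in> borel_measurable borel" for g :: "'a \<Rightarrow> ennreal"
    proof -
      have "(\<integral>\<^sup>+x. indicator V x * g x \<partial>lborel) \<le> (\<integral>\<^sup>+x. g x * indicator \<Omega> x \<partial>lborel)"
        by (rule nn_integral_mono_AE) (rule AE_mp[OF VO], auto intro!: AE_I2 simp: indicator_def)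
      also have "\<dots> = (\<integral>\<^sup>+x. g x * indicator \<Omega> x \<partial>lebesgue)" by (rule nn_integral_completion[symmetric])
      also have "\<dots> = (\<integral>\<^sup>+x. g x \<partial>lebesgue_on \<Omega>)" by (rule nn_integral_restrict_space[OF s, symmetric])
      finally show ?thesis .
    qed
    let ?X = "\<integral>\<^sup>+x. F x \<partial>lebesgue_on \<Omega>" and ?Y = "\<Sum>b\<in>Basis. \<integral>\<^sup>+x. ennreal ((pd b f x)\<^sup>2) \<partial>lebesgue_on \<Omega>"
    have 1: "(\<integral>\<^sup>+x. indicator V x * F x \<partial>lborel) \<le> ?X" by (rule toO[OF FB])
    have pm: "(\<lambda>x. ennreal ((pd b f x)\<^sup>2)) \<in> borel_measurable (lebesgue_on \<Omega>)" if "b \<in> Basis" for b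
      using smooth_measurable_lebesgue_on[OF smooth_pd[OF f that], of \<Omega>] by measurable
    have "(\<integral>\<^sup>+x. D x \<partial>lborel) \<le> (\<integral>\<^sup>+x. ennreal ((norm (grad f x))\<^sup>2) \<partial>lebesgue_on \<Omega>)"
      unfolding D_def using gB by (intro toO) measurable
    also have "\<dots> = (\<integral>\<^sup>+x. (\<Sum>b\<in>Basis. ennreal ((pd b f x)\<^sup>2)) \<partial>lebesgue_on \<Omega>)"
      by (intro nn_integral_cong) (simp add: norm_grad_sq)
    also have "\<dots> = ?Y" by (rule nn_integral_sum[OF pm])
    finally have 2: "(\<integral>\<^sup>+x. D x \<partial>lborel) \<le> ?Y" .
    have "ennreal (C / \<rho>) * (2 * (\<integral>\<^sup>+x. indicator V x * F x \<partial>lborel) + ennreal (2 * \<rho>) * (ennreal \<rho> * (\<integral>\<^sup>+x. D x \<partial>lborel)))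
      \<le> ennreal (C / \<rho>) * (ennreal (2 + 2 * \<rho>\<^sup>2) * ?X + ennreal (2 + 2 * \<rho>\<^sup>2) * ?Y)"
    proof (intro mult_left_mono add_mono)
      have "(2::ennreal) = ennreal 2" by simp
      also have "\<dots> \<le> ennreal (2 + 2 * \<rho>\<^sup>2)" by (intro ennreal_leI) simp
      finally show "2 * (\<integral>\<^sup>+x. indicator V x * F x \<partial>lborel) \<le> ennreal (2 + 2 * \<rho>\<^sup>2) * ?X" by (intro mult_mono 1) auto
      have "ennreal (2 * \<rho>) * (ennreal \<rho> * (\<integral>\<^sup>+x. D x \<partial>lborel)) = ennreal (2 * \<rho> * \<rho>) * (\<integral>\<^sup>+x. D x \<partial>lborel)"
        using rho(1) by (simp add: ennreal_mult mult.assoc)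
      also have "\<dots> \<le> ennreal (2 + 2 * \<rho>\<^sup>2) * ?Y"
        using 2 by (intro mult_mono ennreal_leI) (auto simp: power2_eq_square)
      finally show "ennreal (2 * \<rho>) * (ennreal \<rho> * (\<integral>\<^sup>+x. D x \<partial>lborel)) \<le> ennreal (2 + 2 * \<rho>\<^sup>2) * ?Y" .
    qed simp_all
    also have "\<dots> = ennreal K * (?X + ?Y)"
    proof -
      have "ennreal K = ennreal (C / \<rho>) * ennreal (2 + 2 * \<rho>\<^sup>2)" unfolding K_def using rho by (intro ennreal_mult') simp
      then show ?thesis by (simp only: distrib_left mult.assoc)
    qed
    finally show "(\<integral>\<^sup>+x. indicator (cball p \<rho>) x * ennreal ((f x)\<^sup>2) \<partial>surface_measure \<Omega>) \<le>
       ennreal K * ((\<integral>\<^sup>+x. ennreal ((f x)\<^sup>2) \<partial>lebesgue_on \<Omega>) + ?Y)"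
      using main unfolding F_def by (rule order_trans[rotated])
  qed
qed

lemma L2_tendstoD: "L2_tendsto M f g \<Longrightarrow> (\<lambda>n. \<integral>\<^sup>+x. ennreal ((f n x - g x)\<^sup>2) \<partial>M) \<longlonglongrightarrow> 0"
  by (simp add: L2_tendsto_def)

lemma trace_unique_smooth:
  fixes \<Omega> :: "'a::euclidean_space set"
  assumes n: "DIM('a) \<ge> 2" and dom: "bounded_C1_domain \<Omega>" and F: "smooth F"
    and ae: "AE x in lebesgue_on \<Omega>. F x = v x" and t: "is_trace \<Omega> v t"
  shows "AE x in surface_measure \<Omega>. F x = t x"
proof -
  let ?S = "surface_measure \<Omega>"
  note O = bounded_C1_domainD(2)[OF dom]
  have tm: "t \<in> borel_measurable ?S" using t unfolding is_trace_def L2_def by blast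
  obtain \<phi> :: "nat \<Rightarrow> 'a \<Rightarrow> real" where ph: "\<And>n. smooth (\<phi> n)" "L2_tendsto (lebesgue_on \<Omega>) \<phi> v"
    "\<And>b. b \<in> Basis \<Longrightarrow> L2_tendsto (lebesgue_on \<Omega>) (\<lambda>n. pd b (\<phi> n)) (wderiv \<Omega> b v)" "L2_tendsto ?S \<phi> t"
    using t unfolding is_trace_def by blast
  have sm: "f \<in> borel_measurable ?S" if "smooth f" for f :: "'a \<Rightarrow> real"
    unfolding measurable_cong_sets[OF sets_surface_measure refl] by (intro measurable_restrict_space1 smooth_borel that)
  have d0: "(\<lambda>n. \<integral>\<^sup>+x. ennreal ((\<phi> n x - F x)\<^sup>2) \<partial>lebesgue_on \<Omega>) \<longlonglongrightarrow> 0"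
  proof -
    have "(\<integral>\<^sup>+x. ennreal ((\<phi> n x - F x)\<^sup>2) \<partial>lebesgue_on \<Omega>) = (\<integral>\<^sup>+x. ennreal ((\<phi> n x - v x)\<^sup>2) \<partial>lebesgue_on \<Omega>)" for n
      by (rule nn_integral_cong_AE) (rule eventually_mono[OF ae], simp)
    then show ?thesis using L2_tendstoD[OF ph(2)] by simp
  qed
  have d1: "(\<lambda>n. \<integral>\<^sup>+x. ennreal ((pd b (\<lambda>x. \<phi> n x - F x) x)\<^sup>2) \<partial>lebesgue_on \<Omega>) \<longlonglongrightarrow> 0" if b: "b \<in> Basis" for b
  proof -
    have "(\<integral>\<^sup>+x. ennreal ((pd b (\<lambda>x. \<phi> n x - F x) x)\<^sup>2) \<partial>lebesgue_on \<Omega>) = 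
       (\<integral>\<^sup>+x. ennreal ((pd b (\<phi> n) x - wderiv \<Omega> b v x)\<^sup>2) \<partial>lebesgue_on \<Omega>)" for n
      unfolding pd_diff[OF ph(1) F]
      by (rule nn_integral_cong_AE) (rule eventually_mono[OF wderiv_smooth[OF O F b ae]], simp)
    then show ?thesis using L2_tendstoD[OF ph(3)[OF b]] by simp
  qed
  have local: "\<exists>r>0. AE x in ?S. x \<in> cball p r \<longrightarrow> F x = t x" if p: "p \<in> frontier \<Omega>" for p
  proof -
    obtain \<rho> K where rho: "\<rho> > 0" and K: "K \<ge> 0" "\<And>f. smooth f \<Longrightarrow> (\<integral>\<^sup>+x. indicator (cball p \<rho>) x * ennreal ((f x)\<^sup>2) \<partial>?S) \<le>
       ennreal K * ((\<integral>\<^sup>+x. ennreal ((f x)\<^sup>2) \<partial>lebesgue_on \<Omega>) + (\<Sum>b\<in>Basis. \<integral>\<^sup>+x. ennreal ((pd b f x)\<^sup>2) \<partial>lebesgue_on \<Omega>))"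
      by (rule local_trace_inequality[OF n dom p], rule that, assumption+)
    have indm: "(indicator (cball p \<rho>) :: 'a \<Rightarrow> ennreal) \<in> borel_measurable ?S"
      unfolding measurable_cong_sets[OF sets_surface_measure refl]
      by (intro measurable_restrict_space1 borel_measurable_indicator) simp
    let ?R = "\<lambda>n. ennreal K * ((\<integral>\<^sup>+x. ennreal ((\<phi> n x - F x)\<^sup>2) \<partial>lebesgue_on \<Omega>) + 
       (\<Sum>b\<in>Basis. \<integral>\<^sup>+x. ennreal ((pd b (\<lambda>x. \<phi> n x - F x) x)\<^sup>2) \<partial>lebesgue_on \<Omega>))"
    let ?T = "\<lambda>n. \<integral>\<^sup>+x. ennreal ((\<phi> n x - t x)\<^sup>2) \<partial>?S"
    have le: "(\<integral>\<^sup>+x. indicator (cball p \<rho>) x * ennreal ((F x - t x)\<^sup>2) \<partial>?S) \<le> 2 * ?R n + 2 * ?T n" for n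
    proof -
      have m: "(\<lambda>x. indicator (cball p \<rho>) x * ennreal ((\<phi> n x - F x)\<^sup>2)) \<in> borel_measurable ?S"
          "(\<lambda>x. ennreal ((\<phi> n x - t x)\<^sup>2)) \<in> borel_measurable ?S"
        using indm sm[OF ph(1)] sm[OF F] tm by measurable
      have "(\<integral>\<^sup>+x. indicator (cball p \<rho>) x * ennreal ((F x - t x)\<^sup>2) \<partial>?S) \<le>
        (\<integral>\<^sup>+x. 2 * (indicator (cball p \<rho>) x * ennreal ((\<phi> n x - F x)\<^sup>2)) + 2 * ennreal ((\<phi> n x - t x)\<^sup>2) \<partial>?S)"
      proof (rule nn_integral_mono)
        fix x
        have "(F x - t x)\<^sup>2 \<le> 2 * (\<phi> n x - F x)\<^sup>2 + 2 * (\<phi> n x - t x)\<^sup>2"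
          using zero_le_power2[of "(\<phi> n x - F x) + (\<phi> n x - t x)"] by (simp add: power2_eq_square algebra_simps)
        then have "ennreal ((F x - t x)\<^sup>2) \<le> ennreal (2 * (\<phi> n x - F x)\<^sup>2 + 2 * (\<phi> n x - t x)\<^sup>2)" by (rule ennreal_leI)
        then have "ennreal ((F x - t x)\<^sup>2) \<le> 2 * ennreal ((\<phi> n x - F x)\<^sup>2) + 2 * ennreal ((\<phi> n x - t x)\<^sup>2)" by (simp add: ennreal_mult')
        then show "indicator (cball p \<rho>) x * ennreal ((F x - t x)\<^sup>2) \<le> 
           2 * (indicator (cball p \<rho>) x * ennreal ((\<phi> n x - F x)\<^sup>2)) + 2 * ennreal ((\<phi> n x - t x)\<^sup>2)"
          by (cases "x \<in> cball p \<rho>") simp_all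
      qed
      also have "\<dots> = 2 * (\<integral>\<^sup>+x. indicator (cball p \<rho>) x * ennreal ((\<phi> n x - F x)\<^sup>2) \<partial>?S) + 2 * ?T n"
        using m by (simp add: nn_integral_add nn_integral_cmult)
      also have "\<dots> \<le> 2 * ?R n + 2 * ?T n"
        by (intro add_right_mono mult_left_mono K(2)[OF smooth_diff[OF ph(1) F]]) simp
      finally show ?thesis .
    qed
    have "?R \<longlonglongrightarrow> ennreal K * (0 + (\<Sum>b\<in>(Basis::'a set). 0))"
      by (intro tendsto_add d0 tendsto_sum d1 ennreal_tendsto_cmult) (simp_all add: less_top[symmetric])
    then have R0: "?R \<longlonglongrightarrow> 0" by simp
    have "(\<lambda>n. 2 * ?R n + 2 * ?T n) \<longlonglongrightarrow> 2 * 0 + 2 * 0"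
      by (intro tendsto_add ennreal_tendsto_cmult R0 L2_tendstoD[OF ph(4)]) (simp_all add: less_top[symmetric])
    then have "(\<lambda>n. 2 * ?R n + 2 * ?T n) \<longlonglongrightarrow> 0" by simp
    then have "(\<integral>\<^sup>+x. indicator (cball p \<rho>) x * ennreal ((F x - t x)\<^sup>2) \<partial>?S) \<le> 0"
      by (rule tendsto_lowerbound) (auto intro!: always_eventually le)
    then have "(\<integral>\<^sup>+x. indicator (cball p \<rho>) x * ennreal ((F x - t x)\<^sup>2) \<partial>?S) = 0" by simp
    moreover have "(\<lambda>x. indicator (cball p \<rho>) x * ennreal ((F x - t x)\<^sup>2)) \<in> borel_measurable ?S"
      using indm sm[OF F] tm by measurable
    ultimately have "AE x in ?S. indicator (cball p \<rho>) x * ennreal ((F x - t x)\<^sup>2) = 0"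
      by (simp add: nn_integral_0_iff_AE)
    then have "AE x in ?S. x \<in> cball p \<rho> \<longrightarrow> F x = t x"
      by (rule eventually_mono) (auto simp: indicator_def ennreal_eq_0_iff split: if_splits)
    then show ?thesis using rho by blast
  qed
  then obtain r where r: "\<And>p. p \<in> frontier \<Omega> \<Longrightarrow> r p > 0" "\<And>p. p \<in> frontier \<Omega> \<Longrightarrow> AE x in ?S. x \<in> cball p (r p) \<longrightarrow> F x = t x" by metis
  have cF: "compact (frontier \<Omega>)" using bounded_C1_domainD(3)[OF dom] by (rule compact_frontier_bounded)
  have "frontier \<Omega> \<subseteq> (\<Union>p\<in>frontier \<Omega>. ball p (r p))" using r(1) by (intro subsetI UN_I) auto
  then obtain T where T: "T \<subseteq> frontier \<Omega>" "finite T" "frontier \<Omega> \<subseteq> (\<Union>p\<in>T. ball p (r p))"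
    by (rule compactE_image[OF cF open_ball])
  have "AE x in ?S. \<forall>p\<in>T. x \<in> cball p (r p) \<longrightarrow> F x = t x"
    using T(1) r(2) by (intro AE_finite_allI[OF T(2)]) blast
  then show ?thesis
  proof (rule AE_mp, intro AE_I2 impI)
    fix x assume sp: "x \<in> space ?S" and a: "\<forall>p\<in>T. x \<in> cball p (r p) \<longrightarrow> F x = t x"
    have "x \<in> frontier \<Omega>" using sp by simp
    then have "x \<in> (\<Union>p\<in>T. ball p (r p))" by (rule subsetD[OF T(3)])
    then obtain p where "p \<in> T" "x \<in> ball p (r p)" by blast
    then have "x \<in> cball p (r p)" using ball_subset_cball by blast
    then show "F x = t x" using a \<open>p \<in> T\<close> by blast
  qed
qed

(*T9*)
lemma measurable_surface_borel: "f \<in> borel_measurable borel \<Longrightarrow> f \<in> borel_measurable (surface_measure \<Omega>)"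
  unfolding measurable_cong_sets[OF sets_surface_measure refl] by (rule measurable_restrict_space1)

lemma integrable_surface_bounded:
  fixes f :: "'a::euclidean_space \<Rightarrow> real"
  assumes n: "DIM('a) \<ge> 2" and dom: "bounded_C1_domain \<Omega>" and f: "f \<in> borel_measurable (surface_measure \<Omega>)"
    and B: "\<And>x. x \<in> frontier \<Omega> \<Longrightarrow> \<bar>f x\<bar> \<le> B"
  shows "integrable (surface_measure \<Omega>) f"
proof -
  interpret finite_measure "surface_measure \<Omega>" by (rule finite_surface_measure[OF n dom])
  show ?thesis by (rule integrable_const_bound[of _ B]) (use f B in \<open>auto intro!: AE_I2\<close>)
qed

lemma is_trace_smooth:
  fixes \<Omega> :: "'a::euclidean_space set"
  assumes n: "DIM('a) \<ge> 2" and dom: "bounded_C1_domain \<Omega>" and F: "smooth F"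
    and ae: "AE x in lebesgue_on \<Omega>. F x = v x"
  shows "is_trace \<Omega> v F"
  unfolding is_trace_def
proof (intro conjI exI[of _ "\<lambda>_. F"] allI ballI)
  note O = bounded_C1_domainD(2)[OF dom]
  have Fm: "F \<in> borel_measurable (surface_measure \<Omega>)" by (rule measurable_surface_borel[OF smooth_borel[OF F]])
  have cF: "compact (frontier \<Omega>)" using bounded_C1_domainD(3)[OF dom] by (rule compact_frontier_bounded)
  have "bounded ((\<lambda>x. (F x)\<^sup>2) ` frontier \<Omega>)"
    by (intro compact_imp_bounded compact_continuous_image cF continuous_intros smooth_continuous F)
  then obtain B where B: "\<And>x. x \<in> frontier \<Omega> \<Longrightarrow> \<bar>(F x)\<^sup>2\<bar> \<le> B" unfolding bounded_iff real_norm_def by (metis imageI)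
  have "integrable (surface_measure \<Omega>) (\<lambda>x. (F x)\<^sup>2)"
    by (rule integrable_surface_bounded[OF n dom borel_measurable_power[OF Fm] B])
  then show "F \<in> L2 (surface_measure \<Omega>)" unfolding L2_def using Fm by simp
  show "smooth F" by (rule F)
  have "(\<integral>\<^sup>+x. ennreal ((F x - v x)\<^sup>2) \<partial>lebesgue_on \<Omega>) = (\<integral>\<^sup>+x. 0 \<partial>lebesgue_on \<Omega>)"
    by (rule nn_integral_cong_AE) (rule eventually_mono[OF ae], simp)
  then show "L2_tendsto (lebesgue_on \<Omega>) (\<lambda>_. F) v" unfolding L2_tendsto_def by simp
  show "L2_tendsto (surface_measure \<Omega>) (\<lambda>_. F) F" unfolding L2_tendsto_def by simp
  fix b :: 'a assume b: "b \<in> Basis"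
  have "(\<integral>\<^sup>+x. ennreal ((pd b F x - wderiv \<Omega> b v x)\<^sup>2) \<partial>lebesgue_on \<Omega>) = (\<integral>\<^sup>+x. 0 \<partial>lebesgue_on \<Omega>)"
    by (rule nn_integral_cong_AE) (rule eventually_mono[OF wderiv_smooth[OF O F b ae]], simp)
  then show "L2_tendsto (lebesgue_on \<Omega>) (\<lambda>n. pd b F) (wderiv \<Omega> b v)" unfolding L2_tendsto_def by simp
qed

lemma trace_smooth:
  fixes \<Omega> :: "'a::euclidean_space set"
  assumes n: "DIM('a) \<ge> 2" and dom: "bounded_C1_domain \<Omega>" and F: "smooth F"
    and ae: "AE x in lebesgue_on \<Omega>. F x = v x"
  shows "AE x in surface_measure \<Omega>. F x = trace \<Omega> v x" "trace \<Omega> v \<in> borel_measurable (surface_measure \<Omega>)"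
proof -
  have t: "is_trace \<Omega> v (trace \<Omega> v)"
    unfolding trace_def by (rule someI[of "is_trace \<Omega> v"]) (rule is_trace_smooth[OF assms])
  show "AE x in surface_measure \<Omega>. F x = trace \<Omega> v x" by (rule trace_unique_smooth[OF n dom F ae t])
  show "trace \<Omega> v \<in> borel_measurable (surface_measure \<Omega>)" using t unfolding is_trace_def L2_def by blast
qed

lemma measurable_outer_normal:
  assumes dom: "bounded_C1_domain \<Omega>"
  shows "outer_normal \<Omega> \<in> borel_measurable (surface_measure \<Omega>)"
  unfolding measurable_cong_sets[OF sets_surface_measure refl]
  by (rule borel_measurable_continuous_on_restrict[OF continuous_on_outer_normal[OF dom]])

lemma measurable_normal_flux:
  assumes dom: "bounded_C1_domain \<Omega>" and F: "smooth F"
  shows "(\<lambda>x. grad F x \<bullet> outer_normal \<Omega> x) \<in> borel_measurable (surface_measure \<Omega>)"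
  by (intro borel_measurable_inner measurable_outer_normal[OF dom] measurable_surface_borel
     borel_measurable_continuous_onI continuous_grad F)

lemma normal_deriv_smooth:
  fixes \<Omega> :: "'a::euclidean_space set"
  assumes n: "DIM('a) \<ge> 2" and dom: "bounded_C1_domain \<Omega>" and F: "smooth F"
  shows "AE x in surface_measure \<Omega>. grad F x \<bullet> outer_normal \<Omega> x = normal_deriv \<Omega> F x"
    "normal_deriv \<Omega> F \<in> borel_measurable (surface_measure \<Omega>)"
proof -
  note O = bounded_C1_domainD(2)[OF dom]
  have w: "AE x in lebesgue_on \<Omega>. pd b F x = wderiv \<Omega> b F x" if "b \<in> Basis" for b
    by (rule wderiv_smooth[OF O F that]) simp
  have "AE x in surface_measure \<Omega>. \<forall>b\<in>Basis. pd b F x = trace \<Omega> (wderiv \<Omega> b F) x"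
    by (intro AE_finite_allI finite_Basis) (rule trace_smooth(1)[OF n dom smooth_pd[OF F] w])
  then show "AE x in surface_measure \<Omega>. grad F x \<bullet> outer_normal \<Omega> x = normal_deriv \<Omega> F x"
  proof (rule eventually_mono)
    fix x assume "\<forall>b\<in>Basis. pd b F x = trace \<Omega> (wderiv \<Omega> b F) x"
    then show "grad F x \<bullet> outer_normal \<Omega> x = normal_deriv \<Omega> F x"
      unfolding grad_def normal_deriv_def inner_sum_left by (intro sum.cong) (simp_all add: inner_commute)
  qed
  have "trace \<Omega> (wderiv \<Omega> b F) \<in> borel_measurable (surface_measure \<Omega>)" if "b \<in> Basis" for b
    by (rule trace_smooth(2)[OF n dom smooth_pd[OF F that] w[OF that]])
  then show "normal_deriv \<Omega> F \<in> borel_measurable (surface_measure \<Omega>)"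
    unfolding normal_deriv_def[abs_def]
    by (intro borel_measurable_sum borel_measurable_times borel_measurable_inner measurable_outer_normal[OF dom]) simp_all
qed

definition bending :: "real \<Rightarrow> ('a::euclidean_space \<Rightarrow> real) \<Rightarrow> 'a \<Rightarrow> real" where
  "bending \<sigma> F x = (1 - \<sigma>) * (\<Sum>i\<in>Basis. \<Sum>j\<in>Basis. (pd i (pd j F) x)\<^sup>2) + \<sigma> * (\<Sum>i\<in>Basis. pd i (pd i F) x)\<^sup>2"

lemma Qform_smooth:
  fixes \<Omega> :: "'a::euclidean_space set"
  assumes n: "DIM('a) \<ge> 2" and dom: "bounded_C1_domain \<Omega>" and F: "smooth F"
  shows "Qform \<Omega> \<sigma> \<alpha> \<beta> \<gamma> F F =
     (\<integral>x. bending \<sigma> F x \<partial>lebesgue_on \<Omega>) + \<alpha> * (\<integral>x. (norm (grad F x))\<^sup>2 \<partial>lebesgue_on \<Omega>)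
     + \<beta> * (\<integral>x. (grad F x \<bullet> outer_normal \<Omega> x)\<^sup>2 \<partial>surface_measure \<Omega>)
     + \<gamma> * (\<integral>x. (F x)\<^sup>2 \<partial>surface_measure \<Omega>)"
proof -
  note O = bounded_C1_domainD(2)[OF dom]
  let ?L = "lebesgue_on \<Omega>" let ?S = "surface_measure \<Omega>"
  have w: "AE x in ?L. pd b F x = wderiv \<Omega> b F x" if "b \<in> Basis" for b
    by (rule wderiv_smooth[OF O F that]) simp
  have h: "AE x in ?L. pd i (pd j F) x = hess \<Omega> i j F x" if "i \<in> Basis" "j \<in> Basis" for i j
    unfolding hess_def by (rule wderiv_smooth[OF O smooth_pd[OF F that(2)] that(1) w[OF that(2)]])
  have mw: "wderiv \<Omega> b F \<in> borel_measurable ?L" if "b \<in> Basis" for b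
    by (rule measurable_lebesgue_on_AE[OF O smooth_measurable_lebesgue_on[OF smooth_pd[OF F that]] w[OF that]])
  have mh: "hess \<Omega> i j F \<in> borel_measurable ?L" if "i \<in> Basis" "j \<in> Basis" for i j
    by (rule measurable_lebesgue_on_AE[OF O smooth_measurable_lebesgue_on[OF smooth_pd[OF smooth_pd[OF F that(2)] that(1)]] h[OF that]])
  have mpp: "pd i (pd j F) \<in> borel_measurable ?L" if "i \<in> Basis" "j \<in> Basis" for i j
    by (rule smooth_measurable_lebesgue_on[OF smooth_pd[OF smooth_pd[OF F that(2)] that(1)]])
  have aw: "AE x in ?L. \<forall>b\<in>Basis. pd b F x = wderiv \<Omega> b F x" by (intro AE_finite_allI finite_Basis w)
  have ah: "AE x in ?L. \<forall>i\<in>Basis. \<forall>j\<in>Basis. pd i (pd j F) x = hess \<Omega> i j F x" by (intro AE_finite_allI finite_Basis h)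
  have 1: "(\<integral>x. (1 - \<sigma>) * (\<Sum>i\<in>Basis. \<Sum>j\<in>Basis. hess \<Omega> i j F x * hess \<Omega> i j F x)
          + \<sigma> * (laplacian \<Omega> F x * laplacian \<Omega> F x) \<partial>?L) = (\<integral>x. bending \<sigma> F x \<partial>?L)"
  proof (rule integral_cong_AE)
    show "(\<lambda>x. (1 - \<sigma>) * (\<Sum>i\<in>Basis. \<Sum>j\<in>Basis. hess \<Omega> i j F x * hess \<Omega> i j F x)
          + \<sigma> * (laplacian \<Omega> F x * laplacian \<Omega> F x)) \<in> borel_measurable ?L"
      unfolding laplacian_def[abs_def] using mh
      by (intro borel_measurable_add borel_measurable_times borel_measurable_const borel_measurable_sum) simp_all
    show "bending \<sigma> F \<in> borel_measurable ?L" unfolding bending_def[abs_def] using mpp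
      by (intro borel_measurable_add borel_measurable_times borel_measurable_const borel_measurable_sum borel_measurable_power) simp_all
    show "AE x in ?L. (1 - \<sigma>) * (\<Sum>i\<in>Basis. \<Sum>j\<in>Basis. hess \<Omega> i j F x * hess \<Omega> i j F x)
          + \<sigma> * (laplacian \<Omega> F x * laplacian \<Omega> F x) = bending \<sigma> F x"
    proof (rule eventually_mono[OF ah])
      fix x assume a: "\<forall>i\<in>Basis. \<forall>j\<in>Basis. pd i (pd j F) x = hess \<Omega> i j F x"
      have "(\<Sum>i\<in>Basis. \<Sum>j\<in>Basis. hess \<Omega> i j F x * hess \<Omega> i j F x) = (\<Sum>i\<in>Basis. \<Sum>j\<in>Basis. (pd i (pd j F) x)\<^sup>2)"
        by (intro sum.cong refl) (use a in \<open>simp add: power2_eq_square\<close>)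
      moreover have "laplacian \<Omega> F x = (\<Sum>i\<in>Basis. pd i (pd i F) x)"
        unfolding laplacian_def by (intro sum.cong refl) (use a in simp)
      ultimately show "(1 - \<sigma>) * (\<Sum>i\<in>Basis. \<Sum>j\<in>Basis. hess \<Omega> i j F x * hess \<Omega> i j F x)
          + \<sigma> * (laplacian \<Omega> F x * laplacian \<Omega> F x) = bending \<sigma> F x"
        unfolding bending_def by (simp only: power2_eq_square)
    qed
  qed
  have 2: "(\<integral>x. (\<Sum>i\<in>Basis. wderiv \<Omega> i F x * wderiv \<Omega> i F x) \<partial>?L) = (\<integral>x. (norm (grad F x))\<^sup>2 \<partial>?L)"
  proof (rule integral_cong_AE)
    show "(\<lambda>x. \<Sum>i\<in>Basis. wderiv \<Omega> i F x * wderiv \<Omega> i F x) \<in> borel_measurable ?L" using mw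
      by (intro borel_measurable_times borel_measurable_sum) simp_all
    show "(\<lambda>x. (norm (grad F x))\<^sup>2) \<in> borel_measurable ?L"
      by (intro borel_measurable_lebesgue_on borel_measurable_power borel_measurable_norm borel_measurable_continuous_onI continuous_intros continuous_grad F)
    show "AE x in ?L. (\<Sum>i\<in>Basis. wderiv \<Omega> i F x * wderiv \<Omega> i F x) = (norm (grad F x))\<^sup>2"
      unfolding norm_grad_sq
      by (rule eventually_mono[OF aw], intro sum.cong refl) (simp add: power2_eq_square)
  qed
  have 3: "(\<integral>x. normal_deriv \<Omega> F x * normal_deriv \<Omega> F x \<partial>?S) = (\<integral>x. (grad F x \<bullet> outer_normal \<Omega> x)\<^sup>2 \<partial>?S)"
  proof (rule integral_cong_AE)
    show "(\<lambda>x. normal_deriv \<Omega> F x * normal_deriv \<Omega> F x) \<in> borel_measurable ?S"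
      by (intro borel_measurable_times normal_deriv_smooth(2)[OF n dom F])
    show "(\<lambda>x. (grad F x \<bullet> outer_normal \<Omega> x)\<^sup>2) \<in> borel_measurable ?S"
      by (intro borel_measurable_power measurable_normal_flux[OF dom F])
    show "AE x in ?S. normal_deriv \<Omega> F x * normal_deriv \<Omega> F x = (grad F x \<bullet> outer_normal \<Omega> x)\<^sup>2"
      by (rule eventually_mono[OF normal_deriv_smooth(1)[OF n dom F]]) (simp add: power2_eq_square)
  qed
  have a0: "AE x in ?L. F x = F x" by simp
  have 4: "(\<integral>x. trace \<Omega> F x * trace \<Omega> F x \<partial>?S) = (\<integral>x. (F x)\<^sup>2 \<partial>?S)"
  proof (rule integral_cong_AE)
    show "(\<lambda>x. trace \<Omega> F x * trace \<Omega> F x) \<in> borel_measurable ?S"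
      by (intro borel_measurable_times trace_smooth(2)[OF n dom F a0])
    show "(\<lambda>x. (F x)\<^sup>2) \<in> borel_measurable ?S"
      by (intro borel_measurable_power measurable_surface_borel smooth_borel F)
    show "AE x in ?S. trace \<Omega> F x * trace \<Omega> F x = (F x)\<^sup>2"
      by (rule eventually_mono[OF trace_smooth(1)[OF n dom F a0]]) (simp add: power2_eq_square)
  qed
  show ?thesis unfolding Qform_def 1 2 3 4 ..
qed

(*T10*)
lemma integrable_smooth_on_bounded:
  fixes f :: "'a::euclidean_space \<Rightarrow> real"
  assumes O: "open \<Omega>" and bd: "bounded \<Omega>" and f: "continuous_on UNIV f"
  shows "integrable (lebesgue_on \<Omega>) f"
proof -
  have s: "\<Omega> \<inter> space lebesgue \<in> sets lebesgue" using O by (simp add: borel_open sets_completionI_sets)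
  have c: "compact (closure \<Omega>)" using bd by simp
  have "integrable lborel (\<lambda>x. indicator (closure \<Omega>) x *\<^sub>R f x)"
    by (rule borel_integrable_compact[OF c continuous_on_subset[OF f]]) simp
  then have "integrable lebesgue (\<lambda>x. indicator (closure \<Omega>) x *\<^sub>R f x)" by (simp add: integrable_completion)
  then have "set_integrable lebesgue \<Omega> f"
    using s closure_subset[of \<Omega>] set_integrable_subset[of lebesgue "closure \<Omega>" f \<Omega>]
    unfolding set_integrable_def[of _ "closure \<Omega>"] by simp
  then show ?thesis unfolding set_integrable_def integrable_restrict_space[OF s] .
qed

lemma continuous_bending: "smooth F \<Longrightarrow> continuous_on A (bending \<sigma> F)"
  unfolding bending_def[abs_def] by (intro continuous_intros smooth_continuous smooth_pd) simp_all

lemma pd_zero_off_closed: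
  assumes "closed K" "\<And>x. x \<notin> K \<Longrightarrow> F x = 0" "x \<notin> K" shows "pd b F x = 0"
proof -
  have "closure {x. F x \<noteq> 0} \<subseteq> K" by (rule closure_minimal) (use assms in auto)
  then show ?thesis using assms(3) by (intro pd_zero_outside) blast
qed

lemma separated_sum:
  fixes G :: "nat \<Rightarrow> 'a::euclidean_space \<Rightarrow> real" and c :: "nat \<Rightarrow> real"
  assumes G: "\<And>i. i < k \<Longrightarrow> smooth (G i)" and K: "\<And>i. i < k \<Longrightarrow> closed (K i)"
    and z: "\<And>i x. i < k \<Longrightarrow> x \<notin> K i \<Longrightarrow> G i x = 0"
    and disj: "\<And>i j. i < k \<Longrightarrow> j < k \<Longrightarrow> i \<noteq> j \<Longrightarrow> K i \<inter> K j = {}"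
  defines "u \<equiv> (\<lambda>x. \<Sum>i<k. c i * G i x)"
  shows "smooth u" "(u x)\<^sup>2 = (\<Sum>i<k. (c i)\<^sup>2 * (G i x)\<^sup>2)"
    "bending \<sigma> u x = (\<Sum>i<k. (c i)\<^sup>2 * bending \<sigma> (G i) x)"
    "(norm (grad u x))\<^sup>2 = (\<Sum>i<k. (c i)\<^sup>2 * (norm (grad (G i) x))\<^sup>2)"
    "(grad u x \<bullet> v)\<^sup>2 = (\<Sum>i<k. (c i)\<^sup>2 * (grad (G i) x \<bullet> v)\<^sup>2)"
proof -
  have scG: "smooth (\<lambda>x. c i * G i x)" if "i < k" for i using G[OF that] by (intro smooth_mult) simp_all
  show su: "smooth u" unfolding u_def by (rule smooth_sum) (use scG in simp)
  have pu: "pd b u = (\<lambda>x. \<Sum>i<k. c i * pd b (G i) x)" for b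
    unfolding u_def using pd_sum[of "{..<k}" "\<lambda>i x. c i * G i x"] scG pd_cmult[OF G]
    by (auto simp: fun_eq_iff intro!: sum.cong)
  have pu': "pd b u x = (\<Sum>i<k. c i * pd b (G i) x)" for b x using fun_cong[OF pu] .
  have ppu: "pd a (pd b u) = (\<lambda>x. \<Sum>i<k. c i * pd a (pd b (G i)) x)" if b: "b \<in> Basis" for a b
  proof -
    have s: "smooth (\<lambda>x. c i * pd b (G i) x)" if "i < k" for i
      by (intro smooth_mult smooth_pd G that b) simp
    show ?thesis unfolding pu using pd_sum[of "{..<k}" "\<lambda>i x. c i * pd b (G i) x"] s pd_cmult[OF smooth_pd[OF G b]]
      by (auto simp: fun_eq_iff intro!: sum.cong)
  qed
  have ppu': "pd a (pd b u) x = (\<Sum>i<k. c i * pd a (pd b (G i)) x)" if "b \<in> Basis" for a b x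
    using fun_cong[OF ppu[OF that]] .
  have gz: "grad (G i) x = 0" if "i < k" "x \<notin> K i" for i
    unfolding grad_def using pd_zero_off_closed[OF K[OF that(1)] z[OF that(1)] that(2)] by simp
  have pz: "pd a (pd b (G i)) x = 0" if "i < k" "x \<notin> K i" for i a b
    by (rule pd_zero_off_closed[OF K[OF that(1)] pd_zero_off_closed[OF K[OF that(1)] z[OF that(1)]] that(2)])
  have bz: "bending \<sigma> (G i) x = 0" if "i < k" "x \<notin> K i" for i
    unfolding bending_def using pz[OF that] by simp
  have gu: "grad u x = (\<Sum>i<k. c i *\<^sub>R grad (G i) x)"
    unfolding grad_def pu' scaleR_sum_left scaleR_sum_right by (subst sum.swap) simp
  have "(u x)\<^sup>2 = (\<Sum>i<k. (c i)\<^sup>2 * (G i x)\<^sup>2) \<and>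
    bending \<sigma> u x = (\<Sum>i<k. (c i)\<^sup>2 * bending \<sigma> (G i) x) \<and>
    (norm (grad u x))\<^sup>2 = (\<Sum>i<k. (c i)\<^sup>2 * (norm (grad (G i) x))\<^sup>2) \<and>
    (grad u x \<bullet> v)\<^sup>2 = (\<Sum>i<k. (c i)\<^sup>2 * (grad (G i) x \<bullet> v)\<^sup>2)"
  proof (cases "\<exists>i<k. x \<in> K i")
    case True
    then obtain i where i: "i < k" "x \<in> K i" by blast
    have ni: "x \<notin> K j" if "j < k" "j \<noteq> i" for j using disj[OF that(1) i(1) that(2)] i(2) by blast
    have one: "(\<Sum>j<k. h j) = h i" if "\<And>j. j < k \<Longrightarrow> j \<noteq> i \<Longrightarrow> h j = 0" for h :: "nat \<Rightarrow> 'c::comm_monoid_add"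
      using sum.remove[of "{..<k}" i h] i(1) that by (simp add: sum.neutral)
    have u1: "u x = c i * G i x" unfolding u_def by (rule one) (use z ni in simp)
    have g1: "grad u x = c i *\<^sub>R grad (G i) x" unfolding gu by (rule one) (use gz ni in simp)
    have p1: "pd a (pd b u) x = c i * pd a (pd b (G i)) x" if "b \<in> Basis" for a b
      unfolding ppu'[OF that] by (rule one) (use pz ni in simp)
    have b1: "bending \<sigma> u x = (c i)\<^sup>2 * bending \<sigma> (G i) x"
    proof -
      have "(\<Sum>a\<in>Basis. \<Sum>b\<in>Basis. (pd a (pd b u) x)\<^sup>2) = (c i)\<^sup>2 * (\<Sum>a\<in>Basis. \<Sum>b\<in>Basis. (pd a (pd b (G i)) x)\<^sup>2)"
        unfolding sum_distrib_left by (intro sum.cong refl) (simp add: p1 power_mult_distrib)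
      moreover have "(\<Sum>a\<in>Basis. pd a (pd a u) x) = c i * (\<Sum>a\<in>Basis. pd a (pd a (G i)) x)"
        unfolding sum_distrib_left by (intro sum.cong refl) (simp add: p1)
      ultimately show ?thesis unfolding bending_def by (simp add: power_mult_distrib distrib_left mult.left_commute)
    qed
    have s1: "(\<Sum>j<k. (c j)\<^sup>2 * (G j x)\<^sup>2) = (c i)\<^sup>2 * (G i x)\<^sup>2" by (rule one) (use z ni in simp)
    have s2: "(\<Sum>j<k. (c j)\<^sup>2 * bending \<sigma> (G j) x) = (c i)\<^sup>2 * bending \<sigma> (G i) x" by (rule one) (use bz ni in simp)
    have s3: "(\<Sum>j<k. (c j)\<^sup>2 * (norm (grad (G j) x))\<^sup>2) = (c i)\<^sup>2 * (norm (grad (G i) x))\<^sup>2" by (rule one) (use gz ni in simp)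
    have s4: "(\<Sum>j<k. (c j)\<^sup>2 * (grad (G j) x \<bullet> v)\<^sup>2) = (c i)\<^sup>2 * (grad (G i) x \<bullet> v)\<^sup>2" by (rule one) (use gz ni in simp)
    show ?thesis unfolding s1 s2 s3 s4 b1 u1 g1 by (simp add: power_mult_distrib)
  next
    case False
    then have n: "x \<notin> K i" if "i < k" for i using that by blast
    have 0: "u x = 0" unfolding u_def using z n by (simp add: sum.neutral)
    have 1: "grad u x = 0" unfolding gu using gz n by (simp add: sum.neutral)
    have "pd a (pd b u) x = 0" if "b \<in> Basis" for a b unfolding ppu'[OF that] using pz n by (simp add: sum.neutral)
    then have "bending \<sigma> u x = 0" unfolding bending_def by (simp add: sum.neutral)
    then show ?thesis using 0 1 z gz bz n by (simp add: sum.neutral)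
  qed
  then show "(u x)\<^sup>2 = (\<Sum>i<k. (c i)\<^sup>2 * (G i x)\<^sup>2)"
    "bending \<sigma> u x = (\<Sum>i<k. (c i)\<^sup>2 * bending \<sigma> (G i) x)"
    "(norm (grad u x))\<^sup>2 = (\<Sum>i<k. (c i)\<^sup>2 * (norm (grad (G i) x))\<^sup>2)"
    "(grad u x \<bullet> v)\<^sup>2 = (\<Sum>i<k. (c i)\<^sup>2 * (grad (G i) x \<bullet> v)\<^sup>2)" by blast+
qed

lemma integrable_flux_sq:
  fixes \<Omega> :: "'a::euclidean_space set"
  assumes n: "DIM('a) \<ge> 2" and dom: "bounded_C1_domain \<Omega>" and F: "smooth F"
  shows "integrable (surface_measure \<Omega>) (\<lambda>x. (grad F x \<bullet> outer_normal \<Omega> x)\<^sup>2)"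
    "integrable (surface_measure \<Omega>) (\<lambda>x. (F x)\<^sup>2)"
proof -
  have cF: "compact (frontier \<Omega>)" using bounded_C1_domainD(3)[OF dom] by (rule compact_frontier_bounded)
  have "bounded (grad F ` frontier \<Omega>)" "bounded (F ` frontier \<Omega>)"
    by (intro compact_imp_bounded compact_continuous_image cF continuous_grad smooth_continuous F)+
  then obtain B B' where B: "\<And>x. x \<in> frontier \<Omega> \<Longrightarrow> norm (grad F x) \<le> B" "\<And>x. x \<in> frontier \<Omega> \<Longrightarrow> norm (F x) \<le> B'"
    unfolding bounded_iff by (metis imageI)
  have b: "\<bar>(grad F x \<bullet> outer_normal \<Omega> x)\<^sup>2\<bar> \<le> B\<^sup>2" if "x \<in> frontier \<Omega>" for x
  proof -
    have "\<bar>grad F x \<bullet> outer_normal \<Omega> x\<bar> \<le> norm (grad F x) * norm (outer_normal \<Omega> x)" by (rule Cauchy_Schwarz_ineq2)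
    also have "\<dots> \<le> B" using B(1)[OF that] norm_outer_normal[OF dom that] by simp
    finally have "\<bar>grad F x \<bullet> outer_normal \<Omega> x\<bar>\<^sup>2 \<le> B\<^sup>2" by (rule power_mono) simp
    then show ?thesis by simp
  qed
  show "integrable (surface_measure \<Omega>) (\<lambda>x. (grad F x \<bullet> outer_normal \<Omega> x)\<^sup>2)"
    by (rule integrable_surface_bounded[OF n dom borel_measurable_power[OF measurable_normal_flux[OF dom F]] b])
  have b': "\<bar>(F x)\<^sup>2\<bar> \<le> B'\<^sup>2" if "x \<in> frontier \<Omega>" for x
  proof -
    have "\<bar>F x\<bar>\<^sup>2 \<le> B'\<^sup>2" using B(2)[OF that] by (intro power_mono) simp_all
    then show ?thesis by simp
  qed
  show "integrable (surface_measure \<Omega>) (\<lambda>x. (F x)\<^sup>2)"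
    by (rule integrable_surface_bounded[OF n dom borel_measurable_power[OF measurable_surface_borel[OF smooth_borel[OF F]]] b'])
qed

theorem eigenvalue_le_separated:
  fixes \<Omega> :: "'a::euclidean_space set" and G :: "nat \<Rightarrow> 'a \<Rightarrow> real"
  assumes n: "DIM('a) \<ge> 2" and dom: "bounded_C1_domain \<Omega>"
    and G: "\<And>i. i < k \<Longrightarrow> smooth (G i)" and K: "\<And>i. i < k \<Longrightarrow> closed (K i)"
    and z: "\<And>i x. i < k \<Longrightarrow> x \<notin> K i \<Longrightarrow> G i x = 0"
    and disj: "\<And>i j. i < k \<Longrightarrow> j < k \<Longrightarrow> i \<noteq> j \<Longrightarrow> K i \<inter> K j = {}"
    and pos: "\<And>i. i < k \<Longrightarrow> (\<integral>x. (G i x)\<^sup>2 \<partial>lebesgue_on \<Omega>) > 0"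
    and Q: "\<And>i. i < k \<Longrightarrow> Qform \<Omega> \<sigma> \<alpha> \<beta> \<gamma> (G i) (G i) \<le> - \<Lambda> * (\<integral>x. (G i x)\<^sup>2 \<partial>lebesgue_on \<Omega>)"
  shows "eigenvalue \<Omega> \<sigma> \<alpha> \<beta> \<gamma> k \<le> ereal (- \<Lambda>)"
proof -
  let ?L = "lebesgue_on \<Omega>" let ?S = "surface_measure \<Omega>"
  note O = bounded_C1_domainD(2)[OF dom] and bd = bounded_C1_domainD(3)[OF dom]
  define u where "u c = (\<lambda>x. \<Sum>i<k. c i * G i x)" for c :: "nat \<Rightarrow> real"
  have sep1: "(u c x)\<^sup>2 = (\<Sum>i<k. (c i)\<^sup>2 * (G i x)\<^sup>2)" for c x
    unfolding u_def by (rule separated_sum(2)[where K=K]) (simp_all add: G K z disj)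
  have sep2: "bending \<sigma> (u c) x = (\<Sum>i<k. (c i)\<^sup>2 * bending \<sigma> (G i) x)" for c x
    unfolding u_def by (rule separated_sum(3)[where K=K]) (simp_all add: G K z disj)
  have sep3: "(norm (grad (u c) x))\<^sup>2 = (\<Sum>i<k. (c i)\<^sup>2 * (norm (grad (G i) x))\<^sup>2)" for c x
    unfolding u_def by (rule separated_sum(4)[where K=K]) (simp_all add: G K z disj)
  have sep4: "(grad (u c) x \<bullet> v)\<^sup>2 = (\<Sum>i<k. (c i)\<^sup>2 * (grad (G i) x \<bullet> v)\<^sup>2)" for c x and v
    unfolding u_def by (rule separated_sum(5)[where K=K]) (simp_all add: G K z disj)
  have su: "smooth (u c)" for c unfolding u_def by (intro smooth_sum smooth_mult G) simp_all
  have int: "integrable ?L (\<lambda>x. (G i x)\<^sup>2)" "integrable ?L (bending \<sigma> (G i))" "integrable ?L (\<lambda>x. (norm (grad (G i) x))\<^sup>2)" if "i < k" for i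
    by (intro integrable_smooth_on_bounded[OF O bd] continuous_bending continuous_intros smooth_continuous continuous_grad G that)+
  have sq: "(\<integral>x. (u c x)\<^sup>2 \<partial>?L) = (\<Sum>i<k. (c i)\<^sup>2 * (\<integral>x. (G i x)\<^sup>2 \<partial>?L))" for c
    unfolding sep1 using int by (subst Bochner_Integration.integral_sum) auto
  have bq: "(\<integral>x. bending \<sigma> (u c) x \<partial>?L) = (\<Sum>i<k. (c i)\<^sup>2 * (\<integral>x. bending \<sigma> (G i) x \<partial>?L))" for c
    unfolding sep2 using int by (subst Bochner_Integration.integral_sum) auto
  have gq: "(\<integral>x. (norm (grad (u c) x))\<^sup>2 \<partial>?L) = (\<Sum>i<k. (c i)\<^sup>2 * (\<integral>x. (norm (grad (G i) x))\<^sup>2 \<partial>?L))" for c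
    unfolding sep3 using int by (subst Bochner_Integration.integral_sum) auto
  have nq: "(\<integral>x. (grad (u c) x \<bullet> outer_normal \<Omega> x)\<^sup>2 \<partial>?S) = (\<Sum>i<k. (c i)\<^sup>2 * (\<integral>x. (grad (G i) x \<bullet> outer_normal \<Omega> x)\<^sup>2 \<partial>?S))" for c
    unfolding sep4 using integrable_flux_sq(1)[OF n dom G] by (subst Bochner_Integration.integral_sum) auto
  have tq: "(\<integral>x. (u c x)\<^sup>2 \<partial>?S) = (\<Sum>i<k. (c i)\<^sup>2 * (\<integral>x. (G i x)\<^sup>2 \<partial>?S))" for c
    unfolding sep1 using integrable_flux_sq(2)[OF n dom G] by (subst Bochner_Integration.integral_sum) auto
  have Qu: "Qform \<Omega> \<sigma> \<alpha> \<beta> \<gamma> (u c) (u c) = (\<Sum>i<k. (c i)\<^sup>2 * Qform \<Omega> \<sigma> \<alpha> \<beta> \<gamma> (G i) (G i))" for c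
  proof -
    have "(\<Sum>i<k. (c i)\<^sup>2 * Qform \<Omega> \<sigma> \<alpha> \<beta> \<gamma> (G i) (G i)) = (\<Sum>i<k. (c i)\<^sup>2 * (
       (\<integral>x. bending \<sigma> (G i) x \<partial>?L) + \<alpha> * (\<integral>x. (norm (grad (G i) x))\<^sup>2 \<partial>?L)
     + \<beta> * (\<integral>x. (grad (G i) x \<bullet> outer_normal \<Omega> x)\<^sup>2 \<partial>?S) + \<gamma> * (\<integral>x. (G i x)\<^sup>2 \<partial>?S)))"
      by (intro sum.cong refl) (simp add: Qform_smooth[OF n dom G])
    also have "\<dots> = Qform \<Omega> \<sigma> \<alpha> \<beta> \<gamma> (u c) (u c)"
      unfolding Qform_smooth[OF n dom su] bq gq nq tq distrib_left sum.distrib sum_distrib_left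
      by (simp only: mult.left_commute)
    finally show ?thesis ..
  qed
  have Qle: "Qform \<Omega> \<sigma> \<alpha> \<beta> \<gamma> (u c) (u c) \<le> - \<Lambda> * (\<integral>x. (u c x)\<^sup>2 \<partial>?L)" for c
  proof -
    have "(\<Sum>i<k. (c i)\<^sup>2 * Qform \<Omega> \<sigma> \<alpha> \<beta> \<gamma> (G i) (G i)) \<le> (\<Sum>i<k. (c i)\<^sup>2 * (- \<Lambda> * (\<integral>x. (G i x)\<^sup>2 \<partial>?L)))"
      using Q by (intro sum_mono mult_left_mono) auto
    then show ?thesis unfolding Qu sq sum_distrib_left by (simp only: mult.left_commute)
  qed
  have zero: "c i = 0" if "AE x in ?L. u c x = 0" "i < k" for c i
  proof -
    have "(\<integral>x. (u c x)\<^sup>2 \<partial>?L) = (\<integral>x. 0 \<partial>?L)"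
    proof (rule integral_cong_AE)
      show "(\<lambda>x. (u c x)\<^sup>2) \<in> borel_measurable ?L" by (intro borel_measurable_power smooth_measurable_lebesgue_on su)
      show "AE x in ?L. (u c x)\<^sup>2 = 0" using that(1) by (rule eventually_mono) simp
    qed simp
    then have "(\<Sum>i<k. (c i)\<^sup>2 * (\<integral>x. (G i x)\<^sup>2 \<partial>?L)) = 0" unfolding sq by simp
    moreover have "0 \<le> (c j)\<^sup>2 * (\<integral>x. (G j x)\<^sup>2 \<partial>?L)" for j by simp
    ultimately have "(c i)\<^sup>2 * (\<integral>x. (G i x)\<^sup>2 \<partial>?L) = 0"
      using sum_nonneg_eq_0_iff[of "{..<k}" "\<lambda>i. (c i)\<^sup>2 * (\<integral>x. (G i x)\<^sup>2 \<partial>?L)"] that(2) by simp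
    then show "c i = 0" using pos[OF that(2)] by simp
  qed
  let ?V = "{(\<lambda>x. \<Sum>i<k. c i * G i x) | c :: nat \<Rightarrow> real. True}"
  have "H2_subspace \<Omega> k ?V"
    unfolding H2_subspace_def
  proof (intro exI[of _ G] conjI allI impI)
    fix i assume "i < k" then show "G i \<in> H2 \<Omega>" by (intro H2_smooth O bd G)
  next
    fix c :: "nat \<Rightarrow> real" and i assume "AE x in ?L. (\<Sum>i<k. c i * G i x) = 0" "i < k"
    then show "c i = 0" using zero unfolding u_def by blast
  qed simp
  moreover have "(SUP w \<in> {w \<in> ?V. \<not> (AE x in ?L. w x = 0)}. ereal (Qform \<Omega> \<sigma> \<alpha> \<beta> \<gamma> w w / (\<integral>x. (w x)\<^sup>2 \<partial>?L))) \<le> ereal (- \<Lambda>)"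
  proof (rule SUP_least)
    fix w assume w: "w \<in> {w \<in> ?V. \<not> (AE x in ?L. w x = 0)}"
    then obtain c where c: "w = u c" unfolding u_def by blast
    have ne: "\<not> (AE x in ?L. u c x = 0)" using w c by simp
    have "0 < (\<integral>x. (u c x)\<^sup>2 \<partial>?L)"
    proof -
      have "\<exists>i<k. c i \<noteq> 0"
      proof (rule ccontr)
        assume "\<not> (\<exists>i<k. c i \<noteq> 0)" then have "u c x = 0" for x unfolding u_def by (simp add: sum.neutral)
        then show False using ne by simp
      qed
      then obtain i where i: "i < k" "c i \<noteq> 0" by blast
      then have "0 < (c i)\<^sup>2 * (\<integral>x. (G i x)\<^sup>2 \<partial>?L)" using pos by simp
      then show ?thesis unfolding sq using i(1) by (intro sum_pos2[of _ i]) auto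
    qed
    then have "Qform \<Omega> \<sigma> \<alpha> \<beta> \<gamma> (u c) (u c) / (\<integral>x. (u c x)\<^sup>2 \<partial>?L) \<le> - \<Lambda>"
      using Qle[of c] by (simp add: pos_divide_le_eq)
    then show "ereal (Qform \<Omega> \<sigma> \<alpha> \<beta> \<gamma> w w / (\<integral>x. (w x)\<^sup>2 \<partial>?L)) \<le> ereal (- \<Lambda>)" unfolding c by simp
  qed
  ultimately show ?thesis unfolding eigenvalue_def by (intro INF_lower2[of ?V]) simp_all
qed

(*T11*)
lemma integral_lebesgue_on_borel:
  fixes f :: "'a::euclidean_space \<Rightarrow> real"
  assumes O: "open \<Omega>" and f: "f \<in> borel_measurable borel"
  shows "(\<integral>x. f x \<partial>lebesgue_on \<Omega>) = (\<integral>x. indicator \<Omega> x * f x \<partial>lborel)"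
proof -
  have s: "\<Omega> \<inter> space lebesgue \<in> sets lebesgue" using O by (simp add: borel_open sets_completionI_sets)
  have m: "(\<lambda>x. indicator \<Omega> x * f x) \<in> borel_measurable lborel"
    using f O by (simp add: borel_measurable_times borel_measurable_indicator borel_open)
  have "(\<integral>x. f x \<partial>lebesgue_on \<Omega>) = (\<integral>x. indicator \<Omega> x * f x \<partial>lebesgue)"
    unfolding integral_restrict_space[OF s] by simp
  also have "\<dots> = (\<integral>x. indicator \<Omega> x * f x \<partial>lborel)" by (rule integral_completion[OF m])
  finally show ?thesis .
qed

lemma lborel_integral_dilate:
  fixes g :: "'a::euclidean_space \<Rightarrow> real"
  assumes a: "a > 0" and g: "g \<in> borel_measurable borel"
  shows "(\<integral>x. g x \<partial>lborel) = a ^ DIM('a) * (\<integral>x. g (a *\<^sub>R (x - x0)) \<partial>lborel)"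
proof -
  have T: "(\<lambda>x. - a *\<^sub>R x0 + a *\<^sub>R x) \<in> lborel \<rightarrow>\<^sub>M (borel :: 'a measure)" by simp
  have "(\<integral>x. g x \<partial>lborel) = (\<integral>x. g x \<partial>density (distr lborel borel (\<lambda>x. - a *\<^sub>R x0 + a *\<^sub>R x)) (\<lambda>_. ennreal (\<bar>a\<bar> ^ DIM('a))))"
    using lborel_affine[of a "- a *\<^sub>R x0"] a by simp
  also have "\<dots> = (\<integral>x. a ^ DIM('a) *\<^sub>R g x \<partial>distr lborel borel (\<lambda>x. - a *\<^sub>R x0 + a *\<^sub>R x))"
    using a g by (subst integral_density) simp_all
  also have "\<dots> = (\<integral>x. a ^ DIM('a) *\<^sub>R g (- a *\<^sub>R x0 + a *\<^sub>R x) \<partial>lborel)"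
    using g by (intro integral_distr[OF T]) simp
  also have "\<dots> = a ^ DIM('a) * (\<integral>x. g (a *\<^sub>R (x - x0)) \<partial>lborel)"
    by (simp add: scaleR_diff_right)
  finally show ?thesis .
qed

lemma volume_blowup_limit:
  fixes \<Phi> :: "'a::euclidean_space \<Rightarrow> real"
  assumes O: "open \<Omega>" and H: "H \<in> sets borel"
    and conv: "AE y in lborel. \<forall>\<^sub>F a in at_top. (x0 + (1 / a) *\<^sub>R y \<in> \<Omega>) = (y \<in> H)"
    and P: "continuous_on UNIV \<Phi>" and K: "compact K" "\<And>y. y \<notin> K \<Longrightarrow> \<Phi> y = 0"
  shows "((\<lambda>a. a ^ DIM('a) * (\<integral>x. \<Phi> (a *\<^sub>R (x - x0)) \<partial>lebesgue_on \<Omega>)) \<longlongrightarrow> (\<integral>y. indicator H y * \<Phi> y \<partial>lborel)) at_top"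
proof -
  define s where "s a y = indicator \<Omega> (x0 + (1 / a) *\<^sub>R y) * \<Phi> y" for a y
  have PB: "\<Phi> \<in> borel_measurable borel" by (rule borel_measurable_continuous_onI[OF P])
  have indm: "(\<lambda>y. indicator \<Omega> (x0 + (1 / a) *\<^sub>R y) :: real) \<in> borel_measurable borel" for a
    by (rule measurable_compose[OF _ borel_measurable_indicator[OF borel_open[OF O]]]) simp
  have sB: "s a \<in> borel_measurable borel" for a unfolding s_def[abs_def]
    by (intro borel_measurable_times indm PB)
  have e: "a ^ DIM('a) * (\<integral>x. \<Phi> (a *\<^sub>R (x - x0)) \<partial>lebesgue_on \<Omega>) = (\<integral>y. s a y \<partial>lborel)" if a: "a > 0" for a
  proof -
    have "(\<lambda>x. \<Phi> (a *\<^sub>R (x - x0))) \<in> borel_measurable borel"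
      by (intro borel_measurable_continuous_onI continuous_on_compose2[OF P] continuous_intros) simp
    then have "(\<integral>x. \<Phi> (a *\<^sub>R (x - x0)) \<partial>lebesgue_on \<Omega>) = (\<integral>x. indicator \<Omega> x * \<Phi> (a *\<^sub>R (x - x0)) \<partial>lborel)"
      by (rule integral_lebesgue_on_borel[OF O])
    also have "\<dots> = (\<integral>x. s a (a *\<^sub>R (x - x0)) \<partial>lborel)"
      using a by (intro Bochner_Integration.integral_cong refl) (simp add: s_def)
    finally show ?thesis using lborel_integral_dilate[OF a sB, of a x0] by simp
  qed
  have "((\<lambda>a. \<integral>y. s a y \<partial>lborel) \<longlongrightarrow> (\<integral>y. indicator H y * \<Phi> y \<partial>lborel)) at_top"
  proof (rule integral_dominated_convergence_at_top[where w="\<lambda>y. norm (\<Phi> y)"])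
    show "(\<lambda>y. indicator H y * \<Phi> y) \<in> borel_measurable lborel" using H PB by (simp add: borel_measurable_times borel_measurable_indicator)
    show "s a \<in> borel_measurable lborel" for a using sB by simp
    show "integrable lborel (\<lambda>y. norm (\<Phi> y))" by (intro integrable_norm integrable_lborel_compact_support[OF K(1) P K(2)])
    show "\<forall>\<^sub>F a in at_top. AE y in lborel. norm (s a y) \<le> norm (\<Phi> y)"
      by (intro always_eventually allI AE_I2) (simp add: s_def indicator_def)
    show "AE y in lborel. ((\<lambda>a. s a y) \<longlongrightarrow> indicator H y * \<Phi> y) at_top"
    proof (rule eventually_mono[OF conv])
      fix y assume "\<forall>\<^sub>F a in at_top. (x0 + (1 / a) *\<^sub>R y \<in> \<Omega>) = (y \<in> H)"
      then show "((\<lambda>a. s a y) \<longlongrightarrow> indicator H y * \<Phi> y) at_top"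
        by (intro tendsto_eventually) (auto elim!: eventually_mono simp: s_def indicator_def)
    qed
  qed
  then show ?thesis
    by (rule Lim_transform_eventually) (auto intro!: eventually_mono[OF eventually_gt_at_top[of 0]] e[symmetric])
qed

lemma blowup_interior:
  fixes \<Omega> :: "'a::euclidean_space set"
  assumes O: "open \<Omega>" and x0: "x0 \<in> \<Omega>"
  shows "\<forall>\<^sub>F a in at_top. (x0 + (1 / a) *\<^sub>R y \<in> \<Omega>) = (y \<in> UNIV)"
proof -
  have "((\<lambda>a::real. x0 + (1 / a) *\<^sub>R y) \<longlongrightarrow> x0 + 0 *\<^sub>R y) at_top"
    by (intro tendsto_intros tendsto_divide_0[OF tendsto_const] filterlim_at_top_imp_at_infinity filterlim_ident)
  then have "\<forall>\<^sub>F a in at_top. x0 + (1 / a) *\<^sub>R y \<in> \<Omega>"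
    using O x0 by (intro topological_tendstoD) simp_all
  then show ?thesis by simp
qed

lemma normal_cone:
  fixes \<Omega> :: "'a::euclidean_space set"
  assumes dom: "bounded_C1_domain \<Omega>" and x0: "x0 \<in> frontier \<Omega>" and eps: "\<epsilon> > 0"
  shows "\<exists>r>0. \<forall>y. norm y < r \<longrightarrow>
     (y \<bullet> outer_normal \<Omega> x0 < - \<epsilon> * norm y \<longrightarrow> x0 + y \<in> \<Omega>) \<and> (\<epsilon> * norm y < y \<bullet> outer_normal \<Omega> x0 \<longrightarrow> x0 + y \<notin> \<Omega>)"
proof -
  obtain U e h where ch: "C1_chart \<Omega> U e h" and xU: "x0 \<in> U" using bounded_C1_domainD(4)[OF dom x0] by blast
  note O = bounded_C1_domainD(2)[OF dom]
  define N where "N = norm (e - grad h x0)"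
  have N: "N > 0" unfolding N_def by (rule chart_normal_pos[OF ch])
  have on: "e - grad h x0 = N *\<^sub>R outer_normal \<Omega> x0"
    unfolding outer_normal_chart[OF ch O xU x0] chart_normal_def N_def[symmetric] using N by simp
  have "\<epsilon> * N > 0" using eps N by simp
  then obtain r where r: "r > 0" "\<And>y. norm y < r \<Longrightarrow>
     (y \<bullet> (e - grad h x0) < - (\<epsilon> * N) * norm y \<longrightarrow> x0 + y \<in> \<Omega>) \<and> ((\<epsilon> * N) * norm y < y \<bullet> (e - grad h x0) \<longrightarrow> x0 + y \<notin> \<Omega>)"
    using chart_tangent[OF ch O xU x0] by blast
  have c1: "(y \<bullet> (e - grad h x0) < - (\<epsilon> * N) * norm y) = (y \<bullet> outer_normal \<Omega> x0 < - \<epsilon> * norm y)" for y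
  proof -
    have "(y \<bullet> (e - grad h x0) < - (\<epsilon> * N) * norm y) = (N * (y \<bullet> outer_normal \<Omega> x0) < N * (- \<epsilon> * norm y))"
      unfolding on by (simp add: mult_ac)
    then show ?thesis unfolding mult_less_cancel_left_pos[OF N] .
  qed
  have c2: "((\<epsilon> * N) * norm y < y \<bullet> (e - grad h x0)) = (\<epsilon> * norm y < y \<bullet> outer_normal \<Omega> x0)" for y
  proof -
    have "((\<epsilon> * N) * norm y < y \<bullet> (e - grad h x0)) = (N * (\<epsilon> * norm y) < N * (y \<bullet> outer_normal \<Omega> x0))"
      unfolding on by (simp add: mult_ac)
    then show ?thesis unfolding mult_less_cancel_left_pos[OF N] .
  qed
  show ?thesis using r unfolding c1 c2 by blast
qed

lemma blowup_boundary:
  fixes \<Omega> :: "'a::euclidean_space set"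
  assumes dom: "bounded_C1_domain \<Omega>" and x0: "x0 \<in> frontier \<Omega>" and b: "outer_normal \<Omega> x0 = b"
  shows "AE y in lborel. \<forall>\<^sub>F a in at_top. (x0 + (1 / a) *\<^sub>R y \<in> \<Omega>) = (y \<in> {y. y \<bullet> b < 0})"
proof -
  have nb: "norm b = 1" using norm_outer_normal[OF dom x0] b by simp
  have "negligible {y. b \<bullet> y = 0}" by (rule negligible_hyperplane) (use nb in auto)
  then have "{y. b \<bullet> y = 0} \<in> null_sets lborel"
    by (simp add: negligible_iff_null_sets null_sets_completion_iff borel_closed closed_hyperplane)
  then have "AE y in lborel. y \<notin> {y. b \<bullet> y = 0}" by (rule AE_not_in)
  then show ?thesis
  proof (rule eventually_mono)
    fix y assume "y \<notin> {y. b \<bullet> y = 0}"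
    then have y: "y \<bullet> b \<noteq> 0" by (simp add: inner_commute)
    then have y0: "norm y > 0" by auto
    define \<epsilon> where "\<epsilon> = \<bar>y \<bullet> b\<bar> / (2 * norm y)"
    have eps: "\<epsilon> > 0" "\<epsilon> * norm y < \<bar>y \<bullet> b\<bar>" using y y0 by (auto simp: \<epsilon>_def)
    obtain r where r: "r > 0" "\<And>y. norm y < r \<Longrightarrow>
     (y \<bullet> b < - \<epsilon> * norm y \<longrightarrow> x0 + y \<in> \<Omega>) \<and> (\<epsilon> * norm y < y \<bullet> b \<longrightarrow> x0 + y \<notin> \<Omega>)"
      using normal_cone[OF dom x0 eps(1)] unfolding b by blast
    show "\<forall>\<^sub>F a in at_top. (x0 + (1 / a) *\<^sub>R y \<in> \<Omega>) = (y \<in> {y. y \<bullet> b < 0})"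
    proof (rule eventually_mono[OF eventually_gt_at_top[of "norm y / r"]])
      fix a assume a: "norm y / r < a"
      have "0 < norm y / r" using y0 r(1) by simp
      with a have a0: "a > 0" by linarith
      have "norm ((1 / a) *\<^sub>R y) < r" using a a0 r(1) by (simp add: pos_divide_less_eq mult.commute)
      note rr = r(2)[OF this]
      have i: "((1 / a) *\<^sub>R y) \<bullet> b = (y \<bullet> b) / a" "\<epsilon> * norm ((1 / a) *\<^sub>R y) = (\<epsilon> * norm y) / a" using a0 by simp_all
      show "(x0 + (1 / a) *\<^sub>R y \<in> \<Omega>) = (y \<in> {y. y \<bullet> b < 0})"
      proof (cases "y \<bullet> b < 0")
        case True
        then have "(y \<bullet> b) / a < (- (\<epsilon> * norm y)) / a" using eps(2) a0 by (intro divide_strict_right_mono) simp_all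
        then have "(y \<bullet> b) / a < - ((\<epsilon> * norm y) / a)" by (simp only: minus_divide_left)
        then have "x0 + (1 / a) *\<^sub>R y \<in> \<Omega>" using rr unfolding mult_minus_left i by blast
        then show ?thesis using True by simp
      next
        case False
        then have "(\<epsilon> * norm y) / a < (y \<bullet> b) / a" using eps(2) a0 y by (intro divide_strict_right_mono) auto
        then have "x0 + (1 / a) *\<^sub>R y \<notin> \<Omega>" using rr unfolding mult_minus_left i by blast
        then show ?thesis using False by simp
      qed
    qed
  qed
qed

lemma frontier_flat:
  fixes \<Omega> :: "'a::euclidean_space set"
  assumes dom: "bounded_C1_domain \<Omega>" and x0: "x0 \<in> frontier \<Omega>" and b: "outer_normal \<Omega> x0 = b" and eps: "\<epsilon> > 0"
  shows "\<exists>r>0. \<forall>x\<in>frontier \<Omega>. norm (x - x0) < r \<longrightarrow> \<bar>(x - x0) \<bullet> b\<bar> \<le> \<epsilon> * norm (x - x0)"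
proof -
  note O = bounded_C1_domainD(2)[OF dom]
  have fr: "frontier \<Omega> = closure \<Omega> - \<Omega>" using O by (simp add: frontier_def interior_open)
  obtain r where r: "r > 0" "\<And>y. norm y < r \<Longrightarrow>
     (y \<bullet> b < - \<epsilon> * norm y \<longrightarrow> x0 + y \<in> \<Omega>) \<and> (\<epsilon> * norm y < y \<bullet> b \<longrightarrow> x0 + y \<notin> \<Omega>)"
    using normal_cone[OF dom x0 eps] unfolding b by blast
  show ?thesis
  proof (intro exI[of _ r] conjI r(1) ballI impI)
    fix x assume x: "x \<in> frontier \<Omega>" "norm (x - x0) < r"
    have 1: "\<not> (x - x0) \<bullet> b < - \<epsilon> * norm (x - x0)" using r(2)[OF x(2)] x(1) fr by auto
    have 2: "\<not> \<epsilon> * norm (x - x0) < (x - x0) \<bullet> b"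
    proof
      assume lt: "\<epsilon> * norm (x - x0) < (x - x0) \<bullet> b"
      define W where "W = {w. norm (w - x0) < r} \<inter> {w. \<epsilon> * norm (w - x0) < (w - x0) \<bullet> b}"
      have oW: "open W" unfolding W_def by (intro open_Int open_Collect_less continuous_intros)
      have xW: "x \<in> W" using x(2) lt by (simp add: W_def)
      have "W \<inter> \<Omega> = {}"
      proof (rule ccontr)
        assume "W \<inter> \<Omega> \<noteq> {}"
        then obtain w where w: "norm (w - x0) < r" "\<epsilon> * norm (w - x0) < (w - x0) \<bullet> b" "w \<in> \<Omega>" unfolding W_def by blast
        then show False using r(2)[OF w(1)] by simp
      qed
      then have "W \<inter> closure \<Omega> = {}" using open_Int_closure_eq_empty[OF oW] by blast
      then show False using xW x(1) fr by blast
    qed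
    show "\<bar>(x - x0) \<bullet> b\<bar> \<le> \<epsilon> * norm (x - x0)" using 1 2 by (simp add: abs_le_iff)
  qed
qed

lemma frontier_crossing:
  fixes \<Omega> :: "'a::euclidean_space set"
  assumes dom: "bounded_C1_domain \<Omega>" and x0: "x0 \<in> frontier \<Omega>" and b: "outer_normal \<Omega> x0 = b" and eps: "\<epsilon> > 0"
  shows "\<exists>r>0. \<forall>z s. z \<bullet> b = 0 \<longrightarrow> \<epsilon> * (norm z + s) < s \<longrightarrow> norm z + s < r \<longrightarrow> 0 < s \<longrightarrow>
     (\<exists>t. \<bar>t\<bar> \<le> s \<and> x0 + z + t *\<^sub>R b \<in> frontier \<Omega>)"
proof -
  have nb: "norm b = 1" "b \<bullet> b = 1" using norm_outer_normal[OF dom x0] b by (simp_all add: norm_eq_1)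
  obtain r where r: "r > 0" "\<And>y. norm y < r \<Longrightarrow>
     (y \<bullet> b < - \<epsilon> * norm y \<longrightarrow> x0 + y \<in> \<Omega>) \<and> (\<epsilon> * norm y < y \<bullet> b \<longrightarrow> x0 + y \<notin> \<Omega>)"
    using normal_cone[OF dom x0 eps] unfolding b by blast
  show ?thesis
  proof (rule exI[of _ r], intro conjI r(1) allI impI)
    fix z :: 'a and s :: real assume z: "z \<bullet> b = 0" and s: "\<epsilon> * (norm z + s) < s" "norm z + s < r" "0 < s"
    have n: "norm (z + t *\<^sub>R b) \<le> norm z + s" if "\<bar>t\<bar> \<le> s" for t
      using norm_triangle_ineq[of z "t *\<^sub>R b"] nb that by simp
    have e: "\<epsilon> * norm (z + t *\<^sub>R b) < s" if "\<bar>t\<bar> \<le> s" for t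
      using mult_left_mono[OF n[OF that], of \<epsilon>] eps s(1) by linarith
    have i: "(z + t *\<^sub>R b) \<bullet> b = t" for t using z nb by (simp add: inner_add_left)
    have ms: "\<bar>- s\<bar> \<le> s" "\<bar>s\<bar> \<le> s" using s(3) by simp_all
    have "norm (z + (- s) *\<^sub>R b) < r" "norm (z + s *\<^sub>R b) < r" using n[OF ms(1)] n[OF ms(2)] s(2) by linarith+
    note rr = r(2)[OF this(1)] r(2)[OF this(2)]
    have inn: "x0 + (z + (- s) *\<^sub>R b) \<in> \<Omega>" using rr(1) e[OF ms(1)] i[of "- s"] by simp
    have out: "x0 + (z + s *\<^sub>R b) \<notin> \<Omega>" using rr(2) e[OF ms(2)] i[of s] by simp
    let ?S = "(\<lambda>t. x0 + (z + t *\<^sub>R b)) ` {- s..s}"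
    have "connected ?S" by (intro connected_continuous_image continuous_intros) simp
    moreover have "x0 + (z + (- s) *\<^sub>R b) \<in> ?S" "x0 + (z + s *\<^sub>R b) \<in> ?S" using s(3) by (intro imageI; simp)+
    ultimately have "?S \<inter> frontier \<Omega> \<noteq> {}" using inn out by (intro connected_Int_frontier) blast+
    then obtain t where "t \<in> {- s..s}" "x0 + (z + t *\<^sub>R b) \<in> frontier \<Omega>" by blast
    then show "\<exists>t. \<bar>t\<bar> \<le> s \<and> x0 + z + t *\<^sub>R b \<in> frontier \<Omega>" by (intro exI[of _ t]) (auto simp: add.assoc abs_le_iff)
  qed
qed

lemma surface_ge_projection:
  fixes \<Omega> S P :: "'a::euclidean_space set" and f :: "'a \<Rightarrow> ennreal"
  assumes n: "DIM('a) \<ge> 2" and b: "b \<in> Basis" and S: "S \<in> sets borel" "S \<subseteq> frontier \<Omega>" and P: "P \<in> sets borel"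
    and cov: "\<And>x. perp b x \<in> P \<Longrightarrow> perp b x \<in> perp b ` S" and f: "f \<in> borel_measurable borel"
  shows "(\<integral>\<^sup>+x. indicator {x. 0 \<le> x \<bullet> b \<and> x \<bullet> b \<le> 1 \<and> perp b x \<in> P} x * f (perp b x) \<partial>lborel)
     \<le> (\<integral>\<^sup>+x. indicator S x * f (perp b x) \<partial>surface_measure \<Omega>)"
proof -
  let ?Z = "{x. 0 \<le> x \<bullet> b \<and> x \<bullet> b \<le> 1 \<and> perp b x \<in> P}" and ?n = "DIM('a) - 1"
  have n1: "?n \<ge> 1" using n by simp
  note [measurable] = P S(1) f
  have Z: "?Z \<in> sets borel" by measurable
  define M where "M = distr (density lborel (indicator ?Z)) borel (perp b)"
  define N where "N = distr (density (hausdorff_measure ?n) (indicator S)) borel (perp b)"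
  have eM: "emeasure M B = emeasure lborel (?Z \<inter> perp b -` B)" if "B \<in> sets borel" for B
  proof -
    have pre: "perp b -` B \<in> sets borel" using measurable_sets[OF measurable_perp that] by simp
    have "emeasure M B = emeasure (density lborel (indicator ?Z)) (perp b -` B)"
      unfolding M_def using that by (subst emeasure_distr) auto
    also have "\<dots> = (\<integral>\<^sup>+x. indicator ?Z x * indicator (perp b -` B) x \<partial>lborel)"
      by (rule emeasure_density) (use pre Z in \<open>simp_all add: borel_measurable_indicator\<close>)
    also have "\<dots> = (\<integral>\<^sup>+x. indicator (?Z \<inter> perp b -` B) x \<partial>lborel)" by (simp only: indicator_inter_arith)
    also have "\<dots> = emeasure lborel (?Z \<inter> perp b -` B)" by (rule nn_integral_indicator) (use pre Z in simp)
    finally show ?thesis .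
  qed
  have eN: "emeasure N B = hausdorff_outer ?n (S \<inter> perp b -` B)" if "B \<in> sets borel" for B
  proof -
    have pre: "perp b -` B \<in> sets borel" using measurable_sets[OF measurable_perp that] by simp
    have "emeasure N B = emeasure (density (hausdorff_measure ?n) (indicator S)) (perp b -` B)"
      unfolding N_def using that by (subst emeasure_distr) (auto simp: measurable_cong_sets[OF sets_hausdorff_measure refl] cong: measurable_cong_sets)
    also have "\<dots> = (\<integral>\<^sup>+x. indicator S x * indicator (perp b -` B) x \<partial>hausdorff_measure ?n)"
      by (rule emeasure_density) (use pre S in \<open>simp_all add: borel_measurable_indicator\<close>)
    also have "\<dots> = (\<integral>\<^sup>+x. indicator (S \<inter> perp b -` B) x \<partial>hausdorff_measure ?n)" by (simp only: indicator_inter_arith)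
    also have "\<dots> = emeasure (hausdorff_measure ?n) (S \<inter> perp b -` B)" by (rule nn_integral_indicator) (use pre S in simp)
    also have "\<dots> = hausdorff_outer ?n (S \<inter> perp b -` B)" using pre S n1 by (intro emeasure_hausdorff_measure) simp_all
    finally show ?thesis .
  qed
  have le: "emeasure M B \<le> 1 * emeasure N B" if "B \<in> sets M" for B
  proof -
    have B: "B \<in> sets borel" using that by (simp add: M_def)
    have "?Z \<inter> perp b -` B \<subseteq> {x. perp b x \<in> perp b ` (S \<inter> perp b -` B) \<and> 0 \<le> x \<bullet> b \<and> x \<bullet> b \<le> 1}"
    proof
      fix x assume x: "x \<in> ?Z \<inter> perp b -` B"
      then obtain s where s: "s \<in> S" "perp b x = perp b s" using cov[of x] by auto
      then have "s \<in> S \<inter> perp b -` B" using x by auto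
      with s(2) x show "x \<in> {x. perp b x \<in> perp b ` (S \<inter> perp b -` B) \<and> 0 \<le> x \<bullet> b \<and> x \<bullet> b \<le> 1}" by blast
    qed
    then show ?thesis unfolding eM[OF B] eN[OF B] mult_1 by (rule hausdorff_outer_ge_projection[OF b])
  qed
  have "(\<integral>\<^sup>+x. indicator ?Z x * f (perp b x) \<partial>lborel) = (\<integral>\<^sup>+x. f x \<partial>M)"
    unfolding M_def using Z by (subst nn_integral_distr) (auto simp: nn_integral_density)
  also have "\<dots> \<le> 1 * (\<integral>\<^sup>+x. f x \<partial>N)"
    by (rule nn_integral_mono_scaled_measure[OF _ le]) (auto simp: M_def N_def)
  also have "1 * (\<integral>\<^sup>+x. f x \<partial>N) = (\<integral>\<^sup>+x. indicator S x * f (perp b x) \<partial>hausdorff_measure ?n)"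
    unfolding N_def by (subst nn_integral_distr) (auto simp: nn_integral_density)
  also have "\<dots> = (\<integral>\<^sup>+x. (indicator S x * f (perp b x)) * indicator (frontier \<Omega>) x \<partial>hausdorff_measure ?n)"
    using S(2) by (intro nn_integral_cong) (auto simp: indicator_def)
  also have "\<dots> = (\<integral>\<^sup>+x. indicator S x * f (perp b x) \<partial>surface_measure \<Omega>)"
    unfolding surface_measure_def by (rule nn_integral_restrict_space[symmetric]) (simp add: borel_closed frontier_closed)
  finally show ?thesis .
qed

lemma slab_scaling:
  fixes \<Phi> :: "'a::euclidean_space \<Rightarrow> ennreal"
  assumes b: "b \<in> Basis" and a: "a > 0" and P: "\<Phi> \<in> borel_measurable borel" and t: "t \<bullet> b = 0"
  shows "(\<integral>\<^sup>+x. indicator {x. 0 \<le> x \<bullet> b \<and> x \<bullet> b \<le> 1} x * \<Phi> (a *\<^sub>R (perp b x - t)) \<partial>lborel)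
     = ennreal ((1 / a) ^ (DIM('a) - 1)) * (\<integral>\<^sup>+x. indicator {x. 0 \<le> x \<bullet> b \<and> x \<bullet> b \<le> 1} x * \<Phi> (perp b x) \<partial>lborel)"
proof -
  define c where "c j = (if j = b then 1 else 1 / a)" for j :: 'a
  define T where "T x = t + (\<Sum>j\<in>Basis. (c j * (x \<bullet> j)) *\<^sub>R j)" for x :: 'a
  have c0: "\<And>j. j \<in> Basis \<Longrightarrow> c j \<noteq> 0" using a by (simp add: c_def)
  have T1: "T x = t + ((1 / a) *\<^sub>R perp b x + (x \<bullet> b) *\<^sub>R b)" for x
  proof -
    have "(\<Sum>j\<in>Basis. (c j * (x \<bullet> j)) *\<^sub>R j) = (c b * (x \<bullet> b)) *\<^sub>R b + (\<Sum>j\<in>Basis - {b}. (c j * (x \<bullet> j)) *\<^sub>R j)"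
      by (rule sum.remove[OF finite_Basis b])
    also have "(\<Sum>j\<in>Basis - {b}. (c j * (x \<bullet> j)) *\<^sub>R j) = (1 / a) *\<^sub>R (\<Sum>j\<in>Basis - {b}. (x \<bullet> j) *\<^sub>R j)"
      unfolding scaleR_sum_right by (intro sum.cong refl) (simp add: c_def)
    also have "(\<Sum>j\<in>Basis - {b}. (x \<bullet> j) *\<^sub>R j) = perp b x"
    proof -
      have "x = (x \<bullet> b) *\<^sub>R b + (\<Sum>j\<in>Basis - {b}. (x \<bullet> j) *\<^sub>R j)"
        using sum.remove[OF finite_Basis b, of "\<lambda>j. (x \<bullet> j) *\<^sub>R j"] by (simp only: euclidean_representation)
      then show ?thesis unfolding perp_def by (metis add_diff_cancel_left')
    qed
    finally show ?thesis by (simp add: T_def c_def)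
  qed
  have bb: "b \<bullet> b = 1" using b by simp
  have pb: "perp b x \<bullet> b = 0" for x using bb by (simp add: perp_def inner_diff_left)
  have Tb: "T x \<bullet> b = x \<bullet> b" for x unfolding T1 using t bb pb by (simp add: inner_add_left)
  have Tp: "a *\<^sub>R (perp b (T x) - t) = perp b x" for x
  proof -
    have "perp b (T x) - t = (1 / a) *\<^sub>R perp b x" unfolding perp_def[of b "T x"] Tb unfolding T1 by simp
    then show ?thesis using a by simp
  qed
  have prod: "(\<Prod>j\<in>Basis. \<bar>c j\<bar>) = (1 / a) ^ (DIM('a) - 1)"
  proof -
    have "(\<Prod>j\<in>Basis. \<bar>c j\<bar>) = \<bar>c b\<bar> * (\<Prod>j\<in>Basis - {b}. \<bar>c j\<bar>)" by (rule prod.remove[OF finite_Basis b])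
    also have "(\<Prod>j\<in>Basis - {b}. \<bar>c j\<bar>) = (\<Prod>j\<in>Basis - {b}. 1 / a)" using a by (intro prod.cong refl) (simp add: c_def)
    finally show ?thesis using b by (simp add: c_def)
  qed
  have Tm: "T \<in> borel_measurable borel" unfolding T1[abs_def]
    by (intro borel_measurable_continuous_onI continuous_intros continuous_perp)
  let ?f = "\<lambda>x. indicator {x. 0 \<le> x \<bullet> b \<and> x \<bullet> b \<le> 1} x * \<Phi> (a *\<^sub>R (perp b x - t))"
  have fm: "?f \<in> borel_measurable borel"
  proof -
    have "(\<lambda>x. a *\<^sub>R (perp b x - t)) \<in> borel_measurable borel"
      by (intro borel_measurable_continuous_onI continuous_intros continuous_perp)
    note [measurable] = measurable_compose[OF this P]
    show ?thesis by measurable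
  qed
  have "(\<integral>\<^sup>+x. ?f x \<partial>lborel) = (\<integral>\<^sup>+x. ?f x \<partial>density (distr lborel borel T) (\<lambda>_. ennreal (\<Prod>j\<in>Basis. \<bar>c j\<bar>)))"
    using lborel_affine_euclidean[of c t, OF c0] unfolding T_def[abs_def] by simp
  also have "\<dots> = (\<integral>\<^sup>+x. ennreal (\<Prod>j\<in>Basis. \<bar>c j\<bar>) * ?f x \<partial>distr lborel borel T)"
    using fm by (subst nn_integral_density) simp_all
  also have "\<dots> = (\<integral>\<^sup>+x. ennreal (\<Prod>j\<in>Basis. \<bar>c j\<bar>) * ?f (T x) \<partial>lborel)"
    using fm Tm by (subst nn_integral_distr) simp_all
  also have "\<dots> = (\<integral>\<^sup>+x. ennreal ((1 / a) ^ (DIM('a) - 1)) * (indicator {x. 0 \<le> x \<bullet> b \<and> x \<bullet> b \<le> 1} x * \<Phi> (perp b x)) \<partial>lborel)"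
    unfolding prod Tp by (intro nn_integral_cong) (simp add: indicator_def Tb)
  also have "\<dots> = ennreal ((1 / a) ^ (DIM('a) - 1)) * (\<integral>\<^sup>+x. indicator {x. 0 \<le> x \<bullet> b \<and> x \<bullet> b \<le> 1} x * \<Phi> (perp b x) \<partial>lborel)"
  proof (rule nn_integral_cmult)
    note [measurable] = measurable_compose[OF measurable_perp P]
    show "(\<lambda>x. indicator {x. 0 \<le> x \<bullet> b \<and> x \<bullet> b \<le> 1} x * \<Phi> (perp b x)) \<in> borel_measurable lborel" by measurable
  qed
  finally show ?thesis .
qed

text \<open>Boundary integrals under blow-up.\<close>

lemma boundary_blowup_lower:
  fixes \<Omega> :: "'a::euclidean_space set" and \<Phi> :: "'a \<Rightarrow> real" and \<Theta> :: "real \<Rightarrow> 'a \<Rightarrow> real"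
  assumes n: "DIM('a) \<ge> 2" and dom: "bounded_C1_domain \<Omega>" and x0: "x0 \<in> frontier \<Omega>"
    and b: "outer_normal \<Omega> x0 = b" "b \<in> Basis"
    and P: "continuous_on UNIV \<Phi>" "\<And>y. 0 \<le> \<Phi> y" and R0: "R0 > 0" "\<And>y. R0 < norm y \<Longrightarrow> \<Phi> y = 0"
    and Tm: "\<And>a. a > 0 \<Longrightarrow> integrable (surface_measure \<Omega>) (\<Theta> a)" and T0: "\<And>a x. 0 \<le> \<Theta> a x"
    and near: "\<And>\<eta>. \<eta> > 0 \<Longrightarrow> \<forall>\<^sub>F a in at_top. \<forall>x\<in>frontier \<Omega>. norm (x - x0) \<le> (R0 + 1) / a \<longrightarrow> 
       \<Phi> (perp b (a *\<^sub>R (x - x0))) - \<eta> \<le> \<Theta> a x"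
    and eps: "\<epsilon> > 0"
  shows "\<forall>\<^sub>F a in at_top. (\<integral>y. indicator {x. 0 \<le> x \<bullet> b \<and> x \<bullet> b \<le> 1} y * \<Phi> (perp b y) \<partial>lborel) - \<epsilon> \<le> 
      a ^ (DIM('a) - 1) * (\<integral>x. \<Theta> a x \<partial>surface_measure \<Omega>)"
proof -
  let ?n = "DIM('a) - 1" and ?S = "surface_measure \<Omega>" and ?I = "{x. 0 \<le> x \<bullet> b \<and> x \<bullet> b \<le> 1}"
  interpret fin: finite_measure ?S by (rule finite_surface_measure[OF n dom])
  have nb: "norm b = 1" using b(2) by simp
  have bb: "b \<bullet> b = 1" using b(2) by simp
  have pb: "perp b x \<bullet> b = 0" for x using bb by (simp add: perp_def inner_diff_left)
  have IB: "?I \<in> sets borel" by measurable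
  have Phb: "\<Phi> \<in> borel_measurable borel" by (rule borel_measurable_continuous_onI[OF P(1)])
  define E where "E = (\<integral>y. indicator ?I y * \<Phi> (perp b y) \<partial>lborel)"
  have Ei: "integrable lborel (\<lambda>y. indicator ?I y * \<Phi> (perp b y))"
  proof -
    have c: "compact {y. norm (perp b y) \<le> R0 \<and> \<bar>y \<bullet> b\<bar> \<le> 1}"
    proof -
      have "closed {y. norm (perp b y) \<le> R0 \<and> \<bar>y \<bullet> b\<bar> \<le> 1}"
        by (intro closed_Collect_conj closed_Collect_le continuous_intros continuous_perp)
      moreover have "norm y \<le> R0 + 1" if "norm (perp b y) \<le> R0" "\<bar>y \<bullet> b\<bar> \<le> 1" for y
      proof -
        have "y = perp b y + (y \<bullet> b) *\<^sub>R b" by (simp add: perp_def)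
        then have "norm y \<le> norm (perp b y) + \<bar>y \<bullet> b\<bar>" using nb norm_triangle_ineq[of "perp b y" "(y \<bullet> b) *\<^sub>R b"] by simp
        then show ?thesis using that by linarith
      qed
      then have "bounded {y. norm (perp b y) \<le> R0 \<and> \<bar>y \<bullet> b\<bar> \<le> 1}" unfolding bounded_iff by blast
      ultimately show ?thesis by (simp add: compact_eq_bounded_closed)
    qed
    have cP: "continuous_on UNIV (\<lambda>y. \<Phi> (perp b y))" by (rule continuous_on_compose2[OF P(1) continuous_perp]) simp
    have i: "integrable lborel (\<lambda>y. indicator {y. norm (perp b y) \<le> R0 \<and> \<bar>y \<bullet> b\<bar> \<le> 1} y *\<^sub>R \<Phi> (perp b y))"
      by (rule borel_integrable_compact[OF c continuous_on_subset[OF cP subset_UNIV]])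
    have "(\<lambda>y. indicator ?I y * \<Phi> (perp b y)) = (\<lambda>y. indicator ?I y *\<^sub>R (indicator {y. norm (perp b y) \<le> R0 \<and> \<bar>y \<bullet> b\<bar> \<le> 1} y *\<^sub>R \<Phi> (perp b y)))"
    proof (rule ext)
      fix y
      show "indicator ?I y * \<Phi> (perp b y) = indicator ?I y *\<^sub>R (indicator {y. norm (perp b y) \<le> R0 \<and> \<bar>y \<bullet> b\<bar> \<le> 1} y *\<^sub>R \<Phi> (perp b y))"
      proof (cases "R0 < norm (perp b y)")
        case True then show ?thesis using R0(2)[OF True] by simp
      next
        case False then show ?thesis by (simp add: indicator_def)
      qed
    qed
    then show ?thesis using integrable_mult_indicator[OF _ i, of ?I] IB by simp
  qed
  obtain \<rho> C where rho: "\<rho> > 0" "C > 0" 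
    and gr: "\<And>r. 0 < r \<Longrightarrow> r \<le> \<rho> \<Longrightarrow> hausdorff_outer ?n (frontier \<Omega> \<inter> cball x0 r) \<le> ennreal (C * r ^ ?n)"
    using boundary_growth[OF n dom x0] by metis
  define D where "D = C * (R0 + 1) ^ ?n"
  have D: "D > 0" using rho R0 by (simp add: D_def)
  define \<eta> where "\<eta> = \<epsilon> / D"
  have eta: "\<eta> > 0" using eps D by (simp add: \<eta>_def)
  define \<delta> where "\<delta> = 1 / (2 * (R0 + 1))"
  have del: "\<delta> > 0" using R0 by (simp add: \<delta>_def)
  obtain r where r: "r > 0" and cross: "\<And>z s. z \<bullet> b = 0 \<Longrightarrow> \<delta> * (norm z + s) < s \<Longrightarrow> norm z + s < r \<Longrightarrow> 0 < s \<Longrightarrow>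
     (\<exists>t. \<bar>t\<bar> \<le> s \<and> x0 + z + t *\<^sub>R b \<in> frontier \<Omega>)"
    using frontier_crossing[OF dom x0 b(1) del] by blast
  have ev: "\<forall>\<^sub>F a in at_top. (0::real) < a \<and> (R0 + 1) / a \<le> \<rho> \<and> (R0 + 1) / a < r"
  proof -
    have "\<forall>\<^sub>F a in at_top. (R0 + 1) / a < min \<rho> r"
      by (rule order_tendstoD(2)[of _ 0]) (use rho r in \<open>auto intro!: tendsto_divide_0[OF tendsto_const] filterlim_at_top_imp_at_infinity filterlim_ident\<close>)
    then show ?thesis using eventually_gt_at_top[of 0] by eventually_elim auto
  qed
  show ?thesis using ev near[OF eta]
  proof eventually_elim
    fix a :: real
    assume a: "0 < a \<and> (R0 + 1) / a \<le> \<rho> \<and> (R0 + 1) / a < r"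
      and nr: "\<forall>x\<in>frontier \<Omega>. norm (x - x0) \<le> (R0 + 1) / a \<longrightarrow> \<Phi> (perp b (a *\<^sub>R (x - x0))) - \<eta> \<le> \<Theta> a x"
    have a0: "a > 0" using a by simp
    define G where "G = frontier \<Omega> \<inter> cball x0 ((R0 + 1) / a)"
    have GB: "G \<in> sets borel" "G \<subseteq> frontier \<Omega>" unfolding G_def by (intro borel_closed closed_Int frontier_closed closed_cball) simp
    have GS: "G \<in> sets ?S" unfolding sets_surface_measure sets_restrict_space using GB by blast
    have mG: "measure ?S G \<le> D / a ^ ?n"
    proof -
      have "emeasure ?S G = hausdorff_outer ?n G" by (rule emeasure_surface_measure[OF n GB])
      also have "\<dots> \<le> ennreal (C * ((R0 + 1) / a) ^ ?n)" unfolding G_def using a a0 R0 by (intro gr) simp_all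
      also have "C * ((R0 + 1) / a) ^ ?n = D / a ^ ?n" by (simp add: D_def power_divide)
      finally have "ennreal (measure ?S G) \<le> ennreal (D / a ^ ?n)" by (simp add: fin.emeasure_eq_measure)
      then show ?thesis using D a0 by simp
    qed
    define \<Psi> where "\<Psi> x = \<Phi> (a *\<^sub>R (x - perp b x0))" for x
    have Psb: "\<Psi> \<in> borel_measurable borel" unfolding \<Psi>_def[abs_def]
      by (intro borel_measurable_continuous_onI continuous_on_compose2[OF P(1)] continuous_intros) simp
    have Pp: "\<Phi> (perp b (a *\<^sub>R (x - x0))) = \<Psi> (perp b x)" for x unfolding \<Psi>_def perp_scale perp_diff ..
    have Psb': "(\<lambda>x. \<Psi> (perp b x)) \<in> borel_measurable ?S" by (intro measurable_surface_borel measurable_compose[OF measurable_perp Psb])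
    have indG: "(indicator G :: 'a \<Rightarrow> real) \<in> borel_measurable ?S" by (rule borel_measurable_indicator[OF GS])
    obtain B where B: "\<And>x. \<bar>\<Phi> x\<bar> \<le> B"
    proof -
      have "bounded (\<Phi> ` cball 0 R0)" by (intro compact_imp_bounded compact_continuous_image compact_cball continuous_on_subset[OF P(1)]) simp
      then obtain B where "\<And>x. x \<in> cball 0 R0 \<Longrightarrow> norm (\<Phi> x) \<le> B" unfolding bounded_iff by (metis imageI)
      then have "\<bar>\<Phi> x\<bar> \<le> max B 0" for x using R0(2)[of x] by (cases "R0 < norm x") (auto simp: max.coboundedI1)
      then show thesis by (rule that)
    qed
    have iP: "integrable ?S (\<lambda>x. indicator G x * \<Psi> (perp b x))"
      by (rule integrable_surface_bounded[OF n dom borel_measurable_times[OF indG Psb'], where B=B])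
        (use B order_trans[OF abs_ge_zero B] in \<open>simp add: indicator_def \<Psi>_def\<close>)
    have iG: "integrable ?S (\<lambda>x. \<eta> * indicator G x)"
      by (rule integrable_surface_bounded[OF n dom borel_measurable_times[OF borel_measurable_const indG], where B=\<eta>])
        (use eta in \<open>simp add: indicator_def\<close>)
    have low: "(\<integral>x. indicator G x * \<Psi> (perp b x) \<partial>?S) - \<eta> * measure ?S G \<le> (\<integral>x. \<Theta> a x \<partial>?S)"
    proof -
      have "(\<integral>x. indicator G x * \<Psi> (perp b x) \<partial>?S) - \<eta> * measure ?S G = (\<integral>x. indicator G x * \<Psi> (perp b x) - \<eta> * indicator G x \<partial>?S)"
        using GS Int_absorb2[OF GB(2)] by (subst Bochner_Integration.integral_diff[OF iP iG]) simp
      also have "\<dots> \<le> (\<integral>x. \<Theta> a x \<partial>?S)"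
      proof (rule integral_mono[OF Bochner_Integration.integrable_diff[OF iP iG] Tm[OF a0]])
        fix x assume "x \<in> space ?S"
        then have xf: "x \<in> frontier \<Omega>" by simp
        show "indicator G x * \<Psi> (perp b x) - \<eta> * indicator G x \<le> \<Theta> a x"
        proof (cases "x \<in> G")
          case True
          then have "norm (x - x0) \<le> (R0 + 1) / a" by (simp add: G_def dist_norm norm_minus_commute)
          then show ?thesis using nr xf True unfolding Pp by simp
        next
          case False then show ?thesis using T0 by simp
        qed
      qed
      finally show ?thesis .
    qed
    define Z where "Z = cball (perp b x0) (R0 / a)"
    have cov: "perp b x \<in> perp b ` G" if x: "perp b x \<in> Z" for x
    proof -
      define z where "z = perp b x - perp b x0"
      have z: "z \<bullet> b = 0" "norm z \<le> R0 / a" using x pb by (simp_all add: z_def inner_diff_left Z_def dist_norm norm_minus_commute)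
      have s1: "norm z + 1 / a \<le> (R0 + 1) / a" using z(2) by (simp add: add_divide_distrib)
      have "\<delta> * (norm z + 1 / a) \<le> \<delta> * ((R0 + 1) / a)" using s1 del by (intro mult_left_mono) simp_all
      also have "\<delta> * ((R0 + 1) / a) = (\<delta> * (R0 + 1)) / a" by (rule times_divide_eq_right)
      also have "\<delta> * (R0 + 1) = 1 / 2" using R0(1) by (simp add: \<delta>_def field_simps)
      also have "1 / 2 / a = 1 / (2 * a)" by simp
      also have "\<dots> < 1 / a" using a0 by (simp add: field_simps)
      finally have s2: "\<delta> * (norm z + 1 / a) < 1 / a" .
      obtain t where t: "\<bar>t\<bar> \<le> 1 / a" "x0 + z + t *\<^sub>R b \<in> frontier \<Omega>"
        using cross[OF z(1) s2] s1 a a0 by force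
      have "norm (z + t *\<^sub>R b) \<le> norm z + \<bar>t\<bar>" using norm_triangle_ineq[of z "t *\<^sub>R b"] nb by simp
      then have "norm (z + t *\<^sub>R b) \<le> (R0 + 1) / a" using s1 t(1) by linarith
      moreover have "dist (x0 + z + t *\<^sub>R b) x0 = norm (z + t *\<^sub>R b)" by (simp add: dist_norm add.assoc)
      ultimately have "x0 + z + t *\<^sub>R b \<in> G" using t(2) unfolding G_def Int_iff mem_cball dist_commute[of x0] by simp
      moreover have "perp b (x0 + z + t *\<^sub>R b) = perp b x"
      proof -
        have "perp b z = z" using z(1) by (simp add: perp_def)
        then show ?thesis unfolding perp_add perp_self[OF nb] z_def by simp
      qed
      ultimately show ?thesis by (metis imageI)
    qed
    have EP: "ennreal ((1 / a) ^ ?n * E) \<le> ennreal (\<integral>x. indicator G x * \<Psi> (perp b x) \<partial>?S)"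
    proof -
      have Pe: "(\<lambda>x. ennreal (\<Phi> x)) \<in> borel_measurable borel" using Phb by measurable
      have Pse: "(\<lambda>x. ennreal (\<Psi> x)) \<in> borel_measurable borel" using Psb by measurable
      have E0: "0 \<le> E" unfolding E_def using P(2) by (intro integral_nonneg_AE AE_I2) simp
      have "ennreal E = (\<integral>\<^sup>+x. ennreal (indicator ?I x * \<Phi> (perp b x)) \<partial>lborel)"
        unfolding E_def by (rule nn_integral_eq_integral[OF Ei, symmetric]) (use P(2) in \<open>auto intro!: AE_I2\<close>)
      also have "\<dots> = (\<integral>\<^sup>+x. indicator ?I x * ennreal (\<Phi> (perp b x)) \<partial>lborel)"
        by (intro nn_integral_cong) (simp add: indicator_def)
      finally have EE: "ennreal E = (\<integral>\<^sup>+x. indicator ?I x * ennreal (\<Phi> (perp b x)) \<partial>lborel)" .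
      have "ennreal ((1 / a) ^ ?n * E) = ennreal ((1 / a) ^ ?n) * ennreal E" using a0 by (intro ennreal_mult') simp
      also have "\<dots> = (\<integral>\<^sup>+x. indicator ?I x * ennreal (\<Phi> (a *\<^sub>R (perp b x - perp b x0))) \<partial>lborel)"
        unfolding EE by (rule slab_scaling[OF b(2) a0 Pe pb, symmetric])
      also have "\<dots> \<le> (\<integral>\<^sup>+x. indicator {x. 0 \<le> x \<bullet> b \<and> x \<bullet> b \<le> 1 \<and> perp b x \<in> Z} x * ennreal (\<Psi> (perp b x)) \<partial>lborel)"
      proof (rule nn_integral_mono)
        fix x
        show "indicator ?I x * ennreal (\<Phi> (a *\<^sub>R (perp b x - perp b x0))) \<le>
           indicator {x. 0 \<le> x \<bullet> b \<and> x \<bullet> b \<le> 1 \<and> perp b x \<in> Z} x * ennreal (\<Psi> (perp b x))"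
        proof (cases "perp b x \<in> Z")
          case True then show ?thesis by (simp add: indicator_def \<Psi>_def)
        next
          case False
          then have "R0 / a < norm (perp b x - perp b x0)" by (simp add: Z_def dist_norm norm_minus_commute)
          then have "R0 < norm (a *\<^sub>R (perp b x - perp b x0))" using a0 by (simp add: pos_divide_less_eq mult.commute)
          then show ?thesis using R0(2) by simp
        qed
      qed
      also have "\<dots> \<le> (\<integral>\<^sup>+x. indicator G x * ennreal (\<Psi> (perp b x)) \<partial>?S)"
        by (rule surface_ge_projection[OF n b(2) GB _ cov Pse]) (simp_all add: Z_def)
      also have "\<dots> = (\<integral>\<^sup>+x. ennreal (indicator G x * \<Psi> (perp b x)) \<partial>?S)"
        by (intro nn_integral_cong) (simp add: indicator_def)
      also have "\<dots> = ennreal (\<integral>x. indicator G x * \<Psi> (perp b x) \<partial>?S)"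
        by (rule nn_integral_eq_integral[OF iP]) (use P(2) in \<open>auto intro!: AE_I2 simp: \<Psi>_def\<close>)
      finally show ?thesis .
    qed
    have pos: "0 \<le> (\<integral>x. indicator G x * \<Psi> (perp b x) \<partial>?S)"
      by (rule integral_nonneg_AE) (use P(2) in \<open>auto intro!: AE_I2 simp: \<Psi>_def\<close>)
    have EPr: "(1 / a) ^ ?n * E \<le> (\<integral>x. indicator G x * \<Psi> (perp b x) \<partial>?S)" using EP pos by simp
    have an: "a ^ ?n > 0" using a0 by simp
    have "\<eta> * measure ?S G \<le> \<eta> * (D / a ^ ?n)" using mG eta by (intro mult_left_mono) simp_all
    also have "\<dots> = \<epsilon> / a ^ ?n" using D by (simp add: \<eta>_def)
    finally have "(1 / a) ^ ?n * E - \<epsilon> / a ^ ?n \<le> (\<integral>x. \<Theta> a x \<partial>?S)" using low EPr by linarith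
    then have "a ^ ?n * ((1 / a) ^ ?n * E - \<epsilon> / a ^ ?n) \<le> a ^ ?n * (\<integral>x. \<Theta> a x \<partial>?S)"
      using an by (intro mult_left_mono) simp_all
    moreover have "a ^ ?n * ((1 / a) ^ ?n * E - \<epsilon> / a ^ ?n) = E - \<epsilon>"
    proof -
      have "(1 / a) ^ ?n = 1 / a ^ ?n" by (simp only: power_divide power_one)
      moreover have "p * (1 / p * E - \<epsilon> / p) = E - \<epsilon>" if "p > 0" for p :: real using that by (simp add: right_diff_distrib)
      ultimately show ?thesis using an by metis
    qed
    ultimately show "(\<integral>y. indicator ?I y * \<Phi> (perp b y) \<partial>lborel) - \<epsilon> \<le> a ^ ?n * (\<integral>x. \<Theta> a x \<partial>?S)"
      unfolding E_def by linarith
  qed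
qed

lemma boundary_blowup_upper:
  fixes \<Omega> :: "'a::euclidean_space set" and \<Theta> :: "real \<Rightarrow> 'a \<Rightarrow> real"
  assumes n: "DIM('a) \<ge> 2" and dom: "bounded_C1_domain \<Omega>" and x0: "x0 \<in> frontier \<Omega>" and R: "R > 0"
    and Tm: "\<And>a. a > 0 \<Longrightarrow> integrable (surface_measure \<Omega>) (\<Theta> a)" and B: "\<And>a x. x \<in> frontier \<Omega> \<Longrightarrow> \<bar>\<Theta> a x\<bar> \<le> B"
    and z: "\<And>a x. a > 0 \<Longrightarrow> R / a < norm (x - x0) \<Longrightarrow> \<Theta> a x = 0"
  shows "\<exists>D\<ge>0. \<forall>\<^sub>F a in at_top. a ^ (DIM('a) - 1) * (\<integral>x. \<Theta> a x \<partial>surface_measure \<Omega>) \<le> D"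
proof -
  let ?n = "DIM('a) - 1" and ?S = "surface_measure \<Omega>"
  interpret fin: finite_measure ?S by (rule finite_surface_measure[OF n dom])
  have B0: "B \<ge> 0" using B[OF x0, of 0] by linarith
  obtain \<rho> C where rho: "\<rho> > 0" "C > 0" 
    and gr: "\<And>r. 0 < r \<Longrightarrow> r \<le> \<rho> \<Longrightarrow> hausdorff_outer ?n (frontier \<Omega> \<inter> cball x0 r) \<le> ennreal (C * r ^ ?n)"
    using boundary_growth[OF n dom x0] by metis
  have ev: "\<forall>\<^sub>F a in at_top. (0::real) < a \<and> R / a \<le> \<rho>"
  proof -
    have "\<forall>\<^sub>F a in at_top. R / a < \<rho>"
      by (rule order_tendstoD(2)[of _ 0]) (use rho in \<open>auto intro!: tendsto_divide_0[OF tendsto_const] filterlim_at_top_imp_at_infinity filterlim_ident\<close>)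
    then show ?thesis using eventually_gt_at_top[of 0] by eventually_elim auto
  qed
  have "\<forall>\<^sub>F a in at_top. a ^ ?n * (\<integral>x. \<Theta> a x \<partial>?S) \<le> B * (C * R ^ ?n)"
    using ev
  proof eventually_elim
    fix a :: real assume a: "0 < a \<and> R / a \<le> \<rho>"
    define G where "G = frontier \<Omega> \<inter> cball x0 (R / a)"
    have GB: "G \<in> sets borel" "G \<subseteq> frontier \<Omega>" unfolding G_def by (intro borel_closed closed_Int frontier_closed closed_cball) simp
    have GS: "G \<in> sets ?S" unfolding sets_surface_measure sets_restrict_space using GB by blast
    have an: "a ^ ?n > 0" using a by simp
    have mG: "measure ?S G \<le> C * R ^ ?n / a ^ ?n"
    proof -
      have "emeasure ?S G = hausdorff_outer ?n G" by (rule emeasure_surface_measure[OF n GB])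
      also have "\<dots> \<le> ennreal (C * (R / a) ^ ?n)" unfolding G_def using a R by (intro gr) simp_all
      also have "C * (R / a) ^ ?n = C * R ^ ?n / a ^ ?n" by (simp add: power_divide)
      finally have "ennreal (measure ?S G) \<le> ennreal (C * R ^ ?n / a ^ ?n)" by (simp add: fin.emeasure_eq_measure)
      then show ?thesis using rho R an by simp
    qed
    have iG: "integrable ?S (\<lambda>x. B * indicator G x)"
      by (rule integrable_surface_bounded[OF n dom borel_measurable_times[OF borel_measurable_const borel_measurable_indicator[OF GS]], where B=B])
        (use B0 in \<open>simp add: indicator_def\<close>)
    have "(\<integral>x. \<Theta> a x \<partial>?S) \<le> (\<integral>x. B * indicator G x \<partial>?S)"
    proof (rule integral_mono[OF Tm iG])
      fix x assume "x \<in> space ?S"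
      then have xf: "x \<in> frontier \<Omega>" by simp
      show "\<Theta> a x \<le> B * indicator G x"
      proof (cases "x \<in> G")
        case True then show ?thesis using B[OF xf, of a] by simp
      next
        case False
        then have "R / a < norm (x - x0)" using xf by (simp add: G_def dist_norm norm_minus_commute)
        then show ?thesis using z a False by simp
      qed
    qed (use a in simp)
    also have "\<dots> = B * measure ?S G" using GS Int_absorb2[OF GB(2)] by simp
    also have "\<dots> \<le> B * (C * R ^ ?n / a ^ ?n)" using mG B0 by (rule mult_left_mono)
    finally have "a ^ ?n * (\<integral>x. \<Theta> a x \<partial>?S) \<le> a ^ ?n * (B * (C * R ^ ?n / a ^ ?n))" using an by (intro mult_left_mono) simp_all
    moreover have "p * (B * (q / p)) = B * q" if "p > 0" for p q :: real using that by simp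
    ultimately show "a ^ ?n * (\<integral>x. \<Theta> a x \<partial>?S) \<le> B * (C * R ^ ?n)" using an by metis
  qed
  then show ?thesis using B0 rho R by (intro exI[of _ "B * (C * R ^ ?n)"]) simp
qed

(*T12*)
lemma grad_dilate: "smooth F \<Longrightarrow> grad (\<lambda>x. F (a *\<^sub>R (x - x0))) x = a *\<^sub>R grad F (a *\<^sub>R (x - x0))"
  unfolding grad_def by (simp add: pd_dilate scaleR_sum_right)

lemma bending_dilate:
  assumes F: "smooth F"
  shows "bending \<sigma> (\<lambda>x. F (a *\<^sub>R (x - x0))) x = a ^ 4 * bending \<sigma> F (a *\<^sub>R (x - x0))"
proof -
  have p: "pd i (pd j (\<lambda>x. F (a *\<^sub>R (x - x0)))) x = a\<^sup>2 * pd i (pd j F) (a *\<^sub>R (x - x0))" if j: "j \<in> Basis" for i j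
  proof -
    have "pd j (\<lambda>x. F (a *\<^sub>R (x - x0))) = (\<lambda>x. a * pd j F (a *\<^sub>R (x - x0)))" by (rule ext) (rule pd_dilate[OF F])
    then have "pd i (pd j (\<lambda>x. F (a *\<^sub>R (x - x0)))) x = pd i (\<lambda>x. a * pd j F (a *\<^sub>R (x - x0))) x" by simp
    also have "\<dots> = a * pd i (\<lambda>x. pd j F (a *\<^sub>R (x - x0))) x" by (rule pd_cmult[OF smooth_dilate[OF smooth_pd[OF F j]]])
    also have "\<dots> = a * (a * pd i (pd j F) (a *\<^sub>R (x - x0)))" by (simp only: pd_dilate[OF smooth_pd[OF F j]])
    finally show ?thesis by (simp add: power2_eq_square)
  qed
  have a4: "(a\<^sup>2 * z)\<^sup>2 = a ^ 4 * z\<^sup>2" for z :: real by (simp add: power_mult_distrib flip: power_mult)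
  have 1: "(\<Sum>i\<in>Basis. \<Sum>j\<in>Basis. (pd i (pd j (\<lambda>x. F (a *\<^sub>R (x - x0)))) x)\<^sup>2) = a ^ 4 * (\<Sum>i\<in>Basis. \<Sum>j\<in>Basis. (pd i (pd j F) (a *\<^sub>R (x - x0)))\<^sup>2)"
    unfolding sum_distrib_left by (intro sum.cong refl) (simp only: p a4)
  have "(\<Sum>i\<in>Basis. pd i (pd i (\<lambda>x. F (a *\<^sub>R (x - x0)))) x) = a\<^sup>2 * (\<Sum>i\<in>Basis. pd i (pd i F) (a *\<^sub>R (x - x0)))"
    unfolding sum_distrib_left by (intro sum.cong refl) (simp only: p)
  then have 2: "(\<Sum>i\<in>Basis. pd i (pd i (\<lambda>x. F (a *\<^sub>R (x - x0)))) x)\<^sup>2 = a ^ 4 * (\<Sum>i\<in>Basis. pd i (pd i F) (a *\<^sub>R (x - x0)))\<^sup>2"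
    by (simp only: a4)
  show ?thesis unfolding bending_def 1 2 by (simp add: distrib_left mult.left_commute)
qed

lemma Qform_dilate:
  fixes \<Omega> :: "'a::euclidean_space set"
  assumes n: "DIM('a) \<ge> 2" and dom: "bounded_C1_domain \<Omega>" and F: "smooth F"
  shows "Qform \<Omega> \<sigma> \<alpha> \<beta> \<gamma> (\<lambda>x. F (a *\<^sub>R (x - x0))) (\<lambda>x. F (a *\<^sub>R (x - x0))) =
     a ^ 4 * (\<integral>x. bending \<sigma> F (a *\<^sub>R (x - x0)) \<partial>lebesgue_on \<Omega>) 
     + \<alpha> * (a\<^sup>2 * (\<integral>x. (norm (grad F (a *\<^sub>R (x - x0))))\<^sup>2 \<partial>lebesgue_on \<Omega>))
     + \<beta> * (a\<^sup>2 * (\<integral>x. (grad F (a *\<^sub>R (x - x0)) \<bullet> outer_normal \<Omega> x)\<^sup>2 \<partial>surface_measure \<Omega>))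
     + \<gamma> * (\<integral>x. (F (a *\<^sub>R (x - x0)))\<^sup>2 \<partial>surface_measure \<Omega>)"
  unfolding Qform_smooth[OF n dom smooth_dilate[OF F]] bending_dilate[OF F] grad_dilate[OF F]
  by (simp add: power_mult_distrib)

text \<open>Profiles: smooth functions supported in a ball.\<close>

definition profile :: "('a::euclidean_space \<Rightarrow> real) \<Rightarrow> real \<Rightarrow> bool" where
  "profile F R \<longleftrightarrow> smooth F \<and> R > 0 \<and> (\<forall>y. R < norm y \<longrightarrow> F y = 0)"

lemma profileD:
  assumes "profile F R"
  shows "smooth F" "R > 0" "R < norm y \<Longrightarrow> F y = 0" "R < norm y \<Longrightarrow> pd b F y = 0"
    "R < norm y \<Longrightarrow> grad F y = 0" "R < norm y \<Longrightarrow> bending \<sigma> F y = 0"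
proof -
  show 1: "smooth F" "R > 0" and 2: "\<And>y. R < norm y \<Longrightarrow> F y = 0" using assms unfolding profile_def by blast+
  have o: "F y = 0" if "y \<notin> cball 0 R" for y using 2 that by simp
  have p: "pd b F y = 0" if "R < norm y" for b y
    by (rule pd_zero_off_closed[of "cball 0 R", OF closed_cball o]) (use that in simp_all)
  have o2: "pd b F y = 0" if "y \<notin> cball 0 R" for b y using p that by simp
  have pp: "pd a (pd b F) y = 0" if "R < norm y" for a b y
    by (rule pd_zero_off_closed[of "cball 0 R", OF closed_cball o2]) (use that in simp_all)
  show "R < norm y \<Longrightarrow> pd b F y = 0" "R < norm y \<Longrightarrow> grad F y = 0" "R < norm y \<Longrightarrow> bending \<sigma> F y = 0"
    using p pp by (simp_all add: grad_def bending_def)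
qed

lemma eventually_div_small: "c > (0::real) \<Longrightarrow> \<forall>\<^sub>F a in at_top. 0 < a \<and> R / a < c"
proof -
  assume c: "c > 0"
  have "\<forall>\<^sub>F a in at_top. R / a < c"
    by (rule order_tendstoD(2)[of _ 0]) (use c in \<open>auto intro!: tendsto_divide_0[OF tendsto_const] filterlim_at_top_imp_at_infinity filterlim_ident\<close>)
  then show ?thesis using eventually_gt_at_top[of 0] by eventually_elim auto
qed

lemma interior_blowup:
  fixes \<Omega> :: "'a::euclidean_space set"
  assumes n: "DIM('a) \<ge> 2" and dom: "bounded_C1_domain \<Omega>" and x0: "x0 \<in> \<Omega>" and P: "profile F R"
    and J: "(\<integral>y. bending \<sigma> F y \<partial>lborel) - (\<integral>y. (norm (grad F y))\<^sup>2 \<partial>lborel) < - c * (\<integral>y. (F y)\<^sup>2 \<partial>lborel)"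
    and M: "0 < (\<integral>y. (F y)\<^sup>2 \<partial>lborel)"
  shows "\<forall>\<^sub>F a in at_top. (\<integral>x. (F (a *\<^sub>R (x - x0)))\<^sup>2 \<partial>lebesgue_on \<Omega>) > 0 \<and>
     (\<forall>\<beta> \<gamma>. Qform \<Omega> \<sigma> (- a\<^sup>2) \<beta> \<gamma> (\<lambda>x. F (a *\<^sub>R (x - x0))) (\<lambda>x. F (a *\<^sub>R (x - x0)))
        \<le> - (c * a ^ 4) * (\<integral>x. (F (a *\<^sub>R (x - x0)))\<^sup>2 \<partial>lebesgue_on \<Omega>))"
proof -
  let ?d = "DIM('a)" let ?L = "lebesgue_on \<Omega>"
  note O = bounded_C1_domainD(2)[OF dom] and F = profileD(1)[OF P]
  note vl = volume_blowup_limit[OF O, of UNIV x0, OF _ AE_I2[OF blowup_interior[OF O x0]] _ compact_cball, of _ 0 R]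
  have l4: "((\<lambda>a. a ^ ?d * (\<integral>x. bending \<sigma> F (a *\<^sub>R (x - x0)) \<partial>?L)) \<longlongrightarrow> (\<integral>y. bending \<sigma> F y \<partial>lborel)) at_top"
    using vl[of "bending \<sigma> F"] continuous_bending[OF F] profileD(6)[OF P] by simp
  have l2: "((\<lambda>a. a ^ ?d * (\<integral>x. (norm (grad F (a *\<^sub>R (x - x0))))\<^sup>2 \<partial>?L)) \<longlongrightarrow> (\<integral>y. (norm (grad F y))\<^sup>2 \<partial>lborel)) at_top"
    using vl[of "\<lambda>y. (norm (grad F y))\<^sup>2"] continuous_grad[OF F] profileD(5)[OF P] by (simp add: continuous_intros)
  have l0: "((\<lambda>a. a ^ ?d * (\<integral>x. (F (a *\<^sub>R (x - x0)))\<^sup>2 \<partial>?L)) \<longlongrightarrow> (\<integral>y. (F y)\<^sup>2 \<partial>lborel)) at_top"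
    using vl[of "\<lambda>y. (F y)\<^sup>2"] smooth_continuous[OF F] profileD(3)[OF P] by (simp add: continuous_intros)
  have lim: "((\<lambda>a. a ^ ?d * (\<integral>x. bending \<sigma> F (a *\<^sub>R (x - x0)) \<partial>?L) - a ^ ?d * (\<integral>x. (norm (grad F (a *\<^sub>R (x - x0))))\<^sup>2 \<partial>?L)
     + c * (a ^ ?d * (\<integral>x. (F (a *\<^sub>R (x - x0)))\<^sup>2 \<partial>?L))) \<longlongrightarrow> 
     (\<integral>y. bending \<sigma> F y \<partial>lborel) - (\<integral>y. (norm (grad F y))\<^sup>2 \<partial>lborel) + c * (\<integral>y. (F y)\<^sup>2 \<partial>lborel)) at_top"
    by (intro tendsto_intros l4 l2 l0)
  have neg: "(\<integral>y. bending \<sigma> F y \<partial>lborel) - (\<integral>y. (norm (grad F y))\<^sup>2 \<partial>lborel) + c * (\<integral>y. (F y)\<^sup>2 \<partial>lborel) < 0" using J by linarith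
  obtain r where r: "r > 0" "cball x0 r \<subseteq> \<Omega>" using O x0 open_contains_cball by blast
  show ?thesis using order_tendstoD(2)[OF lim neg] order_tendstoD(1)[OF l0 M] eventually_div_small[OF r(1), of R]
  proof eventually_elim
    fix a :: real
    let ?V4 = "\<integral>x. bending \<sigma> F (a *\<^sub>R (x - x0)) \<partial>?L" and ?V2 = "\<integral>x. (norm (grad F (a *\<^sub>R (x - x0))))\<^sup>2 \<partial>?L"
      and ?m = "\<integral>x. (F (a *\<^sub>R (x - x0)))\<^sup>2 \<partial>?L"
    assume l: "a ^ ?d * ?V4 - a ^ ?d * ?V2 + c * (a ^ ?d * ?m) < 0" and m: "0 < a ^ ?d * ?m" and a: "0 < a \<and> R / a < r"
    have ad: "a ^ ?d > 0" using a by simp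
    have off: "R < norm (a *\<^sub>R (x - x0))" if "x \<in> frontier \<Omega>" for x
    proof -
      have "x \<notin> \<Omega>" using that O by (simp add: frontier_def interior_open)
      then have "x \<notin> cball x0 r" using r(2) by blast
      then have "r < norm (x - x0)" by (simp add: dist_norm norm_minus_commute)
      then have "R / a < norm (x - x0)" using a by linarith
      then show ?thesis using a by (simp add: pos_divide_less_eq mult.commute)
    qed
    have s1: "(\<integral>x. (grad F (a *\<^sub>R (x - x0)) \<bullet> outer_normal \<Omega> x)\<^sup>2 \<partial>surface_measure \<Omega>) = (\<integral>x. 0 \<partial>surface_measure \<Omega>)"
      by (intro Bochner_Integration.integral_cong refl) (simp add: profileD(5)[OF P off])
    have s0: "(\<integral>x. (F (a *\<^sub>R (x - x0)))\<^sup>2 \<partial>surface_measure \<Omega>) = (\<integral>x. 0 \<partial>surface_measure \<Omega>)"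
      by (intro Bochner_Integration.integral_cong refl) (simp add: profileD(3)[OF P off])
    have "a ^ ?d * (?V4 - ?V2 + c * ?m) < 0" using l by (simp add: algebra_simps)
    then have k: "?V4 - ?V2 + c * ?m < 0" using ad a by (auto simp: mult_less_0_iff)
    have "a ^ 4 * (?V4 - ?V2 + c * ?m) \<le> 0" using k a by (intro mult_nonneg_nonpos) simp_all
    then have k2: "a ^ 4 * ?V4 + (- a\<^sup>2) * (a\<^sup>2 * ?V2) \<le> - (c * a ^ 4) * ?m"
      by (simp add: algebra_simps power2_eq_square power4_eq_xxxx)
    have mp: "?m > 0" using m ad a by (auto simp: zero_less_mult_iff)
    show "?m > 0 \<and> (\<forall>\<beta> \<gamma>. Qform \<Omega> \<sigma> (- a\<^sup>2) \<beta> \<gamma> (\<lambda>x. F (a *\<^sub>R (x - x0))) (\<lambda>x. F (a *\<^sub>R (x - x0))) \<le> - (c * a ^ 4) * ?m)"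
      unfolding Qform_dilate[OF n dom F] s1 s0 using mp k2 by simp
  qed
qed

lemma boundary_integrals:
  fixes \<Omega> :: "'a::euclidean_space set" and G :: "'a \<times> 'a \<Rightarrow> real"
  assumes n: "DIM('a) \<ge> 2" and dom: "bounded_C1_domain \<Omega>" and x0: "x0 \<in> frontier \<Omega>"
    and b: "outer_normal \<Omega> x0 = b" "b \<in> Basis" and R: "R > 0"
    and G: "continuous_on UNIV G" "\<And>p. 0 \<le> G p" "\<And>y v. R < norm y \<Longrightarrow> G (y, v) = 0"
  shows "\<epsilon> > 0 \<Longrightarrow> \<forall>\<^sub>F a in at_top. (\<integral>y. indicator {x. 0 \<le> x \<bullet> b \<and> x \<bullet> b \<le> 1} y * G (perp b y, b) \<partial>lborel) - \<epsilon> \<le> 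
      a ^ (DIM('a) - 1) * (\<integral>x. G (a *\<^sub>R (x - x0), outer_normal \<Omega> x) \<partial>surface_measure \<Omega>)"
    and "\<exists>D\<ge>0. \<forall>\<^sub>F a in at_top. a ^ (DIM('a) - 1) * (\<integral>x. G (a *\<^sub>R (x - x0), outer_normal \<Omega> x) \<partial>surface_measure \<Omega>) \<le> D"
proof -
  let ?S = "surface_measure \<Omega>"
  have nb: "norm b = 1" using b(2) by simp
  have "bounded (G ` (cball 0 R \<times> cball 0 1))"
    by (intro compact_imp_bounded compact_continuous_image compact_Times compact_cball continuous_on_subset[OF G(1)]) simp
  then obtain B0 where B0: "\<And>p. p \<in> cball 0 R \<times> cball 0 1 \<Longrightarrow> norm (G p) \<le> B0" unfolding bounded_iff by (metis imageI)
  have B: "\<bar>G (y, v)\<bar> \<le> max B0 0" if "norm v = 1" for y v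
    using B0[of "(y, v)"] G(3)[of y v] that by (cases "R < norm y") (auto simp: max.coboundedI1)
  have meas: "(\<lambda>x. G (a *\<^sub>R (x - x0), outer_normal \<Omega> x)) \<in> borel_measurable ?S" for a
  proof (rule borel_measurable_continuous_on[OF G(1)])
    have "(\<lambda>x. a *\<^sub>R (x - x0)) \<in> borel_measurable ?S"
      by (intro measurable_surface_borel borel_measurable_continuous_onI continuous_intros)
    then show "(\<lambda>x. (a *\<^sub>R (x - x0), outer_normal \<Omega> x)) \<in> borel_measurable ?S"
      by (rule borel_measurable_Pair[OF _ measurable_outer_normal[OF dom]])
  qed
  have int: "integrable ?S (\<lambda>x. G (a *\<^sub>R (x - x0), outer_normal \<Omega> x))" for a
    by (rule integrable_surface_bounded[OF n dom meas B[OF norm_outer_normal[OF dom]]])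
  show "\<exists>D\<ge>0. \<forall>\<^sub>F a in at_top. a ^ (DIM('a) - 1) * (\<integral>x. G (a *\<^sub>R (x - x0), outer_normal \<Omega> x) \<partial>?S) \<le> D"
  proof (rule boundary_blowup_upper[OF n dom x0 R int B[OF norm_outer_normal[OF dom]]])
    fix a x assume "a > (0::real)" "R / a < norm (x - x0)"
    then have "R < norm (a *\<^sub>R (x - x0))" by (simp add: pos_divide_less_eq mult.commute)
    then show "G (a *\<^sub>R (x - x0), outer_normal \<Omega> x) = 0" by (rule G(3))
  qed
  assume eps: "\<epsilon> > 0"
  show "\<forall>\<^sub>F a in at_top. (\<integral>y. indicator {x. 0 \<le> x \<bullet> b \<and> x \<bullet> b \<le> 1} y * G (perp b y, b) \<partial>lborel) - \<epsilon> \<le> 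
      a ^ (DIM('a) - 1) * (\<integral>x. G (a *\<^sub>R (x - x0), outer_normal \<Omega> x) \<partial>?S)"
  proof (rule boundary_blowup_lower[where \<Phi>="\<lambda>y. G (y, b)" and ?R0.0=R, OF n dom x0 b _ G(2) R G(3) int G(2) _ eps])
    show "continuous_on UNIV (\<lambda>y. G (y, b))" by (rule continuous_on_compose2[OF G(1)]) (auto intro!: continuous_intros)
    fix \<eta> :: real assume eta: "\<eta> > 0"
    let ?C = "cball (0::'a) (R + 1) \<times> cball (0::'a) 1"
    have "uniformly_continuous_on ?C G"
      by (intro compact_uniformly_continuous compact_Times compact_cball continuous_on_subset[OF G(1)]) simp
    then obtain d where d: "d > 0" "\<And>p q. p \<in> ?C \<Longrightarrow> q \<in> ?C \<Longrightarrow> dist q p < d \<Longrightarrow> dist (G q) (G p) < \<eta>"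
      using eta unfolding uniformly_continuous_on_def by metis
    define e1 where "e1 = d / (4 * (R + 1))"
    have e1: "e1 > 0" using d(1) R by (simp add: e1_def)
    obtain r1 where r1: "r1 > 0" "\<And>x. x \<in> frontier \<Omega> \<Longrightarrow> norm (x - x0) < r1 \<Longrightarrow> \<bar>(x - x0) \<bullet> b\<bar> \<le> e1 * norm (x - x0)"
      using frontier_flat[OF dom x0 b(1) e1] by blast
    have "d / 4 > 0" using d(1) by simp
    then obtain r2 where r2: "r2 > 0" "\<And>x. x \<in> frontier \<Omega> \<Longrightarrow> dist x x0 < r2 \<Longrightarrow> dist (outer_normal \<Omega> x) b < d / 4"
      using continuous_on_outer_normal[OF dom] x0 unfolding continuous_on_iff b(1)[symmetric] by metis
    have m: "min r1 r2 > 0" using r1(1) r2(1) by simp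
    show "\<forall>\<^sub>F a in at_top. \<forall>x\<in>frontier \<Omega>. norm (x - x0) \<le> (R + 1) / a \<longrightarrow> 
       G (perp b (a *\<^sub>R (x - x0)), b) - \<eta> \<le> G (a *\<^sub>R (x - x0), outer_normal \<Omega> x)"
      using eventually_div_small[OF m, of "R + 1"]
    proof eventually_elim
      fix a :: real assume a: "0 < a \<and> (R + 1) / a < min r1 r2"
      show "\<forall>x\<in>frontier \<Omega>. norm (x - x0) \<le> (R + 1) / a \<longrightarrow> 
         G (perp b (a *\<^sub>R (x - x0)), b) - \<eta> \<le> G (a *\<^sub>R (x - x0), outer_normal \<Omega> x)"
      proof (intro ballI impI)
        fix x assume x: "x \<in> frontier \<Omega>" "norm (x - x0) \<le> (R + 1) / a"
        let ?y = "a *\<^sub>R (x - x0)"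
        have ny: "norm ?y \<le> R + 1" using x(2) a by (simp add: pos_le_divide_eq mult.commute)
        have f: "\<bar>(x - x0) \<bullet> b\<bar> \<le> e1 * norm (x - x0)" using r1(2)[OF x(1)] x(2) a by linarith
        have "\<bar>?y \<bullet> b\<bar> = a * \<bar>(x - x0) \<bullet> b\<bar>" using a by (simp add: abs_mult)
        also have "\<dots> \<le> a * (e1 * norm (x - x0))" using f a by (intro mult_left_mono) simp_all
        also have "\<dots> = e1 * norm ?y" using a by simp
        also have "\<dots> \<le> e1 * (R + 1)" using ny e1 by (intro mult_left_mono) simp_all
        also have "e1 * (R + 1) = d / 4" using R by (simp add: e1_def field_simps)
        finally have yb: "\<bar>?y \<bullet> b\<bar> \<le> d / 4" .
        have "dist (perp b ?y) ?y = \<bar>?y \<bullet> b\<bar>" unfolding dist_norm perp_def using nb by simp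
        moreover have "dist b (outer_normal \<Omega> x) < d / 4" using r2(2)[OF x(1)] x(2) a by (simp add: dist_norm norm_minus_commute)
        moreover have "dist (perp b ?y, b) (?y, outer_normal \<Omega> x) \<le> dist (perp b ?y) ?y + dist b (outer_normal \<Omega> x)"
          unfolding dist_Pair_Pair by (rule sqrt_sum_squares_le_sum) simp_all
        ultimately have dd: "dist (perp b ?y, b) (?y, outer_normal \<Omega> x) < d" using yb d(1) by linarith
        have "norm (perp b ?y) \<le> R + 1" using norm_perp_le[OF nb, of ?y] ny by linarith
        then have q: "(perp b ?y, b) \<in> ?C" using nb by simp
        have p: "(?y, outer_normal \<Omega> x) \<in> ?C" using ny norm_outer_normal[OF dom x(1)] by simp
        show "G (perp b ?y, b) - \<eta> \<le> G (?y, outer_normal \<Omega> x)" using d(2)[OF p q dd] by (simp add: dist_real_def)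
      qed
    qed
  qed
qed

lemma boundary_blowup:
  fixes \<Omega> :: "'a::euclidean_space set" and \<sigma> c B :: real
  assumes n: "DIM('a) \<ge> 2" and dom: "bounded_C1_domain \<Omega>" and x0: "x0 \<in> frontier \<Omega>"
    and b: "outer_normal \<Omega> x0 = b" "b \<in> Basis" and P: "profile F R"
    and M: "0 < (\<integral>y. indicator {y. y \<bullet> b < 0} y * (F y)\<^sup>2 \<partial>lborel)"
  defines "A \<equiv> (\<integral>y. indicator {y. y \<bullet> b < 0} y * bending \<sigma> F y \<partial>lborel)"
    and "m \<equiv> (\<integral>y. indicator {y. y \<bullet> b < 0} y * (F y)\<^sup>2 \<partial>lborel)"
  shows "A - (\<integral>y. indicator {x. 0 \<le> x \<bullet> b \<and> x \<bullet> b \<le> 1} y * (pd b F (perp b y))\<^sup>2 \<partial>lborel) < - c * m \<Longrightarrow>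
     \<forall>\<^sub>F a in at_top. (\<integral>x. (F (a *\<^sub>R (x - x0)))\<^sup>2 \<partial>lebesgue_on \<Omega>) > 0 \<and>
     (\<forall>\<alpha> \<gamma>. \<bar>\<alpha>\<bar> \<le> B \<longrightarrow> \<bar>\<gamma>\<bar> \<le> B \<longrightarrow> Qform \<Omega> \<sigma> \<alpha> (- a) \<gamma> (\<lambda>x. F (a *\<^sub>R (x - x0))) (\<lambda>x. F (a *\<^sub>R (x - x0)))
        \<le> - (c * a ^ 4) * (\<integral>x. (F (a *\<^sub>R (x - x0)))\<^sup>2 \<partial>lebesgue_on \<Omega>))"
    and "A - (\<integral>y. indicator {x. 0 \<le> x \<bullet> b \<and> x \<bullet> b \<le> 1} y * (F (perp b y))\<^sup>2 \<partial>lborel) < - c * m \<Longrightarrow>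
     \<forall>\<^sub>F a in at_top. (\<integral>x. (F (a *\<^sub>R (x - x0)))\<^sup>2 \<partial>lebesgue_on \<Omega>) > 0 \<and>
     (\<forall>\<alpha> \<beta>. \<bar>\<alpha>\<bar> \<le> B \<longrightarrow> \<bar>\<beta>\<bar> \<le> B \<longrightarrow> Qform \<Omega> \<sigma> \<alpha> \<beta> (- (a ^ 3)) (\<lambda>x. F (a *\<^sub>R (x - x0))) (\<lambda>x. F (a *\<^sub>R (x - x0)))
        \<le> - (c * a ^ 4) * (\<integral>x. (F (a *\<^sub>R (x - x0)))\<^sup>2 \<partial>lebesgue_on \<Omega>))"
proof -
  let ?d = "DIM('a)" let ?L = "lebesgue_on \<Omega>" and ?S = "surface_measure \<Omega>" and ?H = "{y. y \<bullet> b < 0}"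
  note O = bounded_C1_domainD(2)[OF dom] and F = profileD(1)[OF P] and R = profileD(2)[OF P]
  have HB: "?H \<in> sets borel" by measurable
  note vl = volume_blowup_limit[OF O HB blowup_boundary[OF dom x0 b(1)] _ compact_cball, of _ 0 R]
  define V4 where "V4 a = (\<integral>x. bending \<sigma> F (a *\<^sub>R (x - x0)) \<partial>?L)" for a
  define V2 where "V2 a = (\<integral>x. (norm (grad F (a *\<^sub>R (x - x0))))\<^sup>2 \<partial>?L)" for a
  define V0 where "V0 a = (\<integral>x. (F (a *\<^sub>R (x - x0)))\<^sup>2 \<partial>?L)" for a
  define W1 where "W1 a = (\<integral>x. (grad F (a *\<^sub>R (x - x0)) \<bullet> outer_normal \<Omega> x)\<^sup>2 \<partial>?S)" for a
  define W0 where "W0 a = (\<integral>x. (F (a *\<^sub>R (x - x0)))\<^sup>2 \<partial>?S)" for a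
  define A2 where "A2 = (\<integral>y. indicator ?H y * (norm (grad F y))\<^sup>2 \<partial>lborel)"
  have l4: "((\<lambda>a. a ^ ?d * V4 a) \<longlongrightarrow> A) at_top"
    unfolding V4_def A_def using vl[of "bending \<sigma> F"] continuous_bending[OF F] profileD(6)[OF P] by simp
  have l2: "((\<lambda>a. a ^ ?d * V2 a) \<longlongrightarrow> A2) at_top"
    unfolding V2_def A2_def using vl[of "\<lambda>y. (norm (grad F y))\<^sup>2"] continuous_grad[OF F] profileD(5)[OF P] by (simp add: continuous_intros)
  have l0: "((\<lambda>a. a ^ ?d * V0 a) \<longlongrightarrow> m) at_top"
    unfolding V0_def m_def using vl[of "\<lambda>y. (F y)\<^sup>2"] smooth_continuous[OF F] profileD(3)[OF P] by (simp add: continuous_intros)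
  have Q: "Qform \<Omega> \<sigma> \<alpha> \<beta> \<gamma> (\<lambda>x. F (a *\<^sub>R (x - x0))) (\<lambda>x. F (a *\<^sub>R (x - x0))) =
     a ^ 4 * V4 a + \<alpha> * (a\<^sup>2 * V2 a) + \<beta> * (a\<^sup>2 * W1 a) + \<gamma> * W0 a" for \<alpha> \<beta> \<gamma> a
    unfolding V4_def V2_def W1_def W0_def by (rule Qform_dilate[OF n dom F])
  have g1: "continuous_on UNIV (\<lambda>p. (grad F (fst p) \<bullet> snd p)\<^sup>2)"
    by (intro continuous_intros continuous_on_compose2[OF continuous_grad[OF F, of UNIV]]) simp
  have g0: "continuous_on UNIV (\<lambda>p::'a \<times> 'a. (F (fst p))\<^sup>2)"
    by (intro continuous_intros continuous_on_compose2[OF smooth_continuous[OF F, of UNIV]]) simp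
  have z1: "(grad F (fst (y, v)) \<bullet> snd (y, v))\<^sup>2 = 0" "(F (fst (y, v)))\<^sup>2 = 0" if "R < norm y" for y v :: 'a
    using profileD(3,5)[OF P that] by simp_all
  note B1 = boundary_integrals[OF n dom x0 b R g1 zero_le_power2 z1(1), simplified fst_conv snd_conv, folded W1_def]
  note B0 = boundary_integrals[OF n dom x0 b R g0 zero_le_power2 z1(2), simplified fst_conv snd_conv, folded W0_def]
  obtain D1 where D1: "D1 \<ge> 0" "\<forall>\<^sub>F a in at_top. a ^ (?d - 1) * W1 a \<le> D1" using B1(2)[OF TrueI] by blast
  obtain D0 where D0: "D0 \<ge> 0" "\<forall>\<^sub>F a in at_top. a ^ (?d - 1) * W0 a \<le> D0" using B0(2)[OF TrueI] by blast
  have W1n: "W1 a \<ge> 0" and W0n: "W0 a \<ge> 0" for a unfolding W1_def W0_def by (intro integral_nonneg_AE AE_I2; simp)+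
  have pdg: "grad F y \<bullet> b = pd b F y" for y using b(2) by (simp add: grad_def)
  have dS: "a ^ ?d = a * a ^ (?d - 1)" for a :: real by (metis Suc_diff_1 DIM_positive power_Suc)
  have small: "((\<lambda>a. \<bar>B\<bar> * \<bar>a ^ ?d * V2 a\<bar> / a\<^sup>2 + \<bar>B\<bar> * D0 / a ^ 3 + \<bar>B\<bar> * D1 / a) \<longlongrightarrow> 0 + 0 + 0) at_top"
  proof (intro tendsto_add)
    have i: "filterlim (\<lambda>a::real. a ^ k) at_infinity at_top" if "k > 0" for k
      by (intro filterlim_at_top_imp_at_infinity filterlim_pow_at_top that filterlim_ident)
    show "((\<lambda>a. \<bar>B\<bar> * \<bar>a ^ ?d * V2 a\<bar> / a\<^sup>2) \<longlongrightarrow> 0) at_top"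
      by (rule tendsto_divide_0[OF tendsto_mult[OF tendsto_const tendsto_rabs[OF l2]] i]) simp
    show "((\<lambda>a. \<bar>B\<bar> * D0 / a ^ 3) \<longlongrightarrow> 0) at_top" by (rule tendsto_divide_0[OF tendsto_const i]) simp
    show "((\<lambda>a. \<bar>B\<bar> * D1 / a) \<longlongrightarrow> 0) at_top"
      using tendsto_divide_0[OF tendsto_const i[of 1], of "\<bar>B\<bar> * D1"] by simp
  qed
  have lim: "((\<lambda>a. (a ^ ?d * V4 a + c * (a ^ ?d * V0 a)) + (\<bar>B\<bar> * \<bar>a ^ ?d * V2 a\<bar> / a\<^sup>2 + \<bar>B\<bar> * D0 / a ^ 3 + \<bar>B\<bar> * D1 / a)) \<longlongrightarrow> (A + c * m) + (0 + 0 + 0)) at_top"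
    by (intro tendsto_add[OF tendsto_add[OF l4 tendsto_mult[OF tendsto_const l0]] small])
  have core: "a ^ 4 * V4 a + \<alpha> * (a\<^sup>2 * V2 a) + \<beta> * (a\<^sup>2 * W1 a) + \<gamma> * W0 a \<le> - (c * a ^ 4) * V0 a"
    if a: "a > 0" and al: "\<bar>\<alpha>\<bar> \<le> B" and X: "a ^ ?d * V4 a + c * (a ^ ?d * V0 a) + \<bar>B\<bar> * \<bar>a ^ ?d * V2 a\<bar> / a\<^sup>2
       + \<beta> / a * (a ^ (?d - 1) * W1 a) + \<gamma> / a ^ 3 * (a ^ (?d - 1) * W0 a) \<le> 0" for a \<alpha> \<beta> \<gamma>
  proof -
    have ad: "a ^ ?d > 0" using a by simp
    have "\<alpha> * (a ^ ?d * V2 a) \<le> \<bar>\<alpha>\<bar> * \<bar>a ^ ?d * V2 a\<bar>" by (metis abs_ge_self abs_mult)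
    also have "\<dots> \<le> \<bar>B\<bar> * \<bar>a ^ ?d * V2 a\<bar>" using al by (intro mult_right_mono) simp_all
    finally have "\<alpha> * (a ^ ?d * V2 a) / a\<^sup>2 \<le> \<bar>B\<bar> * \<bar>a ^ ?d * V2 a\<bar> / a\<^sup>2" by (rule divide_right_mono) simp
    then have Y: "a ^ ?d * V4 a + c * (a ^ ?d * V0 a) + \<alpha> * (a ^ ?d * V2 a) / a\<^sup>2
       + \<beta> / a * (a ^ (?d - 1) * W1 a) + \<gamma> / a ^ 3 * (a ^ (?d - 1) * W0 a) \<le> 0" using X by linarith
    define q where "q = a ^ (?d - 1)"
    have q: "q > 0" using a by (simp add: q_def)
    have e: "(q / a ^ 3) * (a ^ 4 * V4 a + \<alpha> * (a\<^sup>2 * V2 a) + \<beta> * (a\<^sup>2 * W1 a) + \<gamma> * W0 a + (c * a ^ 4) * V0 a) =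
      a * q * V4 a + c * (a * q * V0 a) + \<alpha> * (a * q * V2 a) / a\<^sup>2 + \<beta> / a * (q * W1 a) + \<gamma> / a ^ 3 * (q * W0 a)"
      using a by (simp add: field_simps power2_eq_square power3_eq_cube power4_eq_xxxx)
    have "(q / a ^ 3) * (a ^ 4 * V4 a + \<alpha> * (a\<^sup>2 * V2 a) + \<beta> * (a\<^sup>2 * W1 a) + \<gamma> * W0 a + (c * a ^ 4) * V0 a) \<le> 0"
      unfolding e using Y unfolding dS q_def[symmetric] .
    moreover have "q / a ^ 3 > 0" using q a by simp
    ultimately have "a ^ 4 * V4 a + \<alpha> * (a\<^sup>2 * V2 a) + \<beta> * (a\<^sup>2 * W1 a) + \<gamma> * W0 a + (c * a ^ 4) * V0 a \<le> 0"
      by (simp only: mult_le_0_iff) linarith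
    then show ?thesis by simp
  qed
  have pos: "\<forall>\<^sub>F a in at_top. 0 < a ^ ?d * V0 a" using order_tendstoD(1)[OF l0] M unfolding m_def by blast
  have V0p: "V0 a > 0" if "0 < a ^ ?d * V0 a" "a > 0" for a using that by (simp add: zero_less_mult_iff)
  let ?E1 = "\<integral>y. indicator {x. 0 \<le> x \<bullet> b \<and> x \<bullet> b \<le> 1} y * (pd b F (perp b y))\<^sup>2 \<partial>lborel"
  let ?E0 = "\<integral>y. indicator {x. 0 \<le> x \<bullet> b \<and> x \<bullet> b \<le> 1} y * (F (perp b y))\<^sup>2 \<partial>lborel"
  have bnd: "u / a ^ k * w \<le> \<bar>B\<bar> * D / a ^ k" if "\<bar>u\<bar> \<le> B" "0 \<le> w" "w \<le> D" "a > 0" for u w D a :: real and k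
  proof -
    have "u * w \<le> \<bar>u\<bar> * w" using that(2) by (intro mult_right_mono) simp_all
    also have "\<dots> \<le> \<bar>B\<bar> * D" using that by (intro mult_mono) simp_all
    finally have "u * w / a ^ k \<le> \<bar>B\<bar> * D / a ^ k" using that(4) by (intro divide_right_mono) simp_all
    then show ?thesis by simp
  qed
  {
    assume J: "A - ?E1 < - c * m"
    define \<delta> where "\<delta> = ?E1 - A - c * m"
    have del: "\<delta> / 2 > 0" using J by (simp add: \<delta>_def)
    have lt: "(A + c * m) + (0 + 0 + 0) < ?E1 - \<delta> / 2" using del by (simp add: \<delta>_def field_simps)
    show "\<forall>\<^sub>F a in at_top. (\<integral>x. (F (a *\<^sub>R (x - x0)))\<^sup>2 \<partial>?L) > 0 \<and>
     (\<forall>\<alpha> \<gamma>. \<bar>\<alpha>\<bar> \<le> B \<longrightarrow> \<bar>\<gamma>\<bar> \<le> B \<longrightarrow> Qform \<Omega> \<sigma> \<alpha> (- a) \<gamma> (\<lambda>x. F (a *\<^sub>R (x - x0))) (\<lambda>x. F (a *\<^sub>R (x - x0)))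
        \<le> - (c * a ^ 4) * (\<integral>x. (F (a *\<^sub>R (x - x0)))\<^sup>2 \<partial>?L))"
      using order_tendstoD(2)[OF lim lt] B1(1)[OF TrueI del, unfolded pdg] D0(2) pos eventually_gt_at_top[of 0] unfolding Q V0_def[symmetric]
    proof eventually_elim
      case (elim a)
      have "a ^ 4 * V4 a + \<alpha> * (a\<^sup>2 * V2 a) + (- a) * (a\<^sup>2 * W1 a) + \<gamma> * W0 a \<le> - (c * a ^ 4) * V0 a" if "\<bar>\<alpha>\<bar> \<le> B" "\<bar>\<gamma>\<bar> \<le> B" for \<alpha> \<gamma>
      proof (rule core[OF elim(5) that(1)])
        have w: "0 \<le> a ^ (?d - 1) * W0 a" using elim(5) W0n by simp
        have 1: "(- a) / a * (a ^ (?d - 1) * W1 a) = - (a ^ (?d - 1) * W1 a)" using elim(5) by simp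
        have 2: "\<gamma> / a ^ 3 * (a ^ (?d - 1) * W0 a) \<le> \<bar>B\<bar> * D0 / a ^ 3" by (rule bnd[OF that(2) w elim(3,5)])
        have 3: "0 \<le> \<bar>B\<bar> * D1 / a" using D1(1) elim(5) by simp
        show "a ^ ?d * V4 a + c * (a ^ ?d * V0 a) + \<bar>B\<bar> * \<bar>a ^ ?d * V2 a\<bar> / a\<^sup>2
          + (- a) / a * (a ^ (?d - 1) * W1 a) + \<gamma> / a ^ 3 * (a ^ (?d - 1) * W0 a) \<le> 0"
          unfolding 1 using elim(1,2) 2 3 by linarith
      qed
      then show ?case using V0p[OF elim(4,5)] by blast
    qed
  }
  {
    assume J: "A - ?E0 < - c * m"
    define \<delta> where "\<delta> = ?E0 - A - c * m"
    have del: "\<delta> / 2 > 0" using J by (simp add: \<delta>_def)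
    have lt: "(A + c * m) + (0 + 0 + 0) < ?E0 - \<delta> / 2" using del by (simp add: \<delta>_def field_simps)
    show "\<forall>\<^sub>F a in at_top. (\<integral>x. (F (a *\<^sub>R (x - x0)))\<^sup>2 \<partial>?L) > 0 \<and>
     (\<forall>\<alpha> \<beta>. \<bar>\<alpha>\<bar> \<le> B \<longrightarrow> \<bar>\<beta>\<bar> \<le> B \<longrightarrow> Qform \<Omega> \<sigma> \<alpha> \<beta> (- (a ^ 3)) (\<lambda>x. F (a *\<^sub>R (x - x0))) (\<lambda>x. F (a *\<^sub>R (x - x0)))
        \<le> - (c * a ^ 4) * (\<integral>x. (F (a *\<^sub>R (x - x0)))\<^sup>2 \<partial>?L))"
      using order_tendstoD(2)[OF lim lt] B0(1)[OF TrueI del] D1(2) pos eventually_gt_at_top[of 0] unfolding Q V0_def[symmetric]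
    proof eventually_elim
      case (elim a)
      have "a ^ 4 * V4 a + \<alpha> * (a\<^sup>2 * V2 a) + \<beta> * (a\<^sup>2 * W1 a) + (- (a ^ 3)) * W0 a \<le> - (c * a ^ 4) * V0 a" if "\<bar>\<alpha>\<bar> \<le> B" "\<bar>\<beta>\<bar> \<le> B" for \<alpha> \<beta>
      proof (rule core[OF elim(5) that(1)])
        have w: "0 \<le> a ^ (?d - 1) * W1 a" using elim(5) W1n by simp
        have 1: "(- (a ^ 3)) / a ^ 3 * (a ^ (?d - 1) * W0 a) = - (a ^ (?d - 1) * W0 a)" using elim(5) by simp
        have 2: "\<beta> / a * (a ^ (?d - 1) * W1 a) \<le> \<bar>B\<bar> * D1 / a" using bnd[OF that(2) w elim(3,5), of 1] by simp
        have 3: "0 \<le> \<bar>B\<bar> * D0 / a ^ 3" using D0(1) elim(5) by simp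
        show "a ^ ?d * V4 a + c * (a ^ ?d * V0 a) + \<bar>B\<bar> * \<bar>a ^ ?d * V2 a\<bar> / a\<^sup>2
          + \<beta> / a * (a ^ (?d - 1) * W1 a) + (- (a ^ 3)) / a ^ 3 * (a ^ (?d - 1) * W0 a) \<le> 0"
          unfolding 1 using elim(1,2) 2 3 by linarith
      qed
      then show ?case using V0p[OF elim(4,5)] by blast
    qed
  }
qed

(*T13*)
definition stretch :: "'a::euclidean_space \<Rightarrow> real \<Rightarrow> 'a \<Rightarrow> 'a" where
  "stretch b s x = (\<Sum>j\<in>Basis. ((if j = b then 1 else s) * (x \<bullet> j)) *\<^sub>R j)"

lemma stretch_inner: "j \<in> Basis \<Longrightarrow> stretch b s x \<bullet> j = (if j = b then 1 else s) * (x \<bullet> j)"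
  unfolding stretch_def by (simp add: inner_sum_left inner_Basis if_distrib[of "\<lambda>z. _ * z"] cong: if_cong)

lemma stretch_Basis: "j \<in> Basis \<Longrightarrow> stretch b s j = (if j = b then 1 else s) *\<^sub>R j"
  by (rule euclidean_eqI) (auto simp: stretch_inner inner_Basis)

lemma continuous_on_stretch: "continuous_on A (stretch b s)"
  unfolding stretch_def[abs_def] by (intro continuous_intros)

lemma pd_stretch_differentiable:
  assumes F: "(F has_derivative frechet_derivative F (at (stretch b s x))) (at (stretch b s x))" and j: "j \<in> Basis"
  shows "((\<lambda>x. F (stretch b s x)) has_derivative (\<lambda>v. frechet_derivative F (at (stretch b s x)) (stretch b s v))) (at x)"
    "pd j (\<lambda>x. F (stretch b s x)) x = (if j = b then 1 else s) * pd j F (stretch b s x)"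
proof -
  have T: "(stretch b s has_derivative stretch b s) (at x)"
    unfolding stretch_def[abs_def] by (auto intro!: derivative_eq_intros)
  show d: "((\<lambda>x. F (stretch b s x)) has_derivative (\<lambda>v. frechet_derivative F (at (stretch b s x)) (stretch b s v))) (at x)"
    using has_derivative_compose[OF T F] .
  have lin: "linear (frechet_derivative F (at (stretch b s x)))" using F by (rule has_derivative_linear)
  show "pd j (\<lambda>x. F (stretch b s x)) x = (if j = b then 1 else s) * pd j F (stretch b s x)"
    unfolding pdI[OF d] stretch_Basis[OF j] by (simp add: linear_cmul[OF lin])
qed

lemma Ck_stretch: "Ck k F \<Longrightarrow> Ck k (\<lambda>x. F (stretch b s x))"
proof (induction k arbitrary: F)
  case 0 then show ?case by (auto intro: continuous_on_compose2[OF _ continuous_on_stretch])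
next
  case (Suc k)
  note D = pd_stretch_differentiable[OF Ck_Suc_has_derivative[OF Suc.prems]]
  have e: "pd j (\<lambda>x. F (stretch b s x)) = (\<lambda>x. (if j = b then 1 else s) * pd j F (stretch b s x))" if "j \<in> Basis" for j
    using D(2)[OF that] by (rule ext)
  have "Ck k (pd j (\<lambda>x. F (stretch b s x)))" if "j \<in> Basis" for j
    unfolding e[OF that] using Suc.prems that by (intro Ck_mult Ck_const Suc.IH) simp
  moreover have "(\<lambda>x. F (stretch b s x)) differentiable (at x)" for x
    using D(1) nonempty_Basis differentiableI by blast
  ultimately show ?case by (simp add: differentiable_on_def differentiable_at_withinI)
qed

lemma smooth_stretch: "smooth F \<Longrightarrow> smooth (\<lambda>x. F (stretch b s x))"
  by (simp add: smooth_def Ck_stretch)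

lemma pd_stretch: "smooth F \<Longrightarrow> j \<in> Basis \<Longrightarrow> pd j (\<lambda>x. F (stretch b s x)) x = (if j = b then 1 else s) * pd j F (stretch b s x)"
  by (rule pd_stretch_differentiable(2)[OF smooth_has_derivative])

lemma perp_stretch: "b \<in> Basis \<Longrightarrow> perp b (stretch b s y) = stretch b s (perp b y)"
  by (rule euclidean_eqI) (auto simp: perp_def stretch_inner inner_diff_left inner_Basis algebra_simps)

lemma lborel_integral_stretch:
  fixes g :: "'a::euclidean_space \<Rightarrow> real"
  assumes s: "s > 0" and g: "g \<in> borel_measurable borel"
  shows "(\<integral>x. g x \<partial>lborel) = (\<Prod>j\<in>Basis. if j = b then 1 else s) * (\<integral>x. g (stretch b s x) \<partial>lborel)"
proof -
  have T: "(\<lambda>x::'a. 0 + (\<Sum>j\<in>Basis. ((if j = b then 1 else s) * (x \<bullet> j)) *\<^sub>R j)) \<in> lborel \<rightarrow>\<^sub>M borel" by measurable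
  have 1: "(\<Prod>j\<in>(Basis::'a set). \<bar>if j = b then 1 else s\<bar>) = (\<Prod>j\<in>Basis. if j = b then 1 else s)"
    using s by (intro prod.cong refl) simp
  have "(\<integral>x. g x \<partial>lborel) = (\<integral>x. g x \<partial>density (distr lborel borel (\<lambda>x. 0 + (\<Sum>j\<in>Basis. ((if j = b then 1 else s) * (x \<bullet> j)) *\<^sub>R j)))
      (\<lambda>_. ennreal (\<Prod>j\<in>Basis. \<bar>if j = b then 1 else s\<bar>)))"
    using s by (subst lborel_affine_euclidean[where c="\<lambda>j. if j = b then 1 else s" and t="0::'a"]) auto
  also have "\<dots> = (\<Prod>j\<in>(Basis::'a set). if j = b then 1 else s) * (\<integral>x. g (stretch b s x) \<partial>lborel)"
    unfolding 1 using g T s by (subst integral_density) (auto simp: integral_distr stretch_def prod_nonneg)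
  finally show ?thesis .
qed

lemma profile_stretch:
  assumes P: "profile F R" and s: "0 < s" "s \<le> 1"
  shows "profile (\<lambda>x. F (stretch b s x)) (R / s)"
  unfolding profile_def
proof (intro conjI allI impI)
  show "smooth (\<lambda>x. F (stretch b s x))" by (rule smooth_stretch[OF profileD(1)[OF P]])
  show "R / s > 0" using profileD(2)[OF P] s by simp
  fix y :: 'a assume y: "R / s < norm y"
  have "norm (s *\<^sub>R y) \<le> norm (stretch b s y)"
    by (rule norm_le_componentwise) (use s in \<open>auto simp: stretch_inner abs_mult mult_left_le_one_le\<close>)
  then have "R < norm (stretch b s y)" using y s by (simp add: pos_divide_less_eq mult.commute)
  then show "F (stretch b s y) = 0" by (rule profileD(3)[OF P])
qed

lemma bending_stretch_limit:
  fixes F :: "'a::euclidean_space \<Rightarrow> real"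
  assumes P: "profile F R" and b: "b \<in> Basis" and H: "H \<in> sets borel" 
    and HT: "\<And>s x. s > 0 \<Longrightarrow> stretch b s x \<in> H \<longleftrightarrow> x \<in> H"
    and X: "(\<integral>y. indicator H y * (pd b (pd b F) y)\<^sup>2 \<partial>lborel) < X"
  shows "\<exists>s. 0 < s \<and> s \<le> 1 \<and> (\<Prod>j\<in>(Basis::'a set). if j = b then 1 else s) * 
     (\<integral>y. indicator H y * bending \<sigma> (\<lambda>x. F (stretch b s x)) y \<partial>lborel) < X"
proof -
  note F = profileD(1)[OF P]
  define c where "c s j = (if j = b then 1 else s :: real)" for s and j :: 'a
  define D where "D i j y = (1 - \<sigma>) * (pd i (pd j F) y)\<^sup>2 + \<sigma> * (pd i (pd i F) y * pd j (pd j F) y)" for i j y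
  define K where "K i j = (\<integral>y. indicator H y * D i j y \<partial>lborel)" for i j
  have p: "pd i (pd j (\<lambda>x. F (stretch b s x))) y = c s i * c s j * pd i (pd j F) (stretch b s y)" if "i \<in> Basis" "j \<in> Basis" for s i j y
  proof -
    have e: "pd j (\<lambda>x. F (stretch b s x)) = (\<lambda>x. c s j * pd j F (stretch b s x))" 
      unfolding c_def by (rule ext) (rule pd_stretch[OF F that(2)])
    have "pd i (pd j (\<lambda>x. F (stretch b s x))) y = c s j * pd i (\<lambda>x. pd j F (stretch b s x)) y"
      unfolding e by (rule pd_cmult[OF smooth_stretch[OF smooth_pd[OF F that(2)]]])
    also have "\<dots> = c s j * (c s i * pd i (pd j F) (stretch b s y))"
      unfolding c_def by (simp only: pd_stretch[OF smooth_pd[OF F that(2)] that(1)])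
    finally show ?thesis by simp
  qed
  have bs: "bending \<sigma> (\<lambda>x. F (stretch b s x)) y = (\<Sum>i\<in>Basis. \<Sum>j\<in>Basis. (c s i)\<^sup>2 * (c s j)\<^sup>2 * D i j (stretch b s y))" for s y
  proof -
    have 1: "(\<Sum>i\<in>Basis. pd i (pd i (\<lambda>x. F (stretch b s x))) y)\<^sup>2 = 
       (\<Sum>i\<in>Basis. \<Sum>j\<in>Basis. (c s i)\<^sup>2 * (c s j)\<^sup>2 * (pd i (pd i F) (stretch b s y) * pd j (pd j F) (stretch b s y)))"
      unfolding power2_eq_square[of "sum _ _"] sum_product
      by (intro sum.cong refl) (simp add: p power2_eq_square algebra_simps)
    have 2: "(\<Sum>i\<in>Basis. \<Sum>j\<in>Basis. (pd i (pd j (\<lambda>x. F (stretch b s x))) y)\<^sup>2) = 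
       (\<Sum>i\<in>Basis. \<Sum>j\<in>Basis. (c s i)\<^sup>2 * (c s j)\<^sup>2 * (pd i (pd j F) (stretch b s y))\<^sup>2)"
      by (intro sum.cong refl) (simp add: p power_mult_distrib)
    show ?thesis unfolding bending_def 1 2 D_def sum_distrib_left sum.distrib[symmetric]
      by (intro sum.cong refl) (simp add: algebra_simps)
  qed
  have Dc: "continuous_on UNIV (D i j)" if "i \<in> Basis" "j \<in> Basis" for i j
    unfolding D_def[abs_def] using that by (intro continuous_intros smooth_continuous smooth_pd F)
  have pp: "pd i (pd j F) y = 0" if "y \<notin> cball 0 R" for i j y
  proof (rule pd_zero_off_closed[of "cball 0 R", OF closed_cball _ that])
    fix z :: 'a assume "z \<notin> cball 0 R" then show "pd j F z = 0" using profileD(4)[OF P] by simp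
  qed
  have Di: "integrable lborel (\<lambda>y. indicator H y * D i j y)" if "i \<in> Basis" "j \<in> Basis" for i j
  proof -
    have "integrable lborel (D i j)"
      by (rule integrable_lborel_compact_support[OF compact_cball[of 0 R] Dc[OF that]]) (simp add: D_def pp)
    from integrable_mult_indicator[OF _ this, of H] H show ?thesis by simp
  qed
  have val: "(\<Prod>j\<in>(Basis::'a set). if j = b then 1 else s) * (\<integral>y. indicator H y * bending \<sigma> (\<lambda>x. F (stretch b s x)) y \<partial>lborel)
    = (\<Sum>i\<in>Basis. \<Sum>j\<in>Basis. (c s i)\<^sup>2 * (c s j)\<^sup>2 * K i j)" if s: "s > 0" for s
  proof -
    define g where "g y = (\<Sum>i\<in>Basis. \<Sum>j\<in>Basis. (c s i)\<^sup>2 * (c s j)\<^sup>2 * (indicator H y * D i j y))" for y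
    have gb: "g \<in> borel_measurable borel"
      unfolding g_def[abs_def] using H Dc by (intro borel_measurable_sum borel_measurable_times borel_measurable_const borel_measurable_indicator borel_measurable_continuous_onI)
    have "indicator H y * bending \<sigma> (\<lambda>x. F (stretch b s x)) y = g (stretch b s y)" for y
    proof -
      have "indicator H (stretch b s y) = (indicator H y :: real)" using HT[OF s] by (simp add: indicator_def)
      then show ?thesis unfolding bs g_def sum_distrib_left by (intro sum.cong refl) (simp only: mult.left_commute)
    qed
    then have "(\<Prod>j\<in>(Basis::'a set). if j = b then 1 else s) * (\<integral>y. indicator H y * bending \<sigma> (\<lambda>x. F (stretch b s x)) y \<partial>lborel) = (\<integral>y. g y \<partial>lborel)"
      unfolding lborel_integral_stretch[OF s gb, of b] by simp
    also have "\<dots> = (\<Sum>i\<in>Basis. \<Sum>j\<in>Basis. (c s i)\<^sup>2 * (c s j)\<^sup>2 * K i j)"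
      unfolding g_def K_def using Di by simp
    finally show ?thesis .
  qed
  have "((\<lambda>s. \<Sum>i\<in>Basis. \<Sum>j\<in>Basis. (c s i)\<^sup>2 * (c s j)\<^sup>2 * K i j) \<longlongrightarrow> (\<Sum>i\<in>Basis. \<Sum>j\<in>Basis. (c 0 i)\<^sup>2 * (c 0 j)\<^sup>2 * K i j)) (at_right 0)"
    unfolding c_def by (intro tendsto_sum tendsto_mult tendsto_power tendsto_const) (auto intro!: tendsto_ident_at)
  also have "(\<Sum>i\<in>Basis. \<Sum>j\<in>Basis. (c 0 i)\<^sup>2 * (c 0 j)\<^sup>2 * K i j) = (\<Sum>i\<in>Basis. if i = b then K b b else 0)"
  proof (intro sum.cong refl)
    fix i :: 'a
    have "(\<Sum>j\<in>Basis. (c 0 i)\<^sup>2 * (c 0 j)\<^sup>2 * K i j) = (\<Sum>j\<in>Basis. if j = b then (c 0 i)\<^sup>2 * K i b else 0)"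
      by (intro sum.cong refl) (simp add: c_def)
    then show "(\<Sum>j\<in>Basis. (c 0 i)\<^sup>2 * (c 0 j)\<^sup>2 * K i j) = (if i = b then K b b else 0)"
      using b by (simp add: c_def)
  qed
  also have "\<dots> = K b b" using b by simp
  also have "K b b = (\<integral>y. indicator H y * (pd b (pd b F) y)\<^sup>2 \<partial>lborel)"
    unfolding K_def D_def by (intro Bochner_Integration.integral_cong refl) (simp add: power2_eq_square algebra_simps)
  finally have "\<forall>\<^sub>F s in at_right 0. (\<Sum>i\<in>Basis. \<Sum>j\<in>Basis. (c s i)\<^sup>2 * (c s j)\<^sup>2 * K i j) < X"
    by (rule order_tendstoD(2)[OF _ X])
  moreover have "\<forall>\<^sub>F s in at_right (0::real). s \<in> {0<..<1}" by (rule eventually_at_right_real) simp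
  ultimately have "\<forall>\<^sub>F s in at_right 0. (\<Sum>i\<in>Basis. \<Sum>j\<in>Basis. (c s i)\<^sup>2 * (c s j)\<^sup>2 * K i j) < X \<and> s \<in> {0<..<1}" by (rule eventually_conj)
  from eventually_happens'[OF _ this] obtain s where "s \<in> {0<..<1}" "(\<Sum>i\<in>Basis. \<Sum>j\<in>Basis. (c s i)\<^sup>2 * (c s j)\<^sup>2 * K i j) < X" by auto
  then show ?thesis using val[of s] by (intro exI[of _ s]) auto
qed

definition tensor :: "'a::euclidean_space \<Rightarrow> (real \<Rightarrow> real) \<Rightarrow> (real \<Rightarrow> real) \<Rightarrow> 'a \<Rightarrow> real" where
  "tensor b f w y = f (y \<bullet> b) * (\<Prod>j\<in>Basis - {b}. w (y \<bullet> j))"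

lemma smooth_tensor: "smooth f \<Longrightarrow> smooth w \<Longrightarrow> smooth (tensor b f w)"
  unfolding tensor_def[abs_def] by (intro smooth_mult smooth_prod smooth_compose_coordinate)

lemma pd_tensor:
  assumes f: "smooth f" and w: "smooth w" and b: "b \<in> Basis"
  shows "pd b (tensor b f w) = tensor b (deriv f) w"
proof
  fix y :: 'a
  let ?g = "\<lambda>y::'a. \<Prod>j\<in>Basis - {b}. w (y \<bullet> j)"
  have g: "smooth ?g" by (intro smooth_prod smooth_compose_coordinate w)
  have "((\<lambda>y. y \<bullet> b) has_derivative (\<lambda>v. v \<bullet> b)) (at y)" by (auto intro!: derivative_eq_intros)
  from pdI[OF has_derivative_compose[OF this has_field_derivative_imp_has_derivative[OF smooth_real_deriv(1)[OF f]]], of b]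
  have 1: "pd b (\<lambda>y. f (y \<bullet> b)) y = deriv f (y \<bullet> b)" using b by simp
  have 2: "pd b ?g y = 0"
  proof -
    have "((\<lambda>t. y + t *\<^sub>R b) has_derivative (\<lambda>t. t *\<^sub>R b)) (at 0)" by (auto intro!: derivative_eq_intros)
    from has_derivative_compose[OF this, of ?g "frechet_derivative ?g (at y)"] smooth_has_derivative[OF g, of y]
    have d: "((\<lambda>t. ?g (y + t *\<^sub>R b)) has_derivative (\<lambda>t. frechet_derivative ?g (at y) (t *\<^sub>R b))) (at 0)" by simp
    have "?g (y + t *\<^sub>R b) = ?g y" for t using b by (intro prod.cong refl) (auto simp: inner_add_left inner_Basis)
    then have "((\<lambda>t::real. ?g (y + t *\<^sub>R b)) has_derivative (\<lambda>_. 0)) (at 0)" by simp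
    from has_derivative_unique[OF d this] have "frechet_derivative ?g (at y) (1 *\<^sub>R b) = 0" by metis
    then show ?thesis by simp
  qed
  show "pd b (tensor b f w) y = tensor b (deriv f) w y"
    unfolding tensor_def[abs_def] pd_mult[OF smooth_compose_coordinate[OF f] g] 1 2 by simp
qed

lemma enn2real_power: "enn2real (x ^ n) = enn2real x ^ n"
  by (induction n) (simp_all add: enn2real_mult)

lemma integral_tensor:
  fixes b :: "'a::euclidean_space"
  assumes b: "b \<in> Basis" and f: "f \<in> borel_measurable borel" "\<And>t. 0 \<le> f t" and w: "w \<in> borel_measurable borel" "\<And>t. 0 \<le> w t"
  shows "(\<integral>y. tensor b f w y \<partial>lborel) = (\<integral>t. f t \<partial>lborel) * (\<integral>t. w t \<partial>lborel) ^ (DIM('a) - 1)"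
proof -
  have pr: "(\<Prod>j\<in>Basis. h j) = h b * (\<Prod>j\<in>Basis - {b}. h j)" for h :: "'a \<Rightarrow> 'b::comm_monoid_mult"
    using b by (simp add: prod.remove)
  have "(\<integral>\<^sup>+y. ennreal (tensor b f w y) \<partial>(lborel::'a measure)) = (\<integral>\<^sup>+y. (\<Prod>j\<in>Basis. ennreal ((if j = b then f else w) (y \<bullet> j))) \<partial>lborel)"
    unfolding tensor_def pr using f w by (intro nn_integral_cong) (simp add: ennreal_mult prod_nonneg prod_ennreal cong: prod.cong_simp)
  also have "\<dots> = (\<Prod>j\<in>(Basis::'a set). \<integral>\<^sup>+t. ennreal ((if j = b then f else w) t) \<partial>lborel)"
    by (rule nn_integral_lborel_prod) (use f w in auto)
  also have "\<dots> = (\<integral>\<^sup>+t. ennreal (f t) \<partial>lborel) * (\<integral>\<^sup>+t. ennreal (w t) \<partial>lborel) ^ (DIM('a) - 1)"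
    unfolding pr using b by simp
  finally have n: "(\<integral>\<^sup>+y. ennreal (tensor b f w y) \<partial>(lborel::'a measure)) = \<dots>" .
  have tm: "tensor b f w \<in> borel_measurable borel" unfolding tensor_def[abs_def] using f(1) w(1) by measurable
  have tn: "0 \<le> tensor b f w y" for y unfolding tensor_def using f w by (simp add: prod_nonneg)
  have "(\<integral>y. tensor b f w y \<partial>lborel) = enn2real (\<integral>\<^sup>+y. ennreal (tensor b f w y) \<partial>lborel)"
    using tm tn by (intro integral_eq_nn_integral) auto
  then show ?thesis unfolding n using f w by (simp add: enn2real_mult enn2real_power integral_eq_nn_integral)
qed

lemma profile_tensor:
  fixes b :: "'a::euclidean_space"
  assumes f: "smooth f" "\<And>t. N < \<bar>t\<bar> \<Longrightarrow> f t = 0" and w: "smooth w" "\<And>t. N < \<bar>t\<bar> \<Longrightarrow> w t = 0" and N: "N > 0" and b: "b \<in> Basis"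
  shows "profile (tensor b f w) (N * DIM('a))"
  unfolding profile_def
proof (intro conjI allI impI)
  show "smooth (tensor b f w)" by (rule smooth_tensor[OF f(1) w(1)])
  show "0 < N * DIM('a)" using N by simp
  fix y :: 'a assume y: "N * DIM('a) < norm y"
  have "\<exists>j\<in>Basis. N < \<bar>y \<bullet> j\<bar>"
  proof (rule ccontr)
    assume "\<not> ?thesis"
    then have "(\<Sum>j\<in>Basis. \<bar>y \<bullet> j\<bar>) \<le> (\<Sum>j\<in>(Basis::'a set). N)" by (intro sum_mono) force
    then show False using norm_le_l1[of y] y by (simp add: mult.commute)
  qed
  then obtain j where j: "j \<in> Basis" "N < \<bar>y \<bullet> j\<bar>" by blast
  show "tensor b f w y = 0"
  proof (cases "j = b")
    case True then show ?thesis using f(2) j by (simp add: tensor_def)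
  next
    case False 
    then have "(\<Prod>j\<in>Basis - {b}. w (y \<bullet> j)) = 0" using w(2)[OF j(2)] j(1) by (intro prod_zero) auto
    then show ?thesis by (simp add: tensor_def)
  qed
qed


lemma indicator_tensor_square:
  "b \<in> Basis \<Longrightarrow> indicator {y. y \<bullet> b \<in> I} y * (tensor b f w y)\<^sup>2 = tensor b (\<lambda>t. indicator I t * (f t)\<^sup>2) (\<lambda>t. (w t)\<^sup>2) y"
  by (simp add: tensor_def power_mult_distrib prod_power_distrib indicator_def)

lemma integral_tensor_square:
  fixes b :: "'a::euclidean_space"
  assumes b: "b \<in> Basis" and f: "smooth f" and w: "smooth w" and I: "I \<in> sets borel"
  shows "(\<integral>y. indicator {y. y \<bullet> b \<in> I} y * (tensor b f w y)\<^sup>2 \<partial>lborel) = 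
     (\<integral>t. indicator I t * (f t)\<^sup>2 \<partial>lborel) * (\<integral>t. (w t)\<^sup>2 \<partial>lborel) ^ (DIM('a) - 1)"
  unfolding indicator_tensor_square[OF b]
  by (rule integral_tensor[OF b]) (use smooth_borel[OF f] smooth_borel[OF w] I in auto)

lemma half_space_profile:
  fixes b :: "'a::euclidean_space"
  assumes b: "b \<in> Basis" and f: "smooth f" "\<And>t. N < \<bar>t\<bar> \<Longrightarrow> f t = 0" and w: "smooth w" "\<And>t. N < \<bar>t\<bar> \<Longrightarrow> w t = 0" and N: "N > 0"
    and wp: "0 < (\<integral>t. (w t)\<^sup>2 \<partial>lborel)" and fp: "0 < (\<integral>t. indicator {..<0} t * (f t)\<^sup>2 \<partial>lborel)"
  defines "H \<equiv> {y. y \<bullet> b < 0}" and "S \<equiv> {x. 0 \<le> x \<bullet> b \<and> x \<bullet> b \<le> 1}"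
  shows "(\<integral>t. indicator {..<0} t * (deriv (deriv f) t)\<^sup>2 \<partial>lborel) - (deriv f 0)\<^sup>2 < - c * (\<integral>t. indicator {..<0} t * (f t)\<^sup>2 \<partial>lborel) \<Longrightarrow>
      \<exists>G r. profile G r \<and> 0 < (\<integral>y. indicator H y * (G y)\<^sup>2 \<partial>lborel) \<and>
        (\<integral>y. indicator H y * bending \<sigma> G y \<partial>lborel) - (\<integral>y. indicator S y * (pd b G (perp b y))\<^sup>2 \<partial>lborel)
          < - c * (\<integral>y. indicator H y * (G y)\<^sup>2 \<partial>lborel)"
    and "(\<integral>t. indicator {..<0} t * (deriv (deriv f) t)\<^sup>2 \<partial>lborel) - (f 0)\<^sup>2 < - c * (\<integral>t. indicator {..<0} t * (f t)\<^sup>2 \<partial>lborel) \<Longrightarrow>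
      \<exists>G r. profile G r \<and> 0 < (\<integral>y. indicator H y * (G y)\<^sup>2 \<partial>lborel) \<and>
        (\<integral>y. indicator H y * bending \<sigma> G y \<partial>lborel) - (\<integral>y. indicator S y * (G (perp b y))\<^sup>2 \<partial>lborel)
          < - c * (\<integral>y. indicator H y * (G y)\<^sup>2 \<partial>lborel)"
proof -
  define \<kappa> where "\<kappa> = (\<integral>t. (w t)\<^sup>2 \<partial>lborel) ^ (DIM('a) - 1)"
  have k: "\<kappa> > 0" using wp by (simp add: \<kappa>_def)
  let ?F = "tensor b f w" and ?H = "{y::'a. y \<bullet> b < 0}" and ?S = "{x::'a. 0 \<le> x \<bullet> b \<and> x \<bullet> b \<le> 1}"
  note P = profile_tensor[OF f w N b] and F = smooth_tensor[OF f(1) w(1), of b]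
  note f' = smooth_real_deriv(2)[OF f(1)] and f'' = smooth_real_deriv(2)[OF smooth_real_deriv(2)[OF f(1)]]
  have HB: "?H \<in> sets borel" and SB: "?S \<in> sets borel" by measurable
  have i1: "(\<integral>y. indicator ?H y * (pd b (pd b ?F) y)\<^sup>2 \<partial>lborel) = (\<integral>t. indicator {..<0} t * (deriv (deriv f) t)\<^sup>2 \<partial>lborel) * \<kappa>"
    unfolding \<kappa>_def pd_tensor[OF f(1) w(1) b] fun_cong[OF pd_tensor[OF f' w(1) b]]
    using integral_tensor_square[OF b f'' w(1), of "{..<0}"] by simp
  have i2: "(\<integral>y. indicator ?H y * (?F y)\<^sup>2 \<partial>lborel) = (\<integral>t. indicator {..<0} t * (f t)\<^sup>2 \<partial>lborel) * \<kappa>"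
    unfolding \<kappa>_def using integral_tensor_square[OF b f(1) w(1), of "{..<0}"] by simp
  have i3: "(\<integral>y. indicator ?S y * (tensor b g w (perp b y))\<^sup>2 \<partial>lborel) = (g 0)\<^sup>2 * \<kappa>" for g
  proof -
    have "tensor b g w (perp b y) = tensor b (\<lambda>_. g 0) w y" for y
      using b by (auto simp: tensor_def perp_def inner_diff_left inner_Basis split: if_splits intro!: prod.cong)
    then show ?thesis unfolding \<kappa>_def using integral_tensor_square[OF b smooth_const[of "g 0"] w(1), of "{0..1}"] by simp
  qed
  have key: "\<exists>s. 0 < s \<and> s \<le> 1 \<and> (\<Prod>j\<in>(Basis::'a set). if j = b then 1 else s) * 
     (\<integral>y. indicator ?H y * bending \<sigma> (\<lambda>x. ?F (stretch b s x)) y \<partial>lborel) < X" 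
    if "(\<integral>t. indicator {..<0} t * (deriv (deriv f) t)\<^sup>2 \<partial>lborel) * \<kappa> < X" for X
    by (rule bending_stretch_limit[OF P b HB _ that[folded i1]]) (simp_all add: stretch_inner[OF b])
  have fin: "\<exists>G r. profile G r \<and> 0 < (\<integral>y. indicator ?H y * (G y)\<^sup>2 \<partial>lborel) \<and>
        (\<integral>y. indicator ?H y * bending \<sigma> G y \<partial>lborel) - (\<integral>y. indicator ?S y * (\<Phi> G (perp b y))\<^sup>2 \<partial>lborel)
          < - c * (\<integral>y. indicator ?H y * (G y)\<^sup>2 \<partial>lborel)"
    if J: "(\<integral>t. indicator {..<0} t * (deriv (deriv f) t)\<^sup>2 \<partial>lborel) - q < - c * (\<integral>t. indicator {..<0} t * (f t)\<^sup>2 \<partial>lborel)"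
      and q: "(\<integral>y. indicator ?S y * (\<Phi> ?F (perp b y))\<^sup>2 \<partial>lborel) = q * \<kappa>" 
      and Pc: "continuous_on UNIV (\<Phi> ?F)" and Ps: "\<And>s y. \<Phi> (\<lambda>x. ?F (stretch b s x)) y = \<Phi> ?F (stretch b s y)" for q and \<Phi> :: "('a \<Rightarrow> real) \<Rightarrow> 'a \<Rightarrow> real"
  proof -
    let ?m = "\<integral>t. indicator {..<0} t * (f t)\<^sup>2 \<partial>lborel"
    have "(\<integral>t. indicator {..<0} t * (deriv (deriv f) t)\<^sup>2 \<partial>lborel) * \<kappa> < (q - c * ?m) * \<kappa>"
      using J k by (intro mult_strict_right_mono) simp_all
    from key[OF this] obtain s where s: "0 < s" "s \<le> 1" and Q: "(\<Prod>j\<in>(Basis::'a set). if j = b then 1 else s) * 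
     (\<integral>y. indicator ?H y * bending \<sigma> (\<lambda>x. ?F (stretch b s x)) y \<partial>lborel) < (q - c * ?m) * \<kappa>" by blast
    define p where "p = (\<Prod>j\<in>(Basis::'a set). if j = b then 1 else s)"
    have p: "p > 0" unfolding p_def using s by (intro prod_pos) simp
    let ?G = "\<lambda>x. ?F (stretch b s x)"
    have iH: "indicator ?H (stretch b s y) = (indicator ?H y :: real)" for y by (simp add: indicator_def stretch_inner[OF b])
    have iS: "indicator ?S (stretch b s y) = (indicator ?S y :: real)" for y by (simp add: indicator_def stretch_inner[OF b])
    have m: "?m * \<kappa> = p * (\<integral>y. indicator ?H y * (?G y)\<^sup>2 \<partial>lborel)"
    proof -
      have "(\<lambda>y. indicator ?H y * (?F y)\<^sup>2) \<in> borel_measurable borel" using HB smooth_borel[OF F] by measurable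
      from lborel_integral_stretch[OF s(1) this, of b] show ?thesis unfolding i2 iH p_def .
    qed
    have e: "q * \<kappa> = p * (\<integral>y. indicator ?S y * (\<Phi> ?G (perp b y))\<^sup>2 \<partial>lborel)"
    proof -
      have "continuous_on UNIV (perp b)" unfolding perp_def[abs_def] by (intro continuous_intros)
      then have "continuous_on UNIV (\<lambda>y. \<Phi> ?F (perp b y))" by (intro continuous_on_compose2[OF Pc]) auto
      then have "(\<lambda>y. indicator ?S y * (\<Phi> ?F (perp b y))\<^sup>2) \<in> borel_measurable borel" 
        using SB by (intro borel_measurable_times borel_measurable_power borel_measurable_continuous_onI borel_measurable_indicator)
      from lborel_integral_stretch[OF s(1) this, of b] show ?thesis unfolding q iS p_def Ps perp_stretch[OF b] .
    qed
    show ?thesis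
    proof (intro exI[of _ ?G] exI[of _ "N * DIM('a) / s"] conjI)
      show "profile ?G (N * DIM('a) / s)" by (rule profile_stretch[OF P s])
      have "0 < p * (\<integral>y. indicator ?H y * (?G y)\<^sup>2 \<partial>lborel)" unfolding m[symmetric] using fp k by simp
      then show "0 < (\<integral>y. indicator ?H y * (?G y)\<^sup>2 \<partial>lborel)" using p by (simp add: zero_less_mult_iff)
      have "p * (\<integral>y. indicator ?H y * bending \<sigma> ?G y \<partial>lborel) < q * \<kappa> - c * (?m * \<kappa>)" using Q unfolding p_def by (simp add: algebra_simps)
      then have "p * (\<integral>y. indicator ?H y * bending \<sigma> ?G y \<partial>lborel) < p * ((\<integral>y. indicator ?S y * (\<Phi> ?G (perp b y))\<^sup>2 \<partial>lborel) - c * (\<integral>y. indicator ?H y * (?G y)\<^sup>2 \<partial>lborel))"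
        unfolding e m by (simp add: algebra_simps)
      then show "(\<integral>y. indicator ?H y * bending \<sigma> ?G y \<partial>lborel) - (\<integral>y. indicator ?S y * (\<Phi> ?G (perp b y))\<^sup>2 \<partial>lborel) < - c * (\<integral>y. indicator ?H y * (?G y)\<^sup>2 \<partial>lborel)"
        using p by simp
    qed
  qed
  {
    assume J: "(\<integral>t. indicator {..<0} t * (deriv (deriv f) t)\<^sup>2 \<partial>lborel) - (deriv f 0)\<^sup>2 < - c * (\<integral>t. indicator {..<0} t * (f t)\<^sup>2 \<partial>lborel)"
    show "\<exists>G r. profile G r \<and> 0 < (\<integral>y. indicator H y * (G y)\<^sup>2 \<partial>lborel) \<and>
        (\<integral>y. indicator H y * bending \<sigma> G y \<partial>lborel) - (\<integral>y. indicator S y * (pd b G (perp b y))\<^sup>2 \<partial>lborel)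
          < - c * (\<integral>y. indicator H y * (G y)\<^sup>2 \<partial>lborel)"
      unfolding H_def S_def
    proof (rule fin[OF J])
      show "(\<integral>y. indicator ?S y * (pd b ?F (perp b y))\<^sup>2 \<partial>lborel) = (deriv f 0)\<^sup>2 * \<kappa>"
        unfolding fun_cong[OF pd_tensor[OF f(1) w(1) b]] by (rule i3)
      show "continuous_on UNIV (pd b ?F)" by (rule smooth_continuous[OF smooth_pd[OF F b]])
      show "pd b (\<lambda>x. ?F (stretch b s x)) y = pd b ?F (stretch b s y)" for s y using pd_stretch[OF F b, of b s y] by simp
    qed
  }
  {
    assume J: "(\<integral>t. indicator {..<0} t * (deriv (deriv f) t)\<^sup>2 \<partial>lborel) - (f 0)\<^sup>2 < - c * (\<integral>t. indicator {..<0} t * (f t)\<^sup>2 \<partial>lborel)"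
    show "\<exists>G r. profile G r \<and> 0 < (\<integral>y. indicator H y * (G y)\<^sup>2 \<partial>lborel) \<and>
        (\<integral>y. indicator H y * bending \<sigma> G y \<partial>lborel) - (\<integral>y. indicator S y * (G (perp b y))\<^sup>2 \<partial>lborel)
          < - c * (\<integral>y. indicator H y * (G y)\<^sup>2 \<partial>lborel)"
      unfolding H_def S_def
      by (rule fin[OF J, where \<Phi>="\<lambda>G. G"]) (simp_all only: i3 smooth_continuous[OF F])
  }
qed

lemma whole_space_profile:
  fixes b :: "'a::euclidean_space"
  assumes b: "b \<in> Basis" and f: "smooth f" "\<And>t. N < \<bar>t\<bar> \<Longrightarrow> f t = 0" and w: "smooth w" "\<And>t. N < \<bar>t\<bar> \<Longrightarrow> w t = 0" and N: "N > 0"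
    and wp: "0 < (\<integral>t. (w t)\<^sup>2 \<partial>lborel)" and fp: "0 < (\<integral>t. (f t)\<^sup>2 \<partial>lborel)"
    and J: "(\<integral>t. (deriv (deriv f) t)\<^sup>2 \<partial>lborel) - (\<integral>t. (deriv f t)\<^sup>2 \<partial>lborel) < - c * (\<integral>t. (f t)\<^sup>2 \<partial>lborel)"
  shows "\<exists>G r. profile G r \<and> 0 < (\<integral>y. (G y)\<^sup>2 \<partial>(lborel :: 'a measure)) \<and>
        (\<integral>y. bending \<sigma> G y \<partial>lborel) - (\<integral>y. (norm (grad G y))\<^sup>2 \<partial>lborel) < - c * (\<integral>y. (G y)\<^sup>2 \<partial>lborel)"
proof -
  define \<kappa> where "\<kappa> = (\<integral>t. (w t)\<^sup>2 \<partial>lborel) ^ (DIM('a) - 1)"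
  have k: "\<kappa> > 0" using wp by (simp add: \<kappa>_def)
  let ?F = "tensor b f w"
  note P = profile_tensor[OF f w N b] and F = smooth_tensor[OF f(1) w(1), of b]
  note f' = smooth_real_deriv(2)[OF f(1)] and f'' = smooth_real_deriv(2)[OF smooth_real_deriv(2)[OF f(1)]]
  note it = integral_tensor_square[OF b _ w(1), of _ UNIV, folded \<kappa>_def, simplified]
  let ?A = "\<integral>t. (deriv (deriv f) t)\<^sup>2 \<partial>lborel" and ?D = "\<integral>t. (deriv f t)\<^sup>2 \<partial>lborel" and ?m = "\<integral>t. (f t)\<^sup>2 \<partial>lborel"
  have "?A * \<kappa> < (?D - c * ?m) * \<kappa>" using J k by (intro mult_strict_right_mono) simp_all
  then have "(\<integral>y. indicator UNIV y * (pd b (pd b ?F) y)\<^sup>2 \<partial>lborel) < (?D - c * ?m) * \<kappa>"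
    unfolding pd_tensor[OF f(1) w(1) b] fun_cong[OF pd_tensor[OF f' w(1) b]] by (simp add: it[OF f''])
  from bending_stretch_limit[OF P b _ _ this, of \<sigma>] obtain s where s: "0 < s" "s \<le> 1" 
    and Q: "(\<Prod>j\<in>(Basis::'a set). if j = b then 1 else s) * (\<integral>y. bending \<sigma> (\<lambda>x. ?F (stretch b s x)) y \<partial>lborel) < (?D - c * ?m) * \<kappa>" by auto
  define p where "p = (\<Prod>j\<in>(Basis::'a set). if j = b then 1 else s)"
  have p: "p > 0" unfolding p_def using s by (intro prod_pos) simp
  let ?G = "\<lambda>x. ?F (stretch b s x)"
  note PG = profile_stretch[OF P s, of b] note G = profileD(1)[OF PG]
  have m: "?m * \<kappa> = p * (\<integral>y. (?G y)\<^sup>2 \<partial>lborel)"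
    unfolding it[OF f(1), symmetric] p_def using smooth_borel[OF F] by (intro lborel_integral_stretch[OF s(1)]) measurable
  have d: "?D * \<kappa> = p * (\<integral>y. (pd b ?G y)\<^sup>2 \<partial>lborel)"
  proof -
    have "(\<lambda>y. (pd b ?F y)\<^sup>2) \<in> borel_measurable borel" using smooth_borel[OF smooth_pd[OF F b]] by measurable
    from lborel_integral_stretch[OF s(1) this, of b] show ?thesis
      unfolding p_def using it[OF f'] by (simp add: fun_cong[OF pd_tensor[OF f(1) w(1) b]] pd_stretch[OF F b])
  qed
  have g: "(\<integral>y. (pd b ?G y)\<^sup>2 \<partial>lborel) \<le> (\<integral>y. (norm (grad ?G y))\<^sup>2 \<partial>lborel)"
  proof (rule integral_mono)
    show "integrable lborel (\<lambda>y. (pd b ?G y)\<^sup>2)"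
      by (rule integrable_lborel_compact_support[OF compact_cball[of 0 "N * DIM('a) / s"]])
        (use smooth_continuous[OF smooth_pd[OF G b]] profileD(4)[OF PG] in \<open>auto intro!: continuous_intros\<close>)
    show "integrable lborel (\<lambda>y. (norm (grad ?G y))\<^sup>2)"
      by (rule integrable_lborel_compact_support[OF compact_cball[of 0 "N * DIM('a) / s"]])
        (use continuous_grad[OF G] profileD(5)[OF PG] in \<open>auto intro!: continuous_intros\<close>)
    fix y show "(pd b ?G y)\<^sup>2 \<le> (norm (grad ?G y))\<^sup>2"
      unfolding norm_grad_sq using b member_le_sum[of b Basis "\<lambda>j. (pd j ?G y)\<^sup>2"] by simp
  qed
  show ?thesis
  proof (intro exI[of _ ?G] exI[of _ "N * DIM('a) / s"] conjI)
    show "profile ?G (N * DIM('a) / s)" by (rule PG)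
    have "0 < p * (\<integral>y. (?G y)\<^sup>2 \<partial>lborel)" unfolding m[symmetric] using fp k by simp
    then show "0 < (\<integral>y. (?G y)\<^sup>2 \<partial>lborel)" using p by (simp add: zero_less_mult_iff)
    have "p * (\<integral>y. bending \<sigma> ?G y \<partial>lborel) < ?D * \<kappa> - c * (?m * \<kappa>)" using Q unfolding p_def by (simp add: algebra_simps)
    then have "p * (\<integral>y. bending \<sigma> ?G y \<partial>lborel) < p * ((\<integral>y. (pd b ?G y)\<^sup>2 \<partial>lborel) - c * (\<integral>y. (?G y)\<^sup>2 \<partial>lborel))"
      unfolding d m by (simp add: algebra_simps)
    then have "(\<integral>y. bending \<sigma> ?G y \<partial>lborel) < (\<integral>y. (pd b ?G y)\<^sup>2 \<partial>lborel) - c * (\<integral>y. (?G y)\<^sup>2 \<partial>lborel)" using p by simp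
    then show "(\<integral>y. bending \<sigma> ?G y \<partial>lborel) - (\<integral>y. (norm (grad ?G y))\<^sup>2 \<partial>lborel) < - c * (\<integral>y. (?G y)\<^sup>2 \<partial>lborel)" using g by simp
  qed
qed

(*T14*)
definition bump :: "real \<Rightarrow> real" where "bump t = exp 2 * (flat (1 - t) * flat (1 + t))"

lemma smooth_bump: "smooth bump"
proof -
  have "smooth (\<lambda>t. flat (1 - t))" using smooth_compose_affine[OF smooth_flat, of "-1" 1] by simp
  moreover have "smooth (\<lambda>t. flat (1 + t))" using smooth_compose_affine[OF smooth_flat, of 1 "-1"] by (simp add: add.commute)
  ultimately show ?thesis unfolding bump_def[abs_def] by (intro smooth_mult smooth_const)
qed

lemma bump_outside: "1 < \<bar>t\<bar> \<Longrightarrow> bump t = 0"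
  by (auto simp: bump_def flat_def)

lemma bump_pos: "\<bar>t\<bar> < 1 \<Longrightarrow> 0 < bump t"
  by (simp add: bump_def flat_pos abs_less_iff)

lemma bump_0: "bump 0 = 1"
  by (simp add: bump_def flat_def flip: exp_add)

lemma deriv_zero_outside:
  fixes f :: "real \<Rightarrow> real"
  assumes "\<And>t. N < \<bar>t\<bar> \<Longrightarrow> f t = 0" "N < \<bar>t\<bar>"
  shows "deriv f t = 0"
proof (rule DERIV_imp_deriv, rule has_field_derivative_transform_within_open)
  show "((\<lambda>_. 0::real) has_field_derivative 0) (at t)" by simp
  show "open {t::real. N < \<bar>t\<bar>}" by (intro open_Collect_less continuous_intros)
qed (use assms in auto)

lemma bounded_compact_support:
  fixes f :: "real \<Rightarrow> real"
  assumes "continuous_on UNIV f" "\<And>t. N < \<bar>t\<bar> \<Longrightarrow> f t = 0"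
  shows "\<exists>B\<ge>0. \<forall>t. \<bar>f t\<bar> \<le> B"
proof -
  have "bounded (f ` {-N..N})"
    by (intro compact_imp_bounded compact_continuous_image continuous_on_subset[OF assms(1)]) auto
  then obtain B where B: "\<And>t. t \<in> {-N..N} \<Longrightarrow> \<bar>f t\<bar> \<le> B" unfolding bounded_iff by (metis imageI real_norm_def)
  have "\<bar>f t\<bar> \<le> max B 0" for t 
    by (cases "N < \<bar>t\<bar>", simp add: assms(2), rule order_trans[OF B max.cobounded1], auto)
  then show ?thesis by (intro exI[of _ "max B 0"]) auto
qed

lemma exponential_half_line:
  assumes k: "k > (0::real)"
  shows "integrable lborel (\<lambda>t. indicator {..<0} t * exp (k * t))" "(\<integral>t. indicator {..<0} t * exp (k * t) \<partial>lborel) = 1 / k"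
proof -
  have e: "einterval (-\<infinity>) (ereal 0) = {..<0::real}" by (auto simp: einterval_def)
  note FTC = interval_integral_FTC_nonneg[of "-\<infinity>" "ereal 0" "\<lambda>t. exp (k * t) / k" "\<lambda>t. exp (k * t)" 0 "1 / k"]
  have l: "((\<lambda>t. exp (k * t) / k) \<longlongrightarrow> 0) at_bot"
    using k by (intro tendsto_divide_zero filterlim_compose[OF exp_at_bot] filterlim_tendsto_pos_mult_at_bot[OF tendsto_const]) (auto simp: filterlim_ident)
  have r: "((\<lambda>t. exp (k * t) / k) \<longlongrightarrow> 1 / k) (at_left 0)"
    using k tendsto_divide[OF tendsto_exp[OF tendsto_mult[OF tendsto_const[of k] tendsto_ident_at[of 0 "{..<0}"]]] tendsto_const[of k]] by simp
  have F: "set_integrable lborel (einterval (-\<infinity>) (ereal 0)) (\<lambda>t. exp (k * t))" "(LBINT t=-\<infinity>..ereal 0. exp (k * t)) = 1 / k - 0"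
    by (rule FTC; use k l r in \<open>auto intro!: derivative_eq_intros continuous_intros simp: ereal_tendsto_simps1\<close>)+
  show "integrable lborel (\<lambda>t. indicator {..<0} t * exp (k * t))"
    using F(1) unfolding e set_integrable_def by simp
  show "(\<integral>t. indicator {..<0} t * exp (k * t) \<partial>lborel) = 1 / k"
    using F(2) unfolding interval_lebesgue_integral_def e set_lebesgue_integral_def by simp
qed

definition exp_profile :: "real \<Rightarrow> nat \<Rightarrow> real \<Rightarrow> real" where
  "exp_profile c n t = exp (c * t) * bump (1 / real (Suc n) * (t - 0))"

lemma exp_profile_derivs:
  defines "e n \<equiv> 1 / real (Suc n)"
  shows "smooth (exp_profile c n)" "real (Suc n) < \<bar>t\<bar> \<Longrightarrow> exp_profile c n t = 0"
    "deriv (exp_profile c n) t = exp (c * t) * (c * bump (e n * t) + e n * deriv bump (e n * t))"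
    "deriv (deriv (exp_profile c n)) t = exp (c * t) * (c\<^sup>2 * bump (e n * t) + 2 * c * e n * deriv bump (e n * t) + (e n)\<^sup>2 * deriv (deriv bump) (e n * t))"
proof -
  show "smooth (exp_profile c n)" unfolding exp_profile_def[abs_def]
    by (intro smooth_mult smooth_exp_mult smooth_compose_affine smooth_bump)
  show "real (Suc n) < \<bar>t\<bar> \<Longrightarrow> exp_profile c n t = 0"
    unfolding exp_profile_def by (subst bump_outside) (simp_all add: pos_less_divide_eq)
  have d: "(bump has_real_derivative deriv bump x) (at x)" "(deriv bump has_real_derivative deriv (deriv bump) x) (at x)" for x
    by (rule smooth_real_deriv(1) smooth_real_deriv(2) smooth_bump)+
  have D: "((\<lambda>t. g (e n * t)) has_real_derivative e n * g' (e n * t)) (at t)" if "\<And>x. (g has_real_derivative g' x) (at x)" for g g' :: "real \<Rightarrow> real" and t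
  proof -
    have "((\<lambda>t. e n * t) has_real_derivative e n) (at t)" by (auto intro!: derivative_eq_intros)
    from DERIV_chain2[OF that this] show ?thesis by (simp only: mult.commute)
  qed
  have 1: "exp_profile c n = (\<lambda>t. exp (c * t) * bump (e n * t))" by (simp add: exp_profile_def[abs_def] e_def)
  have E: "((\<lambda>t. exp (c * t) * h t) has_real_derivative exp (c * t) * (c * h t + h')) (at t)" if "(h has_real_derivative h') (at t)" for h h' t
    using that by (auto intro!: derivative_eq_intros simp: algebra_simps)
  note d1 = D[OF d(1)] and d2 = D[OF d(2)]
  have 2: "deriv (exp_profile c n) = (\<lambda>t. exp (c * t) * (c * bump (e n * t) + e n * deriv bump (e n * t)))"
    unfolding 1 by (rule ext) (rule DERIV_imp_deriv[OF E[OF d1]])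
  show "deriv (exp_profile c n) t = exp (c * t) * (c * bump (e n * t) + e n * deriv bump (e n * t))" by (simp add: 2)
  show "deriv (deriv (exp_profile c n)) t = exp (c * t) * (c\<^sup>2 * bump (e n * t) + 2 * c * e n * deriv bump (e n * t) + (e n)\<^sup>2 * deriv (deriv bump) (e n * t))"
    unfolding 2 DERIV_imp_deriv[OF E[OF DERIV_add[OF DERIV_cmult[OF d1] DERIV_cmult[OF d2]]]] by (simp add: algebra_simps power2_eq_square)
qed

lemma exp_profile_limits:
  assumes c: "c > 0"
  shows "(\<lambda>n. \<integral>t. indicator {..<0} t * (exp_profile c n t)\<^sup>2 \<partial>lborel) \<longlonglongrightarrow> 1 / (2 * c)"
    "(\<lambda>n. \<integral>t. indicator {..<0} t * (deriv (deriv (exp_profile c n)) t)\<^sup>2 \<partial>lborel) \<longlonglongrightarrow> c ^ 3 / 2"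
    "(\<lambda>n. deriv (exp_profile c n) 0) \<longlonglongrightarrow> c" "exp_profile c n 0 = 1"
proof -
  define e where "e n = 1 / real (Suc n)" for n
  note s0 = smooth_bump and s1 = smooth_real_deriv(2)[OF smooth_bump] and s2 = smooth_real_deriv(2)[OF smooth_real_deriv(2)[OF smooth_bump]]
  have e: "e \<longlonglongrightarrow> 0" unfolding e_def by (rule LIMSEQ_Suc[OF lim_1_over_n])
  have e01: "0 \<le> e n" "e n \<le> 1" for n by (simp_all add: e_def)
  have z1: "deriv bump t = 0" if "1 < \<bar>t\<bar>" for t by (rule deriv_zero_outside[where N=1]) (use that bump_outside in auto)
  have z2: "deriv (deriv bump) t = 0" if "1 < \<bar>t\<bar>" for t by (rule deriv_zero_outside[where N=1]) (use that z1 in auto)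
  obtain B0 where B0: "B0 \<ge> 0" "\<And>t. \<bar>bump t\<bar> \<le> B0" using bounded_compact_support[OF smooth_continuous[OF s0] bump_outside] by blast
  obtain B1 where B1: "B1 \<ge> 0" "\<And>t. \<bar>deriv bump t\<bar> \<le> B1" using bounded_compact_support[OF smooth_continuous[OF s1] z1] by blast
  obtain B2 where B2: "B2 \<ge> 0" "\<And>t. \<bar>deriv (deriv bump) t\<bar> \<le> B2" using bounded_compact_support[OF smooth_continuous[OF s2] z2] by blast
  have cont: "(\<lambda>n. g (e n * t)) \<longlonglongrightarrow> g 0" if "smooth g" for g :: "real \<Rightarrow> real" and t
  proof -
    have "isCont g 0" using smooth_continuous[OF that, of UNIV] by (simp add: continuous_on_eq_continuous_at)
    then show ?thesis by (rule isCont_tendsto_compose) (use tendsto_mult_left_zero[OF e, of t] in simp)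
  qed
  have DC: "(\<lambda>n. \<integral>t. indicator {..<0} t * (exp (c * t) * h n t)\<^sup>2 \<partial>lborel) \<longlonglongrightarrow> l\<^sup>2 * (1 / (2 * c))"
    if hm: "\<And>n. h n \<in> borel_measurable borel" and hb: "\<And>n t. \<bar>h n t\<bar> \<le> B" and hl: "\<And>t. (\<lambda>n. h n t) \<longlonglongrightarrow> l" for h :: "nat \<Rightarrow> real \<Rightarrow> real" and B l
  proof -
    have c2: "2 * c > 0" using c by simp
    have sq: "(exp (c * t))\<^sup>2 = exp (2 * c * t)" for t by (simp add: power2_eq_square flip: exp_add)
    have "(\<lambda>n. \<integral>t. indicator {..<0} t * (exp (c * t) * h n t)\<^sup>2 \<partial>lborel) \<longlonglongrightarrow> (\<integral>t. indicator {..<0} t * (exp (c * t) * l)\<^sup>2 \<partial>lborel)"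
    proof (rule integral_dominated_convergence[where w="\<lambda>t. B\<^sup>2 * (indicator {..<0} t * exp (2 * c * t))"])
      show "integrable lborel (\<lambda>t. B\<^sup>2 * (indicator {..<0} t * exp (2 * c * t)))" using exponential_half_line(1)[OF c2] by simp
      show "AE t in lborel. (\<lambda>n. indicator {..<0} t * (exp (c * t) * h n t)\<^sup>2) \<longlonglongrightarrow> indicator {..<0} t * (exp (c * t) * l)\<^sup>2"
        by (intro AE_I2 tendsto_intros hl)
      fix n
      show "AE t in lborel. norm (indicator {..<0} t * (exp (c * t) * h n t)\<^sup>2) \<le> B\<^sup>2 * (indicator {..<0} t * exp (2 * c * t))"
      proof (rule AE_I2)
        fix t :: real
        have "(h n t)\<^sup>2 \<le> B\<^sup>2" using hb[of n t] by (metis abs_ge_zero power2_abs power_mono)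
        then have "exp (2 * c * t) * (h n t)\<^sup>2 \<le> exp (2 * c * t) * B\<^sup>2" by (intro mult_left_mono) simp_all
        then show "norm (indicator {..<0} t * (exp (c * t) * h n t)\<^sup>2) \<le> B\<^sup>2 * (indicator {..<0} t * exp (2 * c * t))"
          unfolding power_mult_distrib sq by (simp add: indicator_def mult.commute)
      qed
      show "(\<lambda>t. indicator {..<0} t * (exp (c * t) * h n t)\<^sup>2) \<in> borel_measurable lborel" using hm[of n] by measurable
    qed measurable
    also have "(\<integral>t. indicator {..<0} t * (exp (c * t) * l)\<^sup>2 \<partial>lborel) = (\<integral>t. l\<^sup>2 * (indicator {..<0} t * exp (2 * c * t)) \<partial>lborel)"
      by (intro Bochner_Integration.integral_cong refl) (simp add: power_mult_distrib sq)
    also have "\<dots> = l\<^sup>2 * (1 / (2 * c))" using exponential_half_line(2)[OF c2] by simp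
    finally show ?thesis .
  qed
  show "exp_profile c n 0 = 1" by (simp add: exp_profile_def bump_0)
  have "(\<lambda>n. c * bump (e n * 0) + e n * deriv bump (e n * 0)) \<longlonglongrightarrow> c * bump 0 + 0 * deriv bump 0"
    by (intro tendsto_intros cont s0 s1 e)
  then show "(\<lambda>n. deriv (exp_profile c n) 0) \<longlonglongrightarrow> c" unfolding exp_profile_derivs(3) e_def[symmetric] by (simp add: bump_0)
  have m: "(\<lambda>t. g (e n * t)) \<in> borel_measurable borel" if "smooth g" for g :: "real \<Rightarrow> real" and n
    using measurable_compose[OF _ smooth_borel[OF that], of "\<lambda>t. e n * t" borel] by simp
  have "(\<lambda>n. \<integral>t. indicator {..<0} t * (exp (c * t) * bump (e n * t))\<^sup>2 \<partial>lborel) \<longlonglongrightarrow> 1\<^sup>2 * (1 / (2 * c))"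
    by (rule DC[OF m[OF s0] B0(2)]) (use cont[OF s0] in \<open>simp add: bump_0\<close>)
  then show "(\<lambda>n. \<integral>t. indicator {..<0} t * (exp_profile c n t)\<^sup>2 \<partial>lborel) \<longlonglongrightarrow> 1 / (2 * c)"
    by (simp add: exp_profile_def e_def)
  have "(\<lambda>n. \<integral>t. indicator {..<0} t * (exp (c * t) * (c\<^sup>2 * bump (e n * t) + 2 * c * e n * deriv bump (e n * t) + (e n)\<^sup>2 * deriv (deriv bump) (e n * t)))\<^sup>2 \<partial>lborel)
     \<longlonglongrightarrow> (c\<^sup>2)\<^sup>2 * (1 / (2 * c))"
  proof (rule DC)
    show "(\<lambda>t. c\<^sup>2 * bump (e n * t) + 2 * c * e n * deriv bump (e n * t) + (e n)\<^sup>2 * deriv (deriv bump) (e n * t)) \<in> borel_measurable borel" for n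
      by (intro borel_measurable_add borel_measurable_times borel_measurable_const m s0 s1 s2)
    have "(\<lambda>n. c\<^sup>2 * bump (e n * t) + 2 * c * e n * deriv bump (e n * t) + (e n)\<^sup>2 * deriv (deriv bump) (e n * t)) \<longlonglongrightarrow> 
       c\<^sup>2 * bump 0 + 2 * c * 0 * deriv bump 0 + 0\<^sup>2 * deriv (deriv bump) 0" for t
      by (intro tendsto_intros cont s0 s1 s2 e)
    then show "(\<lambda>n. c\<^sup>2 * bump (e n * t) + 2 * c * e n * deriv bump (e n * t) + (e n)\<^sup>2 * deriv (deriv bump) (e n * t)) \<longlonglongrightarrow> c\<^sup>2" for t
      by (simp add: bump_0)
    show "\<bar>c\<^sup>2 * bump (e n * t) + 2 * c * e n * deriv bump (e n * t) + (e n)\<^sup>2 * deriv (deriv bump) (e n * t)\<bar> \<le> c\<^sup>2 * B0 + 2 * c * B1 + B2" for n t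
    proof -
      have "\<bar>c\<^sup>2 * bump (e n * t)\<bar> \<le> c\<^sup>2 * B0" unfolding abs_mult using B0 by (simp add: mult_left_mono)
      moreover have "\<bar>2 * c * e n * deriv bump (e n * t)\<bar> \<le> (2 * c * 1) * B1" 
        unfolding abs_mult using B1 c e01[of n] by (intro mult_mono) simp_all
      moreover have "\<bar>(e n)\<^sup>2 * deriv (deriv bump) (e n * t)\<bar> \<le> 1 * B2" 
        unfolding abs_mult using B2 e01[of n] by (intro mult_mono) (simp_all add: power_le_one)
      ultimately show ?thesis by linarith
    qed
  qed
  then show "(\<lambda>n. \<integral>t. indicator {..<0} t * (deriv (deriv (exp_profile c n)) t)\<^sup>2 \<partial>lborel) \<longlonglongrightarrow> c ^ 3 / 2"
    unfolding exp_profile_derivs(4) e_def[symmetric] using c by (simp add: power2_eq_square power3_eq_cube field_simps)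
qed

lemma half_line_profile:
  fixes c C :: real
  assumes c: "c > 0"
  shows "C < 2 * c ^ 3 - c ^ 4 \<Longrightarrow> \<exists>f N. smooth f \<and> N \<ge> 1 \<and> (\<forall>t. N < \<bar>t\<bar> \<longrightarrow> f t = 0) \<and> 0 < (\<integral>t. indicator {..<0} t * (f t)\<^sup>2 \<partial>lborel) \<and>
      (\<integral>t. indicator {..<0} t * (deriv (deriv f) t)\<^sup>2 \<partial>lborel) - (deriv f 0)\<^sup>2 < - C * (\<integral>t. indicator {..<0} t * (f t)\<^sup>2 \<partial>lborel)"
    and "C < 2 * c - c ^ 4 \<Longrightarrow> \<exists>f N. smooth f \<and> N \<ge> 1 \<and> (\<forall>t. N < \<bar>t\<bar> \<longrightarrow> f t = 0) \<and> 0 < (\<integral>t. indicator {..<0} t * (f t)\<^sup>2 \<partial>lborel) \<and>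
      (\<integral>t. indicator {..<0} t * (deriv (deriv f) t)\<^sup>2 \<partial>lborel) - (f 0)\<^sup>2 < - C * (\<integral>t. indicator {..<0} t * (f t)\<^sup>2 \<partial>lborel)"
proof -
  note L = exp_profile_limits[OF c]
  have c3: "1 / (2 * c) > 0" using c by simp
  have ev: "\<exists>f N. smooth f \<and> N \<ge> 1 \<and> (\<forall>t. N < \<bar>t\<bar> \<longrightarrow> f t = 0) \<and> 0 < (\<integral>t. indicator {..<0} t * (f t)\<^sup>2 \<partial>lborel) \<and>
      (\<integral>t. indicator {..<0} t * (deriv (deriv f) t)\<^sup>2 \<partial>lborel) - (q f)\<^sup>2 < - C * (\<integral>t. indicator {..<0} t * (f t)\<^sup>2 \<partial>lborel)"
    if q: "(\<lambda>n. q (exp_profile c n)) \<longlonglongrightarrow> l" and C: "C < 2 * c * (l\<^sup>2 - c ^ 3 / 2)" for q l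
  proof -
    let ?m = "\<lambda>n. \<integral>t. indicator {..<0} t * (exp_profile c n t)\<^sup>2 \<partial>lborel"
    let ?A = "\<lambda>n. \<integral>t. indicator {..<0} t * (deriv (deriv (exp_profile c n)) t)\<^sup>2 \<partial>lborel"
    have lim: "(\<lambda>n. ?A n - (q (exp_profile c n))\<^sup>2 + C * ?m n) \<longlonglongrightarrow> c ^ 3 / 2 - l\<^sup>2 + C * (1 / (2 * c))"
      by (intro tendsto_intros L q)
    have "C * (1 / (2 * c)) < l\<^sup>2 - c ^ 3 / 2" using C c by (simp add: pos_divide_less_eq mult.commute)
    then have neg: "c ^ 3 / 2 - l\<^sup>2 + C * (1 / (2 * c)) < 0" by simp
    have "\<forall>\<^sub>F n in sequentially. 0 < ?m n \<and> ?A n - (q (exp_profile c n))\<^sup>2 + C * ?m n < 0"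
      using order_tendstoD(1)[OF L(1) c3] order_tendstoD(2)[OF lim neg] by (rule eventually_conj)
    from eventually_happens'[OF _ this] obtain n where n: "0 < ?m n" "?A n - (q (exp_profile c n))\<^sup>2 + C * ?m n < 0" by auto
    show ?thesis
    proof (rule exI[of _ "exp_profile c n"], rule exI[of _ "real (Suc n)"], intro conjI)
      show "?A n - (q (exp_profile c n))\<^sup>2 < - C * ?m n" using n(2) by simp
    qed (use n(1) exp_profile_derivs(1,2)[where c=c and n=n] in auto)
  qed
  have f1: "2 * c * (c\<^sup>2 - c ^ 3 / 2) = 2 * c ^ 3 - c ^ 4" by (simp add: algebra_simps power2_eq_square power3_eq_cube power4_eq_xxxx)
  have f2: "2 * c * (1\<^sup>2 - c ^ 3 / 2) = 2 * c - c ^ 4" by (simp add: algebra_simps power3_eq_cube power4_eq_xxxx)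
  show "C < 2 * c ^ 3 - c ^ 4 \<Longrightarrow> \<exists>f N. smooth f \<and> N \<ge> 1 \<and> (\<forall>t. N < \<bar>t\<bar> \<longrightarrow> f t = 0) \<and> 0 < (\<integral>t. indicator {..<0} t * (f t)\<^sup>2 \<partial>lborel) \<and>
      (\<integral>t. indicator {..<0} t * (deriv (deriv f) t)\<^sup>2 \<partial>lborel) - (deriv f 0)\<^sup>2 < - C * (\<integral>t. indicator {..<0} t * (f t)\<^sup>2 \<partial>lborel)"
    by (rule ev[OF L(3)]) (simp only: f1)
  show "C < 2 * c - c ^ 4 \<Longrightarrow> \<exists>f N. smooth f \<and> N \<ge> 1 \<and> (\<forall>t. N < \<bar>t\<bar> \<longrightarrow> f t = 0) \<and> 0 < (\<integral>t. indicator {..<0} t * (f t)\<^sup>2 \<partial>lborel) \<and>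
      (\<integral>t. indicator {..<0} t * (deriv (deriv f) t)\<^sup>2 \<partial>lborel) - (f 0)\<^sup>2 < - C * (\<integral>t. indicator {..<0} t * (f t)\<^sup>2 \<partial>lborel)"
    by (rule ev[where q="\<lambda>f. f 0" and l=1]) (simp_all only: f2 L(4) tendsto_const)
qed

lemma integral_square_pos:
  fixes f :: "'a::euclidean_space \<Rightarrow> real"
  assumes K: "compact K" and f: "continuous_on UNIV f" and z: "\<And>x. x \<notin> K \<Longrightarrow> f x = 0" and x: "f x \<noteq> 0"
  shows "0 < (\<integral>x. (f x)\<^sup>2 \<partial>lborel)"
proof (rule ccontr)
  assume "\<not> ?thesis"
  moreover have "0 \<le> (\<integral>x. (f x)\<^sup>2 \<partial>lborel)" by simp
  ultimately have "(\<integral>x. (f x)\<^sup>2 \<partial>lborel) = 0" by linarith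
  moreover have "integrable lborel (\<lambda>x. (f x)\<^sup>2)"
    by (rule integrable_lborel_compact_support[OF K]) (use f z in \<open>auto intro!: continuous_intros\<close>)
  ultimately have "AE x in lborel. (f x)\<^sup>2 = 0" using integral_nonneg_eq_0_iff_AE[of lborel "\<lambda>x. (f x)\<^sup>2"] by simp
  moreover have O: "open {x. f x \<noteq> 0}" by (intro open_Collect_neq f continuous_intros)
  ultimately have "{x. f x \<noteq> 0} \<in> null_sets lborel" using AE_iff_null[of lborel "\<lambda>x. f x = 0"] by simp
  then have "negligible {x. f x \<noteq> 0}" unfolding negligible_iff_null_sets by (rule null_sets_completionI)
  then show False using O open_not_negligible x by blast
qed

lemma oscillating_profile:
  assumes C: "C < (1 / 4 :: real)"
  shows "\<exists>f N. smooth f \<and> N \<ge> 1 \<and> (\<forall>t. N < \<bar>t\<bar> \<longrightarrow> f t = 0) \<and> 0 < (\<integral>t. (f t)\<^sup>2 \<partial>lborel) \<and>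
      (\<integral>t. (deriv (deriv f) t)\<^sup>2 \<partial>lborel) - (\<integral>t. (deriv f t)\<^sup>2 \<partial>lborel) < - C * (\<integral>t. (f t)\<^sup>2 \<partial>lborel)"
proof -
  note s0 = smooth_bump and s1 = smooth_real_deriv(2)[OF smooth_bump] and s2 = smooth_real_deriv(2)[OF smooth_real_deriv(2)[OF smooth_bump]]
  have z1: "deriv bump t = 0" if "1 < \<bar>t\<bar>" for t by (rule deriv_zero_outside[where N=1]) (use that bump_outside in auto)
  have z2: "deriv (deriv bump) t = 0" if "1 < \<bar>t\<bar>" for t by (rule deriv_zero_outside[where N=1]) (use that z1 in auto)
  have int: "integrable lborel g" if "continuous_on UNIV g" "\<And>t. M < \<bar>t\<bar> \<Longrightarrow> g t = 0" for g :: "real \<Rightarrow> real" and M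
    by (rule integrable_lborel_compact_support[OF compact_cball[of 0 M] that(1)]) (use that(2) in simp)
  define \<omega> where "\<omega> = 1 / sqrt (2::real)"
  have w: "\<omega>\<^sup>2 = 1 / 2" "0 < \<omega>" "\<omega> < 1" by (simp_all add: \<omega>_def power_divide)
  define I0 where "I0 = (\<integral>t. (bump t)\<^sup>2 \<partial>lborel)"
  define I1 where "I1 = (\<integral>t. (deriv bump t)\<^sup>2 - bump t * deriv (deriv bump) t \<partial>lborel)"
  define I2 where "I2 = (\<integral>t. (deriv (deriv bump) t)\<^sup>2 \<partial>lborel)"
  have I0: "0 < I0" unfolding I0_def
    by (rule integral_square_pos[OF compact_cball[of 0 1] smooth_continuous[OF s0], where x=0]) (use bump_outside bump_0 in auto)
  have i0: "integrable lborel (\<lambda>t. (bump t)\<^sup>2)" and i1: "integrable lborel (\<lambda>t. (deriv bump t)\<^sup>2 - bump t * deriv (deriv bump) t)" and i2: "integrable lborel (\<lambda>t. (deriv (deriv bump) t)\<^sup>2)"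
    by (rule int[where M=1]; use z1 z2 bump_outside in \<open>auto intro!: continuous_intros smooth_continuous[OF s0] smooth_continuous[OF s1] smooth_continuous[OF s2]\<close>)+
  have e: "(\<lambda>n. 1 / real (Suc n)) \<longlonglongrightarrow> 0" by (rule LIMSEQ_Suc[OF lim_1_over_n])
  have "(\<lambda>n. (C - 1 / 4) * I0 + (1 / real (Suc n))\<^sup>2 * I1 + (1 / real (Suc n)) ^ 4 * I2) \<longlonglongrightarrow> (C - 1 / 4) * I0 + 0\<^sup>2 * I1 + 0 ^ 4 * I2"
    by (intro tendsto_intros e)
  moreover have "(C - 1 / 4) * I0 + 0\<^sup>2 * I1 + 0 ^ 4 * I2 < 0" using C I0 by (simp add: mult_less_0_iff)
  ultimately have "\<forall>\<^sub>F n in sequentially. (C - 1 / 4) * I0 + (1 / real (Suc n))\<^sup>2 * I1 + (1 / real (Suc n)) ^ 4 * I2 < 0 \<and> 1 \<le> n"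
    by (intro eventually_conj order_tendstoD(2) eventually_ge_at_top)
  from eventually_happens'[OF _ this] obtain n where n: "(C - 1 / 4) * I0 + (1 / real (Suc n))\<^sup>2 * I1 + (1 / real (Suc n)) ^ 4 * I2 < 0" "1 \<le> n" by auto
  define q where "q = 1 / real (Suc n)"
  have q: "0 < q" "q < 1" using n(2) by (simp_all add: q_def)
  have nq: "(C - 1 / 4) * I0 + q\<^sup>2 * I1 + q ^ 4 * I2 < 0" using n(1) by (simp add: q_def)
  have qz: "1 < \<bar>q * t\<bar>" if "real (Suc n) < \<bar>t\<bar>" for t using that by (simp add: q_def pos_less_divide_eq)
  define f where "f = (\<lambda>t. bump (q * t) * cos (\<omega> * t))"
  define g where "g = (\<lambda>t. bump (q * t) * sin (\<omega> * t))"
  have sb: "smooth (\<lambda>t. bump (q * t))" using smooth_compose_affine[OF s0, of q 0] by simp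
  have sf: "smooth f" and sg: "smooth g" unfolding f_def g_def by (intro smooth_mult sb smooth_cos_sin_mult)+
  have fz: "f t = 0" and gz: "g t = 0" if "real (Suc n) < \<bar>t\<bar>" for t using bump_outside[OF qz[OF that]] by (simp_all add: f_def g_def)
  have D: "((\<lambda>t. h (q * t)) has_real_derivative q * h' (q * t)) (at t)" if "\<And>x. (h has_real_derivative h' x) (at x)" for h h' :: "real \<Rightarrow> real" and t
  proof -
    have "((\<lambda>t. q * t) has_real_derivative q) (at t)" by (auto intro!: derivative_eq_intros)
    from DERIV_chain2[OF that this] show ?thesis by (simp only: mult.commute)
  qed
  define u where "u t = bump (q * t)" for t
  define v where "v t = q * deriv bump (q * t)" for t
  define z where "z t = q\<^sup>2 * deriv (deriv bump) (q * t)" for t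
  have du: "(u has_real_derivative v t) (at t)" for t
    unfolding u_def[abs_def] v_def by (rule D[OF smooth_real_deriv(1)[OF s0]])
  have dv: "(v has_real_derivative z t) (at t)" for t
    unfolding v_def[abs_def] z_def power2_eq_square mult.assoc by (rule DERIV_cmult[OF D[OF smooth_real_deriv(1)[OF s1]]])
  have fu: "f = (\<lambda>t. u t * cos (\<omega> * t))" and gu: "g = (\<lambda>t. u t * sin (\<omega> * t))" by (simp_all add: f_def g_def u_def)
  have f1: "deriv f = (\<lambda>t. v t * cos (\<omega> * t) - \<omega> * u t * sin (\<omega> * t))" unfolding fu
    by (rule ext, rule DERIV_imp_deriv) (auto intro!: derivative_eq_intros du)
  have g1: "deriv g = (\<lambda>t. v t * sin (\<omega> * t) + \<omega> * u t * cos (\<omega> * t))" unfolding gu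
    by (rule ext, rule DERIV_imp_deriv) (auto intro!: derivative_eq_intros du)
  have f2: "deriv (deriv f) = (\<lambda>t. (z t - \<omega>\<^sup>2 * u t) * cos (\<omega> * t) - 2 * \<omega> * v t * sin (\<omega> * t))" unfolding f1
    by (rule ext, rule DERIV_imp_deriv) (auto intro!: derivative_eq_intros du dv simp: algebra_simps power2_eq_square)
  have g2: "deriv (deriv g) = (\<lambda>t. (z t - \<omega>\<^sup>2 * u t) * sin (\<omega> * t) + 2 * \<omega> * v t * cos (\<omega> * t))" unfolding g1
    by (rule ext, rule DERIV_imp_deriv) (auto intro!: derivative_eq_intros du dv simp: algebra_simps power2_eq_square)
  have rot: "(x * cos s - y * sin s)\<^sup>2 + (x * sin s + y * cos s)\<^sup>2 = x\<^sup>2 + y\<^sup>2" for x y s :: real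
  proof -
    have "(x * c - y * d)\<^sup>2 + (x * d + y * c)\<^sup>2 = (x\<^sup>2 + y\<^sup>2) * (d\<^sup>2 + c\<^sup>2)" for c d :: real
      by (simp add: power2_eq_square algebra_simps)
    from this[of "cos s" "sin s"] show ?thesis by simp
  qed
  define E where "E h t = (deriv (deriv h) t)\<^sup>2 - (deriv h t)\<^sup>2 + C * (h t)\<^sup>2" for h :: "real \<Rightarrow> real" and t
  have pt: "E f t + E g t = (C - 1 / 4) * (bump (q * t))\<^sup>2 + q\<^sup>2 * ((deriv bump (q * t))\<^sup>2 - bump (q * t) * deriv (deriv bump) (q * t)) + q ^ 4 * (deriv (deriv bump) (q * t))\<^sup>2" for t
  proof -
    have "(f t)\<^sup>2 + (g t)\<^sup>2 = (u t)\<^sup>2" unfolding fu gu using rot[of "u t" "\<omega> * t" 0] by simp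
    moreover have "(deriv f t)\<^sup>2 + (deriv g t)\<^sup>2 = (v t)\<^sup>2 + \<omega>\<^sup>2 * (u t)\<^sup>2"
      unfolding f1 g1 rot by (simp add: power_mult_distrib)
    moreover have "(deriv (deriv f) t)\<^sup>2 + (deriv (deriv g) t)\<^sup>2 = (z t - \<omega>\<^sup>2 * u t)\<^sup>2 + 4 * \<omega>\<^sup>2 * (v t)\<^sup>2"
      unfolding f2 g2 rot by (simp add: power_mult_distrib)
    ultimately have "E f t + E g t = (z t - u t / 2)\<^sup>2 + 2 * (v t)\<^sup>2 - ((v t)\<^sup>2 + (u t)\<^sup>2 / 2) + C * (u t)\<^sup>2"
      unfolding E_def w(1) by (simp add: algebra_simps) (simp flip: distrib_left)
    also have "\<dots> = (C - 1 / 4) * (u t)\<^sup>2 + ((v t)\<^sup>2 - u t * z t) + (z t)\<^sup>2"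
      by (simp add: power2_eq_square field_simps)
    also have "\<dots> = (C - 1 / 4) * (bump (q * t))\<^sup>2 + q\<^sup>2 * ((deriv bump (q * t))\<^sup>2 - bump (q * t) * deriv (deriv bump) (q * t)) + q ^ 4 * (deriv (deriv bump) (q * t))\<^sup>2"
      unfolding u_def v_def z_def by (simp add: power2_eq_square power4_eq_xxxx algebra_simps)
    finally show ?thesis .
  qed
  define G where "G t = (C - 1 / 4) * (bump t)\<^sup>2 + q\<^sup>2 * ((deriv bump t)\<^sup>2 - bump t * deriv (deriv bump) t) + q ^ 4 * (deriv (deriv bump) t)\<^sup>2" for t
  have Gm: "G \<in> borel_measurable borel" unfolding G_def[abs_def]
    by (intro borel_measurable_continuous_onI continuous_intros smooth_continuous[OF s0] smooth_continuous[OF s1] smooth_continuous[OF s2])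
  have "(\<integral>t. G t \<partial>lborel) = (C - 1 / 4) * I0 + q\<^sup>2 * I1 + q ^ 4 * I2"
    unfolding G_def I0_def I1_def I2_def using i0 i1 i2 by simp
  moreover have "(\<integral>t. G t \<partial>lborel) = q * (\<integral>t. E f t + E g t \<partial>lborel)"
    using lborel_integral_dilate[OF q(1) Gm, of 0] unfolding pt G_def by simp
  ultimately have "q * (\<integral>t. E f t + E g t \<partial>lborel) < 0" using nq by linarith
  then have neg: "(\<integral>t. E f t + E g t \<partial>lborel) < 0" using q(1) by (auto simp: mult_less_0_iff)
  have hi: "integrable lborel (\<lambda>t. (h t)\<^sup>2)" "integrable lborel (\<lambda>t. (deriv h t)\<^sup>2)" "integrable lborel (\<lambda>t. (deriv (deriv h) t)\<^sup>2)" if "smooth h" and hz: "\<And>t. real (Suc n) < \<bar>t\<bar> \<Longrightarrow> h t = 0" for h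
  proof -
    have 1: "deriv h t = 0" if "real (Suc n) < \<bar>t\<bar>" for t by (rule deriv_zero_outside[OF hz that])
    have 2: "deriv (deriv h) t = 0" if "real (Suc n) < \<bar>t\<bar>" for t by (rule deriv_zero_outside[OF 1 that])
    show "integrable lborel (\<lambda>t. (h t)\<^sup>2)" "integrable lborel (\<lambda>t. (deriv h t)\<^sup>2)" "integrable lborel (\<lambda>t. (deriv (deriv h) t)\<^sup>2)"
      by (rule int[where M="real (Suc n)"]; use hz 1 2 in \<open>auto simp del: of_nat_Suc intro!: continuous_intros smooth_continuous[OF that(1)] smooth_continuous[OF smooth_real_deriv(2)[OF that(1)]] smooth_continuous[OF smooth_real_deriv(2)[OF smooth_real_deriv(2)[OF that(1)]]]\<close>)+
  qed
  have Ei: "integrable lborel (E h)" "(\<integral>t. E h t \<partial>lborel) = (\<integral>t. (deriv (deriv h) t)\<^sup>2 \<partial>lborel) - (\<integral>t. (deriv h t)\<^sup>2 \<partial>lborel) + C * (\<integral>t. (h t)\<^sup>2 \<partial>lborel)"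
    if "smooth h" "\<And>t. real (Suc n) < \<bar>t\<bar> \<Longrightarrow> h t = 0" for h
    unfolding E_def[abs_def] using hi[OF that] by simp_all
  have "(\<integral>t. E f t \<partial>lborel) + (\<integral>t. E g t \<partial>lborel) < 0"
    using neg Bochner_Integration.integral_add[OF Ei(1)[OF sf fz] Ei(1)[OF sg gz]] by simp
  then consider "(\<integral>t. E f t \<partial>lborel) < 0" | "(\<integral>t. E g t \<partial>lborel) < 0" by linarith
  then have "\<exists>h. smooth h \<and> (\<forall>t. real (Suc n) < \<bar>t\<bar> \<longrightarrow> h t = 0) \<and> (\<integral>t. E h t \<partial>lborel) < 0 \<and> (\<exists>t. h t \<noteq> 0)"
  proof cases
    case 1
    have "f 0 \<noteq> 0" by (simp add: f_def bump_0)
    then show ?thesis using 1 sf fz by blast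
  next
    case 2
    have "\<omega> < pi" using w(3) pi_gt3 by linarith
    then have "sin \<omega> > 0" using w(2) by (intro sin_gt_zero)
    then have "g 1 \<noteq> 0" using bump_pos[of q] q by (simp add: g_def)
    then show ?thesis using 2 sg gz by blast
  qed
  then obtain h t0 where h: "smooth h" "\<And>t. real (Suc n) < \<bar>t\<bar> \<Longrightarrow> h t = 0" "(\<integral>t. E h t \<partial>lborel) < 0" "h t0 \<noteq> 0" by blast
  show ?thesis
  proof (rule exI[of _ h], rule exI[of _ "real (Suc n)"], intro conjI)
    show "0 < (\<integral>t. (h t)\<^sup>2 \<partial>lborel)"
      by (rule integral_square_pos[OF compact_cball[of 0 "real (Suc n)"] smooth_continuous[OF h(1)] _ h(4)]) (use h(2) in auto)
    show "(\<integral>t. (deriv (deriv h) t)\<^sup>2 \<partial>lborel) - (\<integral>t. (deriv h t)\<^sup>2 \<partial>lborel) < - C * (\<integral>t. (h t)\<^sup>2 \<partial>lborel)"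
      using h(3) Ei(2)[OF h(1,2)] by simp
  qed (use h in auto)
qed

(*T15*)
lemma outer_normal_attained:
  fixes \<Omega> :: "'a::euclidean_space set"
  assumes dom: "bounded_C1_domain \<Omega>" and b: "norm b = 1"
  shows "\<exists>x0\<in>frontier \<Omega>. outer_normal \<Omega> x0 = b"
proof -
  note O = bounded_C1_domainD(2)[OF dom]
  have "compact (closure \<Omega>)" using bounded_C1_domainD(3)[OF dom] by (simp add: compact_closure)
  moreover have "closure \<Omega> \<noteq> {}" using bounded_C1_domainD(1)[OF dom] by simp
  moreover have "continuous_on (closure \<Omega>) (\<lambda>x. x \<bullet> b)" by (intro continuous_intros)
  ultimately obtain x0 where x0: "x0 \<in> closure \<Omega>" "\<And>x. x \<in> closure \<Omega> \<Longrightarrow> x \<bullet> b \<le> x0 \<bullet> b"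
    using continuous_attains_sup[of "closure \<Omega>" "\<lambda>x. x \<bullet> b"] by blast
  have bb: "b \<bullet> b = 1" using b by (simp add: norm_eq_1)
  have "x0 \<notin> \<Omega>"
  proof
    assume "x0 \<in> \<Omega>"
    then obtain r where r: "r > 0" "cball x0 r \<subseteq> \<Omega>" using O open_contains_cball by blast
    have "x0 + r *\<^sub>R b \<in> cball x0 r" using r(1) b by (simp add: dist_norm)
    then have "x0 + r *\<^sub>R b \<in> closure \<Omega>" using r(2) closure_subset[of \<Omega>] by blast
    from x0(2)[OF this] show False using r(1) bb by (simp add: inner_add_left)
  qed
  then have x: "x0 \<in> frontier \<Omega>" using x0(1) O by (simp add: frontier_def interior_open)
  let ?n = "outer_normal \<Omega> x0"
  have nn: "?n \<bullet> ?n = 1" using norm_outer_normal[OF dom x] by (simp add: norm_eq_1)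
  have "?n = b"
  proof (rule ccontr)
    assume "?n \<noteq> b"
    then have "0 < (b - ?n) \<bullet> (b - ?n)" by simp
    then have lt: "b \<bullet> ?n < 1" using bb nn by (simp add: inner_diff_left inner_diff_right inner_commute)
    obtain U e h where ch: "C1_chart \<Omega> U e h" and xU: "x0 \<in> U" using bounded_C1_domainD(4)[OF dom x] by blast
    have "(b - ?n) \<bullet> chart_normal e h x0 < 0" 
      unfolding outer_normal_chart[OF ch O xU x, symmetric] using lt nn by (simp add: inner_diff_left)
    from chart_side(1)[OF ch O xU x this] obtain t where t: "t > 0" "x0 + (t / 2) *\<^sub>R (b - ?n) \<in> \<Omega>"
      by (metis field_sum_of_halves half_gt_zero less_add_same_cancel1)
    then have "(x0 + (t / 2) *\<^sub>R (b - ?n)) \<bullet> b \<le> x0 \<bullet> b" using x0(2) closure_subset by blast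
    then have "t * ((b - ?n) \<bullet> b) \<le> 0" by (simp add: inner_add_left)
    then have "(b - ?n) \<bullet> b \<le> 0" using t(1) by (simp add: mult_le_0_iff)
    then have "b \<bullet> b - ?n \<bullet> b \<le> 0" by (simp only: inner_diff_left)
    then show False using lt bb inner_commute[of ?n b] by linarith
  qed
  then show ?thesis using x by blast
qed

lemma eigenvalue_le_copies:
  fixes \<Omega> :: "'a::euclidean_space set" and F :: "'a \<Rightarrow> real" and S :: "real \<Rightarrow> (real \<times> real \<times> real) set"
  assumes n: "DIM('a) \<ge> 2" and dom: "bounded_C1_domain \<Omega>" and P: "profile F r" and \<tau>: "norm \<tau> = 1"
    and ev: "\<And>s. \<forall>\<^sub>F a in at_top. 
       (\<integral>x. (F (1 *\<^sub>R (a *\<^sub>R (x - x0) - s *\<^sub>R \<tau>)))\<^sup>2 \<partial>lebesgue_on \<Omega>) > 0 \<and>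
       (\<forall>(\<alpha>, \<beta>, \<gamma>) \<in> S a. Qform \<Omega> \<sigma> \<alpha> \<beta> \<gamma> (\<lambda>x. F (1 *\<^sub>R (a *\<^sub>R (x - x0) - s *\<^sub>R \<tau>))) (\<lambda>x. F (1 *\<^sub>R (a *\<^sub>R (x - x0) - s *\<^sub>R \<tau>)))
         \<le> - (c * a ^ 4) * (\<integral>x. (F (1 *\<^sub>R (a *\<^sub>R (x - x0) - s *\<^sub>R \<tau>)))\<^sup>2 \<partial>lebesgue_on \<Omega>))"
  shows "\<forall>\<^sub>F a in at_top. \<forall>(\<alpha>, \<beta>, \<gamma>) \<in> S a. eigenvalue \<Omega> \<sigma> \<alpha> \<beta> \<gamma> k \<le> ereal (- (c * a ^ 4))"
proof -
  define s where "s i = 3 * r * real i" for i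
  have r: "r > 0" by (rule profileD(2)[OF P])
  let ?G = "\<lambda>a i x. F (1 *\<^sub>R (a *\<^sub>R (x - x0) - s i *\<^sub>R \<tau>))"
  have "\<forall>\<^sub>F a in at_top. \<forall>i\<in>{..<k}. (\<integral>x. (?G a i x)\<^sup>2 \<partial>lebesgue_on \<Omega>) > 0 \<and>
       (\<forall>(\<alpha>, \<beta>, \<gamma>) \<in> S a. Qform \<Omega> \<sigma> \<alpha> \<beta> \<gamma> (?G a i) (?G a i) \<le> - (c * a ^ 4) * (\<integral>x. (?G a i x)\<^sup>2 \<partial>lebesgue_on \<Omega>))"
    by (intro eventually_ball_finite ballI ev) simp
  then show ?thesis
  proof eventually_elim
    case (elim a)
    show ?case
    proof (intro ballI, clarify)
      fix \<alpha> \<beta> \<gamma> assume p: "(\<alpha>, \<beta>, \<gamma>) \<in> S a"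
      define K where "K i = {x. norm (a *\<^sub>R (x - x0) - s i *\<^sub>R \<tau>) \<le> r}" for i
      show "eigenvalue \<Omega> \<sigma> \<alpha> \<beta> \<gamma> k \<le> ereal (- (c * a ^ 4))"
      proof (rule eigenvalue_le_separated[OF n dom, where G="?G a" and K=K])
        fix i assume i: "i < k"
        have "smooth (\<lambda>x. (\<lambda>y. F (1 *\<^sub>R (y - s i *\<^sub>R \<tau>))) (a *\<^sub>R (x - x0)))"
          by (rule smooth_dilate[OF smooth_dilate[OF profileD(1)[OF P]]])
        then show "smooth (?G a i)" by simp
        show "closed (K i)" unfolding K_def by (intro closed_Collect_le continuous_intros)
        show "(\<integral>x. (?G a i x)\<^sup>2 \<partial>lebesgue_on \<Omega>) > 0"
          "Qform \<Omega> \<sigma> \<alpha> \<beta> \<gamma> (?G a i) (?G a i) \<le> - (c * a ^ 4) * (\<integral>x. (?G a i x)\<^sup>2 \<partial>lebesgue_on \<Omega>)"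
          using elim i p by auto
        show "?G a i x = 0" if "x \<notin> K i" for x using that profileD(3)[OF P] by (simp add: K_def)
      next
        fix i j :: nat assume ij: "i \<noteq> j"
        show "K i \<inter> K j = {}"
        proof (rule ccontr)
          assume "K i \<inter> K j \<noteq> {}"
          then obtain x where x: "norm (a *\<^sub>R (x - x0) - s i *\<^sub>R \<tau>) \<le> r" "norm (a *\<^sub>R (x - x0) - s j *\<^sub>R \<tau>) \<le> r" unfolding K_def by blast
          have "norm (s i *\<^sub>R \<tau> - s j *\<^sub>R \<tau>) \<le> r + r"
            using norm_triangle_le_diff[of "a *\<^sub>R (x - x0) - s j *\<^sub>R \<tau>" "a *\<^sub>R (x - x0) - s i *\<^sub>R \<tau>" "r + r"] x by (simp add: norm_minus_commute)
          moreover have "norm (s i *\<^sub>R \<tau> - s j *\<^sub>R \<tau>) = 3 * r * \<bar>real i - real j\<bar>"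
            using r \<tau> by (simp add: s_def abs_mult flip: scaleR_diff_left right_diff_distrib)
          moreover have "1 \<le> \<bar>real i - real j\<bar>" using ij by linarith
          then have "3 * r * 1 \<le> 3 * r * \<bar>real i - real j\<bar>" using r by (intro mult_left_mono) simp_all
          ultimately show False using r by linarith
        qed
      qed
    qed
  qed
qed

lemma profile_translate:
  fixes v :: "'a::euclidean_space"
  assumes P: "profile F r" shows "profile (\<lambda>y. F (1 *\<^sub>R (y - v))) (r + norm v)"
  unfolding profile_def
proof (intro conjI allI impI)
  show "smooth (\<lambda>y. F (1 *\<^sub>R (y - v)))" by (rule smooth_dilate[OF profileD(1)[OF P]])
  show "r + norm v > 0" using profileD(2)[OF P] by (simp add: add_pos_nonneg)
  fix y :: 'a assume "r + norm v < norm y"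
  then have "r < norm (1 *\<^sub>R (y - v))" using norm_triangle_ineq2[of y v] by simp
  then show "F (1 *\<^sub>R (y - v)) = 0" by (rule profileD(3)[OF P])
qed

lemma integral_translate_along:
  fixes g :: "'a::euclidean_space \<Rightarrow> real"
  assumes g: "g \<in> borel_measurable borel" and v: "v \<bullet> b = 0" and I: "I \<in> sets borel"
  shows "(\<integral>y. indicator {y. y \<bullet> b \<in> I} y * g (1 *\<^sub>R (y - v)) \<partial>lborel) = (\<integral>y. indicator {y. y \<bullet> b \<in> I} y * g y \<partial>lborel)"
proof -
  have "{y :: 'a. y \<bullet> b \<in> I} = (\<lambda>y. y \<bullet> b) -` I \<inter> space borel" by auto
  also have "\<dots> \<in> sets borel" by (rule measurable_sets[OF _ I]) measurable
  finally have "(\<lambda>y. indicator {y. y \<bullet> b \<in> I} y * g y) \<in> borel_measurable borel" using g by measurable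
  from lborel_integral_dilate[OF zero_less_one this, of v] show ?thesis
    using v by (simp add: inner_diff_left indicator_def)
qed

lemma interior_eigenvalue_bound:
  fixes \<Omega> :: "'a::euclidean_space set"
  assumes n: "DIM('a) \<ge> 2" and dom: "bounded_C1_domain \<Omega>" and c: "c < 1 / 4"
  shows "\<forall>\<^sub>F a in at_top. \<forall>\<beta> \<gamma>. eigenvalue \<Omega> \<sigma> (- a\<^sup>2) \<beta> \<gamma> k \<le> ereal (- (c * a ^ 4))"
proof -
  obtain b where b: "b \<in> (Basis :: 'a set)" using nonempty_Basis by blast
  obtain x0 where x0: "x0 \<in> \<Omega>" using bounded_C1_domainD(1)[OF dom] by blast
  obtain f N where f: "smooth f" "N \<ge> 1" "\<And>t. N < \<bar>t\<bar> \<Longrightarrow> f t = 0" "0 < (\<integral>t. (f t)\<^sup>2 \<partial>lborel)"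
    "(\<integral>t. (deriv (deriv f) t)\<^sup>2 \<partial>lborel) - (\<integral>t. (deriv f t)\<^sup>2 \<partial>lborel) < - c * (\<integral>t. (f t)\<^sup>2 \<partial>lborel)"
    using oscillating_profile[OF c] by blast
  have bz: "bump t = 0" if "N < \<bar>t\<bar>" for t using bump_outside[of t] that f(2) by linarith
  have bp: "0 < (\<integral>t. (bump t)\<^sup>2 \<partial>lborel)"
    by (rule integral_square_pos[OF compact_cball[of 0 N] smooth_continuous[OF smooth_bump], where x=0]) (use bz bump_0 in auto)
  have N: "N > 0" using f(2) by simp
  obtain F r where F: "profile F r" "0 < (\<integral>y. (F y)\<^sup>2 \<partial>(lborel :: 'a measure))"
    "(\<integral>y. bending \<sigma> F y \<partial>lborel) - (\<integral>y. (norm (grad F y))\<^sup>2 \<partial>lborel) < - c * (\<integral>y. (F y)\<^sup>2 \<partial>lborel)"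
    using whole_space_profile[OF b f(1,3) smooth_bump bz N bp f(4,5)] by blast
  note sF = profileD(1)[OF F(1)]
  let ?S = "\<lambda>a. {(\<alpha>, \<beta>, \<gamma>). \<alpha> = - a\<^sup>2}"
  have "\<forall>\<^sub>F a in at_top. \<forall>(\<alpha>, \<beta>, \<gamma>) \<in> ?S a. eigenvalue \<Omega> \<sigma> \<alpha> \<beta> \<gamma> k \<le> ereal (- (c * a ^ 4))"
  proof (rule eigenvalue_le_copies[OF n dom F(1), of b])
    show "norm b = 1" using b by simp
    fix s
    let ?F = "\<lambda>y. F (1 *\<^sub>R (y - s *\<^sub>R b))"
    note tr = integral_translate_along[of _ "s *\<^sub>R b" "0" UNIV, simplified indicator_UNIV UNIV_I Collect_const if_True mult_1 inner_zero_right, OF _ refl sets.top[of borel, unfolded space_borel]]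
    have i1: "(\<integral>y. bending \<sigma> ?F y \<partial>lborel) = (\<integral>y. bending \<sigma> F y \<partial>lborel)"
      unfolding bending_dilate[OF sF] power_one mult_1 by (rule tr) (intro borel_measurable_continuous_onI continuous_bending sF)
    have i2: "(\<integral>y. (norm (grad ?F y))\<^sup>2 \<partial>lborel) = (\<integral>y. (norm (grad F y))\<^sup>2 \<partial>lborel)"
      unfolding grad_dilate[OF sF] using tr[of "\<lambda>y. (norm (grad F y))\<^sup>2"] 
      by (simp add: borel_measurable_continuous_onI[OF continuous_on_power[OF continuous_on_norm[OF continuous_grad[OF sF]]]])
    have i3: "(\<integral>y. (?F y)\<^sup>2 \<partial>lborel) = (\<integral>y. (F y)\<^sup>2 \<partial>lborel)"
      by (rule tr[of "\<lambda>y. (F y)\<^sup>2"]) (intro borel_measurable_power smooth_borel sF)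
    show "\<forall>\<^sub>F a in at_top. 
       (\<integral>x. (F (1 *\<^sub>R (a *\<^sub>R (x - x0) - s *\<^sub>R b)))\<^sup>2 \<partial>lebesgue_on \<Omega>) > 0 \<and>
       (\<forall>(\<alpha>, \<beta>, \<gamma>) \<in> ?S a. Qform \<Omega> \<sigma> \<alpha> \<beta> \<gamma> (\<lambda>x. F (1 *\<^sub>R (a *\<^sub>R (x - x0) - s *\<^sub>R b))) (\<lambda>x. F (1 *\<^sub>R (a *\<^sub>R (x - x0) - s *\<^sub>R b)))
         \<le> - (c * a ^ 4) * (\<integral>x. (F (1 *\<^sub>R (a *\<^sub>R (x - x0) - s *\<^sub>R b)))\<^sup>2 \<partial>lebesgue_on \<Omega>))"
      using interior_blowup[OF n dom x0 profile_translate[OF F(1)], of \<sigma> "s *\<^sub>R b" c, unfolded i1 i2 i3, OF F(3,2)]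
      by eventually_elim simp
  qed
  then show ?thesis by eventually_elim auto
qed

lemma boundary_eigenvalue_bound:
  fixes \<Omega> :: "'a::euclidean_space set" and q :: "(real \<Rightarrow> real) \<Rightarrow> real"
  assumes n: "DIM('a) \<ge> 2" and dom: "bounded_C1_domain \<Omega>" and c0: "c0 > 0"
  shows "c < 2 * c0 ^ 3 - c0 ^ 4 \<Longrightarrow> \<forall>\<^sub>F a in at_top. \<forall>\<alpha> \<gamma>. \<bar>\<alpha>\<bar> \<le> B \<longrightarrow> \<bar>\<gamma>\<bar> \<le> B \<longrightarrow> eigenvalue \<Omega> \<sigma> \<alpha> (- a) \<gamma> k \<le> ereal (- (c * a ^ 4))"
    and "c < 2 * c0 - c0 ^ 4 \<Longrightarrow> \<forall>\<^sub>F a in at_top. \<forall>\<alpha> \<beta>. \<bar>\<alpha>\<bar> \<le> B \<longrightarrow> \<bar>\<beta>\<bar> \<le> B \<longrightarrow> eigenvalue \<Omega> \<sigma> \<alpha> \<beta> (- (a ^ 3)) k \<le> ereal (- (c * a ^ 4))"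
proof -
  obtain b where b: "b \<in> (Basis :: 'a set)" using nonempty_Basis by blast
  have "Basis \<noteq> {b}" using n by (metis card.empty card_insert_disjoint empty_iff finite.emptyI One_nat_def Suc_1 Suc_n_not_le_n)
  then obtain \<tau> where \<tau>: "\<tau> \<in> (Basis :: 'a set)" "\<tau> \<noteq> b" using b by blast
  have nt: "norm \<tau> = 1" using \<tau> by simp
  have tb: "(s *\<^sub>R \<tau>) \<bullet> b = 0" for s using \<tau> b by (simp add: inner_not_same_Basis)
  obtain x0 where x0: "x0 \<in> frontier \<Omega>" "outer_normal \<Omega> x0 = b" using outer_normal_attained[OF dom norm_Basis[OF b]] by blast
  let ?H = "{y. y \<bullet> b < 0}" and ?S = "{x. 0 \<le> x \<bullet> b \<and> x \<bullet> b \<le> 1}"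
  have trH: "(\<integral>y. indicator ?H y * g (1 *\<^sub>R (y - s *\<^sub>R \<tau>)) \<partial>lborel) = (\<integral>y. indicator ?H y * g y \<partial>lborel)"
    if "g \<in> borel_measurable borel" for g :: "'a \<Rightarrow> real" and s using integral_translate_along[OF that tb[of s], of "{..<0}"] by simp
  have trS: "(\<integral>y. indicator ?S y * g (1 *\<^sub>R (y - s *\<^sub>R \<tau>)) \<partial>lborel) = (\<integral>y. indicator ?S y * g y \<partial>lborel)"
    if "g \<in> borel_measurable borel" for g :: "'a \<Rightarrow> real" and s using integral_translate_along[OF that tb[of s], of "{0..1}"] by simp
  have pt: "1 *\<^sub>R (perp b y - s *\<^sub>R \<tau>) = perp b (1 *\<^sub>R (y - s *\<^sub>R \<tau>))" for y s
    using tb[of s] by (simp add: perp_def inner_diff_left algebra_simps)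
  have perpc: "continuous_on UNIV (perp b)" unfolding perp_def[abs_def] by (intro continuous_intros)
  have bp: "0 < (\<integral>t. (bump t)\<^sup>2 \<partial>lborel)"
    by (rule integral_square_pos[OF compact_cball[of 0 1] smooth_continuous[OF smooth_bump], where x=0]) (use bump_outside bump_0 in auto)
  have i1: "(\<integral>y. indicator ?H y * bending \<sigma> (\<lambda>y. F (1 *\<^sub>R (y - s *\<^sub>R \<tau>))) y \<partial>lborel) = (\<integral>y. indicator ?H y * bending \<sigma> F y \<partial>lborel)" if "smooth F" for F s
    unfolding bending_dilate[OF that] power_one mult_1 by (rule trH) (intro borel_measurable_continuous_onI continuous_bending that)
  have i2: "(\<integral>y. indicator ?H y * (F (1 *\<^sub>R (y - s *\<^sub>R \<tau>)))\<^sup>2 \<partial>lborel) = (\<integral>y. indicator ?H y * (F y)\<^sup>2 \<partial>lborel)" if "smooth F" for F s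
    by (rule trH[of "\<lambda>y. (F y)\<^sup>2"]) (intro borel_measurable_power smooth_borel that)
  have i3: "(\<integral>y. indicator ?S y * (F (1 *\<^sub>R (perp b y - s *\<^sub>R \<tau>)))\<^sup>2 \<partial>lborel) = (\<integral>y. indicator ?S y * (F (perp b y))\<^sup>2 \<partial>lborel)" if "smooth F" for F s
  proof -
    have "continuous_on UNIV (\<lambda>y. (F (perp b y))\<^sup>2)"
      by (intro continuous_on_power continuous_on_compose2[OF smooth_continuous[OF that, of UNIV] perpc]) auto
    from trS[OF borel_measurable_continuous_onI[OF this], of s] show ?thesis unfolding pt .
  qed
  have i4: "(\<integral>y. indicator ?S y * (pd b (\<lambda>y. F (1 *\<^sub>R (y - s *\<^sub>R \<tau>))) (perp b y))\<^sup>2 \<partial>lborel) = (\<integral>y. indicator ?S y * (pd b F (perp b y))\<^sup>2 \<partial>lborel)" if "smooth F" for F s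
    unfolding pd_dilate[OF that] mult_1 by (rule i3[OF smooth_pd[OF that b]])
  {
    assume c: "c < 2 * c0 ^ 3 - c0 ^ 4"
    obtain f N where f: "smooth f" "N \<ge> 1" "\<And>t. N < \<bar>t\<bar> \<Longrightarrow> f t = 0" "0 < (\<integral>t. indicator {..<0} t * (f t)\<^sup>2 \<partial>lborel)"
      "(\<integral>t. indicator {..<0} t * (deriv (deriv f) t)\<^sup>2 \<partial>lborel) - (deriv f 0)\<^sup>2 < - c * (\<integral>t. indicator {..<0} t * (f t)\<^sup>2 \<partial>lborel)"
      using half_line_profile(1)[OF c0 c] by blast
    have bz: "bump t = 0" if "N < \<bar>t\<bar>" for t using bump_outside[of t] that f(2) by linarith
    have N: "N > 0" using f(2) by simp
    obtain F r where F: "profile F r" "0 < (\<integral>y. indicator ?H y * (F y)\<^sup>2 \<partial>lborel)"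
      "(\<integral>y. indicator ?H y * bending \<sigma> F y \<partial>lborel) - (\<integral>y. indicator ?S y * (pd b F (perp b y))\<^sup>2 \<partial>lborel) < - c * (\<integral>y. indicator ?H y * (F y)\<^sup>2 \<partial>lborel)"
      using half_space_profile(1)[OF b f(1,3) smooth_bump bz N bp f(4,5)] by blast
    note sF = profileD(1)[OF F(1)]
    let ?P = "\<lambda>a. {(\<alpha>, \<beta>, \<gamma>). \<beta> = - a \<and> \<bar>\<alpha>\<bar> \<le> B \<and> \<bar>\<gamma>\<bar> \<le> B}"
    have "\<forall>\<^sub>F a in at_top. \<forall>(\<alpha>, \<beta>, \<gamma>) \<in> ?P a. eigenvalue \<Omega> \<sigma> \<alpha> \<beta> \<gamma> k \<le> ereal (- (c * a ^ 4))"
    proof (rule eigenvalue_le_copies[OF n dom F(1) nt, of x0])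
      fix s
      show "\<forall>\<^sub>F a in at_top. 
       (\<integral>x. (F (1 *\<^sub>R (a *\<^sub>R (x - x0) - s *\<^sub>R \<tau>)))\<^sup>2 \<partial>lebesgue_on \<Omega>) > 0 \<and>
       (\<forall>(\<alpha>, \<beta>, \<gamma>) \<in> ?P a. Qform \<Omega> \<sigma> \<alpha> \<beta> \<gamma> (\<lambda>x. F (1 *\<^sub>R (a *\<^sub>R (x - x0) - s *\<^sub>R \<tau>))) (\<lambda>x. F (1 *\<^sub>R (a *\<^sub>R (x - x0) - s *\<^sub>R \<tau>)))
         \<le> - (c * a ^ 4) * (\<integral>x. (F (1 *\<^sub>R (a *\<^sub>R (x - x0) - s *\<^sub>R \<tau>)))\<^sup>2 \<partial>lebesgue_on \<Omega>))"
        using boundary_blowup(1)[OF n dom x0 b profile_translate[OF F(1)], of "s *\<^sub>R \<tau>" \<sigma> c B, unfolded i1[OF sF] i2[OF sF] i4[OF sF], OF F(2,3)]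
        by eventually_elim auto
    qed
    then show "\<forall>\<^sub>F a in at_top. \<forall>\<alpha> \<gamma>. \<bar>\<alpha>\<bar> \<le> B \<longrightarrow> \<bar>\<gamma>\<bar> \<le> B \<longrightarrow> eigenvalue \<Omega> \<sigma> \<alpha> (- a) \<gamma> k \<le> ereal (- (c * a ^ 4))"
      by eventually_elim auto
  }
  {
    assume c: "c < 2 * c0 - c0 ^ 4"
    obtain f N where f: "smooth f" "N \<ge> 1" "\<And>t. N < \<bar>t\<bar> \<Longrightarrow> f t = 0" "0 < (\<integral>t. indicator {..<0} t * (f t)\<^sup>2 \<partial>lborel)"
      "(\<integral>t. indicator {..<0} t * (deriv (deriv f) t)\<^sup>2 \<partial>lborel) - (f 0)\<^sup>2 < - c * (\<integral>t. indicator {..<0} t * (f t)\<^sup>2 \<partial>lborel)"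
      using half_line_profile(2)[OF c0 c] by blast
    have bz: "bump t = 0" if "N < \<bar>t\<bar>" for t using bump_outside[of t] that f(2) by linarith
    have N: "N > 0" using f(2) by simp
    obtain F r where F: "profile F r" "0 < (\<integral>y. indicator ?H y * (F y)\<^sup>2 \<partial>lborel)"
      "(\<integral>y. indicator ?H y * bending \<sigma> F y \<partial>lborel) - (\<integral>y. indicator ?S y * (F (perp b y))\<^sup>2 \<partial>lborel) < - c * (\<integral>y. indicator ?H y * (F y)\<^sup>2 \<partial>lborel)"
      using half_space_profile(2)[OF b f(1,3) smooth_bump bz N bp f(4,5)] by blast
    note sF = profileD(1)[OF F(1)]
    let ?P = "\<lambda>a. {(\<alpha>, \<beta>, \<gamma>). \<gamma> = - (a ^ 3) \<and> \<bar>\<alpha>\<bar> \<le> B \<and> \<bar>\<beta>\<bar> \<le> B}"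
    have "\<forall>\<^sub>F a in at_top. \<forall>(\<alpha>, \<beta>, \<gamma>) \<in> ?P a. eigenvalue \<Omega> \<sigma> \<alpha> \<beta> \<gamma> k \<le> ereal (- (c * a ^ 4))"
    proof (rule eigenvalue_le_copies[OF n dom F(1) nt, of x0])
      fix s
      show "\<forall>\<^sub>F a in at_top. 
       (\<integral>x. (F (1 *\<^sub>R (a *\<^sub>R (x - x0) - s *\<^sub>R \<tau>)))\<^sup>2 \<partial>lebesgue_on \<Omega>) > 0 \<and>
       (\<forall>(\<alpha>, \<beta>, \<gamma>) \<in> ?P a. Qform \<Omega> \<sigma> \<alpha> \<beta> \<gamma> (\<lambda>x. F (1 *\<^sub>R (a *\<^sub>R (x - x0) - s *\<^sub>R \<tau>))) (\<lambda>x. F (1 *\<^sub>R (a *\<^sub>R (x - x0) - s *\<^sub>R \<tau>)))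
         \<le> - (c * a ^ 4) * (\<integral>x. (F (1 *\<^sub>R (a *\<^sub>R (x - x0) - s *\<^sub>R \<tau>)))\<^sup>2 \<partial>lebesgue_on \<Omega>))"
        using boundary_blowup(2)[OF n dom x0 b profile_translate[OF F(1)], of "s *\<^sub>R \<tau>" \<sigma> c B, unfolded i1[OF sF] i2[OF sF] i3[OF sF], OF F(2,3)]
        by eventually_elim auto
    qed
    then show "\<forall>\<^sub>F a in at_top. \<forall>\<alpha> \<beta>. \<bar>\<alpha>\<bar> \<le> B \<longrightarrow> \<bar>\<beta>\<bar> \<le> B \<longrightarrow> eigenvalue \<Omega> \<sigma> \<alpha> \<beta> (- (a ^ 3)) k \<le> ereal (- (c * a ^ 4))"
      by eventually_elim auto
  }
qed

lemma ereal_quotient_ge: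
  assumes "e \<le> ereal (- (c * X))" "X > 0" shows "ereal c \<le> e / ereal (- X)"
proof (cases e)
  case (real r)
  then have "c * X \<le> - r" using assms by simp
  then have "c \<le> - r / X" using assms(2) by (simp only: pos_le_divide_eq)
  then show ?thesis using assms(2) real by simp
next
  case PInf then show ?thesis using assms by simp
next
  case MInf then show ?thesis using assms(2) by (simp add: divide_ereal_def)
qed

lemma liminf_and_uniform_bound:
  fixes E :: "nat \<Rightarrow> real \<Rightarrow> real \<Rightarrow> real \<Rightarrow> ereal"
  assumes ev: "\<And>c k B. c < C \<Longrightarrow> \<forall>\<^sub>F t in at_bot. \<forall>p q. \<bar>p\<bar> \<le> B \<longrightarrow> \<bar>q\<bar> \<le> B \<longrightarrow> ereal c \<le> E k t p q"
  shows "\<forall>k\<ge>1. \<forall>p q. Bfun p at_bot \<and> Bfun q at_bot \<longrightarrow> Liminf at_bot (\<lambda>t. E k t (p t) (q t)) \<ge> ereal C"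
    and "\<forall>a b. \<forall>\<epsilon>>0. \<forall>\<^sub>F t in at_bot. \<forall>p\<in>{a..b}. \<forall>q\<in>{a..b}. E 1 t p q \<ge> ereal (C - \<epsilon>)"
proof -
  show "\<forall>k\<ge>1. \<forall>p q. Bfun p at_bot \<and> Bfun q at_bot \<longrightarrow> Liminf at_bot (\<lambda>t. E k t (p t) (q t)) \<ge> ereal C"
  proof (intro allI impI)
    fix k :: nat and p q :: "real \<Rightarrow> real" assume "Bfun p at_bot \<and> Bfun q at_bot"
    then obtain P Q where PQ: "\<forall>\<^sub>F t in at_bot. \<bar>p t\<bar> \<le> P" "\<forall>\<^sub>F t in at_bot. \<bar>q t\<bar> \<le> Q" by (auto elim!: BfunE)
    show "ereal C \<le> Liminf at_bot (\<lambda>t. E k t (p t) (q t))"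
      unfolding le_Liminf_iff
    proof (intro allI impI)
      fix y assume "y < ereal C"
      then obtain c where c: "y < ereal c" "ereal c < ereal C" using ereal_dense2 by blast
      then have "c < C" by simp
      from ev[OF this, of "max P Q" k] PQ show "\<forall>\<^sub>F t in at_bot. y < E k t (p t) (q t)"
      proof eventually_elim
        case (elim t)
        then have "\<bar>p t\<bar> \<le> max P Q" "\<bar>q t\<bar> \<le> max P Q" by linarith+
        then have "ereal c \<le> E k t (p t) (q t)" using elim(1) by blast
        then show ?case by (rule less_le_trans[OF c(1)])
      qed
    qed
  qed
  show "\<forall>a b. \<forall>\<epsilon>>0. \<forall>\<^sub>F t in at_bot. \<forall>p\<in>{a..b}. \<forall>q\<in>{a..b}. E 1 t p q \<ge> ereal (C - \<epsilon>)"
  proof (intro allI impI)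
    fix a b \<epsilon> :: real assume "\<epsilon> > 0"
    then have "C - \<epsilon> < C" by simp
    from ev[OF this, of "max \<bar>a\<bar> \<bar>b\<bar>" 1] show "\<forall>\<^sub>F t in at_bot. \<forall>p\<in>{a..b}. \<forall>q\<in>{a..b}. E 1 t p q \<ge> ereal (C - \<epsilon>)"
    proof eventually_elim
      case (elim t)
      show ?case
      proof (intro ballI)
        fix p q assume "p \<in> {a..b}" "q \<in> {a..b}"
        then have "\<bar>p\<bar> \<le> max \<bar>a\<bar> \<bar>b\<bar>" "\<bar>q\<bar> \<le> max \<bar>a\<bar> \<bar>b\<bar>" by auto
        then show "E 1 t p q \<ge> ereal (C - \<epsilon>)" using elim by blast
      qed
    qed
  qed
qed

theorem theorem5p11:
  fixes \<Omega> :: "'a::euclidean_space set" and \<sigma> :: real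
  assumes "DIM('a) \<ge> 2"
    and "bounded_C1_domain \<Omega>"
    and "- 1 / (real DIM('a) - 1) < \<sigma>" and "\<sigma> < 1"
  shows
    "(\<forall>k\<ge>1. \<forall>\<beta> \<gamma> :: real \<Rightarrow> real. Bfun \<beta> at_bot \<and> Bfun \<gamma> at_bot \<longrightarrow>
        Liminf at_bot (\<lambda>\<alpha>. eigenvalue \<Omega> \<sigma> \<alpha> (\<beta> \<alpha>) (\<gamma> \<alpha>) k / ereal (- (\<bar>\<alpha>\<bar>\<^sup>2)))
          \<ge> ereal (1 / 4)) \<and>
     (\<forall>k\<ge>1. \<forall>\<alpha> \<gamma> :: real \<Rightarrow> real. Bfun \<alpha> at_bot \<and> Bfun \<gamma> at_bot \<longrightarrow>
        Liminf at_bot (\<lambda>\<beta>. eigenvalue \<Omega> \<sigma> (\<alpha> \<beta>) \<beta> (\<gamma> \<beta>) k / ereal (- (\<bar>\<beta>\<bar> ^ 4)))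
          \<ge> ereal (1 / 2 * (3 / 2) ^ 3)) \<and>
     (\<forall>k\<ge>1. \<forall>\<alpha> \<beta> :: real \<Rightarrow> real. Bfun \<alpha> at_bot \<and> Bfun \<beta> at_bot \<longrightarrow>
        Liminf at_bot (\<lambda>\<gamma>. eigenvalue \<Omega> \<sigma> (\<alpha> \<gamma>) (\<beta> \<gamma>) \<gamma> k / ereal (- (\<bar>\<gamma>\<bar> powr (4 / 3))))
          \<ge> ereal ((1 / 2) powr (1 / 3) * (3 / 2))) \<and>
     (\<forall>a b :: real. \<forall>\<epsilon>>0. \<forall>\<^sub>F \<alpha> in at_bot. \<forall>\<beta>\<in>{a..b}. \<forall>\<gamma>\<in>{a..b}.
        eigenvalue \<Omega> \<sigma> \<alpha> \<beta> \<gamma> 1 / ereal (- (\<bar>\<alpha>\<bar>\<^sup>2)) \<ge> ereal (1 / 4 - \<epsilon>)) \<and>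
     (\<forall>a b :: real. \<forall>\<epsilon>>0. \<forall>\<^sub>F \<beta> in at_bot. \<forall>\<alpha>\<in>{a..b}. \<forall>\<gamma>\<in>{a..b}.
        eigenvalue \<Omega> \<sigma> \<alpha> \<beta> \<gamma> 1 / ereal (- (\<bar>\<beta>\<bar> ^ 4)) \<ge> ereal (1 / 2 * (3 / 2) ^ 3 - \<epsilon>)) \<and>
     (\<forall>a b :: real. \<forall>\<epsilon>>0. \<forall>\<^sub>F \<gamma> in at_bot. \<forall>\<alpha>\<in>{a..b}. \<forall>\<beta>\<in>{a..b}.
        eigenvalue \<Omega> \<sigma> \<alpha> \<beta> \<gamma> 1 / ereal (- (\<bar>\<gamma>\<bar> powr (4 / 3)))
          \<ge> ereal ((1 / 2) powr (1 / 3) * (3 / 2) - \<epsilon>))"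
proof -
  note n = assms(1) and dom = assms(2)
  have neg: "\<forall>\<^sub>F t in at_bot. t < (0::real)" by (simp add: eventually_at_bot_dense exI[of _ 0])
  have lim: "filterlim (\<lambda>t::real. - t) at_top at_bot" by (rule filterlim_uminus_at_top_at_bot)
  have "\<forall>\<^sub>F t in at_bot. \<forall>p q. \<bar>p\<bar> \<le> B \<longrightarrow> \<bar>q\<bar> \<le> B \<longrightarrow> ereal c \<le> eigenvalue \<Omega> \<sigma> t p q k / ereal (- (\<bar>t\<bar>\<^sup>2))" if "c < 1 / 4" for c k B
  proof -
    have "filterlim (\<lambda>t::real. sqrt (- t)) at_top at_bot" by (rule filterlim_compose[OF sqrt_at_top lim])
    from eventually_compose_filterlim[OF interior_eigenvalue_bound[OF n dom that] this, of \<sigma> k] neg show ?thesis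
    proof eventually_elim
      case (elim t)
      have 1: "(sqrt (- t))\<^sup>2 = - t" using elim(2) by simp
      have "(sqrt (- t)) ^ 4 = ((sqrt (- t))\<^sup>2)\<^sup>2" by (simp flip: power_mult)
      then have 2: "(sqrt (- t)) ^ 4 = \<bar>t\<bar>\<^sup>2" unfolding 1 by simp
      show ?case using elim unfolding 1 2 by (auto intro!: ereal_quotient_ge)
    qed
  qed
  note A = liminf_and_uniform_bound[where E="\<lambda>k t p q. eigenvalue \<Omega> \<sigma> t p q k / ereal (- (\<bar>t\<bar>\<^sup>2))", OF this]
  have "\<forall>\<^sub>F t in at_bot. \<forall>p q. \<bar>p\<bar> \<le> B \<longrightarrow> \<bar>q\<bar> \<le> B \<longrightarrow> ereal c \<le> eigenvalue \<Omega> \<sigma> p t q k / ereal (- (\<bar>t\<bar> ^ 4))" if c: "c < 1 / 2 * (3 / 2) ^ 3" for c k B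
  proof -
    have "c < 2 * (3 / 2) ^ 3 - (3 / 2) ^ 4" using c by (simp add: power3_eq_cube power4_eq_xxxx)
    moreover have "0 < (3 / 2 :: real)" by simp
    ultimately have R: "\<forall>\<^sub>F a in at_top. \<forall>\<alpha> \<gamma>. \<bar>\<alpha>\<bar> \<le> B \<longrightarrow> \<bar>\<gamma>\<bar> \<le> B \<longrightarrow> eigenvalue \<Omega> \<sigma> \<alpha> (- a) \<gamma> k \<le> ereal (- (c * a ^ 4))"
      by (rule boundary_eigenvalue_bound(1)[OF n dom, rotated])
    from eventually_compose_filterlim[OF R lim] neg show ?thesis
    proof eventually_elim
      case (elim t)
      have 2: "(- t) ^ 4 = \<bar>t\<bar> ^ 4" using elim(2) by simp
      show ?case using elim unfolding 2 by (auto intro!: ereal_quotient_ge)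
    qed
  qed
  note B = liminf_and_uniform_bound[where E="\<lambda>k t p q. eigenvalue \<Omega> \<sigma> p t q k / ereal (- (\<bar>t\<bar> ^ 4))", OF this]
  have "\<forall>\<^sub>F t in at_bot. \<forall>p q. \<bar>p\<bar> \<le> B \<longrightarrow> \<bar>q\<bar> \<le> B \<longrightarrow> ereal c \<le> eigenvalue \<Omega> \<sigma> p q t k / ereal (- (\<bar>t\<bar> powr (4 / 3)))" 
    if c: "c < (1 / 2) powr (1 / 3) * (3 / 2)" for c k B
  proof -
    define c0 :: real where "c0 = (1 / 2) powr (1 / 3)"
    have c0: "c0 > 0" by (simp add: c0_def)
    have "c0 ^ 3 = 1 / 2" unfolding c0_def by (simp add: powr_powr flip: powr_numeral)
    then have "c0 ^ 4 = c0 / 2" by (simp add: power4_eq_xxxx power3_eq_cube)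
    then have "c < 2 * c0 - c0 ^ 4" using c unfolding c0_def[symmetric] by simp
    note R = boundary_eigenvalue_bound(2)[OF n dom c0 this]
    have "filterlim (\<lambda>x::real. x powr (1 / 3)) at_top at_top"
      unfolding filterlim_at_top_gt[where c=0]
    proof (intro allI impI)
      fix Z :: real assume Z: "Z > 0"
      show "\<forall>\<^sub>F x in at_top. Z \<le> x powr (1 / 3)"
        using eventually_ge_at_top[of "Z ^ 3"]
      proof eventually_elim
        case (elim x)
        have "Z = (Z ^ 3) powr (1 / 3)" using Z by (simp add: powr_powr flip: powr_numeral)
        also have "\<dots> \<le> x powr (1 / 3)" using elim Z by (intro powr_mono2) simp_all
        finally show ?case .
      qed
    qed
    from filterlim_compose[OF this lim] have "filterlim (\<lambda>t::real. (- t) powr (1 / 3)) at_top at_bot" .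
    from eventually_compose_filterlim[OF R this, of B \<sigma> k] neg show ?thesis
    proof eventually_elim
      case (elim t)
      have 1: "((- t) powr (1 / 3)) ^ 3 = - t" using elim(2) by (simp add: powr_powr flip: powr_numeral)
      have 2: "((- t) powr (1 / 3)) ^ 4 = \<bar>t\<bar> powr (4 / 3)" using elim(2) by (simp add: powr_powr flip: powr_numeral)
      show ?case using elim unfolding 1 2 by (auto intro!: ereal_quotient_ge)
    qed
  qed
  note C = liminf_and_uniform_bound[where E="\<lambda>k t p q. eigenvalue \<Omega> \<sigma> p q t k / ereal (- (\<bar>t\<bar> powr (4 / 3)))", OF this]
  show ?thesis by (intro conjI A B C)
qed

end
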